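(* Fix $s\in\mathbb{C}$ with $\sigma=\operatorname{Re}s>0$, and let $x\in\mathbb{R}^{+}$. Let $a=0$ if $s$ is an odd integer and $a=1$ otherwise. Then \begin{align*} &\sum_{n=1}^{\infty}\frac{\sigma_s(n)}{\sqrt{n}}e^{-2\pi\sqrt{2nx}}\sin\left(\frac{\pi}{4}+2\pi\sqrt{2nx}\right)\\ &=4\pi\left(\frac{\zeta(1-s)}{8\pi^2\sqrt{x}}+\frac{1}{4\sqrt{2}\pi}\zeta\left(\tfrac{1}{2}\right)\zeta\left(\tfrac{1}{2}-s\right)-\frac{2^{-s-3}}{\pi^{s+\frac{3}{2}}}\frac{\Gamma(s+1/2)\cot\left(\frac{\pi s}{2}\right)\zeta(-s)}{x^{s+\frac{1}{2}}}\right)\\ &\quad+\frac{\sqrt{x}}{\pi^{s}}\Bigg\{\sum_{n<x}\frac{\sigma_{s}(n)}{n^{s+1}}\Bigg[-\frac{\sqrt{n}\,\Gamma\left(\frac{1}{4}+\frac{s}{2}\right)}{\sqrt{2x}\,\Gamma\left(\frac{1}{4}-\frac{s}{2}\right)}\\ &\qquad-\frac{a\,\Gamma\left(s+\frac{1}{2}\right)\cot\left(\frac{\pi s}{2}\right)}{2^{s+1}\sqrt{\pi}}\left(\frac{n}{x}\right)^{s+1}\left\{\left(1+\frac{in}{x}\right)^{-(s+\frac{1}{2})}+\left(1-\frac{in}{x}\right)^{-(s+\frac{1}{2})}\right\}\\ &\qquad+\frac{n2^{-s}}{x\sin\left(\frac{\pi s}{2}\right)\Gamma(1-s)}\,{}_3F_2\left(\tfrac14,\tfrac34,1;\tfrac{1-s}{2},1-\tfrac{s}{2};-\tfrac{n^2}{x^2}\right)\Bigg]\\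 &\quad+\sum_{n\geq x}\frac{\sigma_{s}(n)}{n^{s+1}}\Bigg[-\frac{n\Gamma(s)\cos\left(\frac{\pi s}{2}\right)}{2^{s-1}\pi x}\left\{{}_3F_2\left(\tfrac{s}{2},\tfrac{1+s}{2},1;\tfrac14,\tfrac34;-\tfrac{x^2}{n^2}\right)-1\right\}\\ &\qquad-\frac{i\sqrt{n}\,\Gamma\left(s+\frac{1}{2}\right)}{2^{s+1}\sqrt{\pi x}}\Bigg\{\sin\left(\frac{\pi}{4}+\frac{\pi s}{2}\right)\left(\left(1+\frac{ix}{n}\right)^{-(s+\frac{1}{2})}-\left(1-\frac{ix}{n}\right)^{-(s+\frac{1}{2})}\right)\\ &\qquad\quad+i\cos\left(\frac{\pi}{4}+\frac{\pi s}{2}\right)\left(\left(1+\frac{ix}{n}\right)^{-(s+\frac{1}{2})}+\left(1-\frac{ix}{n}\right)^{-(s+\frac{1}{2})}-2\right)\Bigg\}\Bigg]\Bigg\}, \end{align*} where, if $x$ is an integer, we additionally require that $\sigma<\frac{1}{2}$.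
   Context: $\sigma_s(n)=\sum_{d\mid n}d^s$; $\zeta$ is the Riemann zeta function; $\Gamma$ is the Gamma function. The generalized hypergeometric function is ${}_qF_p(a_1,\dots,a_q;b_1,\dots,b_p;z)=\sum_{n\ge0}\frac{(a_1)_n\cdots(a_q)_n}{(b_1)_n\cdots(b_p)_n}\frac{z^n}{n!}$ with $(a)_n=a(a+1)\cdots(a+n-1)$, $(a)_0=1$ (at argument $-1$ the ${}_3F_2$ is the conditionally convergent series). Complex powers are principal values. For positive integers $s$ at which individual factors on the right are singular (e.g. $\cot(\pi s/2)$, $\Gamma(1-s)$, or the denominators of the ${}_3F_2$), the corresponding expressions are understood as limiting values in $s$. *)

theory Defs
  imports "HOL-Analysis.Analysis"
begin

definition divisor_sigma :: "complex \<Rightarrow> nat \<Rightarrow> complex" where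
  "divisor_sigma s n = (\<Sum>d | d dvd n. of_nat d powr s)"

(* The analytic continuation of the Dirichlet series of n^(-s) to the plane without the pole
   at 1.  The value at the pole is set to 0 only to make the description unique. *)
definition riemann_zeta :: "complex \<Rightarrow> complex" where
  "riemann_zeta = (THE f. f holomorphic_on (- {1}) \<and>
     (\<forall>s. Re s > 1 \<longrightarrow> (\<lambda>n. of_nat (Suc n) powr (- s)) sums f s) \<and> f 1 = 0)"

(* The sum of the series is the limit of its partial sums, so conditionally convergent
   cases on the unit circle are covered. *)
definition hypergeo :: "complex list \<Rightarrow> complex list \<Rightarrow> complex \<Rightarrow> complex" where
  "hypergeo as bs z = eval_fps (fps_hypergeo as bs 1) z"

(* Expressions in s that may involve 0 * infinity or infinity - infinity at positive integers
   are read there as limits over the punctured neighbourhood, elsewhere literally. *)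
definition limiting_value :: "(complex \<Rightarrow> complex) \<Rightarrow> complex \<Rightarrow> complex" where
  "limiting_value f s = (if \<exists>k::nat. k > 0 \<and> s = of_nat k then Lim (at s) f else f s)"

end

theory Submission
  imports Defs "HOL-Complex_Analysis.Complex_Analysis" "HOL-Real_Asymp.Real_Asymp" "HOL-Probability.Distributions"
begin

text \<open>With $u = s + 1/2$ and $G(z) = \sum \sigma_s(n) n^{-1/2} e^{-4\pi\sqrt{nz}}$ the left-hand side is
  $(e^{i\pi/4} G(-ix) - e^{-i\pi/4} G(ix))/(2i)$. For real $0 < s < 1/2$ and $z > 0$, $G(z)$ is
  a constant times $\int_0^\infty y^{-3/2} (e^{2\pi/y}-1)^{-1} \sum_d d^{u-1} e^{-2\pi d z y}\,dy$. Subtracting the singular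
  parts of both factors yields the zeta terms; in the remaining integral the partial fractions of the first factor
  and Lipschitz summation in the second produce a series of kernels depending on $z/n$. A kernel is evaluated in terms
  of $\int_0^1 (1 - v q^2)^{u-1}\,dq$ with $v = \pm z/n$, so that the identity continues analytically to $z = \pm ix$ and
  then to all $s$ with positive real part. At $v = \pm ix/n$ this integral is hypergeometric: it is expanded at $0$ when $n \ge x$
  and, after an inversion, at infinity when $n < x$.\<close>

section \<open>Parametric integrals and series\<close>

text \<open>The real stage takes place on 0 < s < 1/2 because everything converges there at once: s
  > 0 gives the Dirichlet series of zeta(1 + s), and u < 1 makes r^(-u) integrable at 0, so that
  integration against r^(-u) can turn the partial fractions of the first factor into Lipschitz
  summation. Partial fractions yield the regularized first factor plus 1/2, and this 1/2 leaves a
  constant, \<open>lip_const u\<close>, that is never evaluated: it multiplies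
  \<open>csqrt z\<close>, which the combination of z = ix and z = -ix on the left-hand side
  annihilates. The kernel keeps one form for all n, through \<open>Rfun\<close>, since its series is
  then holomorphic on Re s > 0; the split at n = x comes after the continuation in s, and the extra
  restriction for integral x enters through the 3F2 at argument -1. As zeta is described by its
  unique continuation, the continuation itself has to be produced: to Re w > 0 by comparing sum and
  integral, further left by the functional equation, which results from two evaluations of one
  Mellin transform. Limiting values reduce to continuity, because the literal expressions agree off
  the integers with functions that are continuous at the point in question.\<close>

lemmas B_integrable_add = Bochner_Integration.integrable_add
  and B_integrable_bound = Bochner_Integration.integrable_bound
  and B_integrable_cong = Bochner_Integration.integrable_cong
  and B_integrable_diff = Bochner_Integration.integrable_diff
  and B_integral_add = Bochner_Integration.integral_add
  and B_integral_cong = Bochner_Integration.integral_cong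
  and B_integral_diff = Bochner_Integration.integral_diff
  and B_integral_sum = Bochner_Integration.integral_sum

abbreviation posM :: "real measure" where "posM \<equiv> restrict_space lborel {0<..}"

lemma continuous_on_posM_measurable:
 fixes f :: "real => 'a::{second_countable_topology, topological_space}"
 shows "continuous_on {0<..} f ==> f \<in> borel_measurable posM"
 by (metis borel_measurable_continuous_on_restrict measurable_cong_sets sets_lborel sets_restrict_space_cong)

lemma borel_measurable_posM [measurable (raw)]: "f \<in> borel_measurable borel ==> f \<in> borel_measurable posM"
 by (simp add: measurable_restrict_space1)

lemma sigma_finite_posM: "sigma_finite_measure posM"
 by (intro sigma_finite_measure_restrict_space lborel.sigma_finite_measure_axioms) auto

lemma integrable_posM_iff:
 fixes f :: "real => 'a::{banach, second_countable_topology}"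
 shows "integrable posM f \<longleftrightarrow> set_integrable lborel {0<..} f"
 unfolding set_integrable_def by (subst integrable_restrict_space) auto

lemma integral_posM:
 fixes f :: "real => 'a::{banach, second_countable_topology}"
 shows "integral\<^sup>L posM f = set_lebesgue_integral lborel {0<..} f"
 unfolding set_lebesgue_integral_def by (subst integral_restrict_space) auto

lemma nn_integral_posM: "integral\<^sup>N posM f = (\<integral>\<^sup>+x. f x * indicator {0<..} x \<partial>lborel)"
 by (subst nn_integral_restrict_space) auto

lemma space_posM: "space posM = {0<..}"
 by (simp add: space_restrict_space)

lemma integrable_integral_posM_scale:
 fixes f :: "real => 'a::{banach, second_countable_topology}"
 assumes c: "c > 0"
 shows "integrable posM (%y. f (c * y)) \<longleftrightarrow> integrable posM f"
  and "integral\<^sup>L posM (%y. f (c * y)) = integral\<^sup>L posM f /\<^sub>R c"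
proof -
 have ind: "indicator {0<..} (c * y) = (indicator {0<..} y :: real)" for y
  using c by (auto simp: indicator_def zero_less_mult_iff)
 define g where "g = (%y. indicator {0<..} y *\<^sub>R f y)"
 have g: "indicator {0<..} y *\<^sub>R f (c * y) = g (0 + c * y)" for y
  using ind[of y] by (simp add: g_def)
 show "integrable posM (%y. f (c * y)) \<longleftrightarrow> integrable posM f"
  unfolding integrable_posM_iff set_integrable_def g
  using c by (subst lborel_integrable_real_affine_iff) (auto simp: g_def)
 have "integral\<^sup>L lborel g = \<bar>c\<bar> *\<^sub>R (\<integral>x. g (0 + c * x) \<partial>lborel)"
  using c by (intro lborel_integral_real_affine) auto
 thus "integral\<^sup>L posM (%y. f (c * y)) = integral\<^sup>L posM f /\<^sub>R c"
  unfolding integral_posM set_lebesgue_integral_def g using c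
  by (simp add: g_def)
qed

text \<open>For nonnegative terms the convergent sum of the integrals is itself the domination, so
  integrability of \<open>F\<close> is part of the conclusion. This direction serves when the
  integrals of the terms are known in closed form.\<close>

lemma sums_integral_nonneg:
 fixes f :: "nat => 'a => real"
 assumes "\<And>n. integrable M (f n)" "\<And>n x. x \<in> space M ==> f n x \<ge> 0"
  and "\<And>x. x \<in> space M ==> (%n. f n x) sums F x"
  and "(%n. integral\<^sup>L M (f n)) sums I"
 shows "integrable M F" "integral\<^sup>L M F = I"
proof -
 have ae: "AE x in M. summable (%n. norm (f n x))"
 proof (rule AE_I2)
  fix x assume x: "x \<in> space M"
  have "(%n. norm (f n x)) = (%n. f n x)" using assms(2)[OF x] by auto
  thus "summable (%n. norm (f n x))" using assms(3)[OF x] by (simp add: sums_iff)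
 qed
 have n: "(\<integral>x. norm (f n x) \<partial>M) = integral\<^sup>L M (f n)" for n
  by (intro B_integral_cong) (use assms in auto)
 have sm: "summable (%n. \<integral>x. norm (f n x) \<partial>M)"
  unfolding n using assms(4) by (simp add: sums_iff)
 have F: "(\<Sum>n. f n x) = F x" if "x \<in> space M" for x using assms(3)[OF that] by (simp add: sums_iff)
 have "integrable M (%x. \<Sum>n. f n x)" by (rule integrable_suminf[OF assms(1) ae sm])
 thus "integrable M F" by (subst B_integrable_cong[OF refl]) (auto simp: F)
 have "(%n. integral\<^sup>L M (f n)) sums (\<integral>x. (\<Sum>n. f n x) \<partial>M)" by (rule sums_integral[OF assms(1) ae sm])
 hence "(\<integral>x. (\<Sum>n. f n x) \<partial>M) = I" using assms(4) sums_unique2 by blast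
 moreover have "(\<integral>x. (\<Sum>n. f n x) \<partial>M) = integral\<^sup>L M F"
  by (intro B_integral_cong) (auto simp: F)
 ultimately show "integral\<^sup>L M F = I" by simp
qed

lemma sums_integral_dominated:
 fixes f :: "nat => 'a => 'b::{banach, second_countable_topology}"
 assumes "\<And>n. f n \<in> borel_measurable M" "\<And>n x. x \<in> space M ==> norm (f n x) \<le> g n x"
  and "\<And>n. integrable M (g n)"
  and "\<And>x. x \<in> space M ==> summable (%n. g n x)"
  and "summable (%n. integral\<^sup>L M (g n))"
  and "\<And>x. x \<in> space M ==> (%n. f n x) sums F x"
 shows "\<And>n. integrable M (f n)" "integrable M F" "(%n. integral\<^sup>L M (f n)) sums integral\<^sup>L M F"
proof -
 show int: "integrable M (f n)" for n
 proof (rule B_integrable_bound[OF assms(3)[of n] assms(1)])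
  show "AE x in M. norm (f n x) \<le> norm (g n x)"
   by (rule AE_I2) (use assms(2) in \<open>fastforce intro: order_trans\<close>)
 qed
 have sn: "summable (%n. norm (f n x))" if "x \<in> space M" for x
  by (rule summable_comparison_test[OF _ assms(4)[OF that]]) (use assms(2)[OF that] in auto)
 have ae: "AE x in M. summable (%n. norm (f n x))" using sn by (auto intro: AE_I2)
 have le: "(\<integral>x. norm (f n x) \<partial>M) \<le> integral\<^sup>L M (g n)" for n
  by (rule integral_mono[OF integrable_norm[OF int] assms(3)]) (use assms(2) in auto)
 have sm: "summable (%n. \<integral>x. norm (f n x) \<partial>M)"
  by (rule summable_comparison_test[OF _ assms(5)]) (use le in auto)
 have F: "(\<Sum>n. f n x) = F x" if "x \<in> space M" for x using assms(6)[OF that] by (simp add: sums_iff)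
 have "integrable M (%x. \<Sum>n. f n x)" by (rule integrable_suminf[OF int ae sm])
 thus "integrable M F" by (subst B_integrable_cong[OF refl]) (auto simp: F)
 have "(%n. integral\<^sup>L M (f n)) sums (\<integral>x. (\<Sum>n. f n x) \<partial>M)" by (rule sums_integral[OF int ae sm])
 also have "(\<integral>x. (\<Sum>n. f n x) \<partial>M) = integral\<^sup>L M F"
  by (intro B_integral_cong) (auto simp: F)
 finally show "(%n. integral\<^sup>L M (f n)) sums integral\<^sup>L M F" .
qed

text \<open>A bound for \<open>f\<close> alone, locally uniform in the parameter, suffices: Cauchy's
  inequality turns it into a bound for the derivative on half the disc, the mean value inequality
  into one for all difference quotients, and dominated convergence differentiates under the
  integral.\<close>

lemma holomorphic_integral:
 fixes f :: "complex => 'a => complex"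
 assumes S: "open S"
  and meas: "\<And>c. c \<in> S ==> f c \<in> borel_measurable M"
  and hol: "\<And>x. x \<in> space M ==> (%c. f c x) holomorphic_on S"
  and dom: "\<And>c. c \<in> S ==> \<exists>r>0. \<exists>g. ball c r \<subseteq> S \<and> integrable M g \<and>
        (\<forall>c'\<in>ball c r. \<forall>x\<in>space M. norm (f c' x) \<le> g x)"
 shows "(%c. integral\<^sup>L M (f c)) holomorphic_on S"
proof -
 have "\<exists>D. ((%c. integral\<^sup>L M (f c)) has_field_derivative D) (at c)" if c: "c \<in> S" for c
 proof -
  from dom[OF c] obtain r g where r: "r > 0" "ball c r \<subseteq> S" and g: "integrable M g"
   and fg: "\<And>c' x. c' \<in> ball c r ==> x \<in> space M ==> norm (f c' x) \<le> g x" by blast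
  have integ: "integrable M (f c')" if "c' \<in> ball c r" for c'
  proof (rule B_integrable_bound[OF g])
   show "f c' \<in> borel_measurable M" using meas r that by blast
   show "AE x in M. norm (f c' x) \<le> norm (g x)"
    by (rule AE_I2) (use fg[OF that] in \<open>fastforce intro: order_trans\<close>)
  qed
  define q where "q = (%h x. (f (c + h) x - f c x) / h)"
  have der: "((%c. f c x) has_field_derivative deriv (%c. f c x) c') (at c')"
   if "x \<in> space M" "c' \<in> S" for x c'
   using hol[OF that(1)] S that(2) by (rule holomorphic_derivI)
  have bnd: "norm (q h x) \<le> g x / (r/2)" if x: "x \<in> space M" and h: "norm h < r / 2" for x h
  proof (cases "h = 0")
   case True
   have "0 \<le> g x" using fg[of c x] x r norm_ge_zero order_trans by (metis centre_in_ball)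
   thus ?thesis using True r by (simp add: q_def)
  next
   case False
   have d: "norm (deriv (%c. f c x) w) \<le> g x / (r/2)" if w: "w \<in> ball c (r/2)" for w
   proof -
    have sub: "cball w (r/2) \<subseteq> ball c r"
    proof
     fix t assume "t \<in> cball w (r/2)"
     thus "t \<in> ball c r" using w dist_triangle[of c t w] by (auto simp: mem_ball mem_cball)
    qed
    \<comment> \<open>The disc of radius r/2 about a point of \<open>ball c (r/2)\<close> stays
      inside \<open>ball c r\<close>, where \<open>g x\<close> is a bound.\<close>
    have "norm ((deriv ^^ 1) (%c. f c x) w) \<le> (fact 1 * g x) / (r/2) ^ 1"
    proof (rule Cauchy_inequality)
     show "(%c. f c x) holomorphic_on ball w (r/2)"
      by (rule holomorphic_on_subset[OF hol[OF x]]) (use sub r in force)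
     show "continuous_on (cball w (r/2)) (%c. f c x)"
      by (rule holomorphic_on_imp_continuous_on, rule holomorphic_on_subset[OF hol[OF x]]) (use sub r in force)
     show "r/2 > 0" using r by simp
     fix t assume "norm (w - t) = r/2"
     hence "t \<in> cball w (r/2)" by (simp add: dist_norm)
     thus "norm (f t x) \<le> g x" using sub fg x by blast
    qed
    thus ?thesis by simp
   qed
   have "norm (f (c + h) x - f c x) \<le> (g x / (r/2)) * norm (c + h - c)"
   proof (rule field_differentiable_bound[of "ball c (r/2)" "%c. f c x" "deriv (%c. f c x)"])
    fix t assume "t \<in> ball c (r/2)"
    hence "t \<in> S" using r by auto
    thus "((%c. f c x) has_field_derivative deriv (%c. f c x) t) (at t within ball c (r/2))"
     using der[OF x] has_field_derivative_at_within by blast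
   qed (use d h r in \<open>auto simp: dist_norm\<close>)
   thus ?thesis using False by (simp add: q_def norm_divide field_simps)
  qed
  have lim: "((%h. q h x) \<longlongrightarrow> deriv (%c. f c x) c) (at 0)" if "x \<in> space M" for x
   using der[OF that c] unfolding has_field_derivative_iff q_def
   by (simp add: LIM_offset_zero_iff)
  have "((%h. (integral\<^sup>L M (f (c + h)) - integral\<^sup>L M (f c)) / h) \<longlongrightarrow>
      integral\<^sup>L M (%x. deriv (%c. f c x) c)) (at 0)"
   unfolding tendsto_at_iff_sequentially
  proof (intro allI impI)
   fix X :: "nat => complex" assume X: "\<forall>i. X i \<in> UNIV - {0}" "X \<longlonglongrightarrow> 0"
   have "eventually (%i. norm (X i) < r / 2) sequentially"
    using X(2) r by (metis half_gt_zero tendsto_norm_zero order_tendstoD(2))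
   then obtain N where N: "\<And>i. i \<ge> N ==> norm (X i) < r / 2"
    by (auto simp: eventually_sequentially)
   define X' where "X' = (%i. X (i + N))"
   have X': "norm (X' i) < r / 2" "X' i ~= 0" for i using N X by (auto simp: X'_def)
   have X'0: "X' \<longlonglongrightarrow> 0" unfolding X'_def using X(2) by (rule LIMSEQ_ignore_initial_segment)
   have inb: "c + X' i \<in> ball c r" for i using X'(1)[of i] r by (simp add: dist_norm)
   have ptw: "(%i. q (X' i) x) \<longlonglongrightarrow> deriv (%c. f c x) c" if "x \<in> space M" for x
    using lim[OF that] X'0 X'(2) unfolding tendsto_at_iff_sequentially comp_def by auto
   have qm: "q (X' i) \<in> borel_measurable M" for i
   proof -
    have "f (c + X' i) \<in> borel_measurable M" "f c \<in> borel_measurable M"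
     using meas inb[of i] r(2) c by blast+
    thus ?thesis unfolding q_def by (intro borel_measurable_divide borel_measurable_diff) auto
   qed
   have "(%i. integral\<^sup>L M (q (X' i))) \<longlonglongrightarrow> integral\<^sup>L M (%x. deriv (%c. f c x) c)"
   proof (rule integral_dominated_convergence)
    show "(%x. deriv (%c. f c x) c) \<in> borel_measurable M"
     by (rule borel_measurable_LIMSEQ_metric[OF qm ptw])
    show "integrable M (%x. g x / (r/2))" using g by simp
    show "AE x in M. (%i. q (X' i) x) \<longlonglongrightarrow> deriv (%c. f c x) c" using ptw by (auto intro: AE_I2)
    show "AE x in M. norm (q (X' i) x) \<le> g x / (r/2)" for i using bnd X' by (auto intro: AE_I2)
   qed (rule qm)
   moreover have "integral\<^sup>L M (q (X' i)) = (integral\<^sup>L M (f (c + X' i)) - integral\<^sup>L M (f c)) / X' i" for i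
    unfolding q_def using integ[OF inb[of i]] integ[of c] r
    by (subst integral_divide_zero) (simp_all)
   ultimately have "(%i. (integral\<^sup>L M (f (c + X' i)) - integral\<^sup>L M (f c)) / X' i) \<longlonglongrightarrow> integral\<^sup>L M (%x. deriv (%c. f c x) c)"
    by simp
   thus "((%h. (integral\<^sup>L M (f (c + h)) - integral\<^sup>L M (f c)) / h) \<circ> X) \<longlonglongrightarrow> integral\<^sup>L M (%x. deriv (%c. f c x) c)"
    unfolding X'_def comp_def by (rule LIMSEQ_offset)
  qed
  thus ?thesis unfolding DERIV_def by blast
 qed
 thus ?thesis using S by (simp add: holomorphic_on_open)
qed

text \<open>A series is an integral over counting measure. The bound is asked for from some index
  \<open>N\<close> on, since the estimates for the kernel hold once z/n or x/n is small; the
  finitely many earlier terms are added separately.\<close>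

lemma holomorphic_suminf:
 fixes f :: "nat => complex => complex"
 assumes S: "open S" and hol: "\<And>n. f n holomorphic_on S"
  and dom: "\<And>c. c \<in> S ==> \<exists>r>0. \<exists>g. \<exists>N. ball c r \<subseteq> S \<and> summable g \<and>
        (\<forall>c'\<in>ball c r. \<forall>n\<ge>N. norm (f n c') \<le> g n)"
 shows "(%c. \<Sum>n. f n c) holomorphic_on S"
proof -
 have "\<exists>D. ((%c. \<Sum>n. f n c) has_field_derivative D) (at c)" if c: "c \<in> S" for c
 proof -
  from dom[OF c] obtain r g N where r: "r > 0" "ball c r \<subseteq> S" "summable g"
   and fg: "\<And>c' n. c' \<in> ball c r ==> n \<ge> N ==> norm (f n c') \<le> g n" by blast
  have "(%c. integral\<^sup>L (count_space UNIV) (%n. f (n + N) c)) holomorphic_on ball c r"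
  proof (rule holomorphic_integral)
   fix c' assume c': "c' \<in> ball c r"
   obtain \<epsilon> where e: "\<epsilon> > 0" "ball c' \<epsilon> \<subseteq> ball c r" using c' open_contains_ball_eq[of "ball c r"] by blast
   have "integrable (count_space UNIV) (%n. g (n + N))"
   proof -
    have "norm (g (n + N)) = g (n + N)" for n using fg[of c "n+N"] r norm_ge_zero order_trans
     by (metis abs_of_nonneg centre_in_ball le_add2 real_norm_def)
    thus ?thesis using r by (simp add: integrable_count_space_nat_iff summable_iff_shift)
   qed
   thus "\<exists>r'>0. \<exists>g. ball c' r' \<subseteq> ball c r \<and> integrable (count_space UNIV) g \<and>
       (\<forall>c'\<in>ball c' r'. \<forall>x\<in>space (count_space UNIV). norm (f (x + N) c') \<le> g x)"
    using e fg by (intro exI[of _ \<epsilon>] conjI exI[of _ "%n. g (n + N)"]) auto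
  qed (use hol r in \<open>auto intro: holomorphic_on_subset\<close>)
  hence "(%c. (\<Sum>n<N. f n c) + integral\<^sup>L (count_space UNIV) (%n. f (n + N) c)) holomorphic_on ball c r"
   by (intro holomorphic_intros) (use hol r in \<open>auto intro: holomorphic_on_subset\<close>)
  moreover have "(\<Sum>n<N. f n c') + integral\<^sup>L (count_space UNIV) (%n. f (n + N) c') = (\<Sum>n. f n c')"
   if c': "c' \<in> ball c r" for c'
  proof -
   have sm: "summable (%n. norm (f (n + N) c'))"
    by (rule summable_comparison_test[of _ "%n. g (n + N)"]) (use fg[OF c'] r in \<open>auto simp: summable_iff_shift\<close>)
   hence "integrable (count_space UNIV) (%n. f (n + N) c')" by (simp add: integrable_count_space_nat_iff)
   hence "integral\<^sup>L (count_space UNIV) (%n. f (n + N) c') = (\<Sum>n. f (n + N) c')" by (rule integral_count_space_nat)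
   moreover have "summable (%n. f n c')" using summable_norm_cancel[OF sm] summable_iff_shift[of "%n. f n c'" N] by blast
   ultimately show ?thesis using suminf_split_initial_segment[of "%n. f n c'" N] by simp
  qed
  ultimately have "(%c. \<Sum>n. f n c) holomorphic_on ball c r"
   by (subst (asm) holomorphic_cong[OF refl]) auto
  thus ?thesis using r by (simp add: holomorphic_on_open)
 qed
 thus ?thesis using S by (simp add: holomorphic_on_open)
qed

section \<open>Beta integrals\<close>

text \<open>The form of the identity theorem behind all continuations below: the midpoint of the
  interval is a limit point of its image in the plane.\<close>

lemma holomorphic_eq_from_reals:
 assumes "open S" "connected S" "f holomorphic_on S" "g holomorphic_on S" "a < b"
  and "\<And>t. a < t ==> t < b ==> of_real t \<in> S \<and> f (of_real t) = g (of_real t)" and "w \<in> S"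
 shows "f w = g w"
proof -
 define m where "m = (a + b) / 2"
 have m: "a < m" "m < b" using assms by (auto simp: m_def)
 have "of_real m islimpt (complex_of_real ` {a<..<b})"
  unfolding islimpt_sequential
 proof (intro exI conjI allI)
  define X where "X = (%n. complex_of_real (m + (b - m) / (real n + 2)))"
  show "X n \<in> complex_of_real ` {a<..<b} - {complex_of_real m}" for n
  proof -
   have "(b - m) / (real n + 2) < b - m" using m by (simp add: divide_simps)
   moreover have "(b - m) / (real n + 2) > 0" using m by simp
   ultimately have "m + (b - m) / (real n + 2) \<in> {a<..<b}" "m + (b - m) / (real n + 2) ~= m"
    unfolding greaterThanLessThan_iff using m by linarith+
   thus ?thesis unfolding X_def using of_real_eq_iff by blast
  qed
  have "(%n. (b - m) / (real n + 2)) \<longlonglongrightarrow> 0"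
   by real_asymp
  hence "(%n. m + (b - m) / (real n + 2)) \<longlonglongrightarrow> m + 0" by (intro tendsto_intros)
  hence "(%n. m + (b - m) / (real n + 2)) \<longlonglongrightarrow> m" by simp
  thus "X \<longlonglongrightarrow> complex_of_real m" unfolding X_def by (rule tendsto_of_real)
 qed
 hence lp: "of_real m islimpt (complex_of_real ` {a<..<b})" .
 have "complex_of_real ` {a<..<b} \<subseteq> S" using assms by auto
 moreover have "of_real m \<in> S" using assms m by auto
 moreover have "(%w. f w - g w) holomorphic_on S" using assms by (intro holomorphic_intros)
 ultimately have "f w - g w = 0"
  using analytic_continuation[of "%w. f w - g w" S "complex_of_real ` {a<..<b}" "of_real m" w, OF _ assms(1,2) _ _ lp]
   assms(6,7) by force
 thus ?thesis by simp
qed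

lemma norm_powr_le:
 assumes "z ~= 0"
 shows "norm (z powr a) \<le> norm z powr Re a * exp (pi * \<bar>Im a\<bar>)"
proof -
 have "norm (z powr a) = exp (Re a * ln (norm z) - Im a * Im (Ln z))"
  using assms by (simp add: powr_def)
 also have "\<dots> \<le> exp (Re a * ln (norm z) + pi * \<bar>Im a\<bar>)"
 proof -
  have "\<bar>Im (Ln z)\<bar> \<le> pi" using assms mpi_less_Im_Ln[of z] Im_Ln_le_pi[of z] by auto
  hence "\<bar>Im a * Im (Ln z)\<bar> \<le> \<bar>Im a\<bar> * pi" by (simp add: abs_mult mult_left_mono)
  thus ?thesis by (simp add: mult.commute)
 qed
 also have "\<dots> = norm z powr Re a * exp (pi * \<bar>Im a\<bar>)"
  using assms by (simp add: exp_add powr_def)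
 finally show ?thesis .
qed

lemma absolutely_integrable_posM:
 fixes f :: "real => real"
 assumes "continuous_on {0<..} f"
 shows "f absolutely_integrable_on {0<..} \<longleftrightarrow> integrable posM f"
  and "integrable posM f ==> integral {0<..} f = integral\<^sup>L posM f"
proof -
 define g where "g = (%x. indicator {0<..} x *\<^sub>R f x)"
 have g: "g \<in> borel_measurable lborel"
  unfolding g_def using assms borel_measurable_continuous_on_indicator[of "{0<..}" f] by simp
 show 1: "f absolutely_integrable_on {0<..} \<longleftrightarrow> integrable posM f"
  using g unfolding integrable_posM_iff set_integrable_def g_def[symmetric] by (rule integrable_completion)
 assume "integrable posM f"
 hence "f absolutely_integrable_on {0<..}" using 1 by simp
 hence "integral {0<..} f = set_lebesgue_integral lebesgue {0<..} f"
  by (rule set_lebesgue_integral_eq_integral(2)[symmetric])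
 also have "\<dots> = integral\<^sup>L posM f"
  unfolding integral_posM set_lebesgue_integral_def g_def[symmetric] using g by (rule integral_completion)
 finally show "integral {0<..} f = integral\<^sup>L posM f" .
qed

text \<open>The substitution t = y / (1 + y) carries (0, infinity) onto (0, 1) and the integrand to
  t^(p-1) (1-t)^(q-1).\<close>

lemma Beta_integral_real:
 fixes p q :: real
 assumes p: "p > 0" and q: "q > 0"
 shows "integrable posM (%y. y powr (p - 1) * (1 + y) powr (- p - q))"
  and "(\<integral>y. y powr (p - 1) * (1 + y) powr (- p - q) \<partial>posM) = Beta p q"
proof -
 define f where "f = (%t::real. t powr (p - 1) * (1 - t) powr (q - 1))"
 define h where "h = (%y::real. y powr (p - 1) * (1 + y) powr (- p - q))"
 have "set_integrable lborel {0..1} f" unfolding f_def by (rule integrable_Beta[OF p q])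
 hence "set_integrable lborel {0<..<1} f" by (rule set_integrable_subset) auto
 hence a: "f absolutely_integrable_on {0<..<1}"
  unfolding set_integrable_def using integrable_completion borel_measurable_integrable by blast
 have b: "integral {0<..<1} f = Beta p q"
  using has_integral_Beta_real[OF p q] unfolding f_def has_integral_Icc_iff_Ioo by (rule integral_unique)
 have im: "(%y. y / (1 + y)) ` {0<..} = {0<..<(1::real)}"
 proof (intro equalityI subsetI)
  fix t :: real assume "t \<in> {0<..<1}"
  thus "t \<in> (%y. y / (1 + y)) ` {0<..}"
   by (intro image_eqI[of _ _ "t / (1 - t)"]) (auto simp: field_simps)
 qed auto
 have "(%x. \<bar>1 / (1 + x)\<^sup>2\<bar> * f (x / (1 + x))) absolutely_integrable_on {0<..} \<and>
    integral {0<..} (%x. \<bar>1 / (1 + x)\<^sup>2\<bar> * f (x / (1 + x))) = Beta p q"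
 proof (rule has_absolute_integral_change_of_variables_1'[where g = "%y. y / (1 + y)", THEN iffD2])
  show "((%y. y / (1 + y)) has_field_derivative 1 / (1 + x)\<^sup>2) (at x within {0<..})"
   if "x \<in> {0<..}" for x :: real
   using that by (auto intro!: derivative_eq_intros simp: field_simps power2_eq_square add_eq_0_iff)
  show "inj_on (%y::real. y / (1 + y)) {0<..}"
   by (intro inj_onI) (auto simp: field_simps)
 qed (use a b im in auto)
 moreover have eq: "\<bar>1 / (1 + x)\<^sup>2\<bar> * f (x / (1 + x)) = h x" if "x \<in> {0<..}" for x
 proof -
  have x: "x > 0" using that by simp
  have "1 - x / (1 + x) = 1 / (1 + x)" using x by (simp add: field_simps)
  hence "f (x / (1 + x)) = x powr (p - 1) / (1 + x) powr (p - 1) * (1 / (1 + x) powr (q - 1))"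
   using x by (simp add: f_def powr_divide)
  moreover have "h x = x powr (p - 1) * (1 + x) powr (-(p - 1) + (-(q - 1)) + (- 2))"
   by (simp add: h_def)
  ultimately show ?thesis using x
   by (simp only: powr_add powr_minus powr_numeral) (simp add: divide_simps powr_minus)
 qed
 ultimately have *: "h absolutely_integrable_on {0<..}" "integral {0<..} h = Beta p q"
  using set_integrable_cong[of lebesgue lebesgue "{0<..}" "{0<..}", OF refl refl, of "%x. \<bar>1 / (1 + x)\<^sup>2\<bar> * f (x / (1 + x))" h]
   integral_cong[of "{0<..}" "%x. \<bar>1 / (1 + x)\<^sup>2\<bar> * f (x / (1 + x))" h] by simp_all
 have "continuous_on {0<..} h" unfolding h_def by (intro continuous_intros) auto
 from absolutely_integrable_posM[OF this] * show "integrable posM h" "integral\<^sup>L posM h = Beta p q"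
  by auto
qed

text \<open>Divided by 1 + y, the number 1 + c y is a point of the segment from 1 to c, and this
  segment misses 0 because c is off the nonpositive real axis. Half of its distance from 0 is given
  up to make the bound uniform for nearby c'.\<close>

lemma segment_bound:
 fixes c :: complex
 assumes "c \<notin> \<real>\<^sub>\<le>\<^sub>0"
 obtains r \<delta> where "r > 0" "\<delta> > 0" "ball c r \<subseteq> - \<real>\<^sub>\<le>\<^sub>0"
  "\<And>c' y. c' \<in> ball c r ==> y \<ge> 0 ==> norm (1 + c' * of_real y) \<ge> \<delta> * (1 + y)"
proof -
 have n0: "0 \<notin> closed_segment 1 c"
 proof
  assume "0 \<in> closed_segment 1 c"
  then obtain u where u: "0 = (1 - u) *\<^sub>R 1 + u *\<^sub>R c" "0 \<le> u" "u \<le> 1" by (auto simp: closed_segment_def)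
  have u0: "u ~= 0" using u by auto
  have e: "1 - u + u * Re c = 0" "u * Im c = 0"
   using arg_cong[OF u(1), of Re] arg_cong[OF u(1), of Im] by simp_all
  have "Im c = 0" using e u0 by simp
  moreover have "u * Re c \<le> 0" using e(1) u by linarith
  hence "Re c \<le> 0" using u u0 by (simp add: mult_le_0_iff)
  ultimately show False using assms by (simp add: complex_nonpos_Reals_iff)
 qed
 define d where "d = infdist 0 (closed_segment 1 c)"
 have d: "d > 0" unfolding d_def using n0 by (intro infdist_pos_not_in_closed) auto
 have "open (- \<real>\<^sub>\<le>\<^sub>0 :: complex set)" by (simp add: open_Compl)
 then obtain r0 where r0: "r0 > 0" "ball c r0 \<subseteq> - \<real>\<^sub>\<le>\<^sub>0" using assms open_contains_ball_eq by blast
 show ?thesis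
 proof (rule that[of "min r0 (d/2)" "d/2"])
  show "ball c (min r0 (d / 2)) \<subseteq> - \<real>\<^sub>\<le>\<^sub>0" using r0 by auto
  fix c' y assume c': "c' \<in> ball c (min r0 (d / 2))" and y: "(y::real) \<ge> 0"
  define l where "l = y / (1 + y)"
  have l: "0 \<le> l" "l \<le> 1" using y by (auto simp: l_def)
  have "(1 - l) *\<^sub>R 1 + l *\<^sub>R c \<in> closed_segment 1 c" using l by (auto simp: closed_segment_def)
  hence "d \<le> dist 0 ((1 - l) *\<^sub>R 1 + l *\<^sub>R c)" unfolding d_def by (rule infdist_le)
  hence "d \<le> norm ((1 - l) *\<^sub>R 1 + l *\<^sub>R c)" by (simp only: dist_0_norm)
  also have "(1 - l) *\<^sub>R 1 + l *\<^sub>R c = ((1 - l) *\<^sub>R 1 + l *\<^sub>R c') + l *\<^sub>R (c - c')" by (simp add: algebra_simps)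
  also have "norm \<dots> \<le> norm ((1 - l) *\<^sub>R 1 + l *\<^sub>R c') + norm (l *\<^sub>R (c - c'))" by (rule norm_triangle_ineq)
  also have "norm (l *\<^sub>R (c - c')) \<le> 1 * (d/2)"
  proof -
   have "norm (c - c') \<le> d/2" using c' by (simp add: dist_norm)
   hence "\<bar>l\<bar> * norm (c - c') \<le> 1 * (d/2)" using l by (intro mult_mono) simp_all
   thus ?thesis by simp
  qed
  finally have "d/2 \<le> norm ((1 - l) *\<^sub>R 1 + l *\<^sub>R c')" by linarith
  hence "d/2 * (1 + y) \<le> norm ((1 - l) *\<^sub>R 1 + l *\<^sub>R c') * (1 + y)" using y by (intro mult_right_mono) auto
  also have "\<dots> = norm (((1 - l) *\<^sub>R 1 + l *\<^sub>R c') * of_real (1 + y))" using y by (simp only: norm_mult norm_of_real)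
  also have "((1 - l) *\<^sub>R 1 + l *\<^sub>R c') * of_real (1 + y) = of_real ((1 - l) * (1 + y)) + of_real (l * (1 + y)) * c'"
   by (simp add: scaleR_conv_of_real algebra_simps)
  also have "(1 - l) * (1 + y) = 1" using y by (simp add: l_def field_simps)
  also have "l * (1 + y) = y" using y by (simp add: l_def)
  finally show "d/2 * (1 + y) \<le> norm (1 + c' * of_real y)" by (simp add: mult.commute)
 qed (use r0 d in auto)
qed

lemma one_plus_mult_not_nonpos:
 fixes c :: complex
 assumes "c \<notin> \<real>\<^sub>\<le>\<^sub>0" "y \<ge> 0" shows "1 + c * of_real y \<notin> \<real>\<^sub>\<le>\<^sub>0"
proof
 assume "1 + c * of_real y \<in> \<real>\<^sub>\<le>\<^sub>0"
 hence a: "1 + Re c * y \<le> 0" "Im c * y = 0" by (auto simp: complex_nonpos_Reals_iff)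
 hence "y ~= 0" by auto
 hence "Im c = 0" "y > 0" using a assms by auto
 moreover have "Re c * y < 0" using a by linarith
 ultimately show False using assms by (auto simp: complex_nonpos_Reals_iff mult_less_0_iff)
qed

lemma continuous_on_powr_slit:
 fixes f :: "'a::topological_space => complex"
 assumes "continuous_on A f" "continuous_on A g" "\<And>x. x \<in> A ==> f x \<notin> \<real>\<^sub>\<le>\<^sub>0"
 shows "continuous_on A (%x. f x powr g x)"
proof -
 have "continuous_on A (%x. exp (g x * Ln (f x)))"
  using assms by (intro continuous_intros) auto
 moreover have "exp (g x * Ln (f x)) = f x powr g x" if "x \<in> A" for x
  using assms(3)[OF that] by (auto simp: powr_def)
 ultimately show ?thesis by (subst (asm) continuous_on_cong[OF refl]) auto
qed

text \<open>Continuation in \<open>q\<close> from the positive reals. Near a point c the real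
  integrand with second parameter Re c / 2 dominates, because 1 + y >= 1 makes the modulus decrease
  in Re q.\<close>

lemma Beta_integral_complex_exponent:
 fixes p :: real and q :: complex
 assumes p: "p > 0" and q: "Re q > 0"
 shows "(\<integral>y. complex_of_real (y powr (p - 1)) * of_real (1 + y) powr (- of_real p - q) \<partial>posM) = Beta (of_real p) q"
proof -
 define F where "F = (%q y. complex_of_real (y powr (p - 1)) * of_real (1 + y) powr (- of_real p - q))"
 have "(%q. integral\<^sup>L posM (F q)) holomorphic_on {q. Re q > 0}"
 proof (rule holomorphic_integral)
  show "open {q. Re q > 0}" by (rule open_halfspace_Re_gt)
  show "F c \<in> borel_measurable posM" for c
   unfolding F_def by (intro continuous_on_posM_measurable continuous_on_powr_slit continuous_intros) (auto simp: complex_nonpos_Reals_iff)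
  show "(%c. F c y) holomorphic_on {q. Re q > 0}" if "y \<in> space posM" for y
   unfolding F_def by (intro holomorphic_intros)
  fix c assume "c \<in> {q. Re q > 0}"
  hence c: "Re c > 0" by simp
  have re: "Re c' \<ge> Re c / 2" if "c' \<in> ball c (Re c / 2)" for c'
   using that abs_Re_le_cmod[of "c - c'"] by (auto simp: dist_norm)
  show "\<exists>r>0. \<exists>g. ball c r \<subseteq> {q. Re q > 0} \<and> integrable posM g \<and> (\<forall>c'\<in>ball c r. \<forall>x\<in>space posM. norm (F c' x) \<le> g x)"
  proof (intro exI conjI ballI)
   show "Re c / 2 > 0" using c by simp
   show "ball c (Re c / 2) \<subseteq> {q. Re q > 0}" using re c by fastforce
   show "integrable posM (%y. y powr (p - 1) * (1 + y) powr (- p - Re c / 2))"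
    using Beta_integral_real(1)[OF p, of "Re c / 2"] c by simp
   fix c' y assume c': "c' \<in> ball c (Re c / 2)" and y: "y \<in> space posM"
   have "norm (F c' y) = y powr (p - 1) * (1 + y) powr (- p - Re c')"
    using y by (simp add: F_def norm_mult space_posM norm_powr_real_powr)
   also have "\<dots> \<le> y powr (p - 1) * (1 + y) powr (- p - Re c / 2)"
    using re[OF c'] y by (intro mult_left_mono powr_mono) (auto simp: space_posM)
   finally show "norm (F c' y) \<le> y powr (p - 1) * (1 + y) powr (- p - Re c / 2)" .
  qed
 qed
 moreover have "(%q. Beta (of_real p) q) holomorphic_on {q. Re q > 0}"
  unfolding Beta_altdef using p
  by (intro holomorphic_intros) (auto elim!: nonpos_Ints_cases)
 moreover have "integral\<^sup>L posM (F (of_real t)) = Beta (of_real p) (of_real t)" if "t > 0" for t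
 proof -
  have "F (of_real t) y = of_real (y powr (p - 1) * (1 + y) powr (- p - t))" if "y > 0" for y
   using that by (simp add: F_def powr_of_real[symmetric])
  hence "integral\<^sup>L posM (F (of_real t)) = (\<integral>y. of_real (y powr (p - 1) * (1 + y) powr (- p - t)) \<partial>posM)"
   by (intro B_integral_cong) (auto simp: space_posM)
  also have "\<dots> = of_real (\<integral>y. (y powr (p - 1) * (1 + y) powr (- p - t)) \<partial>posM)" by (rule integral_complex_of_real)
  also have "\<dots> = Beta (of_real p) (of_real t)"
   using Beta_integral_real(2)[OF p that] Beta_complex_of_real[of p t] by simp
  finally show ?thesis .
 qed
 ultimately have "integral\<^sup>L posM (F q) = Beta (of_real p) q"
  using holomorphic_eq_from_reals[of "{q. Re q > 0}" "%q. integral\<^sup>L posM (F q)" "%q. Beta (of_real p) q" 0 1 q,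
    OF open_halfspace_Re_gt convex_connected[OF convex_halfspace_Re_gt]] q by simp
 thus ?thesis by (simp add: F_def)
qed

lemma connected_slit: "connected (- \<real>\<^sub>\<le>\<^sub>0 :: complex set)"
proof -
 have "(\<real>\<^sub>\<le>\<^sub>0 :: complex set) = complex_of_real ` {..0}"
  by (auto simp: nonpos_Reals_def)
 thus ?thesis using starlike_imp_connected[OF starlike_slotted_complex_plane_left[of 0]] by simp
qed

text \<open>Continuation in \<open>c\<close> over the slit plane. For positive real c a scaling of y
  reduces to the case c = 1, and \<open>segment_bound\<close> supplies the locally uniform
  majorant.\<close>

lemma Beta_integral_complex:
 fixes p :: real and q c :: complex
 assumes p: "p > 0" and q: "Re q > 0" and c: "c \<notin> \<real>\<^sub>\<le>\<^sub>0"
 shows "integrable posM (%y. complex_of_real (y powr (p - 1)) * (1 + c * of_real y) powr (- of_real p - q))"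
  and "(\<integral>y. complex_of_real (y powr (p - 1)) * (1 + c * of_real y) powr (- of_real p - q) \<partial>posM)
    = c powr (- of_real p) * Beta (of_real p) q"
proof -
 define F where "F = (%c y. complex_of_real (y powr (p - 1)) * (1 + c * of_real y) powr (- of_real p - q))"
 have meas: "F c \<in> borel_measurable posM" if "c \<notin> \<real>\<^sub>\<le>\<^sub>0" for c
  unfolding F_def using one_plus_mult_not_nonpos[OF that]
  by (intro continuous_on_posM_measurable continuous_on_powr_slit continuous_intros) auto
 have bound: "\<exists>r>0. \<exists>g. ball c r \<subseteq> - \<real>\<^sub>\<le>\<^sub>0 \<and> integrable posM g \<and> (\<forall>c'\<in>ball c r. \<forall>x\<in>space posM. norm (F c' x) \<le> g x)"
  if c: "c \<notin> \<real>\<^sub>\<le>\<^sub>0" for c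
 proof -
  obtain r \<delta> where r: "r > 0" "\<delta> > 0" "ball c r \<subseteq> - \<real>\<^sub>\<le>\<^sub>0"
   "\<And>c' y. c' \<in> ball c r ==> y \<ge> 0 ==> norm (1 + c' * of_real y) \<ge> \<delta> * (1 + y)"
   using segment_bound[OF c] by blast
  define C where "C = \<delta> powr (- p - Re q) * exp (pi * \<bar>Im q\<bar>)"
  show ?thesis
  proof (intro exI conjI ballI)
   show "integrable posM (%y. C * (y powr (p - 1) * (1 + y) powr (- p - Re q)))"
    using Beta_integral_real(1)[OF p q] by simp
   fix c' y assume c': "c' \<in> ball c r" and y: "y \<in> space posM"
   have y: "y > 0" using y by (simp add: space_posM)
   have n: "norm (1 + c' * of_real y) \<ge> \<delta> * (1 + y)" "\<delta> * (1 + y) > 0" using r c' y by auto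
   have "norm ((1 + c' * of_real y) powr (- of_real p - q)) \<le> norm (1 + c' * of_real y) powr (- p - Re q) * exp (pi * \<bar>Im q\<bar>)"
    using norm_powr_le[of "1 + c' * of_real y" "- of_real p - q"] n by force
   also have "\<dots> \<le> (\<delta> * (1 + y)) powr (- p - Re q) * exp (pi * \<bar>Im q\<bar>)"
    using n p q by (intro mult_right_mono powr_mono2') auto
   also have "\<dots> = C * (1 + y) powr (- p - Re q)" using r y by (simp add: C_def powr_mult)
   finally show "norm (F c' y) \<le> C * (y powr (p - 1) * (1 + y) powr (- p - Re q))"
    using y by (simp add: F_def norm_mult mult_left_mono mult.left_commute)
  qed (use r in auto)
 qed
 show "integrable posM (F c)"
 proof -
  from bound[OF c] obtain r g where "r > 0" "integrable posM g" "\<forall>c'\<in>ball c r. \<forall>x\<in>space posM. norm (F c' x) \<le> g x" by blast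
  thus ?thesis
   by (intro B_integrable_bound[of posM g, OF _ meas[OF c]] AE_I2) (force intro: order_trans[OF _ abs_ge_self])+
 qed
 have hol: "(%c. integral\<^sup>L posM (F c)) holomorphic_on - \<real>\<^sub>\<le>\<^sub>0"
 proof (rule holomorphic_integral)
  show "(%c. F c y) holomorphic_on - \<real>\<^sub>\<le>\<^sub>0" if "y \<in> space posM" for y
   unfolding F_def using that one_plus_mult_not_nonpos by (intro holomorphic_intros) (auto simp: space_posM less_imp_le)
 qed (use meas bound in \<open>auto simp: open_Compl\<close>)
 have real: "integral\<^sup>L posM (F (of_real t)) = of_real t powr (- of_real p) * Beta (of_real p) q" if t: "t > 0" for t
 proof -
  define G where "G = (%y. complex_of_real (y powr (p - 1)) * of_real (1 + y) powr (- of_real p - q))"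
  have "F (of_real t) y = of_real (t powr (1 - p)) * G (t * y)" if "y > 0" for y
  proof -
   have "t powr (1 - p) * (t * y) powr (p - 1) = y powr (p - 1)"
    using t that by (simp add: powr_mult powr_add[symmetric] flip: mult.assoc)
   hence "complex_of_real (t powr (1 - p)) * complex_of_real ((t * y) powr (p - 1)) = complex_of_real (y powr (p - 1))"
    by (metis of_real_mult)
   thus ?thesis by (simp add: F_def G_def flip: mult.assoc)
  qed
  hence "integral\<^sup>L posM (F (of_real t)) = (\<integral>y. of_real (t powr (1 - p)) * G (t * y) \<partial>posM)"
   by (intro B_integral_cong) (auto simp: space_posM)
  also have "\<dots> = of_real (t powr (1 - p)) * (integral\<^sup>L posM G /\<^sub>R t)"
   using integrable_integral_posM_scale(2)[OF t, of G] by simp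
  also have "integral\<^sup>L posM G = Beta (of_real p) q"
   unfolding G_def by (rule Beta_integral_complex_exponent[OF p q])
  also have "of_real (t powr (1 - p)) * (Beta (of_real p) q /\<^sub>R t) = of_real (t powr (1 - p) / t) * Beta (of_real p) q"
   by (simp add: scaleR_conv_of_real field_simps)
  also have "t powr (1 - p) / t = t powr (- p)" using t by (simp add: powr_diff powr_minus field_simps)
  also have "complex_of_real (t powr (- p)) = of_real t powr (- of_real p)" using t by (simp add: powr_of_real[symmetric])
  finally show ?thesis .
 qed
 have "integral\<^sup>L posM (F c) = c powr (- of_real p) * Beta (of_real p) q"
  by (rule holomorphic_eq_from_reals[of "- \<real>\<^sub>\<le>\<^sub>0" "%c. integral\<^sup>L posM (F c)" _ 0 1])
   (use hol real c connected_slit in \<open>auto intro!: holomorphic_intros simp: open_Compl\<close>)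
 thus "(\<integral>y. complex_of_real (y powr (p - 1)) * (1 + c * of_real y) powr (- of_real p - q) \<partial>posM) = c powr (- of_real p) * Beta (of_real p) q"
  by (simp add: F_def)
qed

section \<open>The Riemann zeta function\<close>

text \<open>This is w - 1 times the difference between (d+2)^(-w) and the integral of t^(-w) over
  [d+1, d+2], multiplied out so that nothing is divided by w - 1.\<close>

definition zeta_term :: "complex => nat => complex" where
 "zeta_term w d = (w - 1) * of_nat (d + 2) powr (- w) + of_nat (d + 2) powr (1 - w) - of_nat (d + 1) powr (1 - w)"

text \<open>The function (w - 1) zeta(w) on Re w > 0; the factor removes the pole. The summand w
  consists of w - 1 for the first term of the Dirichlet series and of 1 for the integral of t^(-w)
  over [1, infinity).\<close>

definition zeta_right :: "complex => complex" where
 "zeta_right w = w + (\<Sum>d. zeta_term w d)"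

text \<open>Two mean value estimates in a row: the term is the increment of \<open>g\<close> over a
  unit segment, and the derivative of \<open>g\<close> is w - 1 times a difference of two values of
  z^(-w) on that segment. The second estimate gains a power of d, hence convergence for Re w >
  0.\<close>

lemma norm_zeta_term_le:
 assumes "Re w > - 1"
 shows "norm (zeta_term w d) \<le> norm (w - 1) * norm w * real (d + 1) powr (- Re w - 1)"
proof -
 define S where "S = closed_segment (of_nat (d + 1)) (of_nat (d + 2) :: complex)"
 have S: "Im z = 0" "real (d + 1) \<le> Re z" "Re z \<le> real (d + 2)" if "z \<in> S" for z
 proof -
  have "z \<in> closed_segment (of_real (real (d + 1))) (of_real (real (d + 2)))" using that by (simp add: S_def)
  hence "z \<in> of_real ` closed_segment (real (d + 1)) (real (d + 2))" by (simp only: closed_segment_of_real)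
  thus "Im z = 0" "real (d + 1) \<le> Re z" "Re z \<le> real (d + 2)"
   by (auto simp: closed_segment_eq_real_ivl)
 qed
 have slit: "z \<notin> \<real>\<^sub>\<le>\<^sub>0" if "z \<in> S" for z
  using S[OF that] by (auto simp: complex_nonpos_Reals_iff)
 have cv: "convex S" by (simp add: S_def)
 have ends: "of_nat (d + 1) \<in> S" "of_nat (d + 2) \<in> S" by (simp_all only: S_def ends_in_segment)
 define B where "B = norm w * real (d + 1) powr (- Re w - 1)"
 have nrm: "norm (z powr a) \<le> real (d + 1) powr Re a" if "z \<in> S" "Re a \<le> 0" for z a
 proof -
  have z: "z = of_real (Re z)" "Re z \<ge> real (d + 1)" using S[OF that(1)] by (auto simp: complex_eq_iff)
  have "norm (of_real (Re z) powr a) = Re z powr Re a"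
   using z(2) by (subst norm_powr_real_powr) auto
  also have "\<dots> \<le> real (d + 1) powr Re a" using z(2) that(2) by (intro powr_mono2') auto
  finally show ?thesis using z(1) by simp
 qed
 have inner: "norm (of_nat (d + 2) powr (- w) - z powr (- w)) \<le> B" if z: "z \<in> S" for z
 proof -
  have "norm (of_nat (d + 2) powr (- w) - z powr (- w)) \<le> B * norm (of_nat (d + 2) - z)"
  proof (rule field_differentiable_bound[OF cv])
   fix t assume t: "t \<in> S"
   show "((%t. t powr (- w)) has_field_derivative (- w) * t powr (- w - 1)) (at t within S)"
    using slit[OF t] by (auto intro!: derivative_eq_intros has_field_derivative_powr_right simp: algebra_simps)
   show "norm (- w * t powr (- w - 1)) \<le> B"
    unfolding norm_mult norm_minus_cancel B_def using nrm[OF t, of "- w - 1"] assms by (intro mult_left_mono) auto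
  qed (use z ends in auto)
  also have "norm (of_nat (d + 2) - z) \<le> 1"
  proof -
   have "of_nat (d + 2) - z = of_real (real (d + 2) - Re z)" using S[OF z] by (simp add: complex_eq_iff)
   thus ?thesis using S[OF z] by (simp only: norm_of_real)
  qed
  hence "B * norm (of_nat (d + 2) - z) \<le> B * 1" by (intro mult_left_mono) (auto simp: B_def)
  finally show ?thesis by simp
 qed
 define g where "g = (%z. (w - 1) * of_nat (d + 2) powr (- w) * z + z powr (1 - w))"
 have "norm (g (of_nat (d + 2)) - g (of_nat (d + 1))) \<le> (norm (w - 1) * B) * norm (of_nat (d + 2) - of_nat (d + 1) :: complex)"
 proof (rule field_differentiable_bound[OF cv])
  fix t assume t: "t \<in> S"
  show "(g has_field_derivative (w - 1) * (of_nat (d + 2) powr (- w) - t powr (- w))) (at t within S)"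
   unfolding g_def using slit[OF t] by (auto intro!: derivative_eq_intros has_field_derivative_powr_right simp: algebra_simps)
  show "norm ((w - 1) * (of_nat (d + 2) powr (- w) - t powr (- w))) \<le> norm (w - 1) * B"
   unfolding norm_mult using inner[OF t] by (intro mult_left_mono) auto
 qed (use ends in auto)
 also have "norm (of_nat (d + 2) - of_nat (d + 1) :: complex) = 1" by simp
 also have "g (of_nat (d + 2)) - g (of_nat (d + 1)) = zeta_term w d"
  by (simp add: g_def zeta_term_def algebra_simps)
 finally show ?thesis by (simp add: B_def mult.assoc)
qed

lemma summable_powr_shift: "a > 1 ==> summable (%d. real (d + 1) powr (- a))"
 using summable_iff_shift[of "%n. real n powr (- a)" 1] summable_real_powr_iff[of "- a"] by simp

lemma summable_zeta_term: "Re w > 0 ==> summable (zeta_term w)"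
proof (rule summable_comparison_test[of _ "%d. norm (w - 1) * norm w * real (d + 1) powr (- (Re w + 1))"])
 assume w: "Re w > 0"
 show "\<exists>N. \<forall>d\<ge>N. norm (zeta_term w d) \<le> norm (w - 1) * norm w * real (d + 1) powr (- (Re w + 1))"
  using norm_zeta_term_le[of w] w by auto
 show "summable (%d. norm (w - 1) * norm w * real (d + 1) powr (- (Re w + 1)))"
  using w by (intro summable_mult summable_powr_shift) auto
qed

lemma zeta_right_holomorphic: "zeta_right holomorphic_on {w. Re w > 0}"
proof -
 have "(%w. \<Sum>d. zeta_term w d) holomorphic_on {w. Re w > 0}"
 proof (rule holomorphic_suminf)
  show "(%w. zeta_term w d) holomorphic_on {w. Re w > 0}" for d
   unfolding zeta_term_def by (intro holomorphic_intros)
  fix c assume "c \<in> {w. Re w > 0}"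
  hence c: "Re c > 0" by simp
  define r where "r = Re c / 2"
  have re: "Re c' \<ge> r" "norm c' \<le> norm c + r" "norm (c' - 1) \<le> norm c + r + 1" if "c' \<in> ball c r" for c'
  proof -
   have "norm (c - c') \<le> r" using that by (simp add: dist_norm)
   thus "Re c' \<ge> r" using abs_Re_le_cmod[of "c - c'"] by (simp add: r_def)
   show n: "norm c' \<le> norm c + r" using norm_triangle_ineq2[of c' c] \<open>norm (c - c') \<le> r\<close>
    by (simp add: norm_minus_commute)
   show "norm (c' - 1) \<le> norm c + r + 1" using norm_triangle_ineq4[of c' 1] n by simp
  qed
  show "\<exists>r>0. \<exists>g N. ball c r \<subseteq> {w. Re w > 0} \<and> summable g \<and> (\<forall>c'\<in>ball c r. \<forall>n\<ge>N. norm (zeta_term c' n) \<le> g n)"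
  proof (intro exI conjI ballI allI impI)
   show "r > 0" using c by (simp add: r_def)
   show "ball c r \<subseteq> {w. Re w > 0}" using re(1) \<open>r > 0\<close> by fastforce
   show "summable (%d. (norm c + r + 1) * (norm c + r) * real (d + 1) powr (- (r + 1)))"
    using \<open>r > 0\<close> by (intro summable_mult summable_powr_shift) auto
   fix c' and d :: nat assume c': "c' \<in> ball c r"
   note re = re[OF c']
   have "norm (zeta_term c' d) \<le> norm (c' - 1) * norm c' * real (d + 1) powr (- Re c' - 1)"
    using re \<open>r > 0\<close> by (intro norm_zeta_term_le) auto
   also have "\<dots> \<le> (norm c + r + 1) * (norm c + r) * real (d + 1) powr (- (r + 1))"
    using re \<open>r > 0\<close> by (intro mult_mono powr_mono) auto
   finally show "norm (zeta_term c' d) \<le> (norm c + r + 1) * (norm c + r) * real (d + 1) powr (- (r + 1))" .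
  qed
 qed (rule open_halfspace_Re_gt)
 thus ?thesis unfolding zeta_right_def by (intro holomorphic_intros)
qed

lemma zeta_right_sums:
 assumes "Re w > 1"
 shows "(%n. of_nat (Suc n) powr (- w)) sums (zeta_right w / (w - 1))"
proof -
 have w: "w ~= 1" using assms by auto
 have tel: "(%d. complex_of_nat (d + 2) powr (1 - w) - of_nat (d + 1) powr (1 - w)) sums (0 - of_nat (0 + 1) powr (1 - w))"
 proof -
  have "(%d. complex_of_nat (d + 1) powr (1 - w)) \<longlonglongrightarrow> 0"
  proof (rule tendsto_norm_zero_cancel)
   have "(%d. real (d + 1) powr (1 - Re w)) \<longlonglongrightarrow> 0" using assms by real_asymp
   moreover have "norm (complex_of_nat (d + 1) powr (1 - w)) = real (d + 1) powr (1 - Re w)" for d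
    using norm_powr_real_powr[of "real (d + 1)" "1 - w"] by simp
   ultimately show "(%d. norm (complex_of_nat (d + 1) powr (1 - w))) \<longlonglongrightarrow> 0" by simp
  qed
  from telescope_sums[OF this] show ?thesis by simp
 qed
 have "zeta_term w sums (\<Sum>d. zeta_term w d)" using summable_zeta_term[of w] assms by (simp add: summable_sums)
 from sums_diff[OF this tel] have "(%d. (w - 1) * of_nat (d + 2) powr (- w)) sums ((\<Sum>d. zeta_term w d) + 1)"
  by (simp add: zeta_term_def algebra_simps)
 from sums_mult[OF this, of "1 / (w - 1)"]
 have "(%d. complex_of_nat (Suc (Suc d)) powr (- w)) sums (((\<Sum>d. zeta_term w d) + 1) / (w - 1))"
  using w by simp
 hence "(%d. complex_of_nat (Suc d) powr (- w)) sums (((\<Sum>d. zeta_term w d) + 1) / (w - 1) + of_nat (Suc 0) powr (- w))"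
  by (subst (asm) sums_Suc_iff) simp
 also have "((\<Sum>d. zeta_term w d) + 1) / (w - 1) + of_nat (Suc 0) powr (- w) = zeta_right w / (w - 1)"
  using w by (simp add: zeta_right_def field_simps)
 finally show ?thesis .
qed

text \<open>For real arguments in the critical interval the defining series says that \<zeta> is the sum of
 the differences between \<open>d powr - al\<close> and the integral of that power over \<open>[d - 1, d]\<close>.\<close>

lemma zeta_right_real_sums:
 fixes al :: real
 assumes "0 < al" "al < 1"
 shows "(%d. real (Suc d) powr (- al) - (real (Suc d) powr (1 - al) - real d powr (1 - al)) / (1 - al)) sums
     Re (zeta_right (of_real al) / (of_real al - 1))"
  and "Im (zeta_right (of_real al) / (of_real al - 1)) = 0"
proof -
 define f where "f = (%d. real (Suc d) powr (- al) - (real (Suc d) powr (1 - al) - real d powr (1 - al)) / (1 - al))"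
 have pw: "complex_of_nat n powr of_real a = of_real (real n powr a)" for n a
  using powr_of_real[of "real n" a] by simp
 have a1: "complex_of_real al ~= 1" using assms by auto
 have "zeta_term (of_real al) sums (\<Sum>d. zeta_term (of_real al) d)" using summable_zeta_term[of "of_real al"] assms by (simp add: summable_sums)
 from sums_divide[OF this, of "of_real al - 1"]
 have "(%d. zeta_term (of_real al) d / (of_real al - 1)) sums ((\<Sum>d. zeta_term (of_real al) d) / (of_real al - 1))" .
 also have "(%d. zeta_term (of_real al) d / (of_real al - 1)) = (%d. of_real (f (Suc d)))"
 proof
  fix d
  have "zeta_term (of_real al) d = of_real ((al - 1) * real (d + 2) powr (- al) + real (d + 2) powr (1 - al) - real (d + 1) powr (1 - al))"
   using pw[of "d + 2" "- al"] pw[of "d + 2" "1 - al"] pw[of "d + 1" "1 - al"] by (simp add: zeta_term_def)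
  also have "\<dots> / (of_real al - 1) = of_real (((al - 1) * real (d + 2) powr (- al) + real (d + 2) powr (1 - al) - real (d + 1) powr (1 - al)) / (al - 1))"
   by simp
  also have "((al - 1) * real (d + 2) powr (- al) + real (d + 2) powr (1 - al) - real (d + 1) powr (1 - al)) / (al - 1) = f (Suc d)"
   using assms by (simp add: f_def field_simps)
  finally show "zeta_term (of_real al) d / (of_real al - 1) = of_real (f (Suc d))" .
 qed
 finally have "(%d. complex_of_real (f d)) sums ((\<Sum>d. zeta_term (of_real al) d) / (of_real al - 1) + of_real (f 0))"
  by (subst (asm) sums_Suc_iff) simp
 also have "(\<Sum>d. zeta_term (of_real al) d) / (of_real al - 1) + of_real (f 0) = zeta_right (of_real al) / (of_real al - 1)"
 proof -
  \<comment> \<open>The term d = 0 compares 1 with the integral over [0, 1]. It equals the summand w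
    of \<open>zeta_right\<close> divided by w - 1.\<close>
  have "complex_of_real (f 0) = of_real al / (of_real al - 1)"
  proof -
   have "f 0 = al / (al - 1)" using assms by (simp add: f_def divide_simps) (simp add: algebra_simps)
   thus ?thesis by simp
  qed
  thus ?thesis using a1 by (simp add: zeta_right_def add_divide_distrib)
 qed
 finally have s: "(%d. complex_of_real (f d)) sums (zeta_right (of_real al) / (of_real al - 1))" .
 from sums_Re[OF s] show "f sums Re (zeta_right (of_real al) / (of_real al - 1))" by simp
 from sums_Im[OF s] show "Im (zeta_right (of_real al) / (of_real al - 1)) = 0"
  using sums_unique2[OF sums_zero] by fastforce
qed

section \<open>Zeta on (0, 1) as an integral; sums compared with integrals under Mellin
  transforms\<close>

lemma integral_posM_pieces:
 fixes F :: "real => real"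
 assumes F: "integrable posM F"
 shows "(%d. \<integral>q. indicator {real d<..real (Suc d)} q * F q \<partial>posM) sums integral\<^sup>L posM F"
proof -
 have int: "integrable posM (%q. indicator A q * F q)" if "A \<in> sets borel" for A :: "real set"
 proof (rule B_integrable_bound[OF F])
  have "(indicator A :: real => real) \<in> borel_measurable posM"
   using that by (intro borel_measurable_posM) simp
  thus "(%q. indicator A q * F q) \<in> borel_measurable posM" using F by auto
 qed (auto intro!: AE_I2 simp: indicator_def)
 have part: "(\<Sum>d<n. indicator {real d<..real (Suc d)} q * F q) = indicator {0<..real n} q * F q" for n q
  by (induction n) (auto simp: indicator_def)
 have "(%n. \<integral>q. (\<Sum>d<n. indicator {real d<..real (Suc d)} q * F q) \<partial>posM) \<longlonglongrightarrow> integral\<^sup>L posM F"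
  unfolding part
 proof (rule integral_dominated_convergence[where w = "%q. norm (F q)"])
  show "AE q in posM. (%n. indicator {0<..real n} q * F q) \<longlonglongrightarrow> F q"
  proof (rule AE_I2)
   fix q assume "q \<in> space posM"
   hence q: "q > 0" by (simp add: space_posM)
   have "eventually (%n. indicator {0<..real n} q * F q = F q) sequentially"
    using eventually_ge_at_top[of "nat \<lceil>q\<rceil>"] by eventually_elim (use q in \<open>auto simp: indicator_def ceiling_le_iff\<close>)
   thus "(%n. indicator {0<..real n} q * F q) \<longlonglongrightarrow> F q" by (rule tendsto_eventually)
  qed
  show "(%q. indicator {0<..real n} q * F q) \<in> borel_measurable posM" for n
   using int[of "{0<..real n}"] by auto
 qed (use F in \<open>auto intro!: AE_I2 simp: indicator_def\<close>)
 also have "(%n. \<integral>q. (\<Sum>d<n. indicator {real d<..real (Suc d)} q * F q) \<partial>posM) =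
      (%n. \<Sum>d<n. \<integral>q. indicator {real d<..real (Suc d)} q * F q \<partial>posM)"
  by (intro ext B_integral_sum int) simp
 finally show ?thesis by (simp add: sums_def)
qed

lemma ceiling_on_piece:
 assumes "q \<in> {real d<..real (Suc d)}" shows "real_of_int \<lceil>q\<rceil> = real (Suc d)"
proof -
 have "\<lceil>q\<rceil> = int (Suc d)" using assms by (intro ceiling_unique) auto
 thus ?thesis by simp
qed

lemma integral_piece_const:
 "integral\<^sup>L posM (%q. indicator {real d<..real (Suc d)} q * c) = (c::real)"
 "integrable posM (%q. indicator {real d<..real (Suc d)} q * (c::real))"
proof -
 have e: "indicator {0<..} q *\<^sub>R (indicator {real d<..real (Suc d)} q * c) = indicator {real d<..real (Suc d)} q * c" for q :: real
  by (auto simp: indicator_def)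
 show "integral\<^sup>L posM (%q. indicator {real d<..real (Suc d)} q * c) = (c::real)"
  unfolding integral_posM set_lebesgue_integral_def e by simp
 show "integrable posM (%q. indicator {real d<..real (Suc d)} q * (c::real))"
  unfolding integrable_posM_iff set_integrable_def e by simp
qed

lemma integral_piece_powr:
 assumes "al < 1"
 shows "integrable posM (%q. indicator {real d<..real (Suc d)} q * q powr (- al))"
  and "integral\<^sup>L posM (%q. indicator {real d<..real (Suc d)} q * q powr (- al)) = (real (Suc d) powr (1 - al) - real d powr (1 - al)) / (1 - al)"
proof -
 have e: "indicator {0<..} q *\<^sub>R (indicator {real d<..real (Suc d)} q * q powr (- al)) = q powr (- al) * indicator {real d<..real (Suc d)} q" for q :: real
  by (auto simp: indicator_def)
 have i: "((%q. q powr (- al)) has_integral (real (Suc d) powr (1 - al) / (1 - al) - real d powr (1 - al) / (1 - al))) {real d..real (Suc d)}"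
 proof (rule fundamental_theorem_of_calculus_interior)
  show "continuous_on {real d..real (Suc d)} (%q. q powr (1 - al) / (1 - al))"
   using assms by (intro continuous_intros continuous_on_powr') auto
  show "((%q. q powr (1 - al) / (1 - al)) has_vector_derivative x powr (- al)) (at x)" if "x \<in> {real d<..<real (Suc d)}" for x
  proof -
   have "x > 0" using that by (auto intro: le_less_trans[of 0 "real d"])
   from DERIV_cdivide[OF has_real_derivative_powr[OF this, of "1 - al"], of "1 - al"]
   show ?thesis using assms unfolding has_real_derivative_iff_has_vector_derivative[symmetric] by simp
  qed
 qed auto
 have "set_integrable lebesgue {real d..real (Suc d)} (%q. q powr (- al))"
  by (intro nonnegative_absolutely_integrable_1) (use i in \<open>auto simp: integrable_on_def\<close>)
 hence s: "set_integrable lborel {real d..real (Suc d)} (%q. q powr (- al))"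
  unfolding set_integrable_def by (subst (asm) integrable_completion) auto
 hence s': "set_integrable lborel {real d<..real (Suc d)} (%q. q powr (- al))"
  by (rule set_integrable_subset) auto
 thus "integrable posM (%q. indicator {real d<..real (Suc d)} q * q powr (- al))"
  unfolding integrable_posM_iff set_integrable_def e by (simp add: mult.commute)
 have "integral\<^sup>L posM (%q. indicator {real d<..real (Suc d)} q * q powr (- al)) = (LINT q:{real d<..real (Suc d)}|lborel. q powr (- al))"
  unfolding integral_posM set_lebesgue_integral_def e by (simp add: mult.commute)
 also have "\<dots> = (LINT q:{real d..real (Suc d)}|lborel. q powr (- al))"
 proof (rule set_integral_cong_set)
  show "set_borel_measurable lborel {real d<..real (Suc d)} (%q. q powr - al)"
   using s' unfolding set_integrable_def set_borel_measurable_def by auto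
  show "set_borel_measurable lborel {real d..real (Suc d)} (%q. q powr - al)"
   using s unfolding set_integrable_def set_borel_measurable_def by auto
  show "AE x in lborel. (x \<in> {real d..real (Suc d)}) = (x \<in> {real d<..real (Suc d)})"
   using AE_lborel_singleton[of "real d"] by eventually_elim auto
 qed
 also have "\<dots> = integral {real d..real (Suc d)} (%q. q powr (- al))"
  using s by (rule set_borel_integral_eq_integral(2))
 also have "\<dots> = (real (Suc d) powr (1 - al) - real d powr (1 - al)) / (1 - al)"
  using i by (simp add: integral_unique diff_divide_distrib)
 finally show "integral\<^sup>L posM (%q. indicator {real d<..real (Suc d)} q * q powr (- al)) = (real (Suc d) powr (1 - al) - real d powr (1 - al)) / (1 - al)" .
qed

text \<open>On the piece (d, d+1] the ceiling is constant and the integral is minus the d-th term of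
  \<open>zeta_right_real_sums\<close>. Since q is at most its ceiling, the integrand is nonnegative,
  which gives integrability along with the value -zeta(al).\<close>

lemma integral_power_minus_ceiling_power:
 fixes al :: real
 assumes "0 < al" "al < 1"
 shows "integrable posM (%q. q powr (- al) - real_of_int \<lceil>q\<rceil> powr (- al))"
  and "(\<integral>q. q powr (- al) - real_of_int \<lceil>q\<rceil> powr (- al) \<partial>posM) = - Re (zeta_right (of_real al) / (of_real al - 1))"
proof -
 define f where "f = (%d q. indicator {real d<..real (Suc d)} q * (q powr (- al) - real_of_int \<lceil>q\<rceil> powr (- al)))"
 have f: "f d = (%q. indicator {real d<..real (Suc d)} q * q powr (- al) - indicator {real d<..real (Suc d)} q * real (Suc d) powr (- al))" for d
  by (rule ext) (use ceiling_on_piece[of _ d] in \<open>auto simp: f_def indicator_def\<close>)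
 note pp = integral_piece_powr[OF assms(2)] integral_piece_const
 have int: "integrable posM (f d)" for d unfolding f by (intro B_integrable_diff pp)
 have "integral\<^sup>L posM (f d) = - (real (Suc d) powr (- al) - (real (Suc d) powr (1 - al) - real d powr (1 - al)) / (1 - al))" for d
  unfolding f B_integral_diff[OF pp(1) pp(4)] pp(2,3) by simp
 hence s: "(%d. integral\<^sup>L posM (f d)) sums (- Re (zeta_right (of_real al) / (of_real al - 1)))"
  using sums_minus[OF zeta_right_real_sums(1)[OF assms]] by simp
 have ge: "q powr (- al) - real_of_int \<lceil>q\<rceil> powr (- al) \<ge> 0" if "q > 0" for q
  using powr_mono2'[of "- al" q "real_of_int \<lceil>q\<rceil>"] that assms by simp
 have nn: "f d q \<ge> 0" if "q \<in> space posM" for d q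
  using ge that by (auto simp: f_def space_posM)
 have ptw: "(%d. f d q) sums (q powr (- al) - real_of_int \<lceil>q\<rceil> powr (- al))" if "q \<in> space posM" for q
 proof -
  have q: "q > 0" using that by (simp add: space_posM)
  define k where "k = nat \<lceil>q\<rceil> - 1"
  have k: "real k < q" "q \<le> real (Suc k)" using q by (simp_all add: k_def of_nat_diff) linarith+
  have "q \<in> {real d<..real (Suc d)} \<longleftrightarrow> d = k" for d
  proof
   assume "q \<in> {real d<..real (Suc d)}"
   hence "real d < real (Suc k)" "real k < real (Suc d)" using k by auto
   thus "d = k" by linarith
  qed (use k in auto)
  hence "f d q = (if d = k then q powr (- al) - real_of_int \<lceil>q\<rceil> powr (- al) else 0)" for d
   by (simp add: f_def indicator_def)
  thus ?thesis using sums_single[of k "%_. q powr (- al) - real_of_int \<lceil>q\<rceil> powr (- al)"] by simp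
 qed
 show "integrable posM (%q. q powr (- al) - real_of_int \<lceil>q\<rceil> powr (- al))"
  by (rule sums_integral_nonneg(1)[OF int nn ptw s])
 show "(\<integral>q. q powr (- al) - real_of_int \<lceil>q\<rceil> powr (- al) \<partial>posM) = - Re (zeta_right (of_real al) / (of_real al - 1))"
  by (rule sums_integral_nonneg(2)[OF int nn ptw s])
qed

lemma posM_pair_measurable:
 assumes "F \<in> borel_measurable (borel \<Otimes>\<^sub>M borel)"
 shows "F \<in> borel_measurable (posM \<Otimes>\<^sub>M posM)"
proof -
 have m: "(%x. x) \<in> posM \<rightarrow>\<^sub>M borel" by (rule borel_measurable_posM) simp
 have "(%z. (fst z, snd z)) \<in> posM \<Otimes>\<^sub>M posM \<rightarrow>\<^sub>M borel \<Otimes>\<^sub>M borel"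
  by (intro measurable_Pair measurable_compose[OF measurable_fst m] measurable_compose[OF measurable_snd m])
 from measurable_compose[OF this assms] show ?thesis by simp
qed

lemma pair_sigma_finite_posM: "pair_sigma_finite posM posM"
 by (intro pair_sigma_finite.intro sigma_finite_posM)

text \<open>Euler--Maclaurin comparison of a sum with the integral it approximates, transported
 through the Mellin transform: monotonicity of the summand makes Tonelli's theorem applicable.\<close>

lemma Mellin_sum_minus_integral:
 fixes g S :: "real => real" and p w al M K :: real
 assumes gm: "g \<in> borel_measurable borel"
  and g0: "\<And>y. y > 0 ==> g y \<ge> 0" and ga: "\<And>a b. 0 < a ==> a \<le> b ==> g b \<le> g a"
  and p: "0 < p" "p \<le> 1" and al: "0 < al" "al < 1" "al = w + 1 - p"
  and M: "integrable posM (%y. y powr (w - 1) * g y)" "(\<integral>y. y powr (w - 1) * g y \<partial>posM) = M"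
  and K: "integrable posM (%y. y powr (p - 1) * g y)" "(\<integral>y. y powr (p - 1) * g y \<partial>posM) = K"
  and S: "\<And>y. y > 0 ==> (%d. real (Suc d) powr (p - 1) * g (real (Suc d) * y)) sums S y"
 shows "integrable posM (%y. y powr (w - 1) * (S y - K * y powr (- p)))"
  and "(\<integral>y. y powr (w - 1) * (S y - K * y powr (- p)) \<partial>posM) = M * Re (zeta_right (of_real al) / (of_real al - 1))"
proof -
 define k where "k = (%q y. q powr (p - 1) * g (q * y))"
 define c :: "real => real" where "c = (%q. real_of_int \<lceil>q\<rceil>)"
 \<comment> \<open>Integrated over y, \<Phi> gives M times the integrand of
   \<open>integral_power_minus_ceiling_power\<close>; integrated over q, it gives the integral K
   y^(-p) minus the sum S y, because the ceiling turns the integral over q into the sum.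
   Monotonicity of \<open>k\<close> in q makes \<Phi> nonnegative.\<close>
 define \<Phi> where "\<Phi> = (%q y. y powr (w - 1) * (k q y - k (c q) y))"
 have c: "c q \<ge> q" for q by (simp add: c_def)
 have [measurable]: "c \<in> borel_measurable borel" unfolding c_def by measurable
 have [measurable]: "g \<in> borel_measurable borel" by (rule gm)
 have kanti: "k b y \<le> k a y" if "0 < a" "a \<le> b" "0 < y" for a b y
  unfolding k_def using that p g0 ga[of "a * y" "b * y"] by (intro mult_mono powr_mono2') (auto intro!: g0)
 have k0: "k q y \<ge> 0" if "0 < q" "0 < y" for q y
  using that g0 by (simp add: k_def)
 have \<Phi>0: "\<Phi> q y \<ge> 0" if "0 < q" "0 < y" for q y
  using kanti[OF that(1) c that(2)] by (simp add: \<Phi>_def)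
 have meas: "(%(q, y). \<Phi> q y) \<in> borel_measurable (posM \<Otimes>\<^sub>M posM)"
  by (rule posM_pair_measurable) (unfold \<Phi>_def k_def, measurable)
 have scaleM: "integrable posM (%y. y powr (w - 1) * k q y)" "(\<integral>y. y powr (w - 1) * k q y \<partial>posM) = M * q powr (- al)" if q: "q > 0" for q
 proof -
  have e: "y powr (w - 1) * k q y = q powr (p - w) * ((q * y) powr (w - 1) * g (q * y))" if "y \<in> space posM" for y
  proof -
   have "q powr (p - 1) = q powr (p - w) * q powr (w - 1)" by (simp flip: powr_add)
   thus ?thesis using q that by (simp add: k_def powr_mult space_posM)
  qed
  note sc = integrable_integral_posM_scale[OF q, of "%y. y powr (w - 1) * g y"]
  have i: "integrable posM (%y. q powr (p - w) * ((q * y) powr (w - 1) * g (q * y)))"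
   using sc(1) M by simp
  show "integrable posM (%y. y powr (w - 1) * k q y)"
   by (subst B_integrable_cong[OF refl e]) (use i in auto)
  have "(\<integral>y. y powr (w - 1) * k q y \<partial>posM) = (\<integral>y. q powr (p - w) * ((q * y) powr (w - 1) * g (q * y)) \<partial>posM)"
   by (rule B_integral_cong[OF refl e])
  also have "\<dots> = q powr (p - w) * (M / q)" using sc(2) M by (simp add: divide_inverse mult.commute)
  also have "p - w = 1 - al" using al by simp
  also have "q powr (1 - al) * (M / q) = M * q powr (- al)" using q by (simp add: powr_diff powr_minus field_simps)
  finally show "(\<integral>y. y powr (w - 1) * k q y \<partial>posM) = M * q powr (- al)" .
 qed
 have scaleK: "integrable posM (%q. k q y)" "(\<integral>q. k q y \<partial>posM) = K * y powr (- p)" if y: "y > 0" for y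
 proof -
  have e: "k q y = y powr (1 - p) * ((y * q) powr (p - 1) * g (y * q))" if "q \<in> space posM" for q
  proof -
   have "y powr (1 - p) * y powr (p - 1) = 1" using y by (simp flip: powr_add)
   thus ?thesis using y that by (simp add: k_def powr_mult space_posM mult.commute)
  qed
  note sc = integrable_integral_posM_scale[OF y, of "%y. y powr (p - 1) * g y"]
  have i: "integrable posM (%q. y powr (1 - p) * ((y * q) powr (p - 1) * g (y * q)))"
   using sc(1) K by simp
  show "integrable posM (%q. k q y)"
   by (subst B_integrable_cong[OF refl e]) (use i in auto)
  have "(\<integral>q. k q y \<partial>posM) = (\<integral>q. y powr (1 - p) * ((y * q) powr (p - 1) * g (y * q)) \<partial>posM)"
   by (rule B_integral_cong[OF refl e])
  also have "\<dots> = y powr (1 - p) * (K / y)" using sc(2) K by (simp add: divide_inverse mult.commute)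
  also have "\<dots> = K * y powr (- p)" using y by (simp add: powr_diff powr_minus field_simps)
  finally show "(\<integral>q. k q y \<partial>posM) = K * y powr (- p)" .
 qed
 have stepK: "integrable posM (%q. k (c q) y)" "(\<integral>q. k (c q) y \<partial>posM) = S y" if y: "y > 0" for y
 proof -
  show i: "integrable posM (%q. k (c q) y)"
  proof (rule B_integrable_bound[OF scaleK(1)[OF y]])
   show "(%q. k (c q) y) \<in> borel_measurable posM"
    unfolding k_def by (intro borel_measurable_posM) measurable
   show "AE q in posM. norm (k (c q) y) \<le> norm (k q y)"
   proof (rule AE_I2)
    fix q assume "q \<in> space posM"
    hence q: "q > 0" by (simp add: space_posM)
    hence "c q > 0" using c[of q] by linarith
    from k0[OF this y] kanti[OF q c y] show "norm (k (c q) y) \<le> norm (k q y)" by simp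
   qed
  qed
  have "(%q. indicator {real d<..real (Suc d)} q * k (c q) y) = (%q. indicator {real d<..real (Suc d)} q * k (real (Suc d)) y)" for d
   by (rule ext) (use ceiling_on_piece[of _ d] in \<open>auto simp: indicator_def c_def\<close>)
  hence "(%d. k (real (Suc d)) y) sums (\<integral>q. k (c q) y \<partial>posM)"
   using integral_posM_pieces[OF i] by (simp only: integral_piece_const)
  thus "(\<integral>q. k (c q) y \<partial>posM) = S y" using S[OF y] sums_unique2 unfolding k_def by blast
 qed
 have inner1: "(\<integral>\<^sup>+y. \<Phi> q y \<partial>posM) = ennreal (M * (q powr (- al) - c q powr (- al)))" if "q \<in> space posM" for q
 proof -
  have q: "q > 0" using that by (simp add: space_posM)
  have cq: "c q > 0" using q c[of q] by linarith
  have e: "\<Phi> q = (%y. y powr (w - 1) * k q y - y powr (w - 1) * k (c q) y)" by (simp add: \<Phi>_def fun_eq_iff algebra_simps)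
  have "(\<integral>\<^sup>+y. \<Phi> q y \<partial>posM) = ennreal (\<integral>y. \<Phi> q y \<partial>posM)"
  proof (rule nn_integral_eq_integral)
   show "integrable posM (\<Phi> q)" unfolding e using scaleM(1)[OF q] scaleM(1)[OF cq] by simp
   show "AE y in posM. 0 \<le> \<Phi> q y" using \<Phi>0[OF q] by (auto intro!: AE_I2 simp: space_posM)
  qed
  also have "(\<integral>y. \<Phi> q y \<partial>posM) = M * (q powr (- al) - c q powr (- al))"
   unfolding e using scaleM[OF q] scaleM[OF cq] by (simp add: algebra_simps)
  finally show ?thesis .
 qed
 have inner2: "(\<integral>\<^sup>+q. \<Phi> q y \<partial>posM) = ennreal (y powr (w - 1) * (K * y powr (- p) - S y))"
  "y powr (w - 1) * (K * y powr (- p) - S y) \<ge> 0" if "y \<in> space posM" for y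
 proof -
  have y: "y > 0" using that by (simp add: space_posM)
  have v: "(\<integral>q. \<Phi> q y \<partial>posM) = y powr (w - 1) * (K * y powr (- p) - S y)"
   unfolding \<Phi>_def using scaleK[OF y] stepK[OF y] by simp
  show "(\<integral>\<^sup>+q. \<Phi> q y \<partial>posM) = ennreal (y powr (w - 1) * (K * y powr (- p) - S y))"
   unfolding v[symmetric]
  proof (rule nn_integral_eq_integral)
   show "integrable posM (%q. \<Phi> q y)" unfolding \<Phi>_def using scaleK(1)[OF y] stepK(1)[OF y] by simp
   show "AE q in posM. 0 \<le> \<Phi> q y" using \<Phi>0[OF _ y] by (auto intro!: AE_I2 simp: space_posM)
  qed
  show "y powr (w - 1) * (K * y powr (- p) - S y) \<ge> 0"
   unfolding v[symmetric] using \<Phi>0[OF _ y] by (intro integral_nonneg_AE AE_I2) (auto simp: space_posM)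
 qed
 have M0: "M \<ge> 0" unfolding M(2)[symmetric] using g0 by (intro integral_nonneg_AE AE_I2) (auto simp: space_posM)
 have ge: "q powr (- al) - c q powr (- al) \<ge> 0" if "q > 0" for q
  using powr_mono2'[of "- al" q "c q"] that al c by simp
 define Z where "Z = - Re (zeta_right (of_real al) / (of_real al - 1))"
 note ip = integral_power_minus_ceiling_power[OF al(1,2), folded Z_def]
 have Z0: "Z \<ge> 0" unfolding ip(2)[symmetric] using ge[unfolded c_def] by (intro integral_nonneg_AE AE_I2) (auto simp: space_posM)
 have "(\<integral>\<^sup>+y. ennreal (y powr (w - 1) * (K * y powr (- p) - S y)) \<partial>posM) = (\<integral>\<^sup>+y. \<integral>\<^sup>+q. \<Phi> q y \<partial>posM \<partial>posM)"
  by (intro nn_integral_cong) (simp add: inner2)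
 also have "\<dots> = (\<integral>\<^sup>+q. \<integral>\<^sup>+y. \<Phi> q y \<partial>posM \<partial>posM)"
  using pair_sigma_finite.Fubini'[OF pair_sigma_finite_posM, of "%q y. ennreal (\<Phi> q y)"] meas by (simp add: case_prod_unfold)
 also have "\<dots> = (\<integral>\<^sup>+q. ennreal (M * (q powr (- al) - c q powr (- al))) \<partial>posM)"
  by (intro nn_integral_cong inner1)
 also have "\<dots> = ennreal (M * Z)"
  using ip M0 ge[unfolded c_def] by (subst nn_integral_eq_integral) (auto intro!: AE_I2 simp: space_posM c_def)
 finally have nn: "(\<integral>\<^sup>+y. ennreal (y powr (w - 1) * (K * y powr (- p) - S y)) \<partial>posM) = ennreal (M * Z)" .
 have Sm: "S \<in> borel_measurable posM"
  by (rule borel_measurable_LIMSEQ_metric[where f = "%n y. \<Sum>d<n. real (Suc d) powr (p - 1) * g (real (Suc d) * y)"])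
   (use S in \<open>auto simp: sums_def space_posM intro!: borel_measurable_posM\<close>)
 have Tm: "(%y. y powr (w - 1) * (K * y powr (- p) - S y)) \<in> borel_measurable posM"
 proof -
  have "(%y. y powr (w - 1)) \<in> borel_measurable posM" "(%y. y powr (- p)) \<in> borel_measurable posM"
   by (auto intro!: borel_measurable_posM)
  thus ?thesis using Sm by simp
 qed
 have "integrable posM (%y. y powr (w - 1) * (K * y powr (- p) - S y)) \<and> (\<integral>y. y powr (w - 1) * (K * y powr (- p) - S y) \<partial>posM) = M * Z"
  using nn inner2(2) M0 Z0 by (subst nn_integral_eq_integrable[symmetric, OF Tm]) (auto intro!: AE_I2)
 moreover have "(%y. y powr (w - 1) * (S y - K * y powr (- p))) = (%y. - (y powr (w - 1) * (K * y powr (- p) - S y)))"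
  by (simp add: fun_eq_iff algebra_simps)
 ultimately show "integrable posM (%y. y powr (w - 1) * (S y - K * y powr (- p)))"
  and "(\<integral>y. y powr (w - 1) * (S y - K * y powr (- p)) \<partial>posM) = M * Re (zeta_right (of_real al) / (of_real al - 1))"
  by (simp_all add: Z_def)
qed

section \<open>The Planck factor: partial fractions and Mellin transforms\<close>

lemma Gamma_integral_posM:
 fixes w c :: real
 assumes w: "w > 0" and c: "c > 0"
 shows "integrable posM (%y. y powr (w - 1) * exp (- (c * y)))"
  and "(\<integral>y. y powr (w - 1) * exp (- (c * y)) \<partial>posM) = Gamma w * c powr (- w)"
proof -
 define f where "f = (%y::real. y powr (w - 1) * exp (- y))"
 have cont: "continuous_on {0<..} f" unfolding f_def by (intro continuous_intros) auto
 have "((%t. complex_of_real t powr (complex_of_real w - 1) / complex_of_real (exp t)) has_integral complex_of_real (Gamma w)) {0<..}"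
  using Gamma_integral_complex'[of "of_real w"] w by (simp add: Gamma_complex_of_real)
 hence "((%t. complex_of_real (f t)) has_integral of_real (Gamma w)) {0<..}"
  by (rule has_integral_eq[rotated]) (simp_all add: f_def powr_of_real[symmetric] exp_minus divide_inverse)
 from has_integral_linear[OF this bounded_linear_Re] have hi: "(f has_integral Gamma w) {0<..}"
  by (simp add: o_def)
 have "f absolutely_integrable_on {0<..}"
  by (intro nonnegative_absolutely_integrable_1) (use hi in \<open>auto simp: f_def integrable_on_def\<close>)
 hence f: "integrable posM f" "integral\<^sup>L posM f = Gamma w"
  using absolutely_integrable_posM[OF cont] hi by (auto simp: integral_unique)
 have e: "y powr (w - 1) * exp (- (c * y)) = c powr (1 - w) * f (c * y)" if "y \<in> space posM" for y
 proof -
  have "c powr (1 - w) * c powr (w - 1) = 1" using c by (simp flip: powr_add)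
  thus ?thesis using c that by (simp add: f_def powr_mult space_posM)
 qed
 note sc = integrable_integral_posM_scale[OF c, of f]
 have i: "integrable posM (%y. c powr (1 - w) * f (c * y))" using sc(1) f by simp
 show "integrable posM (%y. y powr (w - 1) * exp (- (c * y)))"
  by (subst B_integrable_cong[OF refl e]) (use i in auto)
 have "(\<integral>y. y powr (w - 1) * exp (- (c * y)) \<partial>posM) = (\<integral>y. c powr (1 - w) * f (c * y) \<partial>posM)"
  by (rule B_integral_cong[OF refl e])
 also have "\<dots> = c powr (1 - w) * (Gamma w / c)" using sc(2) f by (simp add: divide_inverse mult.commute)
 also have "\<dots> = Gamma w * c powr (- w)" using c by (simp add: powr_diff powr_minus field_simps)
 finally show "(\<integral>y. y powr (w - 1) * exp (- (c * y)) \<partial>posM) = Gamma w * c powr (- w)" .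
qed

lemma integral_posM_inverse:
 fixes f :: "real => real"
 assumes f: "continuous_on {0<..} f" "integrable posM f"
 shows "integrable posM (%y. f (1 / y) / y\<^sup>2)" "(\<integral>y. f (1 / y) / y\<^sup>2 \<partial>posM) = integral\<^sup>L posM f"
proof -
 have im: "(%y. 1 / y) ` {0<..} = {0::real<..}"
 proof (intro equalityI subsetI)
  fix t :: real assume "t \<in> {0<..}"
  thus "t \<in> (%y. 1 / y) ` {0<..}" by (intro image_eqI[of _ _ "1 / t"]) auto
 qed auto
 define h where "h = (%y. f (1 / y) / y\<^sup>2)"
 have ch: "continuous_on {0<..} h"
  unfolding h_def using f(1) by (auto intro!: continuous_intros continuous_on_compose2[OF f(1)])
 have "(%y. \<bar>- 1 / y\<^sup>2\<bar> * f (1 / y)) absolutely_integrable_on {0<..} \<and> integral {0<..} (%y. \<bar>- 1 / y\<^sup>2\<bar> * f (1 / y)) = integral\<^sup>L posM f"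
 proof (rule has_absolute_integral_change_of_variables_1'[where g = "%y. 1 / y", THEN iffD2])
  show "((%y. 1 / y) has_field_derivative - 1 / y\<^sup>2) (at y within {0<..})" if "y \<in> {0<..}" for y :: real
   using that by (auto intro!: derivative_eq_intros simp: power2_eq_square)
  show "f absolutely_integrable_on (%y. 1 / y) ` {0<..} \<and> integral ((%y. 1 / y) ` {0<..}) f = integral\<^sup>L posM f"
   unfolding im using absolutely_integrable_posM[OF f(1)] f(2) by simp
 qed (auto intro!: inj_onI)
 hence "h absolutely_integrable_on {0<..} \<and> integral {0<..} h = integral\<^sup>L posM f"
  by (simp add: h_def)
 thus "integrable posM (%y. f (1 / y) / y\<^sup>2)" "(\<integral>y. f (1 / y) / y\<^sup>2 \<partial>posM) = integral\<^sup>L posM f"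
  using absolutely_integrable_posM[OF ch] by (auto simp: h_def)
qed

text \<open>The reflection formula differentiated: Gamma(z) Gamma(1-z) sin(pi z) is constant off the
  integers, so its derivative vanishes there.\<close>

lemma Digamma_minus_Digamma_reflect:
 assumes "z \<notin> \<int>"
 shows "Digamma (1 - z) - Digamma z = of_real pi * cos (of_real pi * z) / sin (of_real pi * z :: complex)"
proof -
 have z: "z \<notin> \<int>\<^sub>\<le>\<^sub>0" "1 - z \<notin> \<int>\<^sub>\<le>\<^sub>0"
  using assms by (auto elim!: nonpos_Ints_cases) (metis Ints_1 Ints_diff Ints_of_int diff_diff_eq2 add_diff_cancel_left')
 have op: "open (- \<int> :: complex set)" by (simp add: open_Compl closed_Ints)
 have s0: "sin (of_real pi * z) ~= 0"
  using assms by (auto simp: sin_eq_0 mult.commute)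
 have d1: "((%z. Gamma z * Gamma (1 - z)) has_field_derivative (Gamma z * Gamma (1 - z)) * (Digamma z - Digamma (1 - z))) (at z)"
  using z by (auto intro!: derivative_eq_intros simp: algebra_simps)
 have d2: "((%z. sin (of_real pi * z)) has_field_derivative of_real pi * cos (of_real pi * z)) (at z)"
  by (auto intro!: derivative_eq_intros)
 have "((%z. Gamma z * Gamma (1 - z) * sin (of_real pi * z)) has_field_derivative 0) (at z)"
 proof (rule has_field_derivative_transform_within_open[OF _ op])
  show "((%_. of_real pi) has_field_derivative 0) (at z)" by (rule DERIV_const)
  show "of_real pi = Gamma w * Gamma (1 - w) * sin (of_real pi * w)" if "w \<in> - \<int>" for w :: complex
  proof -
   have "sin (of_real pi * w) ~= 0" using that by (auto simp: sin_eq_0 mult.commute)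
   thus ?thesis by (simp add: Gamma_reflection_complex)
  qed
 qed (use assms in auto)
 from DERIV_unique[OF DERIV_mult[OF d1 d2] this]
 have "(Gamma z * Gamma (1 - z)) * ((Digamma z - Digamma (1 - z)) * sin (of_real pi * z) + of_real pi * cos (of_real pi * z)) = 0"
  by (simp add: algebra_simps)
 moreover have "Gamma z * Gamma (1 - z) ~= 0" using z by (simp add: Gamma_eq_zero_iff)
 ultimately show ?thesis using s0 by (simp add: divide_simps) (simp add: algebra_simps add_eq_0_iff)
qed

definition planck :: "real => real" where "planck t = 1 / (exp (2 * pi * t) - 1)"

text \<open>The subtracted term is the polar part at 0. The shift by 1/2 that accompanies
  \<open>planck1\<close> below is the negative of its limit at 0.\<close>

definition planck1 :: "real => real" where "planck1 t = planck t - 1 / (2 * pi * t)"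

text \<open>Partial fractions of pi cot(pi z) at z = i t, read off the series for
  \<open>Digamma\<close> at z and 1 - z. The summand is the real part of 1 / (t + i k), the form
  needed for Lipschitz summation.\<close>

lemma planck1_sums:
 assumes t: "t > 0"
 shows "(%k. t / (t\<^sup>2 + (real (Suc k))\<^sup>2)) sums (pi * (planck1 t + 1/2))"
proof -
 define z where "z = \<i> * complex_of_real t"
 have z: "z \<notin> \<int>" using t by (auto simp: z_def Ints_def complex_eq_iff)
 have z0: "z ~= 0" "1 - z ~= 0" using t by (auto simp: z_def complex_eq_iff)
 have nz: "z + of_nat n ~= 0" "1 - z + of_nat n ~= 0" for n using t by (auto simp: z_def complex_eq_iff)
 have trm: "inverse (z + of_nat (Suc n)) - inverse (1 - z + of_nat n) = - (2 * \<i>) * of_real (t / (t\<^sup>2 + (real (Suc n))\<^sup>2))" for n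
 proof -
  have "inverse (z + of_nat (Suc n)) - inverse (1 - z + of_nat n) = (1 - z + of_nat n - (z + of_nat (Suc n))) / ((z + of_nat (Suc n)) * (1 - z + of_nat n))"
   using nz[of n] nz[of "Suc n"] by (simp add: field_simps del: of_nat_Suc)
  also have "1 - z + of_nat n - (z + of_nat (Suc n)) = - 2 * z" by simp
  also have "(z + of_nat (Suc n)) * (1 - z + of_nat n) = of_real (t\<^sup>2 + (real (Suc n))\<^sup>2)"
   by (simp add: z_def complex_eq_iff power2_eq_square algebra_simps)
  finally show ?thesis by (simp add: z_def)
 qed
 have "(%m. (of_real (ln (real m)) - (\<Sum>n<m. inverse (1 - z + of_nat n))) - (of_real (ln (real m)) - (\<Sum>n<m. inverse (z + of_nat n)))) \<longlonglongrightarrow> Digamma (1 - z) - Digamma z"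
  by (intro tendsto_diff Digamma_LIMSEQ z0)
 hence L: "(%m. (\<Sum>n<m. inverse (z + of_nat n)) - (\<Sum>n<m. inverse (1 - z + of_nat n))) \<longlonglongrightarrow> Digamma (1 - z) - Digamma z"
  by simp
 have inv0: "(%m. inverse (z + of_nat m)) \<longlonglongrightarrow> 0"
  by (intro tendsto_inverse_0 [THEN filterlim_compose] tendsto_add_filterlim_at_infinity[OF tendsto_const] tendsto_of_nat)
 \<comment> \<open>The two series are offset so that the index n + 1 of the first meets n of the
   second. The offset leaves a boundary term tending to 0 and the term 1/z, which becomes the pole
   subtracted in \<open>planck1\<close>.\<close>
 have step: "(\<Sum>n<m. inverse (z + of_nat (Suc n)) - inverse (1 - z + of_nat n)) =
   (\<Sum>n<m. inverse (z + of_nat n)) - (\<Sum>n<m. inverse (1 - z + of_nat n)) + inverse (z + of_nat m) - inverse z" for m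
  by (induction m) (simp_all add: algebra_simps)
 have "(%n. inverse (z + of_nat (Suc n)) - inverse (1 - z + of_nat n)) sums (Digamma (1 - z) - Digamma z + 0 - inverse z)"
  unfolding sums_def step by (intro tendsto_intros L inv0)
 also have "Digamma (1 - z) - Digamma z + 0 - inverse z = - (2 * \<i>) * of_real (pi * (planck1 t + 1/2))"
 proof -
  define E where "E = exp (2 * pi * t)"
  have E: "E > 1" using t by (simp add: E_def)
  have e1: "exp (\<i> * (of_real pi * z)) = of_real (exp (- (pi * t)))"
  proof -
   have "\<i> * (of_real pi * z) = of_real (- (pi * t))" by (simp add: z_def complex_eq_iff)
   thus ?thesis by (simp only: exp_of_real)
  qed
  have e2: "exp (- (\<i> * (of_real pi * z))) = of_real (exp (pi * t))"
  proof -
   have "- (\<i> * (of_real pi * z)) = of_real (pi * t)" by (simp add: z_def complex_eq_iff)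
   thus ?thesis by (simp only: exp_of_real)
  qed
  have E2: "E = exp (pi * t) * exp (pi * t)" by (simp add: E_def flip: exp_add)
  have "of_real pi * cos (of_real pi * z) / sin (of_real pi * z) = of_real pi * \<i> * ((of_real (exp (- (pi * t))) + of_real (exp (pi * t))) / (of_real (exp (- (pi * t))) - of_real (exp (pi * t))))"
  proof -
   have "p * (S / 2) / (D / (2 * \<i>)) = p * \<i> * (S / D)" for p S D :: complex
    by (cases "D = 0") (simp_all add: field_simps)
   thus ?thesis unfolding cos_exp_eq sin_exp_eq e1 e2 .
  qed
  also have "\<dots> = of_real pi * \<i> * of_real ((exp (- (pi * t)) + exp (pi * t)) / (exp (- (pi * t)) - exp (pi * t)))"
   by simp
  also have "(exp (- (pi * t)) + exp (pi * t)) / (exp (- (pi * t)) - exp (pi * t)) = (1 + E) / (1 - E)"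
   by (simp add: E2 exp_minus divide_simps)
  also have "(1 + E) / (1 - E) = - (1 + 2 * planck t)"
   using E unfolding planck_def E_def[symmetric] by (simp add: divide_simps) (simp add: algebra_simps)
  finally have D: "Digamma (1 - z) - Digamma z = of_real pi * \<i> * of_real (- (1 + 2 * planck t))"
   unfolding Digamma_minus_Digamma_reflect[OF z] .
  have I: "inverse z = - \<i> / of_real t" using t by (simp add: z_def divide_simps)
  show ?thesis unfolding D I using t by (simp add: planck1_def complex_eq_iff field_simps)
 qed
 finally have "(%n. - (2 * \<i>) * complex_of_real (t / (t\<^sup>2 + (real (Suc n))\<^sup>2))) sums (- (2 * \<i>) * of_real (pi * (planck1 t + 1/2)))"
  unfolding trm .
 from sums_mult[OF this, of "\<i> / 2"] have "(%n. complex_of_real (t / (t\<^sup>2 + (real (Suc n))\<^sup>2))) sums of_real (pi * (planck1 t + 1/2))"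
  by simp
 thus ?thesis by (simp only: sums_of_real_iff)
qed

lemma planck_bounds:
 assumes t: "t > 0"
 shows "planck t > 0" "planck1 t \<le> 0" "- 1 / 2 \<le> planck1 t"
proof -
 have "exp (2 * pi * t) \<ge> 1 + 2 * pi * t" by (rule exp_ge_add_one_self)
 thus p: "planck t > 0" "planck1 t \<le> 0"
  using t by (auto simp: planck_def planck1_def field_simps add_pos_pos intro!: divide_left_mono)
 have "pi * (planck1 t + 1/2) \<ge> 0"
  using planck1_sums[OF t] by (rule sums_le[OF _ sums_zero, rotated]) (use t in auto)
 thus "- 1 / 2 \<le> planck1 t" using pi_gt_zero by (auto simp: zero_le_mult_iff)
qed

lemma planck_sums:
 assumes t: "t > 0"
 shows "(%d. exp (- (2 * pi * real (Suc d) * t))) sums planck t"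
proof -
 define x where "x = exp (- (2 * pi * t))"
 have x: "0 < x" "x < 1" using t by (auto simp: x_def)
 have "(%d. x * x ^ d) sums (x * (1 / (1 - x)))" using x by (intro sums_mult geometric_sums) auto
 also have "x * (1 / (1 - x)) = planck t"
  using t by (simp add: x_def planck_def exp_minus field_simps)
 also have "(%d. x * x ^ d) = (%d. exp (- (2 * pi * real (Suc d) * t)))"
 proof
  fix d
  have "x * x ^ d = exp (real (Suc d) * (- (2 * pi * t)))" unfolding x_def by (simp only: exp_of_nat_mult power_Suc)
  thus "x * x ^ d = exp (- (2 * pi * real (Suc d) * t))" by (simp add: mult_ac)
 qed
 finally show ?thesis .
qed


definition zeta_real :: "real => real" where
 "zeta_real al = Re (zeta_right (of_real al) / (of_real al - 1))"

text \<open>The case g(y) = exp(-2 pi y), where both constants are Gamma integrals. The inequalities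
  p - 1 < w < p place the argument w + 1 - p of zeta in (0, 1).\<close>

lemma Mellin_exp_sum:
 fixes S :: "real => real"
 assumes p: "0 < p" "p \<le> 1" and w: "0 < w" "p - 1 < w" "w < p"
  and S: "\<And>y. y > 0 ==> (%d. real (Suc d) powr (p - 1) * exp (- (2 * pi * (real (Suc d) * y)))) sums S y"
 shows "integrable posM (%y. y powr (w - 1) * (S y - Gamma p * (2 * pi) powr (- p) * y powr (- p)))"
  and "(\<integral>y. y powr (w - 1) * (S y - Gamma p * (2 * pi) powr (- p) * y powr (- p)) \<partial>posM) = Gamma w * (2 * pi) powr (- w) * zeta_real (w + 1 - p)"
 unfolding zeta_real_def
 by (rule Mellin_sum_minus_integral[where g = "%y. exp (- (2 * pi * y))"]; (use assms in \<open>auto intro: Gamma_integral_posM\<close>)?)+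

lemma Mellin_planck1:
 assumes w: "0 < w" "w < 1"
 shows "integrable posM (%y. y powr (w - 1) * planck1 y)"
  and "(\<integral>y. y powr (w - 1) * planck1 y \<partial>posM) = Gamma w * (2 * pi) powr (- w) * zeta_real w"
proof -
 have S: "(%d. real (Suc d) powr (1 - 1) * exp (- (2 * pi * (real (Suc d) * y)))) sums planck y" if "y > 0" for y
  using planck_sums[OF that] by (simp add: mult.assoc del: of_nat_Suc)
 have e: "y powr (w - 1) * (planck y - Gamma 1 * (2 * pi) powr (- 1) * y powr (- 1)) = y powr (w - 1) * planck1 y" if "y \<in> space posM" for y
  using that by (simp add: planck1_def space_posM powr_minus field_simps)
 note M = Mellin_exp_sum[of 1 w planck, OF _ _ w(1) _ w(2) S]
 show "integrable posM (%y. y powr (w - 1) * planck1 y)"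
  by (subst B_integrable_cong[OF refl e[symmetric]]) (use M(1) w in auto)
 show "(\<integral>y. y powr (w - 1) * planck1 y \<partial>posM) = Gamma w * (2 * pi) powr (- w) * zeta_real w"
  by (subst B_integral_cong[OF refl e[symmetric]]) (use M(2) w in auto)
qed

lemma integral_inverse_one_plus_square:
 "integrable posM (%y. 1 / (1 + y\<^sup>2))" "(\<integral>y. 1 / (1 + y\<^sup>2) \<partial>posM) = pi / 2"
proof -
 have "(\<integral>\<^sup>+y. ennreal (1 / (1 + y\<^sup>2)) * indicator {0..} y \<partial>lborel) = ennreal (pi / 2 - arctan 0)"
 proof (rule nn_integral_FTC_atLeast)
  show "DERIV arctan y :> 1 / (1 + y\<^sup>2)" for y :: real by (rule DERIV_arctan[unfolded inverse_eq_divide])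
  show "(arctan \<longlongrightarrow> pi / 2) at_top" by (rule tendsto_arctan_at_top)
 qed auto
 also have "(\<integral>\<^sup>+y. ennreal (1 / (1 + y\<^sup>2)) * indicator {0..} y \<partial>lborel) = (\<integral>\<^sup>+y. ennreal (1 / (1 + y\<^sup>2)) * indicator {0<..} y \<partial>lborel)"
 proof (rule nn_integral_cong_AE)
  show "AE y in lborel. ennreal (1 / (1 + y\<^sup>2)) * indicator {0..} y = ennreal (1 / (1 + y\<^sup>2)) * indicator {0<..} y"
   using AE_lborel_singleton[of "0::real"] by eventually_elim (simp add: indicator_def)
 qed
 finally have nn: "(\<integral>\<^sup>+y. ennreal (1 / (1 + y\<^sup>2)) \<partial>posM) = ennreal (pi / 2)"
  by (simp only: nn_integral_posM arctan_zero_zero diff_zero)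
 have m: "(%y::real. 1 / (1 + y\<^sup>2)) \<in> borel_measurable posM" by (rule borel_measurable_posM) measurable
 have "integrable posM (%y. 1 / (1 + y\<^sup>2)) \<and> (\<integral>y. 1 / (1 + y\<^sup>2) \<partial>posM) = pi / 2"
  using nn by (subst nn_integral_eq_integrable[OF m, symmetric]) simp_all
 thus "integrable posM (%y. 1 / (1 + y\<^sup>2))" "(\<integral>y. 1 / (1 + y\<^sup>2) \<partial>posM) = pi / 2"
  by simp_all
qed

lemma Re_inverse_one_plus: "Re (1 / (1 + \<i> * complex_of_real y)) = 1 / (1 + y\<^sup>2)"
 by (simp add: Re_divide power2_eq_square)

lemma Re_of_real_mult: "Re (complex_of_real a * z) = a * Re z"
 by simp

text \<open>The real part of the Beta integral with c = i and q = 1 - w: the exponent becomes -1,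
  and Re (1 / (1 + i y)) = 1 / (1 + y^2).\<close>

lemma Mellin_inverse_one_plus_square:
 assumes w: "0 < w" "w < 1"
 shows "integrable posM (%y. y powr (w - 1) * (1 / (1 + y\<^sup>2)))"
  and "(\<integral>y. y powr (w - 1) * (1 / (1 + y\<^sup>2)) \<partial>posM) = pi / (2 * sin (pi * w / 2))"
proof -
 have i: "\<i> \<notin> \<real>\<^sub>\<le>\<^sub>0" by (auto simp: complex_nonpos_Reals_iff)
 have ex: "- complex_of_real w - of_real (1 - w) = -1" by simp
 note B = Beta_integral_complex[OF w(1), of "of_real (1 - w)" \<i>, unfolded ex, OF _ i]
 have pm: "(1 + \<i> * complex_of_real y) powr (- 1) = 1 / (1 + \<i> * complex_of_real y)" for y
  by (simp add: powr_minus inverse_eq_divide complex_eq_iff)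
 have e: "Re (complex_of_real (y powr (w - 1)) * (1 + \<i> * complex_of_real y) powr (- 1)) = y powr (w - 1) * (1 / (1 + y\<^sup>2))" for y
  unfolding pm Re_of_real_mult Re_inverse_one_plus by simp
 have 1: "integrable posM (%y. complex_of_real (y powr (w - 1)) * (1 + \<i> * complex_of_real y) powr (- 1))"
  using B(1) w by simp
 from integrable_Re[OF 1] show "integrable posM (%y. y powr (w - 1) * (1 / (1 + y\<^sup>2)))"
  unfolding e .
 have "(\<integral>y. y powr (w - 1) * (1 / (1 + y\<^sup>2)) \<partial>posM) = Re (\<integral>y. complex_of_real (y powr (w - 1)) * (1 + \<i> * complex_of_real y) powr (- 1) \<partial>posM)"
  using integral_Re[OF 1] unfolding e by simp
 also have "\<dots> = Re (\<i> powr (- of_real w) * Beta (of_real w) (of_real (1 - w)))"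
  using B(2) w by simp
 also have "Beta (of_real w) (of_real (1 - w)) = complex_of_real (pi / sin (pi * w))"
 proof -
  have "Beta (complex_of_real w) (of_real (1 - w)) = Gamma (of_real w) * Gamma (1 - of_real w)"
   by (simp add: Beta_def)
  also have "\<dots> = of_real pi / sin (of_real pi * of_real w)" by (rule Gamma_reflection_complex)
  finally show ?thesis by (simp flip: sin_of_real)
 qed
 also have "\<i> powr (- of_real w) = exp (\<i> * of_real (- (pi * w / 2)))"
  by (simp add: powr_def algebra_simps)
 also have "Re (exp (\<i> * of_real (- (pi * w / 2))) * complex_of_real (pi / sin (pi * w))) = cos (pi * w / 2) * (pi / sin (pi * w))"
  by (simp add: exp_Euler cos_of_real sin_of_real del: of_real_minus of_real_mult of_real_divide)
 also have "\<dots> = pi / (2 * sin (pi * w / 2))"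
 proof -
  have "sin (pi * w) = 2 * sin (pi * w / 2) * cos (pi * w / 2)" using sin_double[of "pi * w / 2"] by simp
  moreover have "cos (pi * w / 2) > 0" using w by (intro cos_gt_zero) (auto simp: field_simps)
  moreover have "sin (pi * w / 2) > 0" using w by (intro sin_gt_zero) (auto simp: field_simps)
  ultimately show ?thesis by (simp add: field_simps)
 qed
 finally show "(\<integral>y. y powr (w - 1) * (1 / (1 + y\<^sup>2)) \<partial>posM) = pi / (2 * sin (pi * w / 2))" .
qed

text \<open>By partial fractions (pi/y) (planck1(1/y) + 1/2) is the sum of 1 / (1 + (k y)^2) over k
  >= 1, while pi/(2y) is the integral approximated by that sum. The comparison of sum and integral
  therefore isolates \<open>planck1 (1 / y)\<close>.\<close>

lemma Mellin_planck1_inverse: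
 assumes w: "0 < w" "w < 1"
 shows "integrable posM (%y. y powr (w - 2) * planck1 (1 / y))"
  and "(\<integral>y. y powr (w - 2) * planck1 (1 / y) \<partial>posM) = zeta_real w / (2 * sin (pi * w / 2))"
proof -
 define S where "S = (%y. pi / y * (planck1 (1 / y) + 1 / 2))"
 have S: "(%d. real (Suc d) powr (1 - 1) * (1 / (1 + (real (Suc d) * y)\<^sup>2))) sums S y" if y: "y > 0" for y
 proof -
  have "(%k. 1 / y * ((1 / y) / ((1 / y)\<^sup>2 + (real (Suc k))\<^sup>2))) sums (1 / y * (pi * (planck1 (1 / y) + 1 / 2)))"
   using y by (intro sums_mult planck1_sums) auto
  moreover have "1 / y * ((1 / y) / ((1 / y)\<^sup>2 + (real (Suc k))\<^sup>2)) = real (Suc k) powr (1 - 1) * (1 / (1 + (real (Suc k) * y)\<^sup>2))" for k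
  proof -
   have "y\<^sup>2 * ((1 / y)\<^sup>2 + (real (Suc k))\<^sup>2) = 1 + (real (Suc k) * y)\<^sup>2"
    using y by (simp add: distrib_left power_divide power_mult_distrib mult.commute del: of_nat_Suc)
   thus ?thesis using y by (simp add: power2_eq_square mult.assoc del: of_nat_Suc)
  qed
  ultimately show ?thesis by (simp add: S_def)
 qed
 have anti: "1 / (1 + b\<^sup>2) \<le> 1 / (1 + a\<^sup>2)" if "0 < a" "a \<le> b" for a b :: real
  using that by (intro divide_left_mono add_left_mono power_mono mult_pos_pos add_pos_nonneg) auto
 have K1: "integrable posM (%y. y powr (1 - 1) * (1 / (1 + y\<^sup>2)))" "(\<integral>y. y powr (1 - 1) * (1 / (1 + y\<^sup>2)) \<partial>posM) = pi / 2"
 proof -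
  have e: "y powr (1 - 1) * (1 / (1 + y\<^sup>2)) = 1 / (1 + y\<^sup>2)" if "y \<in> space posM" for y :: real
   using that by (simp add: space_posM)
  show "integrable posM (%y. y powr (1 - 1) * (1 / (1 + y\<^sup>2)))"
   by (subst B_integrable_cong[OF refl e]) (auto intro: integral_inverse_one_plus_square)
  show "(\<integral>y. y powr (1 - 1) * (1 / (1 + y\<^sup>2)) \<partial>posM) = pi / 2"
   by (subst B_integral_cong[OF refl e]) (simp_all only: integral_inverse_one_plus_square)
 qed
 have w1: "w = w + 1 - 1" by simp
 note M = Mellin_sum_minus_integral[where g = "%y. 1 / (1 + y\<^sup>2)" and p = 1 and w = w and al = w,
  OF _ _ anti _ _ w w1 Mellin_inverse_one_plus_square[OF w] K1 S, folded zeta_real_def]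
 have e: "y powr (w - 1) * (S y - pi / 2 * y powr (- 1)) = pi * (y powr (w - 2) * planck1 (1 / y))" if "y \<in> space posM" for y
 proof -
  have y: "y > 0" using that by (simp add: space_posM)
  have "y powr (w - 1) = y * y powr (w - 2)" using y powr_add[of y 1 "w - 2"] by (simp)
  thus ?thesis using y by (simp add: S_def powr_minus field_simps)
 qed
 have "integrable posM (%y. pi * (y powr (w - 2) * planck1 (1 / y)))"
  by (subst B_integrable_cong[OF refl e[symmetric]]) (use M(1) in auto)
 thus "integrable posM (%y. y powr (w - 2) * planck1 (1 / y))" by simp
 have "(\<integral>y. pi * (y powr (w - 2) * planck1 (1 / y)) \<partial>posM) = pi / (2 * sin (pi * w / 2)) * zeta_real w"
  by (subst B_integral_cong[OF refl e[symmetric]]) (use M(2) in auto)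
 hence "pi * (\<integral>y. y powr (w - 2) * planck1 (1 / y) \<partial>posM) = pi * (zeta_real w / (2 * sin (pi * w / 2)))"
  by simp
 thus "(\<integral>y. y powr (w - 2) * planck1 (1 / y) \<partial>posM) = zeta_real w / (2 * sin (pi * w / 2))"
  using pi_neq_zero by (metis mult_left_cancel)
qed

section \<open>Functional equation and continuation of zeta to the punctured plane\<close>

lemma continuous_on_planck1: "continuous_on {0<..} planck1"
 unfolding planck1_def planck_def by (intro continuous_intros) auto

text \<open>The Mellin transform of \<open>planck1\<close> is computed twice: from the exponential
  series, and from partial fractions after y -> 1/y, which replaces w by 1 - w.\<close>

lemma zeta_real_functional_equation:
 assumes w: "0 < w" "w < 1"
 shows "Gamma w * (2 * pi) powr (- w) * zeta_real w = zeta_real (1 - w) / (2 * cos (pi * w / 2))"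
proof -
 have "Gamma w * (2 * pi) powr (- w) * zeta_real w = (\<integral>y. y powr (w - 1) * planck1 y \<partial>posM)"
  using Mellin_planck1(2)[OF w] by simp
 also have "\<dots> = (\<integral>y. (1 / y) powr (w - 1) * planck1 (1 / y) / y\<^sup>2 \<partial>posM)"
  using Mellin_planck1(1)[OF w] by (intro integral_posM_inverse(2)[symmetric] continuous_intros continuous_on_planck1) auto
 also have "\<dots> = (\<integral>y. y powr (1 - w - 2) * planck1 (1 / y) \<partial>posM)"
 proof (rule B_integral_cong[OF refl])
  fix y assume "y \<in> space posM"
  hence y: "y > 0" by (simp add: space_posM)
  have "(1 / y) powr (w - 1) / y\<^sup>2 = y powr (1 - w) * y powr (- 2)"
   using y by (simp add: powr_divide powr_minus powr_diff powr_numeral field_simps)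
  thus "(1 / y) powr (w - 1) * planck1 (1 / y) / y\<^sup>2 = y powr (1 - w - 2) * planck1 (1 / y)"
   unfolding powr_add[symmetric] by (metis add_uminus_conv_diff mult.commute times_divide_eq_right)
 qed
 also have "\<dots> = zeta_real (1 - w) / (2 * sin (pi * (1 - w) / 2))"
  using w by (intro Mellin_planck1_inverse(2)) auto
 also have "sin (pi * (1 - w) / 2) = cos (pi * w / 2)"
 proof -
  have "pi * (1 - w) / 2 = pi / 2 - pi * w / 2" by (simp add: field_simps)
  thus ?thesis using cos_sin_eq[of "pi * w / 2"] by (metis of_real_eq_id id_apply)
 qed
 finally show ?thesis .
qed

text \<open>The functional equation turned into a definition. The quotient sin(pi w/2) / w is
  written with reciprocal Gamma functions, see \<open>sin_rGamma\<close>: the zero of the sine at 0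
  cancels the pole of zeta(1 - w) = zeta_right (1 - w) / (- w), and holomorphy on Re w < 1 can be
  read off.\<close>

definition zeta_left :: "complex => complex" where
 "zeta_left w = - ((2 * of_real pi) powr (w - 1) * of_real pi * Gamma (1 - w) * rGamma (1 + w / 2) * rGamma (1 - w / 2) * zeta_right (1 - w))"

lemma sin_rGamma: "w * (of_real pi * rGamma (1 + w / 2) * rGamma (1 - w / 2)) = 2 * sin (of_real pi * w / 2 :: complex)"
proof -
 have "w / 2 * rGamma (1 + w / 2) = rGamma (w / 2)"
  using rGamma_plus1[of "w / 2"] by (simp add: add.commute)
 hence "w / 2 * (of_real pi * rGamma (1 + w / 2) * rGamma (1 - w / 2)) = of_real pi * (rGamma (w / 2) * rGamma (1 - w / 2))"
  by (metis mult.assoc mult.left_commute)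
 also have "\<dots> = sin (of_real pi * w / 2)" by (simp add: rGamma_reflection_complex)
 finally show ?thesis by simp
qed

lemma zeta_left_alt:
 assumes "w ~= 0"
 shows "zeta_left w = 2 * (2 * of_real pi) powr (w - 1) * Gamma (1 - w) * sin (of_real pi * w / 2) * (zeta_right (1 - w) / ((1 - w) - 1))"
proof -
 have "of_real pi * rGamma (1 + w / 2) * rGamma (1 - w / 2) = 2 * sin (of_real pi * w / 2) / w"
  using sin_rGamma[of w] assms by (simp add: field_simps)
 moreover have "zeta_left w = - ((2 * of_real pi) powr (w - 1) * Gamma (1 - w) * (of_real pi * rGamma (1 + w / 2) * rGamma (1 - w / 2)) * zeta_right (1 - w))"
  unfolding zeta_left_def by (simp only: mult_ac)
 ultimately have "zeta_left w = - ((2 * of_real pi) powr (w - 1) * Gamma (1 - w) * (2 * sin (of_real pi * w / 2) / w) * zeta_right (1 - w))"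
  by (simp only:)
 thus ?thesis using assms by (simp add: field_simps)
qed

lemma zeta_left_holomorphic: "zeta_left holomorphic_on {w. Re w < 1}"
proof -
 have "(%w. zeta_right (1 - w)) holomorphic_on {w. Re w < 1}"
  by (rule holomorphic_on_compose_gen[of "%w. 1 - w" "{w. Re w < 1}" zeta_right "{w. Re w > 0}", unfolded o_def])
   (auto intro!: holomorphic_intros zeta_right_holomorphic)
 thus ?thesis unfolding zeta_left_def by (intro holomorphic_intros) (auto elim!: nonpos_Ints_cases simp: complex_eq_iff)
qed

lemma zeta_right_of_real:
 assumes "0 < al" "al < 1"
 shows "zeta_right (of_real al) / (of_real al - 1) = of_real (zeta_real al)"
 using zeta_right_real_sums(2)[OF assms] by (simp add: zeta_real_def complex_eq_iff)

lemma zeta_left_of_real: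
 assumes a: "0 < al" "al < 1"
 shows "zeta_left (of_real al) = of_real (zeta_real al)"
proof -
 have a': "0 < 1 - al" "1 - al < 1" using a by auto
 have "zeta_left (of_real al) = 2 * (2 * of_real pi) powr (of_real al - 1) * Gamma (1 - of_real al) * sin (of_real pi * of_real al / 2) * of_real (zeta_real (1 - al))"
 proof -
  have "complex_of_real al ~= 0" using a by simp
  thus ?thesis using zeta_right_of_real[OF a'] by (simp only: zeta_left_alt of_real_diff of_real_1 not_False_eq_True)
 qed
 also have "(2 * complex_of_real pi) powr (of_real al - 1) = of_real ((2 * pi) powr (al - 1))"
  using powr_of_real[of "2 * pi" "al - 1"] by simp
 also have "Gamma (1 - complex_of_real al) = of_real (Gamma (1 - al))" using Gamma_complex_of_real[of "1 - al"] by simp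
 also have "sin (complex_of_real pi * of_real al / 2) = of_real (sin (pi * al / 2))"
  using sin_of_real[of "pi * al / 2", where 'a = complex] by simp
 also have "2 * complex_of_real ((2 * pi) powr (al - 1)) * of_real (Gamma (1 - al)) * of_real (sin (pi * al / 2)) * of_real (zeta_real (1 - al)) =
  of_real (2 * sin (pi * al / 2) * (Gamma (1 - al) * (2 * pi) powr (- (1 - al)) * zeta_real (1 - al)))" by simp
 also have "Gamma (1 - al) * (2 * pi) powr (- (1 - al)) * zeta_real (1 - al) = zeta_real (1 - (1 - al)) / (2 * cos (pi * (1 - al) / 2))"
  by (rule zeta_real_functional_equation[OF a'])
 also have "pi * (1 - al) / 2 = pi / 2 - pi * al / 2" by (simp add: field_simps)
 also have "cos (pi / 2 - pi * al / 2) = sin (pi * al / 2)" by (simp add: cos_diff)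
 also have "2 * sin (pi * al / 2) * (zeta_real (1 - (1 - al)) / (2 * sin (pi * al / 2))) = zeta_real al"
 proof -
  have "pi * al < pi * 2" using a by (intro mult_strict_left_mono) auto
  hence "sin (pi * al / 2) > 0" using a by (intro sin_gt_zero) simp_all
  thus ?thesis by simp
 qed
 finally show ?thesis .
qed

lemma zeta_left_eq_right:
 assumes "0 < Re w" "Re w < 1"
 shows "zeta_left w = zeta_right w / (w - 1)"
proof (rule holomorphic_eq_from_reals[where S = "{w. Re w > 0} \<inter> {w. Re w < 1}" and a = 0 and b = 1
   and f = zeta_left and g = "%w. zeta_right w / (w - 1)"])
 show "open ({w. Re w > 0} \<inter> {w. Re w < 1})" by (intro open_Int open_halfspace_Re_gt open_halfspace_Re_lt)
 show "connected ({w. Re w > 0} \<inter> {w. Re w < 1})"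
  by (intro convex_connected convex_Int convex_halfspace_Re_gt convex_halfspace_Re_lt)
 show "zeta_left holomorphic_on ({w. Re w > 0} \<inter> {w. Re w < 1})"
  by (rule holomorphic_on_subset[OF zeta_left_holomorphic]) auto
 show "(%w. zeta_right w / (w - 1)) holomorphic_on ({w. Re w > 0} \<inter> {w. Re w < 1})"
  by (intro holomorphic_intros holomorphic_on_subset[OF zeta_right_holomorphic]) auto
 show "complex_of_real t \<in> {w. Re w > 0} \<inter> {w. Re w < 1} \<and> zeta_left (of_real t) = zeta_right (of_real t) / (of_real t - 1)" if "0 < t" "t < 1" for t
  using zeta_left_of_real[OF that] zeta_right_of_real[OF that] that by simp
qed (use assms in auto)

definition zeta_glued :: "complex => complex" where
 "zeta_glued w = (if w = 1 then 0 else if Re w > 0 then zeta_right w / (w - 1) else zeta_left w)"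

lemma zeta_glued_holomorphic: "zeta_glued holomorphic_on (- {1})"
proof -
 have 1: "zeta_glued holomorphic_on ({w. Re w > 0} - {1})"
 proof -
  have "(%w. zeta_right w / (w - 1)) holomorphic_on ({w. Re w > 0} - {1})"
   by (intro holomorphic_intros holomorphic_on_subset[OF zeta_right_holomorphic]) auto
  thus ?thesis by (rule holomorphic_transform) (auto simp: zeta_glued_def)
 qed
 have 2: "zeta_glued holomorphic_on {w. Re w < 1}"
  by (rule holomorphic_transform[OF zeta_left_holomorphic]) (auto simp: zeta_glued_def zeta_left_eq_right)
 have "zeta_glued holomorphic_on (({w. Re w > 0} - {1}) \<union> {w. Re w < 1})"
  by (rule holomorphic_on_Un[OF 1 2]) (auto intro!: open_Diff open_halfspace_Re_gt open_halfspace_Re_lt)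
 moreover have "({w. Re w > 0} - {1}) \<union> {w. Re w < 1} = - {1::complex}" by auto
 ultimately show ?thesis by simp
qed

text \<open>\<open>zeta_glued\<close> satisfies the description. Any other candidate agrees with it
  on the real interval (2, 3), where the Dirichlet series determines both, hence on the connected
  punctured plane; the value at 1 is prescribed.\<close>

lemma riemann_zeta_eq_glued: "riemann_zeta = zeta_glued"
 unfolding riemann_zeta_def
proof (rule the_equality)
 have sums: "(%n. of_nat (Suc n) powr (- s)) sums zeta_glued s" if "Re s > 1" for s
  using zeta_right_sums[OF that] that by (auto simp: zeta_glued_def)
 show "zeta_glued holomorphic_on - {1} \<and> (\<forall>s. Re s > 1 \<longrightarrow> (%n. of_nat (Suc n) powr (- s)) sums zeta_glued s) \<and> zeta_glued 1 = 0"
  using zeta_glued_holomorphic sums by (simp add: zeta_glued_def)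
 fix f :: "complex => complex"
 assume f: "f holomorphic_on - {1} \<and> (\<forall>s. Re s > 1 \<longrightarrow> (%n. of_nat (Suc n) powr (- s)) sums f s) \<and> f 1 = 0"
 have conn: "connected (- {1 :: complex})" using connected_punctured_universe[of "1::complex"] by simp
 have "f w = zeta_glued w" if "w ~= 1" for w
 proof (rule holomorphic_eq_from_reals[OF _ conn, of f zeta_glued 2 3])
  show "of_real t \<in> - {1 :: complex} \<and> f (of_real t) = zeta_glued (of_real t)" if "2 < t" "t < 3" for t
  proof -
   have r: "Re (complex_of_real t) > 1" using that by simp
   have "(%n. of_nat (Suc n) powr (- complex_of_real t)) sums f (of_real t)" using f r by blast
   from sums_unique2[OF this sums[OF r]] that show ?thesis by auto
  qed
 qed (use f zeta_glued_holomorphic that in auto)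
 moreover have "f 1 = zeta_glued 1" using f by (simp add: zeta_glued_def)
 ultimately show "f = zeta_glued" by (intro ext) metis
qed

lemma riemann_zeta_holomorphic: "riemann_zeta holomorphic_on (- {1})"
 by (simp add: riemann_zeta_eq_glued zeta_glued_holomorphic)

lemma riemann_zeta_sums: "Re w > 1 ==> (%n. of_nat (Suc n) powr (- w)) sums riemann_zeta w"
 using zeta_right_sums[of w] by (auto simp: riemann_zeta_eq_glued zeta_glued_def)

lemma riemann_zeta_of_real: "0 < al ==> al < 1 ==> riemann_zeta (of_real al) = of_real (zeta_real al)"
 using zeta_right_of_real[of al] by (simp add: riemann_zeta_eq_glued zeta_glued_def)

lemma riemann_zeta_reflect:
 assumes "Re w < 0"
 shows "riemann_zeta w = 2 * (2 * of_real pi) powr (w - 1) * Gamma (1 - w) * sin (of_real pi * w / 2) * riemann_zeta (1 - w)"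
proof -
 have "riemann_zeta w = zeta_left w" using assms by (auto simp: riemann_zeta_eq_glued zeta_glued_def)
 moreover have "riemann_zeta (1 - w) = zeta_right (1 - w) / ((1 - w) - 1)" using assms by (auto simp: riemann_zeta_eq_glued zeta_glued_def)
 moreover have "w ~= 0" using assms by auto
 ultimately show ?thesis by (simp only: zeta_left_alt not_False_eq_True)
qed

section \<open>The exponential integral behind the series\<close>

text \<open>The witness is the error function up to the factor sqrt(pi)/2. Normalized to vanish at 0
  it is odd, which transfers the limit at infinity to minus infinity.\<close>

lemma gaussian_antiderivative:
 "\<exists>\<Phi> :: real => real. (\<forall>x. (\<Phi> has_real_derivative exp (- x\<^sup>2)) (at x)) \<and>
  (\<Phi> \<longlongrightarrow> sqrt pi / 2) at_top \<and> (\<Phi> \<longlongrightarrow> - sqrt pi / 2) at_bot"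
proof -
 have "\<exists>F. \<forall>x::real. -\<infinity> < ereal x \<longrightarrow> ereal x < \<infinity> \<longrightarrow> (F has_vector_derivative exp (- x\<^sup>2)) (at x)"
  by (rule einterval_antiderivative) (auto intro!: continuous_intros)
 then obtain F :: "real => real" where F: "\<And>x. (F has_real_derivative exp (- x\<^sup>2)) (at x)"
  by (auto simp: has_real_derivative_iff_has_vector_derivative)
 define \<Phi> where "\<Phi> = (%x. F x - F 0)"
 have d: "(\<Phi> has_real_derivative exp (- x\<^sup>2)) (at x)" for x
  unfolding \<Phi>_def using F[of x] by (auto intro!: derivative_eq_intros)
 define g where "g = (%x::real. indicator {0..} x *\<^sub>R exp (- x\<^sup>2))"
 have g: "integrable lborel g" "integral\<^sup>L lborel g = sqrt pi / 2"
  using gaussian_moment_0 by (auto simp: g_def has_bochner_integral_iff)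
 have top: "(\<Phi> \<longlongrightarrow> sqrt pi / 2) at_top"
 proof -
  have "((%y. \<integral>x. indicator {..y} x *\<^sub>R g x \<partial>lborel) \<longlongrightarrow> integral\<^sup>L lborel g) at_top"
   using g by (intro tendsto_integral_at_top) auto
  moreover have "eventually (%y. (\<integral>x. indicator {..y} x *\<^sub>R g x \<partial>lborel) = \<Phi> y) at_top"
   using eventually_ge_at_top[of 0]
  proof eventually_elim
   case (elim y)
   have "(\<integral>x. indicator {..y} x *\<^sub>R g x \<partial>lborel) = (\<integral>x. indicator {0..y} x *\<^sub>R exp (- x\<^sup>2) \<partial>lborel)"
    by (intro B_integral_cong) (auto simp: g_def indicator_def)
   also have "\<dots> = \<Phi> y - \<Phi> 0"
   proof (rule integral_FTC_atLeastAtMost[OF elim])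
    show "(\<Phi> has_vector_derivative exp (- x\<^sup>2)) (at x within {0..y})" for x
     using d[of x] has_vector_derivative_at_within unfolding has_real_derivative_iff_has_vector_derivative by blast
   qed (intro continuous_intros)
   also have "\<Phi> 0 = 0" by (simp add: \<Phi>_def)
   finally show ?case by (simp only: diff_zero)
  qed
  ultimately have "(\<Phi> \<longlongrightarrow> integral\<^sup>L lborel g) at_top" by (rule Lim_transform_eventually)
  thus ?thesis by (simp only: g(2))
 qed
 have odd: "\<Phi> (- x) = - \<Phi> x" for x
 proof -
  have "\<exists>c. \<forall>x\<in>UNIV. \<Phi> x + \<Phi> (- x) = c"
  proof (rule has_field_derivative_zero_constant)
   fix x :: real
   have "((%x. \<Phi> (- x)) has_real_derivative exp (- (- x)\<^sup>2) * - 1) (at x)"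
    by (rule DERIV_chain2[OF d DERIV_minus[OF DERIV_ident]])
   from DERIV_add[OF d this] show "((%x. \<Phi> x + \<Phi> (- x)) has_real_derivative 0) (at x within UNIV)" by simp
  qed simp
  then obtain c where "\<And>x. \<Phi> x + \<Phi> (- x) = c" by auto
  from this[of x] this[of 0] show ?thesis by (simp add: \<Phi>_def)
 qed
 have "(\<Phi> \<longlongrightarrow> - sqrt pi / 2) at_bot"
 proof -
  have "((%x. - \<Phi> (- x)) \<longlongrightarrow> - (sqrt pi / 2)) at_bot"
   by (rule tendsto_minus[OF filterlim_compose[OF top filterlim_uminus_at_top_at_bot]])
  thus ?thesis by (simp add: odd)
 qed
 with d top show ?thesis by blast
qed

text \<open>Completing the square: with al = a^2 and \<beta> = b^2, the squares of b sqrt(y) -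
  a/sqrt(y) and b sqrt(y) + a/sqrt(y) differ from \<beta> y + al/y by -2ab and 2ab. The weighted
  Gaussian antiderivatives thus have the same exponential in their derivatives; in the difference
  the parts with b cancel and a y^(-3/2) remains.\<close>

lemma exp_reciprocal_integral:
 fixes al \<beta> :: real
 assumes al: "al > 0" and \<beta>: "\<beta> > 0"
 shows "integrable posM (%y. y powr (- 3 / 2) * exp (- (al / y)) * exp (- (\<beta> * y)))"
  and "(\<integral>y. y powr (- 3 / 2) * exp (- (al / y)) * exp (- (\<beta> * y)) \<partial>posM) = sqrt (pi / al) * exp (- 2 * sqrt (al * \<beta>))"
proof -
 obtain \<Phi> where \<Phi>: "\<And>x. (\<Phi> has_real_derivative exp (- x\<^sup>2)) (at x)"
  "(\<Phi> \<longlongrightarrow> sqrt pi / 2) at_top" "(\<Phi> \<longlongrightarrow> - sqrt pi / 2) at_bot"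
  using gaussian_antiderivative by blast
 define a b where "a = sqrt al" and "b = sqrt \<beta>"
 have ab: "a > 0" "b > 0" "a\<^sup>2 = al" "b\<^sup>2 = \<beta>" using al \<beta> by (auto simp: a_def b_def)
 define f where "f = (%y. y powr (- 3 / 2) * exp (- (al / y)) * exp (- (\<beta> * y)))"
 define p1 where "p1 = (%y. b * sqrt y - a / sqrt y)"
 define p2 where "p2 = (%y. b * sqrt y + a / sqrt y)"
 define F where "F = (%y. (exp (- 2 * (a * b)) * \<Phi> (p1 y) - exp (2 * (a * b)) * \<Phi> (p2 y)) / a)"
 have dF: "DERIV F y :> f y" if y: "y > 0" for y
 proof -
  define r where "r = sqrt y"
  have r: "r > 0" "r\<^sup>2 = y" using y by (auto simp: r_def)
  have ds: "(sqrt has_real_derivative (inverse r / 2)) (at y)"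
   using DERIV_real_sqrt[OF y] by (simp add: r_def)
  have di: "((%y. a / sqrt y) has_real_derivative (- a / (2 * r ^ 3))) (at y)"
   using y r by (auto intro!: derivative_eq_intros ds simp: r_def[symmetric] field_simps power2_eq_square power3_eq_cube)
  have d1: "(p1 has_real_derivative (b / (2 * r) + a / (2 * r ^ 3))) (at y)"
   unfolding p1_def using DERIV_diff[OF DERIV_cmult[OF ds, of b] di] r by (simp add: field_simps)
  have d2: "(p2 has_real_derivative (b / (2 * r) - a / (2 * r ^ 3))) (at y)"
   unfolding p2_def using DERIV_add[OF DERIV_cmult[OF ds, of b] di] r by (simp add: field_simps)
  have sq1: "(p1 y)\<^sup>2 = \<beta> * y + al / y - 2 * (a * b)"
   using r ab by (simp add: p1_def r_def[symmetric] field_simps power2_eq_square flip: ab(3,4) r(2))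
  have sq2: "(p2 y)\<^sup>2 = \<beta> * y + al / y + 2 * (a * b)"
   using r ab by (simp add: p2_def r_def[symmetric] field_simps power2_eq_square flip: ab(3,4) r(2))
  define E where "E = exp (- (al / y)) * exp (- (\<beta> * y))"
  have e1: "exp (- (p1 y)\<^sup>2) = E * exp (2 * (a * b))" and e2: "exp (- (p2 y)\<^sup>2) = E * exp (- 2 * (a * b))"
   unfolding sq1 sq2 E_def by (simp_all flip: exp_add add: algebra_simps)
  have ee: "exp (- 2 * (a * b)) * exp (2 * (a * b)) = 1" by (simp flip: exp_add)
  have "(F has_real_derivative (exp (- 2 * (a * b)) * (exp (- (p1 y)\<^sup>2) * (b / (2 * r) + a / (2 * r ^ 3)))
       - exp (2 * (a * b)) * (exp (- (p2 y)\<^sup>2) * (b / (2 * r) - a / (2 * r ^ 3)))) / a) (at y)"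
   unfolding F_def
   by (rule DERIV_cdivide[OF DERIV_diff[OF DERIV_cmult[OF DERIV_chain2[OF \<Phi>(1) d1]] DERIV_cmult[OF DERIV_chain2[OF \<Phi>(1) d2]]]])
  also have "(exp (- 2 * (a * b)) * (exp (- (p1 y)\<^sup>2) * (b / (2 * r) + a / (2 * r ^ 3)))
       - exp (2 * (a * b)) * (exp (- (p2 y)\<^sup>2) * (b / (2 * r) - a / (2 * r ^ 3)))) / a =
   ((exp (- 2 * (a * b)) * exp (2 * (a * b))) * E * ((b / (2 * r) + a / (2 * r ^ 3)) - (b / (2 * r) - a / (2 * r ^ 3)))) / a"
   unfolding e1 e2 by (simp add: algebra_simps)
  also have "\<dots> = E / r ^ 3" unfolding ee using ab r by (simp add: field_simps)
  also have "E / r ^ 3 = E * (1 / r ^ 3)" by simp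
  also have "1 / r ^ 3 = y powr (- 3 / 2)"
  proof -
   have r2: "r = y powr (1 / 2)" using y by (simp add: r_def powr_half_sqrt)
   have "r ^ 3 = r powr 3" using r by simp
   also have "\<dots> = y powr (3 / 2)" unfolding r2 by (simp only: powr_powr) simp
   finally have "r ^ 3 = y powr (3 / 2)" .
   moreover have "(- 3 / 2 :: real) = - (3 / 2)" by simp
   ultimately show ?thesis by (simp only: powr_minus_divide)
  qed
  also have "E * y powr (- 3 / 2) = f y" unfolding f_def E_def by (simp only: mult_ac)
  finally show ?thesis .
 qed
 have lim1: "filterlim p1 at_top at_top" "filterlim p2 at_top at_top"
  unfolding p1_def p2_def using ab(1,2) by real_asymp+
 \<comment> \<open>At 0 the two arguments run to opposite infinities, at infinity to the same one.
   Hence only the term with exp(-2ab) survives in B - A.\<close>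
 have lim0: "filterlim p1 at_bot (at_right 0)" "filterlim p2 at_top (at_right 0)"
  unfolding p1_def p2_def using ab(1,2) by real_asymp+
 define B where "B = (exp (- 2 * (a * b)) * (sqrt pi / 2) - exp (2 * (a * b)) * (sqrt pi / 2)) / a"
 define A where "A = (exp (- 2 * (a * b)) * (- sqrt pi / 2) - exp (2 * (a * b)) * (sqrt pi / 2)) / a"
 have limB: "(F \<longlongrightarrow> B) at_top"
 proof -
  note l = filterlim_compose[OF \<Phi>(2) lim1(1)] filterlim_compose[OF \<Phi>(2) lim1(2)]
  show ?thesis unfolding F_def B_def
   by (rule tendsto_divide[OF tendsto_diff[OF tendsto_mult[OF tendsto_const l(1)] tendsto_mult[OF tendsto_const l(2)]] tendsto_const])
    (use ab in simp)
 qed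
 have limA: "(F \<longlongrightarrow> A) (at_right 0)"
 proof -
  note l = filterlim_compose[OF \<Phi>(3) lim0(1)] filterlim_compose[OF \<Phi>(2) lim0(2)]
  show ?thesis unfolding F_def A_def
   by (rule tendsto_divide[OF tendsto_diff[OF tendsto_mult[OF tendsto_const l(1)] tendsto_mult[OF tendsto_const l(2)]] tendsto_const])
    (use ab in simp)
 qed
 have ei: "einterval 0 \<infinity> = {0<..}" by (auto simp: einterval_def)
 note FTC = interval_integral_FTC_nonneg[where a = 0 and b = \<infinity> and F = F and f = f and A = A and B = B]
 have cond: "(0::ereal) < \<infinity>" "\<And>x. 0 < ereal x ==> ereal x < \<infinity> ==> DERIV F x :> f x"
  "\<And>x. 0 < ereal x ==> ereal x < \<infinity> ==> isCont f x"
  "AE x in lborel. 0 < ereal x \<longrightarrow> ereal x < \<infinity> \<longrightarrow> 0 \<le> f x"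
  "((F \<circ> real_of_ereal) \<longlongrightarrow> A) (at_right 0)" "((F \<circ> real_of_ereal) \<longlongrightarrow> B) (at_left \<infinity>)"
  using dF limA limB by (auto simp: f_def zero_ereal_def ereal_tendsto_simps intro!: continuous_intros)
 have int: "set_integrable lborel {0<..} f" using FTC(1)[OF cond] by (simp add: ei)
 thus "integrable posM f" by (simp add: integrable_posM_iff)
 have "integral\<^sup>L posM f = B - A"
  unfolding integral_posM using FTC(2)[OF cond] by (simp add: interval_lebesgue_integral_def ei)
 also have "B - A = sqrt pi / a * exp (- 2 * (a * b))"
 proof -
  have "x * (p / 2) - y * (p / 2) - (x * (- p / 2) - y * (p / 2)) = p * x" for x y p :: real
   by (simp add: field_simps)
  thus ?thesis unfolding A_def B_def diff_divide_distrib[symmetric] by simp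
 qed
 also have "\<dots> = sqrt (pi / al) * exp (- 2 * sqrt (al * \<beta>))" by (simp add: a_def b_def real_sqrt_divide real_sqrt_mult)
 finally show "integral\<^sup>L posM f = sqrt (pi / al) * exp (- 2 * sqrt (al * \<beta>))" .
qed

section \<open>The Lipschitz summation formula\<close>

text \<open>The polylogarithm of order 1 - u at exp(-2 pi y). With u = s + 1/2 it collects the
  variable d of the divisor sum.\<close>

definition expsum :: "real => real => real" where
 "expsum u y = (\<Sum>d. real (Suc d) powr (u - 1) * exp (- (2 * pi * (real (Suc d) * y))))"

text \<open>The integral of q^(u-1) exp(-2 pi q) over (0, infinity), hence the coefficient of the
  singular part of \<open>expsum u\<close> at 0.\<close>

definition lipc :: "real => real" where "lipc u = Gamma u * (2 * pi) powr (- u)"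

definition expsum1 :: "real => real => real" where "expsum1 u y = expsum u y - lipc u * y powr (- u)"

text \<open>The terms k and -k of the Lipschitz series of (y + i k)^(-u) taken together. The term k
  = 0 is the singular part removed in \<open>expsum1\<close>.\<close>

definition lipterm :: "real => nat => real => real" where
 "lipterm u k y = 2 * Re ((of_real y + \<i> * of_nat k) powr (- of_real u))"

lemma expsum_sums:
 assumes u: "u \<le> 1" and y: "y > 0"
 shows "(%d. real (Suc d) powr (u - 1) * exp (- (2 * pi * (real (Suc d) * y)))) sums expsum u y"
  and "0 \<le> expsum u y" "expsum u y \<le> planck y"
proof -
 have le: "real (Suc d) powr (u - 1) * exp (- (2 * pi * (real (Suc d) * y))) \<le> exp (- (2 * pi * real (Suc d) * y))" for d
 proof -
  have "real (Suc d) powr (u - 1) \<le> real (Suc d) powr 0" using u by (intro powr_mono) auto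
  hence "real (Suc d) powr (u - 1) * exp (- (2 * pi * (real (Suc d) * y))) \<le> 1 * exp (- (2 * pi * (real (Suc d) * y)))"
   by (intro mult_right_mono) auto
  thus ?thesis by (simp add: mult.assoc)
 qed
 have "summable (%d. real (Suc d) powr (u - 1) * exp (- (2 * pi * (real (Suc d) * y))))"
 proof (rule summable_comparison_test)
  show "summable (%d. exp (- (2 * pi * real (Suc d) * y)))" using planck_sums[OF y] by (simp only: sums_iff)
  show "\<exists>N. \<forall>n\<ge>N. norm (real (Suc n) powr (u - 1) * exp (- (2 * pi * (real (Suc n) * y)))) \<le> exp (- (2 * pi * real (Suc n) * y))"
   using le by (intro exI[of _ 0]) (simp del: of_nat_Suc)
 qed
 thus s: "(%d. real (Suc d) powr (u - 1) * exp (- (2 * pi * (real (Suc d) * y)))) sums expsum u y"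
  unfolding expsum_def by (rule summable_sums)
 show "0 \<le> expsum u y" by (rule sums_le[OF _ sums_zero s]) simp
 show "expsum u y \<le> planck y" by (rule sums_le[OF le s planck_sums[OF y]])
qed

lemma Mellin_expsum1:
 assumes u: "1 / 2 < u" "u < 1"
 shows "integrable posM (%y. y powr (- 1 / 2) * expsum1 u y)"
  and "(\<integral>y. y powr (- 1 / 2) * expsum1 u y \<partial>posM) = sqrt pi * (2 * pi) powr (- 1 / 2) * zeta_real (3 / 2 - u)"
proof -
 have "0 < u" "u \<le> 1" "u - 1 < 1 / 2" using u by auto
 note M = Mellin_exp_sum[of u "1 / 2" "expsum u", OF this(1,2) _ this(3) u(1) expsum_sums(1)[OF this(2)]]
 have e: "(1 / 2 - 1 :: real) = - 1 / 2" "- (1 / 2) = (- 1 / 2 :: real)" "1 / 2 + 1 - u = 3 / 2 - u" by simp_all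
 show "integrable posM (%y. y powr (- 1 / 2) * expsum1 u y)"
  using M(1) unfolding expsum1_def lipc_def e by simp
 show "(\<integral>y. y powr (- 1 / 2) * expsum1 u y \<partial>posM) = sqrt pi * (2 * pi) powr (- 1 / 2) * zeta_real (3 / 2 - u)"
  using M(2) unfolding expsum1_def lipc_def e Gamma_one_half_real by simp
qed

text \<open>Turns the resolvent 1/(r + c) into the power c^(-u); by this device partial fractions
  become Lipschitz summation. After division by c it is a Beta integral with parameter 1/c.\<close>

lemma Stieltjes_integral:
 fixes c :: complex
 assumes u: "0 < u" "u < 1" and c: "c \<notin> \<real>\<^sub>\<le>\<^sub>0"
 shows "integrable posM (%r. of_real (r powr (- u)) * (1 / (of_real r + c)))"
  and "(\<integral>r. of_real (r powr (- u)) * (1 / (of_real r + c)) \<partial>posM) = c powr (- of_real u) * of_real (Gamma u * Gamma (1 - u))"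
proof -
 have c0: "c ~= 0" using c by auto
 have ic: "1 / c \<notin> \<real>\<^sub>\<le>\<^sub>0"
 proof
  assume "1 / c \<in> \<real>\<^sub>\<le>\<^sub>0"
  then obtain r where r: "1 / c = of_real r" "r \<le> 0" by (auto elim: nonpos_Reals_cases)
  have "c = 1 / (1 / c)" using c0 by (simp add: field_simps)
  hence "c = of_real (1 / r)" unfolding r(1) by simp
  thus False using c r by (auto simp: complex_nonpos_Reals_iff)
 qed
 have ex: "- complex_of_real (1 - u) - of_real u = -1" by simp
 have u': "0 < 1 - u" "0 < Re (complex_of_real u)" using u by auto
 note B = Beta_integral_complex[OF u' ic, unfolded ex]
 have e: "of_real (r powr (- u)) * (1 / (of_real r + c)) = 1 / c * (complex_of_real (r powr (1 - u - 1)) * (1 + 1 / c * of_real r) powr (- 1))"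
  if "r \<in> space posM" for r
 proof -
  have "c + of_real r ~= 0"
  proof
   assume "c + of_real r = 0"
   hence "c = of_real (- r)" by (simp add: eq_neg_iff_add_eq_0)
   thus False using c that by (simp add: complex_nonpos_Reals_iff space_posM)
  qed
  moreover have "1 + 1 / c * of_real r = (c + of_real r) / c" using c0 by (simp add: field_simps)
  ultimately show ?thesis using c0 by (simp add: powr_minus add.commute)
 qed
 show "integrable posM (%r. of_real (r powr (- u)) * (1 / (of_real r + c)))"
  by (subst B_integrable_cong[OF refl e]) (use B(1) in simp_all)
 have "(\<integral>r. of_real (r powr (- u)) * (1 / (of_real r + c)) \<partial>posM) = 1 / c * ((1 / c) powr (- of_real (1 - u)) * Beta (of_real (1 - u)) (of_real u))"
  by (subst B_integral_cong[OF refl e]) (use B(2) in simp_all)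
 also have "(1 / c) powr (- of_real (1 - u)) = c powr (1 - of_real u)"
 proof -
  have "Ln (1 / c) = - Ln c" using c Ln_inverse[of c] by (simp add: inverse_eq_divide)
  thus ?thesis using c0 by (simp add: powr_def algebra_simps)
 qed
 also have "Beta (of_real (1 - u)) (of_real u) = complex_of_real (Gamma u * Gamma (1 - u))"
 proof -
  have "Beta (1 - u) u = Gamma u * Gamma (1 - u)" by (simp add: Beta_def)
  thus ?thesis by (simp only: Beta_complex_of_real)
 qed
 also have "1 / c * (c powr (1 - of_real u) * of_real (Gamma u * Gamma (1 - u))) = c powr (- of_real u) * of_real (Gamma u * Gamma (1 - u))"
  using c0 by (simp add: powr_diff powr_minus field_simps)
 finally show "(\<integral>r. of_real (r powr (- u)) * (1 / (of_real r + c)) \<partial>posM) = c powr (- of_real u) * of_real (Gamma u * Gamma (1 - u))" .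
qed

lemma Re_inverse_add_i: "Re (1 / (complex_of_real t + \<i> * of_nat k)) = t / (t\<^sup>2 + (real k)\<^sup>2)"
 by (simp add: Re_divide power2_eq_square)

text \<open>The same transform applied to each exponential of \<open>planck (y + r)\<close> attaches
  the weight d^(u-1), up to a constant, to exp(-2 pi d y).\<close>

lemma integral_powr_planck:
 assumes u: "0 < u" "u < 1" and y: "y > 0"
 shows "integrable posM (%r. r powr (- u) * planck (y + r))"
  and "(\<integral>r. r powr (- u) * planck (y + r) \<partial>posM) = Gamma (1 - u) * (2 * pi) powr (u - 1) * expsum u y"
proof -
 define f where "f = (%d r. exp (- (2 * pi * (real (Suc d) * y))) * (r powr ((1 - u) - 1) * exp (- ((2 * pi * real (Suc d)) * r))))"
 have c: "2 * pi * real (Suc d) > 0" for d by simp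
 have u1: "1 - u > 0" using u by simp
 note G = Gamma_integral_posM[OF u1 c]
 have int: "integrable posM (f d)" for d
  unfolding f_def using G(1) by (rule integrable_mult_right)
 have val: "integral\<^sup>L posM (f d) = Gamma (1 - u) * (2 * pi) powr (u - 1) * (real (Suc d) powr (u - 1) * exp (- (2 * pi * (real (Suc d) * y))))" for d
  unfolding f_def using G(2)[of d] by (simp add: powr_mult del: of_nat_Suc)
 have s: "(%d. integral\<^sup>L posM (f d)) sums (Gamma (1 - u) * (2 * pi) powr (u - 1) * expsum u y)"
  unfolding val using expsum_sums(1)[of u y] u y by (intro sums_mult) simp
 have nn: "f d r \<ge> 0" if "r \<in> space posM" for d r by (simp add: f_def)
 have ptw: "(%d. f d r) sums (r powr (- u) * planck (y + r))" if "r \<in> space posM" for r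
 proof -
  have "(%d. r powr (- u) * exp (- (2 * pi * real (Suc d) * (y + r)))) sums (r powr (- u) * planck (y + r))"
   using that y by (intro sums_mult planck_sums) (simp add: space_posM)
  also have "(%d. r powr (- u) * exp (- (2 * pi * real (Suc d) * (y + r)))) = (%d. f d r)"
  proof
   fix d
   have "- (2 * pi * real (Suc d) * (y + r)) = - (2 * pi * (real (Suc d) * y)) + - ((2 * pi * real (Suc d)) * r)"
    by (simp only: distrib_left mult.assoc minus_add_distrib)
   thus "r powr (- u) * exp (- (2 * pi * real (Suc d) * (y + r))) = f d r"
    by (simp only: exp_add f_def) simp
  qed
  finally show ?thesis .
 qed
 show "integrable posM (%r. r powr (- u) * planck (y + r))"
  by (rule sums_integral_nonneg(1)[OF int nn ptw s])
 show "(\<integral>r. r powr (- u) * planck (y + r) \<partial>posM) = Gamma (1 - u) * (2 * pi) powr (u - 1) * expsum u y"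
  by (rule sums_integral_nonneg(2)[OF int nn ptw s])
qed

text \<open>The partial fractions of \<open>planck1 (y + r)\<close> integrated against r^(-u): the
  Planck factor becomes \<open>expsum\<close>, its pole the power y^(-u), each resolvent a power of
  y + i k. Values at y = 0 are subtracted because the sum of k^(-u) diverges for u < 1; the constant
  lost in this way is zeta(1 - u), by the Mellin transform of \<open>planck1\<close>.\<close>

lemma Lipschitz_formula:
 assumes u: "0 < u" "u < 1" and y: "y > 0"
 shows "(%k. lipc u * (lipterm u (Suc k) y - lipterm u (Suc k) 0)) sums (expsum1 u y - zeta_real (1 - u))"
proof -
 \<comment> \<open>The reciprocal of the constant in \<open>integral_powr_planck\<close>, so that
   the transform of \<open>planck (y + r)\<close> is exactly \<open>expsum u y\<close>.\<close>
 define c where "c = (2 * pi) powr (1 - u) / Gamma (1 - u)"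
 have G: "Gamma (1 - u) > 0" "Gamma u > 0" using u by (auto intro!: Gamma_real_pos)
 have cc: "c * (Gamma (1 - u) * (2 * pi) powr (u - 1)) = 1"
  using G by (simp add: c_def powr_diff field_simps)
 define GG where "GG = Gamma u * Gamma (1 - u)"
 have yc: "complex_of_real y \<notin> \<real>\<^sub>\<le>\<^sub>0" using y by (simp add: complex_nonpos_Reals_iff)
 have st_real: "integrable posM (%r. r powr (- u) * (1 / (r + y)))" "(\<integral>r. r powr (- u) * (1 / (r + y)) \<partial>posM) = y powr (- u) * GG"
 proof -
  note S = Stieltjes_integral[OF u yc]
  have e: "complex_of_real (r powr (- u)) * (1 / (of_real r + of_real y)) = of_real (r powr (- u) * (1 / (r + y)))" for r by simp
  show i: "integrable posM (%r. r powr (- u) * (1 / (r + y)))"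
   using integrable_Re[OF S(1)] unfolding e by simp
  have "complex_of_real (\<integral>r. r powr (- u) * (1 / (r + y)) \<partial>posM) = of_real y powr (- of_real u) * of_real GG"
   using S(2) unfolding e integral_complex_of_real GG_def .
  also have "\<dots> = of_real (y powr (- u) * GG)" using y powr_of_real[of y "- u"] by simp
  finally show "(\<integral>r. r powr (- u) * (1 / (r + y)) \<partial>posM) = y powr (- u) * GG" by (simp only: of_real_eq_iff)
 qed
 have p1y: "integrable posM (%r. r powr (- u) * planck1 (y + r))"
  "c * (\<integral>r. r powr (- u) * planck1 (y + r) \<partial>posM) = expsum1 u y"
 proof -
  have e: "r powr (- u) * planck1 (y + r) = r powr (- u) * planck (y + r) - 1 / (2 * pi) * (r powr (- u) * (1 / (r + y)))" for r
   by (simp add: planck1_def algebra_simps)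
  note P = integral_powr_planck[OF u y]
  show "integrable posM (%r. r powr (- u) * planck1 (y + r))"
   unfolding e by (intro B_integrable_diff integrable_mult_right P(1) st_real(1))
  have I: "(\<integral>r. r powr (- u) * planck1 (y + r) \<partial>posM) = Gamma (1 - u) * (2 * pi) powr (u - 1) * expsum u y - 1 / (2 * pi) * (y powr (- u) * GG)"
   unfolding e B_integral_diff[OF P(1) integrable_mult_right[OF st_real(1)]] integral_mult_right_zero P(2) st_real(2) ..
  have "c * (\<integral>r. r powr (- u) * planck1 (y + r) \<partial>posM) = (c * (Gamma (1 - u) * (2 * pi) powr (u - 1))) * expsum u y - c / (2 * pi) * GG * y powr (- u)"
   unfolding I by (simp add: algebra_simps)
  also have "c / (2 * pi) * GG = lipc u"
   using G by (simp add: c_def GG_def lipc_def powr_diff powr_minus field_simps)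
  finally show "c * (\<integral>r. r powr (- u) * planck1 (y + r) \<partial>posM) = expsum1 u y"
   by (simp add: cc expsum1_def)
 qed
 have p10: "integrable posM (%r. r powr (- u) * planck1 r)" "c * (\<integral>r. r powr (- u) * planck1 r \<partial>posM) = zeta_real (1 - u)"
 proof -
  have "0 < 1 - u" "1 - u < 1" using u by auto
  note M = Mellin_planck1[OF this]
  show "integrable posM (%r. r powr (- u) * planck1 r)" using M(1) by simp
  have "(\<integral>r. r powr (- u) * planck1 r \<partial>posM) = Gamma (1 - u) * (2 * pi) powr (u - 1) * zeta_real (1 - u)" using M(2) by simp
  hence "c * (\<integral>r. r powr (- u) * planck1 r \<partial>posM) = (c * (Gamma (1 - u) * (2 * pi) powr (u - 1))) * zeta_real (1 - u)" by simp
  thus "c * (\<integral>r. r powr (- u) * planck1 r \<partial>posM) = zeta_real (1 - u)" by (simp only: cc mult_1)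
 qed
 define h where "h = (%k t. t / (t\<^sup>2 + (real (Suc k))\<^sup>2))"
 define f where "f = (%k r. r powr (- u) * (h k (y + r) - h k r))"
 \<comment> \<open>Majorant from the difference of resolvents: 1/(a + y) - 1/a is at most y / |a|^2
   in modulus for a = r + i (k + 1).\<close>
 define g where "g = (%k r. y * (r powr (- u) * (1 / (r\<^sup>2 + (real (Suc k))\<^sup>2))))"
 define F where "F = (%r. r powr (- u) * (pi * (planck1 (y + r) + 1 / 2) - pi * (planck1 r + 1 / 2)))"
 define M where "M = (\<integral>r. r powr (- u) * (1 / (1 + r\<^sup>2)) \<partial>posM)"
 have Mint: "integrable posM (%r. r powr (- u) * (1 / (1 + r\<^sup>2)))"
  using Mellin_inverse_one_plus_square(1)[of "1 - u"] u by simp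
 have gint: "integrable posM (g k)" "integral\<^sup>L posM (g k) = y * M * real (Suc k) powr (- u - 1)" for k
 proof -
  define K where "K = real (Suc k)"
  have K: "K > 0" by (simp add: K_def)
  have e: "g k r = y * K powr (- u - 2) * ((1 / K * r) powr (- u) * (1 / (1 + (1 / K * r)\<^sup>2)))" if "r \<in> space posM" for r
  proof -
   have r: "r > 0" using that by (simp add: space_posM)
   have "1 / (r\<^sup>2 + K\<^sup>2) = 1 / K\<^sup>2 * (1 / (1 + (1 / K * r)\<^sup>2))"
    using K by (simp add: field_simps power2_eq_square)
   moreover have "K powr (- u - 2) * (1 / K * r) powr (- u) = r powr (- u) * (1 / K\<^sup>2)"
   proof -
    have "(1 / K * r) powr (- u) = K powr u * r powr (- u)"
     using K r by (simp add: powr_divide powr_minus field_simps)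
    hence "K powr (- u - 2) * (1 / K * r) powr (- u) = (K powr (- u - 2) * K powr u) * r powr (- u)" by simp
    also have "K powr (- u - 2) * K powr u = K powr (- 2)" by (simp only: powr_add[symmetric]) simp
    finally show ?thesis using K by (simp add: powr_minus powr_numeral divide_inverse)
   qed
   ultimately show ?thesis unfolding g_def K_def[symmetric] by (metis mult.assoc)
  qed
  have K1: "1 / K > 0" using K by simp
  note sc = integrable_integral_posM_scale[OF K1, of "%r. r powr (- u) * (1 / (1 + r\<^sup>2))"]
  have i: "integrable posM (%r. y * K powr (- u - 2) * ((1 / K * r) powr (- u) * (1 / (1 + (1 / K * r)\<^sup>2))))"
   using sc(1) Mint by (intro integrable_mult_right) simp
  show "integrable posM (g k)"
   using i by (subst B_integrable_cong[of posM posM "g k", OF refl e])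
  have "integral\<^sup>L posM (g k) = (\<integral>r. y * K powr (- u - 2) * ((1 / K * r) powr (- u) * (1 / (1 + (1 / K * r)\<^sup>2))) \<partial>posM)"
   by (rule B_integral_cong[of posM posM "g k", OF refl e])
  also have "\<dots> = y * K powr (- u - 2) * (M * K)" unfolding integral_mult_right_zero sc(2) M_def by simp
  also have "K powr (- u - 2) = K powr (- u - 1) / K"     proof -
   have "- u - 2 = (- u - 1) - 1" by simp
   thus ?thesis using K powr_diff[of K "- u - 1" 1] by (simp only: powr_one)
  qed
  finally show "integral\<^sup>L posM (g k) = y * M * real (Suc k) powr (- u - 1)" using K by (simp add: K_def)
 qed
 have main: "(%k. integral\<^sup>L posM (f k)) sums integral\<^sup>L posM F"
 proof (rule sums_integral_dominated(3))
  show "f k \<in> borel_measurable posM" for k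
   unfolding f_def h_def by (intro borel_measurable_posM) measurable
  show "norm (f k r) \<le> g k r" if "r \<in> space posM" for k r
  proof -
   have r: "r > 0" using that by (simp add: space_posM)
   define a where "a = complex_of_real r + \<i> * of_nat (Suc k)"
   have a: "Im a = real (Suc k)" "Re a = r" by (simp_all add: a_def)
   have a0: "a ~= 0" "a + of_real y ~= 0" using a r y by (auto simp: complex_eq_iff)
   have "h k (y + r) - h k r = Re (1 / (a + of_real y)) - Re (1 / a)"
    using Re_inverse_add_i[of "y + r" "Suc k"] Re_inverse_add_i[of r "Suc k"]
    unfolding h_def a_def by (simp only: of_real_add) (simp add: add_ac del: of_nat_Suc)
   also have "\<bar>\<dots>\<bar> \<le> norm (1 / (a + of_real y) - 1 / a)"
    using abs_Re_le_cmod[of "1 / (a + of_real y) - 1 / a"] by simp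
   also have "1 / (a + of_real y) - 1 / a = - of_real y / ((a + of_real y) * a)"
    using a0 by (simp add: field_simps)
   also have "norm \<dots> = y / (norm (a + of_real y) * norm a)" using y by (simp add: norm_mult norm_divide)
   also have "\<dots> \<le> y / (norm a * norm a)"
   proof -
    have "norm a \<le> norm (a + of_real y)" unfolding cmod_def using a r y by (simp add: power_mono del: of_nat_Suc)
    thus ?thesis using a0 y by (intro divide_left_mono mult_right_mono mult_pos_pos) auto
   qed
   also have "norm a * norm a = r\<^sup>2 + (real (Suc k))\<^sup>2"
    using a by (simp add: cmod_power2 flip: power2_eq_square)
   finally have "\<bar>h k (y + r) - h k r\<bar> \<le> y * (1 / (r\<^sup>2 + (real (Suc k))\<^sup>2))" by simp
   hence "r powr (- u) * \<bar>h k (y + r) - h k r\<bar> \<le> r powr (- u) * (y * (1 / (r\<^sup>2 + (real (Suc k))\<^sup>2)))"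
    by (intro mult_left_mono) auto
   thus ?thesis by (simp only: f_def g_def real_norm_def abs_mult) (simp add: mult.commute)
  qed
  show "summable (%k. g k r)" if "r \<in> space posM" for r
  proof -
   have r: "r > 0" using that by (simp add: space_posM)
   have "summable (%k. r / (r\<^sup>2 + (real (Suc k))\<^sup>2))" using planck1_sums[OF r] by (simp only: sums_iff)
   hence "summable (%k. (y * r powr (- u) / r) * (r / (r\<^sup>2 + (real (Suc k))\<^sup>2)))" by (rule summable_mult)
   also have "(%k. (y * r powr (- u) / r) * (r / (r\<^sup>2 + (real (Suc k))\<^sup>2))) = (%k. g k r)"
    using r by (intro ext) (simp add: g_def del: of_nat_Suc)
   finally show ?thesis .
  qed
  show "summable (%k. integral\<^sup>L posM (g k))"
  proof -
   have "summable (%k. y * M * real (k + 1) powr (- (u + 1)))" using u by (intro summable_mult summable_powr_shift) auto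
   moreover have "- (u + 1) = - u - 1" by simp
   ultimately show ?thesis unfolding gint(2) by (simp only: Suc_eq_plus1)
  qed
  show "(%k. f k r) sums F r" if "r \<in> space posM" for r
   unfolding f_def F_def h_def using that y
   by (intro sums_mult sums_diff planck1_sums) (auto simp: space_posM)
 qed (rule gint(1))
 have fval: "integral\<^sup>L posM (f k) = GG / 2 * (lipterm u (Suc k) y - lipterm u (Suc k) 0)" for k
 proof -
  define c1 where "c1 = complex_of_real y + \<i> * of_nat (Suc k)"
  define c0 where "c0 = complex_of_real 0 + \<i> * of_nat (Suc k)"
  have nc: "c1 \<notin> \<real>\<^sub>\<le>\<^sub>0" "c0 \<notin> \<real>\<^sub>\<le>\<^sub>0" by (auto simp: c1_def c0_def complex_nonpos_Reals_iff)
  note S1 = Stieltjes_integral[OF u nc(1)] and S0 = Stieltjes_integral[OF u nc(2)]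
  have e: "f k r = Re (of_real (r powr (- u)) * (1 / (of_real r + c1)) - of_real (r powr (- u)) * (1 / (of_real r + c0)))" for r
  proof -
   have "Re (1 / (of_real r + c1)) = h k (y + r)"
    using Re_inverse_add_i[of "y + r" "Suc k"] unfolding h_def c1_def by (simp only: of_real_add) (simp add: add_ac del: of_nat_Suc)
   moreover have "Re (1 / (of_real r + c0)) = h k r"
    using Re_inverse_add_i[of r "Suc k"] unfolding h_def c0_def by (simp only: of_real_0 add_0)
   ultimately show ?thesis by (simp only: f_def minus_complex.sel Re_of_real_mult right_diff_distrib)
  qed
  have "integral\<^sup>L posM (f k) = Re ((\<integral>r. of_real (r powr (- u)) * (1 / (of_real r + c1)) - of_real (r powr (- u)) * (1 / (of_real r + c0)) \<partial>posM))"
   unfolding e by (rule integral_Re) (intro B_integrable_diff S1(1) S0(1))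
  also have "\<dots> = Re (c1 powr (- of_real u) * of_real GG - c0 powr (- of_real u) * of_real GG)"
   unfolding B_integral_diff[OF S1(1) S0(1)] S1(2) S0(2) GG_def ..
  also have "\<dots> = GG / 2 * (lipterm u (Suc k) y - lipterm u (Suc k) 0)"
   by (simp add: lipterm_def c1_def c0_def algebra_simps)
  finally show ?thesis .
 qed
 have Fval: "c / pi * integral\<^sup>L posM F = expsum1 u y - zeta_real (1 - u)"
 proof -
  have "F = (%r. pi * (r powr (- u) * planck1 (y + r) - r powr (- u) * planck1 r))"
   by (simp add: F_def fun_eq_iff algebra_simps)
  hence "integral\<^sup>L posM F = pi * ((\<integral>r. r powr (- u) * planck1 (y + r) \<partial>posM) - (\<integral>r. r powr (- u) * planck1 r \<partial>posM))"
   using p1y(1) p10(1) by simp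
  thus ?thesis using p1y(2) p10(2) by (simp add: right_diff_distrib)
 qed
 have "(%k. c / pi * (GG / 2 * (lipterm u (Suc k) y - lipterm u (Suc k) 0))) sums (expsum1 u y - zeta_real (1 - u))"
  using sums_mult[OF main, of "c / pi"] unfolding fval Fval .
 moreover have "c / pi * (GG / 2 * x) = lipc u * x" for x
 proof -
  have "c / pi * (GG / 2) = lipc u"
   using G by (simp add: c_def GG_def lipc_def powr_diff powr_minus field_simps)
  thus ?thesis by (simp only: mult.assoc[symmetric])
 qed
 ultimately show ?thesis by (simp only:)
qed

text \<open>The segment from i k to y + i k keeps the imaginary part k, so t^(-u) has derivative at
  most u k^(-u-1) along it.\<close>

lemma lipterm_bound:
 assumes u: "0 < u" and y: "y \<ge> 0" and k: "k > 0"
 shows "\<bar>lipterm u k y - lipterm u k 0\<bar> \<le> 2 * u * y * real k powr (- u - 1)"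
proof -
 define c where "c = \<i> * complex_of_nat k"
 define S where "S = closed_segment c (of_real y + c)"
 have S: "Im t = real k" if "t \<in> S" for t
  using that k by (auto simp: S_def closed_segment_def c_def algebra_simps)
 have "norm ((of_real y + c) powr (- of_real u) - c powr (- of_real u)) \<le> (u * real k powr (- u - 1)) * norm (of_real y + c - c)"
 proof (rule field_differentiable_bound[where S = S and f' = "%t. - of_real u * t powr (- of_real u - 1)"])
  fix t assume t: "t \<in> S"
  have nn: "t \<notin> \<real>\<^sub>\<le>\<^sub>0" using S[OF t] k by (auto simp: complex_nonpos_Reals_iff)
  show "((%z. z powr (- of_real u)) has_field_derivative - of_real u * t powr (- of_real u - 1)) (at t within S)"
   by (rule has_field_derivative_at_within[OF has_field_derivative_powr[OF nn]])
  have "norm (t powr (- of_real u - 1)) = norm t powr (- u - 1)"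
  proof -
   have "t ~= 0" using nn by auto
   thus ?thesis by (simp add: powr_def)
  qed
  also have "\<dots> \<le> real k powr (- u - 1)"
   using S[OF t] abs_Im_le_cmod[of t] k u by (intro powr_mono2') auto
  finally show "norm (- of_real u * t powr (- of_real u - 1)) \<le> u * real k powr (- u - 1)"
   using u by (simp add: norm_mult mult_left_mono)
 qed (auto simp: S_def)
 also have "norm (of_real y + c - c) = y" using y by simp
 finally have n: "norm ((of_real y + c) powr (- of_real u) - c powr (- of_real u)) \<le> u * real k powr (- u - 1) * y" .
 have "lipterm u k y - lipterm u k 0 = 2 * Re ((of_real y + c) powr (- of_real u) - c powr (- of_real u))"
  by (simp add: lipterm_def c_def)
 also have "\<bar>\<dots>\<bar> \<le> 2 * norm ((of_real y + c) powr (- of_real u) - c powr (- of_real u))"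
  using abs_Re_le_cmod[of "(of_real y + c) powr (- of_real u) - c powr (- of_real u)"] by (simp add: abs_mult)
 also have "\<dots> \<le> 2 * (u * real k powr (- u - 1) * y)" using n by simp
 finally show ?thesis by (simp add: mult_ac)
qed

section \<open>The identity for real parameters\<close>

text \<open>The counterpart of \<open>sums_integral_nonneg\<close>: integrability of the sum is
  known, and convergence of the sum of the integrals is concluded.\<close>

lemma sums_integral_nonneg':
 fixes f :: "nat => 'a => real"
 assumes meas: "\<And>n. f n \<in> borel_measurable M" and nn: "\<And>n x. x \<in> space M ==> f n x \<ge> 0"
  and s: "\<And>x. x \<in> space M ==> (%n. f n x) sums F x" and F: "integrable M F"
 shows "\<And>n. integrable M (f n)" "(%n. integral\<^sup>L M (f n)) sums integral\<^sup>L M F"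
proof -
 have le: "(\<Sum>i<n. f i x) \<le> F x" if "x \<in> space M" for n x
  using sum_le_suminf[of "%i. f i x" "{..<n}"] s[OF that] nn[OF that] by (simp add: sums_iff)
 have F0: "F x \<ge> 0" if "x \<in> space M" for x using le[OF that, of 0] by simp
 have le1: "f n x \<le> F x" if "x \<in> space M" for n x
 proof -
  have "f n x \<le> (\<Sum>i<Suc n. f i x)" using nn[OF that] by (simp add: sum_nonneg)
  thus ?thesis using le[OF that, of "Suc n"] by linarith
 qed
 show int: "integrable M (f n)" for n
  by (rule B_integrable_bound[OF F meas AE_I2]) (use le1 nn F0 in simp)
 have "(%n. \<integral>x. (\<Sum>i<n. f i x) \<partial>M) \<longlonglongrightarrow> integral\<^sup>L M F"
 proof (rule integral_dominated_convergence[OF _ _ F])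
  show "AE x in M. (%n. \<Sum>i<n. f i x) \<longlonglongrightarrow> F x" using s by (intro AE_I2) (simp add: sums_def)
  show "AE x in M. norm (\<Sum>i<n. f i x) \<le> F x" for n
   using le nn by (intro AE_I2) (simp add: sum_nonneg)
  show "(%x. \<Sum>i<n. f i x) \<in> borel_measurable M" for n by (intro borel_measurable_sum meas)
  show "F \<in> borel_measurable M" using F by simp
 qed
 thus "(%n. integral\<^sup>L M (f n)) sums integral\<^sup>L M F"
  unfolding sums_def by (simp add: B_integral_sum[OF int])
qed

text \<open>An absolutely convergent double sum is collected by the product (d+1)(m+1), with all
  indices shifted by one. The subtraction \<open>d - 1\<close> is never truncated, since divisors of
  \<open>Suc n\<close> are positive.\<close>

lemma divisor_sum_regroup:
 fixes F :: "nat => nat => 'a::banach"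
 assumes 1: "\<And>d. summable (%m. norm (F d m))" and 2: "summable (%d. \<Sum>m. norm (F d m))"
 shows "(%n. \<Sum>d | d dvd Suc n. F (d - 1) (Suc n div d - 1)) sums (\<Sum>d. \<Sum>m. F d m)"
proof -
 have i1: "(%m. norm (F d m)) summable_on UNIV" for d
  using norm_summable_imp_summable_on[of "%m. norm (F d m)"] 1[of d] by simp
 have i2: "infsum (%m. norm (F d m)) UNIV = (\<Sum>m. norm (F d m))" for d
  using norm_summable_imp_has_sum[of "%m. norm (F d m)"] 1[of d] by (intro infsumI) (simp add: summable_sums)
 have n2: "norm (\<Sum>m. norm (F d m)) = (\<Sum>m. norm (F d m))" for d using suminf_nonneg[OF 1[of d]] by simp
 have "(%d. norm (infsum (%m. norm (F d m)) UNIV)) summable_on UNIV"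
  unfolding i2 n2 using norm_summable_imp_summable_on[of "%d. (\<Sum>m. norm (F d m))"] 2 n2 by simp
 hence abs: "(%p. norm (case p of (d, m) => F d m)) summable_on (UNIV \<times> UNIV)"
  using i1 Infinite_Sum.abs_summable_on_Sigma_iff[of "%(d, m). F d m" UNIV "%_. UNIV"] by simp
 hence sm: "(%(d, m). F d m) summable_on (UNIV \<times> UNIV)" by (rule Infinite_Sum.abs_summable_summable)
 have s1: "F d sums (\<Sum>m. F d m)" for d
  using summable_norm_cancel[OF 1[of d]] by (rule summable_sums)
 have in1: "infsum (F d) UNIV = (\<Sum>m. F d m)" for d
  using norm_summable_imp_has_sum[OF 1[of d] s1[of d]] by (rule infsumI)
 have sn: "norm (\<Sum>m. F d m) \<le> (\<Sum>m. norm (F d m))" for d by (rule summable_norm[OF 1[of d]])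
 have s2: "summable (%d. norm (\<Sum>m. F d m))" by (rule summable_comparison_test[OF _ 2]) (use sn in simp)
 have s3: "(%d. \<Sum>m. F d m) sums (\<Sum>d. \<Sum>m. F d m)"
  using summable_norm_cancel[OF s2] by (rule summable_sums)
 have "infsum (%(d, m). F d m) (UNIV \<times> UNIV) = infsum (%d. infsum (F d) UNIV) UNIV"
  using infsum_Sigma'_banach[of F UNIV "%_. UNIV"] sm by simp
 also have "\<dots> = infsum (%d. \<Sum>m. F d m) UNIV" by (simp only: in1)
 also have "\<dots> = (\<Sum>d. \<Sum>m. F d m)"
  using norm_summable_imp_has_sum[OF s2 s3] by (rule infsumI)
 finally have hs: "((%(d, m). F d m) has_sum (\<Sum>d. \<Sum>m. F d m)) (UNIV \<times> UNIV)"
  using has_sum_infsum[OF sm] by (simp only:)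
 have "((%(n, d). F (d - 1) (Suc n div d - 1)) has_sum (\<Sum>d. \<Sum>m. F d m)) (Sigma UNIV (%n. {d. d dvd Suc n}))
   \<longleftrightarrow> ((%(d, m). F d m) has_sum (\<Sum>d. \<Sum>m. F d m)) (UNIV \<times> UNIV)"
 proof (rule has_sum_reindex_bij_witness[where j = "%(n, d). (d - 1, Suc n div d - 1)" and i = "%(d, m). (Suc d * Suc m - 1, Suc d)"])
  fix a assume a: "a \<in> Sigma UNIV (%n. {d. d dvd Suc n})"
  obtain n d where nd: "a = (n, d)" by (cases a)
  with a have dv: "d dvd Suc n" by simp
  then obtain q where q: "Suc n = d * q" by (elim dvdE)
  hence pos: "d > 0" "q > 0" by (auto intro: Nat.gr0I)
  have sd: "Suc (d - 1) = d" "Suc (Suc n div d - 1) = q" using pos q by (simp_all add: q)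
  show "(case case a of (n, d) => (d - 1, Suc n div d - 1) of (d, m) => (Suc d * Suc m - 1, Suc d)) = a"
   unfolding nd prod.case sd using q by (metis diff_Suc_1)
 next
  fix b :: "nat \<times> nat"
  obtain d m where b: "b = (d, m)" by (cases b)
  have s: "Suc (Suc d * Suc m - 1) = Suc d * Suc m" by simp
  show "(case case b of (d, m) => (Suc d * Suc m - 1, Suc d) of (n, d) => (d - 1, Suc n div d - 1)) = b"
   unfolding b prod.case s by (simp add: nonzero_mult_div_cancel_left del: mult_Suc mult_Suc_right)
  show "(case b of (d, m) => (Suc d * Suc m - 1, Suc d)) \<in> Sigma UNIV (%n. {d. d dvd Suc n})"
   unfolding b prod.case by (simp only: s mem_Sigma_iff mem_Collect_eq dvd_triv_left UNIV_I simp_thms)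
 qed auto
 hence hs2: "((%(n, d). F (d - 1) (Suc n div d - 1)) has_sum (\<Sum>d. \<Sum>m. F d m)) (Sigma UNIV (%n. {d. d dvd Suc n}))"
  using hs by simp
 have "((%n. \<Sum>d | d dvd Suc n. F (d - 1) (Suc n div d - 1)) has_sum (\<Sum>d. \<Sum>m. F d m)) UNIV"
  by (rule has_sum_SigmaD[OF hs2]) (auto intro!: has_sum_finite)
 thus ?thesis by (rule has_sum_imp_sums)
qed

text \<open>The factor 1 / (1 + y^2) stems from the partial fractions of the Planck factor, y^(-1/2)
  from y^(-3/2) times the y in their numerators. A rescaling of y makes the two summation indices
  enter through their product n alone.\<close>

definition kernel_int :: "real => real => nat => real" where
 "kernel_int u z n = (\<integral>y. y powr (- 1 / 2) / (1 + y\<^sup>2) * (lipterm u n (z * y) - lipterm u n 0) \<partial>posM)"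

definition series_term :: "real => real => nat => nat => real" where
 "series_term u z d m = real (Suc d) powr (u - 1) * (sqrt (1 / (2 * real (Suc m))) * exp (- 4 * pi * sqrt (real (Suc d) * real (Suc m) * z)))"

text \<open>The contribution of the 1/2 in the partial fractions. It stays unevaluated: its
  companion sqrt(z) disappears in the final combination of z = ix and z = -ix.\<close>

definition lip_const :: "real => real" where
 "lip_const u = (\<integral>y. y powr (- 3 / 2) * (expsum1 u y - zeta_real (1 - u)) \<partial>posM)"

definition zeta_sum :: "real => real" where "zeta_sum a = (\<Sum>m. real (m + 1) powr (- a))"

lemma borel_measurable_lipterm_posM:
 assumes "k > 0" "z > 0" shows "(%y. lipterm u k (z * y)) \<in> borel_measurable posM"
proof -
 have "continuous_on {0<..} (%y. complex_of_real (z * y) + \<i> * of_nat k)" by (intro continuous_intros)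
 moreover have "complex_of_real (z * y) + \<i> * of_nat k \<notin> \<real>\<^sub>\<le>\<^sub>0" for y
  using assms by (simp add: complex_nonpos_Reals_iff)
 ultimately have "continuous_on {0<..} (%y. (complex_of_real (z * y) + \<i> * of_nat k) powr (- of_real u))"
  by (intro continuous_on_powr_slit continuous_on_const)
 hence "(%y. (complex_of_real (z * y) + \<i> * of_nat k) powr (- of_real u)) \<in> borel_measurable posM"
  by (rule continuous_on_posM_measurable)
 thus ?thesis unfolding lipterm_def by measurable
qed

lemma integrable_beta_half: "integrable posM (%y. y powr (- 1 / 2) * (1 / (1 + y)))"
proof -
 have "integrable posM (%y. y powr (1 / 2 - 1) * (1 + y) powr (- (1 / 2) - 1 / 2))"
  by (rule Beta_integral_real(1)) auto
 moreover have e: "y powr (1 / 2 - 1) * (1 + y) powr (- (1 / 2) - 1 / 2) = y powr (- 1 / 2) * (1 / (1 + y))" if "y \<in> space posM" for y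
  using that by (simp add: space_posM powr_minus_divide)
 ultimately show ?thesis by (subst (asm) B_integrable_cong[OF refl e])
qed

lemma planck_reciprocal_integral:
 assumes s: "s > 0"
 shows "integrable posM (%y. y powr (- s - 2) * planck (1 / y))"
  and "(\<integral>y. y powr (- s - 2) * planck (1 / y) \<partial>posM) = Gamma (s + 1) * (2 * pi) powr (- s - 1) * zeta_sum (s + 1)"
proof -
 define f where "f = (%t. t powr s * planck t)"
 have cont: "continuous_on {0<..} f" unfolding f_def planck_def by (intro continuous_intros) auto
 define g where "g = (%m t. t powr (s + 1 - 1) * exp (- ((2 * pi * real (Suc m)) * t)))"
 have s1: "s + 1 > 0" using s by simp
 have c: "2 * pi * real (Suc d) > 0" for d by simp
 note G = Gamma_integral_posM[OF s1 c]
 have val: "integral\<^sup>L posM (g m) = Gamma (s + 1) * (2 * pi) powr (- s - 1) * real (m + 1) powr (- (s + 1))" for m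
 proof -
  have m: "- s - 1 = - (s + 1)" by simp
  show ?thesis unfolding g_def G(2) m by (simp add: powr_mult add.commute)
 qed
 have "summable (%m. real (m + 1) powr (- (s + 1)))" using s by (intro summable_powr_shift) simp
 hence sm: "(%m. integral\<^sup>L posM (g m)) sums (Gamma (s + 1) * (2 * pi) powr (- s - 1) * zeta_sum (s + 1))"
  unfolding val zeta_sum_def by (intro sums_mult summable_sums)
 have ptw: "(%m. g m t) sums f t" if "t \<in> space posM" for t
 proof -
  have "(%m. t powr s * exp (- (2 * pi * real (Suc m) * t))) sums f t"
   unfolding f_def using that by (intro sums_mult planck_sums) (simp add: space_posM)
  thus ?thesis by (simp add: g_def)
 qed
 have int: "integrable posM (g m)" for m unfolding g_def by (rule G(1))
 have nn: "g m t \<ge> 0" if "t \<in> space posM" for m t by (simp add: g_def)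
 have S: "integrable posM f" "integral\<^sup>L posM f = Gamma (s + 1) * (2 * pi) powr (- s - 1) * zeta_sum (s + 1)"
  using sums_integral_nonneg[OF int nn ptw sm] by blast+
 note I = integral_posM_inverse[OF cont S(1)]
 have e: "f (1 / y) / y\<^sup>2 = y powr (- s - 2) * planck (1 / y)" if "y \<in> space posM" for y
 proof -
  have y: "y > 0" using that by (simp add: space_posM)
  have "(1 / y) powr s = y powr (- s)" using y by (simp add: powr_divide powr_minus_divide)
  moreover have "y powr (- s - 2) = y powr (- s) / y\<^sup>2" using y by (simp add: powr_diff powr_numeral)
  ultimately show ?thesis by (simp add: f_def)
 qed
 show "integrable posM (%y. y powr (- s - 2) * planck (1 / y))"
  using I(1) by (subst (asm) B_integrable_cong[OF refl e])
 show "(\<integral>y. y powr (- s - 2) * planck (1 / y) \<partial>posM) = Gamma (s + 1) * (2 * pi) powr (- s - 1) * zeta_sum (s + 1)"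
  using I(2) S(2) by (subst (asm) B_integral_cong[OF refl e]) simp_all
qed

lemma planck1_inverse_sums:
 assumes y: "y > 0"
 shows "(%j. y / (1 + (real (Suc j) * y)\<^sup>2)) sums (pi * (planck1 (1 / y) + 1 / 2))"
proof -
 have "(%k. (1 / y) / ((1 / y)\<^sup>2 + (real (Suc k))\<^sup>2)) sums (pi * (planck1 (1 / y) + 1 / 2))"
  using y by (intro planck1_sums) auto
 moreover have "(1 / y) / ((1 / y)\<^sup>2 + (real (Suc k))\<^sup>2) = y / (1 + (real (Suc k) * y)\<^sup>2)" for k
 proof -
  have "1 + (real (Suc k) * y)\<^sup>2 = y\<^sup>2 * ((1 / y)\<^sup>2 + (real (Suc k))\<^sup>2)"
   using y by (simp add: distrib_left power_divide power_mult_distrib mult.commute del: of_nat_Suc)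
  thus ?thesis using y by (simp add: power2_eq_square del: of_nat_Suc)
 qed
 ultimately show ?thesis by simp
qed


text \<open>The Lipschitz series gives O(y), and for y >= 1 all parts are bounded. Together this
  makes the difference integrable against y^(-3/2) at both ends.\<close>

lemma expsum1_minus_zeta_bound:
 assumes u: "0 < u" "u < 1"
 shows "\<exists>C\<ge>0. (\<forall>y>0. \<bar>expsum1 u y - zeta_real (1 - u)\<bar> \<le> C * y) \<and> (\<forall>y\<ge>1. \<bar>expsum1 u y - zeta_real (1 - u)\<bar> \<le> C)"
proof -
 have lc: "lipc u > 0" using u by (simp add: lipc_def Gamma_real_pos)
 define Z where "Z = (\<Sum>k. real (k + 1) powr (- (u + 1)))"
 have sm: "summable (%k. real (k + 1) powr (- (u + 1)))" using u by (intro summable_powr_shift) simp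
 have Z0: "Z \<ge> 0" unfolding Z_def by (rule suminf_nonneg[OF sm]) simp
 define C1 where "C1 = lipc u * (2 * u * Z)"
 define C2 where "C2 = 1 + lipc u + \<bar>zeta_real (1 - u)\<bar>"
 have c: "C1 \<ge> 0" "C2 \<ge> 0" using lc u Z0 by (auto simp: C1_def C2_def)
 have 1: "\<bar>expsum1 u y - zeta_real (1 - u)\<bar> \<le> C1 * y" if y: "y > 0" for y
 proof -
  note L = Lipschitz_formula[OF u y]
  have le: "norm (lipc u * (lipterm u (Suc k) y - lipterm u (Suc k) 0)) \<le> (lipc u * (2 * u * y)) * real (k + 1) powr (- (u + 1))" for k
  proof -
   have "\<bar>lipterm u (Suc k) y - lipterm u (Suc k) 0\<bar> \<le> 2 * u * y * real (Suc k) powr (- u - 1)"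
    using lipterm_bound[of u y "Suc k"] u y by simp
   hence "lipc u * \<bar>lipterm u (Suc k) y - lipterm u (Suc k) 0\<bar> \<le> lipc u * (2 * u * y * real (Suc k) powr (- u - 1))"
    using lc by (intro mult_left_mono) simp_all
   moreover have "- u - 1 = - (u + 1)" "Suc k = k + 1" by simp_all
   ultimately show ?thesis using lc by (simp only: real_norm_def abs_mult abs_of_pos mult.assoc)
  qed
  have s2: "summable (%k. (lipc u * (2 * u * y)) * real (k + 1) powr (- (u + 1)))" by (rule summable_mult[OF sm])
  have s1: "summable (%k. norm (lipc u * (lipterm u (Suc k) y - lipterm u (Suc k) 0)))"
   by (rule summable_comparison_test[OF _ s2]) (use le in simp)
  have "\<bar>expsum1 u y - zeta_real (1 - u)\<bar> = norm (\<Sum>k. lipc u * (lipterm u (Suc k) y - lipterm u (Suc k) 0))"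
   using L by (simp add: sums_iff)
  also have "\<dots> \<le> (\<Sum>k. norm (lipc u * (lipterm u (Suc k) y - lipterm u (Suc k) 0)))" by (rule summable_norm[OF s1])
  also have "\<dots> \<le> (\<Sum>k. (lipc u * (2 * u * y)) * real (k + 1) powr (- (u + 1)))" by (rule suminf_le[OF le s1 s2])
  also have "\<dots> = (lipc u * (2 * u * y)) * Z" unfolding Z_def by (rule suminf_mult[OF sm])
  finally show ?thesis by (simp add: C1_def mult_ac)
 qed
 have 2: "\<bar>expsum1 u y - zeta_real (1 - u)\<bar> \<le> C2" if y: "y \<ge> 1" for y
 proof -
  have y0: "y > 0" using y by simp
  have "planck1 y \<le> 0" by (rule planck_bounds(2)[OF y0])
  hence "planck y \<le> 1 / (2 * pi * y)" by (simp add: planck1_def)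
  also have "\<dots> \<le> 1"
  proof -
   have "1 * 1 \<le> (2 * pi) * y" using y pi_ge_two by (intro mult_mono) auto
   thus ?thesis using y by simp
  qed
  finally have "planck y \<le> 1" .
  hence e: "0 \<le> expsum u y" "expsum u y \<le> 1" using expsum_sums(2,3)[of u y] u y0 by auto
  have "y powr (- u) \<le> 1 powr (- u)" using y u by (intro powr_mono2') auto
  hence "lipc u * y powr (- u) \<le> lipc u * 1" using lc by (intro mult_left_mono) auto
  moreover have "0 \<le> lipc u * y powr (- u)" using lc by simp
  ultimately show ?thesis using e unfolding expsum1_def C2_def by linarith
 qed
 show ?thesis
 proof (intro exI[of _ "C1 + C2"] conjI allI impI)
  show "C1 + C2 \<ge> 0" using c by simp
  show "\<bar>expsum1 u y - zeta_real (1 - u)\<bar> \<le> (C1 + C2) * y" if "y > 0" for y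
  proof -
   have "C1 * y \<le> (C1 + C2) * y" using c that by (intro mult_right_mono) auto
   thus ?thesis using 1[OF that] by linarith
  qed
  show "\<bar>expsum1 u y - zeta_real (1 - u)\<bar> \<le> C1 + C2" if "y \<ge> 1" for y
   using 2[OF that] c by linarith
 qed
qed

lemma measurable_expsum1:
 assumes u: "1 / 2 < u" "u < 1" shows "expsum1 u \<in> borel_measurable posM"
proof -
 have m: "(%y. y powr (- 1 / 2) * expsum1 u y) \<in> borel_measurable posM"
  by (rule borel_measurable_integrable[OF Mellin_expsum1(1)[OF u]])
 have "(%y::real. y powr (1 / 2)) \<in> borel_measurable posM" by (rule borel_measurable_posM) measurable
 from borel_measurable_times[OF this m]
 have "(%y. y powr (1 / 2) * (y powr (- 1 / 2) * expsum1 u y)) \<in> borel_measurable posM" .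
 moreover have "y powr (1 / 2) * (y powr (- 1 / 2) * expsum1 u y) = expsum1 u y" if "y \<in> space posM" for y
 proof -
  have "y powr (1 / 2) * y powr (- 1 / 2) = y powr 0" by (simp only: powr_add[symmetric]) simp
  thus ?thesis using that by (simp add: space_posM flip: mult.assoc)
 qed
 ultimately show ?thesis by (subst (asm) measurable_cong)
qed

lemma measurable_expsum1_scaled:
 assumes u: "1 / 2 < u" "u < 1" and z: "z > 0" shows "(%y. expsum1 u (z * y)) \<in> borel_measurable posM"
proof (rule measurable_compose[OF _ measurable_expsum1[OF u]])
 show "(*) z \<in> posM \<rightarrow>\<^sub>M posM"
  by (rule measurable_restrict_space2) (use z in \<open>auto simp: space_posM intro!: measurable_restrict_space1\<close>)
qed

text \<open>Homogeneity of degree -u. It lets the index j of the partial fractions be absorbed into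
  the Lipschitz index k.\<close>

lemma lipterm_scale:
 assumes "j > 0"
 shows "lipterm u k y = real j powr u * lipterm u (j * k) (real j * y)"
proof -
 have "(of_real (real j) * (of_real y + \<i> * of_nat k)) powr (- of_real u) = of_real (real j) powr (- of_real u) * (of_real y + \<i> * of_nat k) powr (- complex_of_real u)"
  by (rule powr_times_real_left) auto
 moreover have "of_real (real j) * (of_real y + \<i> * of_nat k) = complex_of_real (real j * y) + \<i> * of_nat (j * k)"
  by (simp add: algebra_simps)
 moreover have "of_real (real j) powr (- complex_of_real u) = of_real (real j powr (- u))"
  using powr_of_real[of "real j" "- u"] by simp
 ultimately have e: "(complex_of_real (real j * y) + \<i> * of_nat (j * k)) powr (- of_real u) = of_real (real j powr (- u)) * (of_real y + \<i> * of_nat k) powr (- complex_of_real u)"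
  by (simp only:)
 have "real j powr u * real j powr (- u) = 1" using assms by (simp only: powr_add[symmetric]) simp
 thus ?thesis unfolding lipterm_def e Re_of_real_mult by (simp add: mult.left_commute flip: mult.assoc)
qed

definition half_bump :: "real => real" where "half_bump y = y powr (- 1 / 2) * (y / (1 + y\<^sup>2))"

lemma integrable_half_bump: "integrable posM half_bump"
proof (rule B_integrable_bound[OF integrable_mult_right[OF integrable_beta_half, of 2]])
 show "half_bump \<in> borel_measurable posM" unfolding half_bump_def by (intro borel_measurable_posM) measurable
 show "AE y in posM. norm (half_bump y) \<le> norm (2 * (y powr (- 1 / 2) * (1 / (1 + y))))"
 proof (rule AE_I2)
  fix y assume "y \<in> space posM"
  hence y: "y > 0" by (simp add: space_posM)
  have "y * (1 + y) \<le> 2 * (1 + y\<^sup>2)"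
  proof -
   have "0 \<le> (1 - y)\<^sup>2 + 3 + (y\<^sup>2)" by simp
   hence "2 * y \<le> 4 + 2 * y\<^sup>2" by (simp add: power2_diff)
   thus ?thesis by (simp add: power2_eq_square algebra_simps)
  qed
  hence "y / (1 + y\<^sup>2) \<le> 2 * (1 / (1 + y))"
   using y by (simp add: divide_simps add_pos_nonneg mult.commute)
  hence "y powr (- 1 / 2) * (y / (1 + y\<^sup>2)) \<le> y powr (- 1 / 2) * (2 * (1 / (1 + y)))" by (intro mult_left_mono) auto
  thus "norm (half_bump y) \<le> norm (2 * (y powr (- 1 / 2) * (1 / (1 + y))))"
   unfolding half_bump_def using y by (simp add: abs_mult mult.commute)
 qed
qed

text \<open>Rescaling by j produces j^(-3/2), so these majorants can be summed over j.\<close>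

lemma half_bump_scaled:
 assumes "j > 0"
 shows "integrable posM (%y. y powr (- 1 / 2) * (y / (1 + (j * y)\<^sup>2)))"
  and "(\<integral>y. y powr (- 1 / 2) * (y / (1 + (j * y)\<^sup>2)) \<partial>posM) = j powr (- 3 / 2) * integral\<^sup>L posM half_bump"
proof -
 have e: "y powr (- 1 / 2) * (y / (1 + (j * y)\<^sup>2)) = j powr (- 1 / 2) * half_bump (j * y)" if "y \<in> space posM" for y
 proof -
  have y: "y > 0" using that by (simp add: space_posM)
  have jj: "j powr (- 1 / 2) * j powr (- 1 / 2) * j = 1"
   using assms by (simp only: powr_add[symmetric]) (simp add: powr_minus)
  have "j powr (- 1 / 2) * half_bump (j * y) = (j powr (- 1 / 2) * j powr (- 1 / 2) * j) * (y powr (- 1 / 2) * (y / (1 + (j * y)\<^sup>2)))"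
   unfolding half_bump_def using assms y by (simp add: powr_mult)
  thus ?thesis unfolding jj by simp
 qed
 note sc = integrable_integral_posM_scale[OF assms, of half_bump]
 have i: "integrable posM (%y. j powr (- 1 / 2) * half_bump (j * y))"
  using sc(1) integrable_half_bump by (intro integrable_mult_right) simp
 show "integrable posM (%y. y powr (- 1 / 2) * (y / (1 + (j * y)\<^sup>2)))"
  by (subst B_integrable_cong[OF refl e]) (use i in simp_all)
 have "(\<integral>y. y powr (- 1 / 2) * (y / (1 + (j * y)\<^sup>2)) \<partial>posM) = (\<integral>y. j powr (- 1 / 2) * half_bump (j * y) \<partial>posM)"
  by (rule B_integral_cong[OF refl e])
 also have "\<dots> = (j powr (- 1 / 2) / j) * integral\<^sup>L posM half_bump"
  unfolding integral_mult_right_zero sc(2) real_scaleR_def by (simp only: divide_inverse mult_ac)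
 also have "j powr (- 1 / 2) / j = j powr (- 3 / 2)"
 proof -
  have "- 3 / 2 = - 1 / 2 - (1::real)" by simp
  thus ?thesis using assms powr_diff[of j "- 1 / 2" 1] by (simp only: powr_one)
 qed
 finally show "(\<integral>y. y powr (- 1 / 2) * (y / (1 + (j * y)\<^sup>2)) \<partial>posM) = j powr (- 3 / 2) * integral\<^sup>L posM half_bump" .
qed

text \<open>Both factors are expanded into exponentials, and \<open>exp_reciprocal_integral\<close>
  yields exp(-4 pi sqrt(d m z)). All terms are nonnegative, so integrability of the whole integrand
  justifies both expansions and the absolute convergence needed for regrouping.\<close>

lemma G_real_left:
 assumes u: "u \<le> 1" and z: "z > 0"
  and F: "integrable posM (%y. y powr (- 3 / 2) * planck (1 / y) * expsum u (z * y))"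
 shows "(%n. \<Sum>d | d dvd Suc n. series_term u z (d - 1) (Suc n div d - 1)) sums
     (\<integral>y. y powr (- 3 / 2) * planck (1 / y) * expsum u (z * y) \<partial>posM)"
proof -
 define f where "f = (%d m y. real (Suc d) powr (u - 1) * (y powr (- 3 / 2) * exp (- ((2 * pi * real (Suc m)) / y)) * exp (- ((2 * pi * real (Suc d) * z) * y))))"
 define Fd where "Fd = (%d y. y powr (- 3 / 2) * planck (1 / y) * (real (Suc d) powr (u - 1) * exp (- (2 * pi * (real (Suc d) * (z * y))))))"
 have mf: "f d m \<in> borel_measurable posM" for d m unfolding f_def by (intro borel_measurable_posM) measurable
 have mFd: "Fd d \<in> borel_measurable posM" for d unfolding Fd_def planck_def by (intro borel_measurable_posM) measurable
 have nFd: "Fd d y \<ge> 0" if "y \<in> space posM" for d y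
  using that planck_bounds(1)[of "1 / y"] by (simp add: Fd_def space_posM)
 have sFd: "(%d. Fd d y) sums (y powr (- 3 / 2) * planck (1 / y) * expsum u (z * y))" if "y \<in> space posM" for y
  unfolding Fd_def using that z u by (intro sums_mult expsum_sums(1)) (auto simp: space_posM)
 note A = sums_integral_nonneg'[OF mFd nFd sFd F]
 have sf: "(%m. f d m y) sums Fd d y" if "y \<in> space posM" for d y
 proof -
  have "(%m. (real (Suc d) powr (u - 1) * y powr (- 3 / 2) * exp (- ((2 * pi * real (Suc d) * z) * y))) * exp (- (2 * pi * real (Suc m) * (1 / y)))) sums
     ((real (Suc d) powr (u - 1) * y powr (- 3 / 2) * exp (- ((2 * pi * real (Suc d) * z) * y))) * planck (1 / y))"
   using that by (intro sums_mult planck_sums) (simp add: space_posM)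
  thus ?thesis unfolding f_def Fd_def by (simp add: mult_ac)
 qed
 have nf: "f d m y \<ge> 0" if "y \<in> space posM" for d m y by (simp add: f_def)
 have intFd: "integrable posM (Fd d)" for d using A(1) .
 note B = sums_integral_nonneg'[OF mf nf sf intFd]
 have val: "integral\<^sup>L posM (f d m) = series_term u z d m" for d m
 proof -
  have p: "2 * pi * real (Suc m) > 0" "2 * pi * real (Suc d) * z > 0" using z by simp_all
  have s1: "sqrt (2 * pi * real (Suc m) * (2 * pi * real (Suc d) * z)) = 2 * pi * sqrt (real (Suc d) * real (Suc m) * z)"
  proof -
   have "2 * pi * real (Suc m) * (2 * pi * real (Suc d) * z) = (2 * pi)\<^sup>2 * (real (Suc d) * real (Suc m) * z)"
    by (simp only: power2_eq_square mult_ac)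
   hence "sqrt (2 * pi * real (Suc m) * (2 * pi * real (Suc d) * z)) = sqrt ((2 * pi)\<^sup>2) * sqrt (real (Suc d) * real (Suc m) * z)"
    by (simp only: real_sqrt_mult)
   moreover have "sqrt ((2 * pi)\<^sup>2) = 2 * pi" by (rule real_sqrt_unique) simp_all
   ultimately show ?thesis by (simp only:)
  qed
  have s2: "pi / (2 * pi * real (Suc m)) = 1 / (2 * real (Suc m))" by simp
  have s3: "- 2 * (2 * pi * r) = - 4 * pi * r" for r :: real by simp
  show ?thesis
   unfolding f_def integral_mult_right_zero exp_reciprocal_integral(2)[OF p] series_term_def s1 s2 s3 ..
 qed
 have Bs: "series_term u z d sums integral\<^sup>L posM (Fd d)" for d
  using B(2)[of d] unfolding val by simp
 have nn: "series_term u z d m \<ge> 0" for d m by (simp add: series_term_def)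
 have S: "(\<Sum>m. series_term u z d m) = integral\<^sup>L posM (Fd d)" for d using Bs[of d] by (simp add: sums_iff)
 have "(%n. \<Sum>d | d dvd Suc n. series_term u z (d - 1) (Suc n div d - 1)) sums (\<Sum>d. \<Sum>m. series_term u z d m)"
 proof (rule divisor_sum_regroup)
  show "summable (%m. norm (series_term u z d m))" for d using Bs[of d] nn by (simp add: sums_iff)
  show "summable (%d. \<Sum>m. norm (series_term u z d m))" using nn A(2) by (simp add: S sums_iff)
 qed
 also have "(\<Sum>d. \<Sum>m. series_term u z d m) = (\<integral>y. y powr (- 3 / 2) * planck (1 / y) * expsum u (z * y) \<partial>posM)"
  unfolding S using A(2) by (simp add: sums_iff)
 finally show ?thesis .
qed

text \<open>The first factor is expanded by partial fractions over j, the second by Lipschitz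
  summation over k. Replacing y by y/j moves j into the kernel index j k and leaves the weight j^(u
  - 1/2) = j^s, so that regrouping by n will produce sigma_s(n).\<close>

lemma G_real_right:
 assumes u: "1 / 2 < u" "u < 1" and z: "z > 0"
 defines "P \<equiv> (%y. y powr (- 3 / 2) * (planck1 (1 / y) + 1 / 2) * (expsum1 u (z * y) - zeta_real (1 - u)))"
 shows "integrable posM P"
  and "(%n. \<Sum>d | d dvd Suc n. lipc u / pi * (real (Suc (d - 1)) powr (u - 1 / 2) * kernel_int u z (Suc (d - 1) * Suc (Suc n div d - 1)))) sums integral\<^sup>L posM P"
proof -
 have u0: "0 < u" using u by simp
 obtain C where C: "C \<ge> 0" "\<And>y. y > 0 ==> \<bar>expsum1 u y - zeta_real (1 - u)\<bar> \<le> C * y"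
  using expsum1_minus_zeta_bound[OF u0 u(2)] by blast
 have lc: "lipc u > 0" using u by (simp add: lipc_def Gamma_real_pos)
 define D where "D = (%y. expsum1 u (z * y) - zeta_real (1 - u))"
 have mD: "D \<in> borel_measurable posM" unfolding D_def using measurable_expsum1_scaled[OF u z] by simp
 define w where "w = (%j y::real. y powr (- 1 / 2) / (1 + (real (Suc j) * y)\<^sup>2))"
 have mw: "w j \<in> borel_measurable posM" for j unfolding w_def by (intro borel_measurable_posM) measurable
 have w0: "w j y \<ge> 0" for j y by (simp add: w_def add_nonneg_nonneg)
 define b where "b = (%j y. y powr (- 1 / 2) * (y / (1 + (real (Suc j) * y)\<^sup>2)))"
 have bw: "b j y = w j y * y" for j y by (simp add: b_def w_def)
 define M where "M = integral\<^sup>L posM half_bump"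
 have bint: "integrable posM (b j)" "integral\<^sup>L posM (b j) = real (Suc j) powr (- 3 / 2) * M" for j
  unfolding b_def M_def by (rule half_bump_scaled; simp)+
 define T where "T = (%j y. 1 / pi * (w j y * D y))"
 define t where "t = (%j k y. lipc u / pi * (w j y * (lipterm u (Suc k) (z * y) - lipterm u (Suc k) 0)))"
 have Tb: "norm (T j y) \<le> C * z / pi * b j y" if "y \<in> space posM" for j y
 proof -
  have y: "y > 0" using that by (simp add: space_posM)
  have "\<bar>D y\<bar> \<le> C * (z * y)" using C(2)[of "z * y"] z y by (simp add: D_def)
  hence "1 / pi * (w j y * \<bar>D y\<bar>) \<le> 1 / pi * (w j y * (C * (z * y)))" using w0 by (intro mult_left_mono) auto
  thus ?thesis unfolding T_def bw using w0 by (simp add: abs_mult mult_ac)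
 qed
 have bsum: "summable (%j. K * b j y)" if "y \<in> space posM" for y K
 proof -
  have "(%j. y / (1 + (real (Suc j) * y)\<^sup>2)) sums (pi * (planck1 (1 / y) + 1 / 2))"
   using that by (intro planck1_inverse_sums) (simp add: space_posM)
  thus ?thesis unfolding b_def by (intro summable_mult) (simp only: sums_iff)
 qed
 have s32: "summable (%j. K * real (Suc j) powr (- 3 / 2))" for K
  using summable_powr_shift[of "3/2"] by (intro summable_mult) simp
 have bisum: "summable (%j. \<integral>y. K * b j y \<partial>posM)" for K
  unfolding integral_mult_right_zero bint(2) using s32[of "K * M"] by (simp add: mult_ac)
 have TP: "(%j. T j y) sums P y" if "y \<in> space posM" for y
 proof -
  have y: "y > 0" using that by (simp add: space_posM)
  have "(%j. (y powr (- 3 / 2) * D y / pi) * (y / (1 + (real (Suc j) * y)\<^sup>2))) sums ((y powr (- 3 / 2) * D y / pi) * (pi * (planck1 (1 / y) + 1 / 2)))"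
   using y by (intro sums_mult planck1_inverse_sums)
  moreover have "(y powr (- 3 / 2) * D y / pi) * (y / (1 + (real (Suc j) * y)\<^sup>2)) = T j y" for j
  proof -
   have "y powr (- 3 / 2) * y = y powr (- 1 / 2)" using y powr_add[of y "- 3 / 2" 1] by simp
   hence "w j y = (y powr (- 3 / 2) * y) / (1 + (real (Suc j) * y)\<^sup>2)" by (simp only: w_def)
   thus ?thesis by (simp add: T_def mult_ac)
  qed
  moreover have "(y powr (- 3 / 2) * D y / pi) * (pi * (planck1 (1 / y) + 1 / 2)) = P y" by (simp add: P_def D_def)
  ultimately show ?thesis by simp
 qed
 have mT: "T j \<in> borel_measurable posM" for j unfolding T_def using mw mD by measurable
 note dT = sums_integral_dominated[OF mT Tb integrable_mult_right[OF bint(1)] bsum bisum TP]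
 show "integrable posM P" by (rule dT(2))
 define N where "N = lipc u / pi * (2 * u * z)"
 have N0: "N > 0" using lc u z by (simp add: N_def)
 \<comment> \<open>The bound \<open>e k * b j y\<close> separates the indices: \<open>e k\<close> is
   of order k^(-u-1), and the integral of \<open>b j\<close> of order j^(-3/2). This gives absolute
   convergence of the double series.\<close>
 define e where "e = (%k. N * real (Suc k) powr (- u - 1))"
 have e0: "e k \<ge> 0" for k using N0 by (simp add: e_def)
 have esum: "summable e"
 proof -
  have "- u - 1 = - (u + 1)" by simp
  thus ?thesis unfolding e_def using summable_powr_shift[of "u + 1"] u by (intro summable_mult) (simp only: Suc_eq_plus1)
 qed
 have tb: "norm (t j k y) \<le> e k * b j y" if "y \<in> space posM" for j k y
 proof -
  have y: "y > 0" using that by (simp add: space_posM)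
  have "\<bar>lipterm u (Suc k) (z * y) - lipterm u (Suc k) 0\<bar> \<le> 2 * u * (z * y) * real (Suc k) powr (- u - 1)"
   using lipterm_bound[of u "z * y" "Suc k"] u z y by simp
  hence "lipc u / pi * (w j y * \<bar>lipterm u (Suc k) (z * y) - lipterm u (Suc k) 0\<bar>) \<le> lipc u / pi * (w j y * (2 * u * (z * y) * real (Suc k) powr (- u - 1)))"
   using w0 lc by (intro mult_left_mono) auto
  thus ?thesis unfolding t_def bw e_def N_def using w0[of j y] lc by (simp add: abs_mult mult_ac del: of_nat_Suc)
 qed
 have mt: "t j k \<in> borel_measurable posM" for j k
  unfolding t_def using mw borel_measurable_lipterm_posM[of "Suc k" z u] z by simp
 have tT: "(%k. t j k y) sums T j y" if "y \<in> space posM" for j y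
 proof -
  have "z * y > 0" using that z by (simp add: space_posM)
  from sums_mult[OF Lipschitz_formula[OF u0 u(2) this], of "1 / pi * w j y"]
  show ?thesis unfolding t_def T_def D_def by (simp add: mult_ac)
 qed
 have tes: "summable (%k. e k * b j y)" for j y using esum by (rule summable_mult2)
 have teis: "summable (%k. \<integral>y. e k * b j y \<partial>posM)" for j
  unfolding integral_mult_right_zero using esum by (rule summable_mult2)
 note dt = sums_integral_dominated[OF mt tb integrable_mult_right[OF bint(1)] tes teis tT]
 define a where "a = (%j k. lipc u / pi * (real (Suc j) powr (u - 1 / 2) * kernel_int u z (Suc j * Suc k)))"
 have val: "integral\<^sup>L posM (t j k) = a j k" for j k
 proof -
  define J where "J = real (Suc j)"
  have J: "J > 0" by (simp add: J_def)
  define \<phi> where "\<phi> = (%y. y powr (- 1 / 2) / (1 + y\<^sup>2) * (lipterm u (Suc j * Suc k) (z * y) - lipterm u (Suc j * Suc k) 0))"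
  \<comment> \<open>The exponent 1/2 comes from \<open>y powr (- 1 / 2)\<close> and u from
    \<open>lipterm_scale\<close>; the substitution in the integral will remove one power of
    J.\<close>
  have eq: "w j y * (lipterm u (Suc k) (z * y) - lipterm u (Suc k) 0) = J powr (1 / 2 + u) * \<phi> (J * y)" if "y \<in> space posM" for y
  proof -
   have y: "y > 0" using that by (simp add: space_posM)
   have l1: "lipterm u (Suc k) (z * y) = J powr u * lipterm u (Suc j * Suc k) (z * (J * y))"
    using lipterm_scale[of "Suc j" u "Suc k" "z * y"] by (simp only: J_def zero_less_Suc mult.left_commute)
   have l2: "lipterm u (Suc k) 0 = J powr u * lipterm u (Suc j * Suc k) 0"
    using lipterm_scale[of "Suc j" u "Suc k" 0] by (simp only: J_def zero_less_Suc mult_zero_right)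
   have "J powr (1 / 2) * (J * y) powr (- 1 / 2) = (J powr (1 / 2) * J powr (- 1 / 2)) * y powr (- 1 / 2)"
    using J y by (simp add: powr_mult)
   also have "J powr (1 / 2) * J powr (- 1 / 2) = 1" using J by (simp only: powr_add[symmetric]) simp
   finally have j2: "y powr (- 1 / 2) = J powr (1 / 2) * (J * y) powr (- 1 / 2)" by simp
   have "w j y = J powr (1 / 2) * ((J * y) powr (- 1 / 2) / (1 + (J * y)\<^sup>2))"
    unfolding w_def J_def[symmetric] by (subst j2) simp
   thus ?thesis unfolding l1 l2 \<phi>_def powr_add right_diff_distrib[symmetric] by (simp add: mult_ac)
  qed
  have "(\<integral>y. w j y * (lipterm u (Suc k) (z * y) - lipterm u (Suc k) 0) \<partial>posM) = (\<integral>y. J powr (1 / 2 + u) * \<phi> (J * y) \<partial>posM)"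
   by (rule B_integral_cong[OF refl eq])
  also have "\<dots> = (J powr (1 / 2 + u) / J) * integral\<^sup>L posM \<phi>"
   unfolding integral_mult_right_zero integrable_integral_posM_scale(2)[OF J] real_scaleR_def by (simp only: divide_inverse mult_ac)
  also have "J powr (1 / 2 + u) / J = J powr (u - 1 / 2)"
  proof -
   have "u - 1 / 2 = (1 / 2 + u) - 1" by simp
   thus ?thesis using J powr_diff[of J "1 / 2 + u" 1] by (simp only: powr_one)
  qed
  finally show ?thesis unfolding t_def integral_mult_right_zero a_def kernel_int_def \<phi>_def J_def by simp
 qed
 have asum: "a j sums integral\<^sup>L posM (T j)" for j
  using dt(3)[of j] unfolding val by simp
 have ab: "norm (a j k) \<le> e k * (real (Suc j) powr (- 3 / 2) * M)" for j k
 proof -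
  have "norm (a j k) \<le> (\<integral>y. norm (t j k y) \<partial>posM)" unfolding val[symmetric] by (rule integral_norm_bound)
  also have "\<dots> \<le> (\<integral>y. e k * b j y \<partial>posM)"
   using tb by (intro integral_mono integrable_norm dt(1) integrable_mult_right bint(1))
  also have "\<dots> = e k * (real (Suc j) powr (- 3 / 2) * M)" unfolding integral_mult_right_zero bint(2) ..
  finally show ?thesis .
 qed
 have sa: "summable (%k. norm (a j k))" for j
  by (rule summable_comparison_test[OF _ summable_mult2[OF esum, of "real (Suc j) powr (- 3 / 2) * M"]]) (use ab in simp)
 have "(%n. \<Sum>d | d dvd Suc n. a (d - 1) (Suc n div d - 1)) sums (\<Sum>j. \<Sum>k. a j k)"
 proof (rule divisor_sum_regroup)
  show "summable (%k. norm (a j k))" for j by (rule sa)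
  have "(\<Sum>k. norm (a j k)) \<le> (\<Sum>k. e k * (real (Suc j) powr (- 3 / 2) * M))" for j
   by (rule suminf_le[OF ab sa summable_mult2[OF esum]])
  moreover have "(\<Sum>k. e k * (real (Suc j) powr (- 3 / 2) * M)) = (suminf e * M) * real (Suc j) powr (- 3 / 2)" for j
   using suminf_mult2[OF esum, of "real (Suc j) powr (- 3 / 2) * M"] by (simp add: mult_ac)
  moreover have "0 \<le> (\<Sum>k. norm (a j k))" for j by (rule suminf_nonneg[OF sa]) simp
  ultimately show "summable (%j. \<Sum>k. norm (a j k))"
   by (intro summable_comparison_test[OF _ s32[of "suminf e * M"]]) simp
 qed
 also have "(\<Sum>j. \<Sum>k. a j k) = integral\<^sup>L posM P"
 proof -
  have "(\<Sum>k. a j k) = integral\<^sup>L posM (T j)" for j using asum[of j] by (simp add: sums_iff)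
  thus ?thesis using dT(3) by (simp add: sums_iff)
 qed
 finally show "(%n. \<Sum>d | d dvd Suc n. lipc u / pi * (real (Suc (d - 1)) powr (u - 1 / 2) * kernel_int u z (Suc (d - 1) * Suc (Suc n div d - 1)))) sums integral\<^sup>L posM P"
  unfolding a_def .
qed


text \<open>The pole of the Planck factor and the singular part and constant term of
  \<open>expsum\<close> are split off. \<open>P1\<close>, from the singular part, gives zeta(s+1);
  \<open>P2\<close>, from the pole, zeta(1-s); \<open>P3\<close>, from the constant, zeta(1/2)
  zeta(1/2-s). What remains is \<open>P\<close> minus \<open>P4\<close>, because partial fractions
  expand \<open>planck1\<close> plus 1/2 and not \<open>planck1\<close> itself.\<close>

lemma G_real:
 assumes u: "1 / 2 < u" "u < 1" and z: "z > 0"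
 shows "\<exists>Y. (%n. \<Sum>d | d dvd Suc n. lipc u / pi * (real (Suc (d - 1)) powr (u - 1 / 2) * kernel_int u z (Suc (d - 1) * Suc (Suc n div d - 1)))) sums Y \<and>
  (%n. \<Sum>d | d dvd Suc n. series_term u z (d - 1) (Suc n div d - 1)) sums
   (lipc u * z powr (- u) * (Gamma (u + 1 / 2) * (2 * pi) powr (- u - 1 / 2) * zeta_sum (u + 1 / 2))
    + 1 / (2 * pi) * (z powr (- 1 / 2) * (sqrt pi * (2 * pi) powr (- 1 / 2) * zeta_real (3 / 2 - u)))
    + zeta_real (1 - u) * (zeta_real (1 / 2) / sqrt 2)
    + Y - 1 / 2 * (sqrt z * lip_const u))"
proof -
 have u0: "0 < u" "u \<le> 1" using u by simp_all
 define D where "D = (%y. expsum1 u y - zeta_real (1 - u))"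
 define F where "F = (%y. y powr (- 3 / 2) * planck (1 / y) * expsum u (z * y))"
 define P where "P = (%y. y powr (- 3 / 2) * (planck1 (1 / y) + 1 / 2) * D (z * y))"
 define P1 where "P1 = (%y. lipc u * z powr (- u) * (y powr (- (u - 1 / 2) - 2) * planck (1 / y)))"
 define P2 where "P2 = (%y. 1 / (2 * pi) * (y powr (- 1 / 2) * expsum1 u (z * y)))"
 define P3 where "P3 = (%y. zeta_real (1 - u) * (y powr (1 / 2 - 2) * planck1 (1 / y)))"
 define P4 where "P4 = (%y. 1 / 2 * (y powr (- 3 / 2) * D (z * y)))"
 have R: "integrable posM P" "(%n. \<Sum>d | d dvd Suc n. lipc u / pi * (real (Suc (d - 1)) powr (u - 1 / 2) * kernel_int u z (Suc (d - 1) * Suc (Suc n div d - 1)))) sums integral\<^sup>L posM P"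
  using G_real_right[OF u z] unfolding P_def D_def by (simp_all only:)
 have s: "u - 1 / 2 > 0" using u by simp
 have s1: "u - 1 / 2 + 1 = u + 1 / 2" "- (u - 1 / 2) - 1 = - u - 1 / 2" by simp_all
 have I1: "integrable posM P1" "integral\<^sup>L posM P1 = lipc u * z powr (- u) * (Gamma (u + 1 / 2) * (2 * pi) powr (- u - 1 / 2) * zeta_sum (u + 1 / 2))"
  unfolding P1_def using planck_reciprocal_integral[OF s]
  by (simp_all only: integral_mult_right_zero s1 integrable_mult_right)
 have h: "0 < (1 / 2 :: real)" "1 / 2 < (1 :: real)" by simp_all
 have sq: "2 * sin (pi * (1 / 2) / 2) = sqrt 2" by (simp add: sin_45)
 have I3: "integrable posM P3" "integral\<^sup>L posM P3 = zeta_real (1 - u) * (zeta_real (1 / 2) / sqrt 2)"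
  unfolding P3_def using Mellin_planck1_inverse[OF h]
  by (simp_all only: integral_mult_right_zero sq integrable_mult_right)
 have I2: "integrable posM P2" "integral\<^sup>L posM P2 = 1 / (2 * pi) * (z powr (- 1 / 2) * (sqrt pi * (2 * pi) powr (- 1 / 2) * zeta_real (3 / 2 - u)))"
 proof -
  define f where "f = (%y. y powr (- 1 / 2) * expsum1 u y)"
  note sc = integrable_integral_posM_scale[OF z, of f]
  have e: "y powr (- 1 / 2) * expsum1 u (z * y) = z powr (1 / 2) * f (z * y)" if "y \<in> space posM" for y
  proof -
   have y: "y > 0" using that by (simp add: space_posM)
   have "z powr (1 / 2) * (z * y) powr (- 1 / 2) = (z powr (1 / 2) * z powr (- 1 / 2)) * y powr (- 1 / 2)"
    using z y by (simp add: powr_mult)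
   also have "z powr (1 / 2) * z powr (- 1 / 2) = 1" using z by (simp only: powr_add[symmetric]) simp
   finally have "y powr (- 1 / 2) = z powr (1 / 2) * (z * y) powr (- 1 / 2)" by simp
   thus ?thesis unfolding f_def by (simp only: mult.assoc)
  qed
  have f: "integrable posM f" "integral\<^sup>L posM f = sqrt pi * (2 * pi) powr (- 1 / 2) * zeta_real (3 / 2 - u)"
   unfolding f_def by (rule Mellin_expsum1[OF u])+
  have i: "integrable posM (%y. z powr (1 / 2) * f (z * y))" using sc(1) f(1) by (intro integrable_mult_right) simp
  have i': "integrable posM (%y. y powr (- 1 / 2) * expsum1 u (z * y))"
   by (subst B_integrable_cong[OF refl e]) (use i in simp_all)
  thus "integrable posM P2" unfolding P2_def by (rule integrable_mult_right)
  have "(\<integral>y. y powr (- 1 / 2) * expsum1 u (z * y) \<partial>posM) = (\<integral>y. z powr (1 / 2) * f (z * y) \<partial>posM)"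
   by (rule B_integral_cong[OF refl e])
  also have "\<dots> = (z powr (1 / 2) / z) * integral\<^sup>L posM f"
   unfolding integral_mult_right_zero sc(2) real_scaleR_def by (simp only: divide_inverse mult_ac)
  also have "z powr (1 / 2) / z = z powr (- 1 / 2)"
  proof -
   have "(- 1 / 2 :: real) = 1 / 2 - 1" by simp
   thus ?thesis using z powr_diff[of z "1 / 2" 1] by (simp only: powr_one)
  qed
  finally show "integral\<^sup>L posM P2 = 1 / (2 * pi) * (z powr (- 1 / 2) * (sqrt pi * (2 * pi) powr (- 1 / 2) * zeta_real (3 / 2 - u)))"
   unfolding P2_def integral_mult_right_zero f(2) by simp
 qed
 have I4: "integrable posM P4" "integral\<^sup>L posM P4 = 1 / 2 * (sqrt z * lip_const u)"
 proof -
  define f where "f = (%y. y powr (- 3 / 2) * D y)"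
  note sc = integrable_integral_posM_scale[OF z, of f]
  obtain C where C: "C \<ge> 0" "\<And>y. y > 0 ==> \<bar>D y\<bar> \<le> C * y" "\<And>y. y \<ge> 1 ==> \<bar>D y\<bar> \<le> C"
   using expsum1_minus_zeta_bound[OF u0(1) u(2)] unfolding D_def by blast
  have f: "integrable posM f"
  proof (rule B_integrable_bound[OF integrable_mult_right[OF integrable_beta_half, of "2 * C"]])
   have "D \<in> borel_measurable posM" unfolding D_def using measurable_expsum1[OF u] by simp
   moreover have "(%y::real. y powr (- 3 / 2)) \<in> borel_measurable posM" by (intro borel_measurable_posM) measurable
   ultimately show "f \<in> borel_measurable posM" unfolding f_def by (rule borel_measurable_times[rotated])
   show "AE y in posM. norm (f y) \<le> norm (2 * C * (y powr (- 1 / 2) * (1 / (1 + y))))"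
   proof (rule AE_I2)
    fix y assume "y \<in> space posM"
    hence y: "y > 0" by (simp add: space_posM)
    have ym: "y powr (- 1 / 2) = y powr (- 3 / 2) * y" using y powr_add[of y "- 3 / 2" 1] by simp
    have "\<bar>D y\<bar> \<le> 2 * C * (y / (1 + y))"
    proof (cases "y \<ge> 1")
     case True
     have "1 \<le> 2 * (y / (1 + y))" using True by (simp add: field_simps)
     hence "C * 1 \<le> C * (2 * (y / (1 + y)))" using C(1) by (rule mult_left_mono)
     thus ?thesis using C(3)[OF True] by (simp add: mult_ac)
    next
     case False
     have "y \<le> 2 * (y / (1 + y))" using False y by (simp add: field_simps)
     hence "C * y \<le> C * (2 * (y / (1 + y)))" using C(1) by (rule mult_left_mono)
     thus ?thesis using C(2)[OF y] by (simp add: mult_ac)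
    qed
    hence "y powr (- 3 / 2) * \<bar>D y\<bar> \<le> y powr (- 3 / 2) * (2 * C * (y / (1 + y)))" by (intro mult_left_mono) auto
    also have "\<dots> = 2 * C * (y powr (- 1 / 2) * (1 / (1 + y)))" unfolding ym by simp
    finally have le: "y powr (- 3 / 2) * \<bar>D y\<bar> \<le> 2 * C * (y powr (- 1 / 2) * (1 / (1 + y)))" .
    have nn: "0 \<le> 2 * C * (y powr (- 1 / 2) * (1 / (1 + y)))" using C(1) y by simp
    have "norm (f y) = y powr (- 3 / 2) * \<bar>D y\<bar>" by (simp add: f_def abs_mult)
    thus "norm (f y) \<le> norm (2 * C * (y powr (- 1 / 2) * (1 / (1 + y))))"
     using le unfolding real_norm_def abs_of_nonneg[OF nn] by (simp only:)
   qed
  qed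
  have e: "y powr (- 3 / 2) * D (z * y) = z powr (3 / 2) * f (z * y)" if "y \<in> space posM" for y
  proof -
   have y: "y > 0" using that by (simp add: space_posM)
   have "z powr (3 / 2) * (z * y) powr (- 3 / 2) = (z powr (3 / 2) * z powr (- 3 / 2)) * y powr (- 3 / 2)"
    using z y by (simp add: powr_mult)
   also have "z powr (3 / 2) * z powr (- 3 / 2) = 1" using z by (simp only: powr_add[symmetric]) simp
   finally have "y powr (- 3 / 2) = z powr (3 / 2) * (z * y) powr (- 3 / 2)" by simp
   thus ?thesis unfolding f_def by (simp only: mult.assoc)
  qed
  have i: "integrable posM (%y. z powr (3 / 2) * f (z * y))" using sc(1) f by (intro integrable_mult_right) simp
  have i': "integrable posM (%y. y powr (- 3 / 2) * D (z * y))"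
   by (subst B_integrable_cong[OF refl e]) (use i in simp_all)
  thus "integrable posM P4" unfolding P4_def by (rule integrable_mult_right)
  have "(\<integral>y. y powr (- 3 / 2) * D (z * y) \<partial>posM) = (\<integral>y. z powr (3 / 2) * f (z * y) \<partial>posM)"
   by (rule B_integral_cong[OF refl e])
  also have "\<dots> = (z powr (3 / 2) / z) * integral\<^sup>L posM f"
   unfolding integral_mult_right_zero sc(2) real_scaleR_def by (simp only: divide_inverse mult_ac)
  also have "z powr (3 / 2) / z = sqrt z"
  proof -
   have "(1 / 2 :: real) = 3 / 2 - 1" by simp
   hence "z powr (1 / 2) = z powr (3 / 2) / z" using z powr_diff[of z "3 / 2" 1] by (simp only: powr_one)
   thus ?thesis using z by (simp add: powr_half_sqrt)
  qed
  finally show "integral\<^sup>L posM P4 = 1 / 2 * (sqrt z * lip_const u)"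
   unfolding P4_def integral_mult_right_zero lip_const_def f_def D_def by simp
 qed
 have e: "F y = P1 y + P2 y + P3 y + P y - P4 y" if "y \<in> space posM" for y
 proof -
  have y: "y > 0" using that by (simp add: space_posM)
  define p where "p = y powr (- 3 / 2)"
  have p1: "y powr (- (u - 1 / 2) - 2) = p * y powr (- u)"
  proof -
   have "- (u - 1 / 2) - 2 = - 3 / 2 + (- u)" by simp
   thus ?thesis unfolding p_def by (simp only: powr_add)
  qed
  have p2: "y powr (- 1 / 2) = p * y" using y powr_add[of y "- 3 / 2" 1] by (simp add: p_def)
  have p3: "y powr (1 / 2 - 2) = p" by (simp add: p_def)
  have pl: "planck (1 / y) = planck1 (1 / y) + y / (2 * pi)" by (simp add: planck1_def)
  have ex: "expsum u (z * y) = lipc u * (z powr (- u) * y powr (- u)) + expsum1 u (z * y)"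
   using z y by (simp add: expsum1_def powr_mult)
  have "F y = p * planck (1 / y) * (lipc u * (z powr (- u) * y powr (- u))) + p * (planck1 (1 / y) + y / (2 * pi)) * expsum1 u (z * y)"
   unfolding F_def p_def[symmetric] ex pl by (simp only: distrib_left)
  also have "\<dots> = P1 y + P2 y + P3 y + P y - P4 y"
   unfolding P1_def P2_def P3_def P_def P4_def D_def p1 p2 p3 p_def[symmetric] by (simp add: algebra_simps)
  finally show ?thesis .
 qed
 have i: "integrable posM (%y. P1 y + P2 y + P3 y + P y - P4 y)"
  by (intro B_integrable_add B_integrable_diff I1 I2 I3 I4 R(1))
 have "integrable posM F"
  by (subst B_integrable_cong[OF refl e]) (use i in simp_all)
 from G_real_left[OF u0(2) z this[unfolded F_def], folded F_def]
 have S: "(%n. \<Sum>d | d dvd Suc n. series_term u z (d - 1) (Suc n div d - 1)) sums integral\<^sup>L posM F" .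
 have "integral\<^sup>L posM F = (\<integral>y. P1 y + P2 y + P3 y + P y - P4 y \<partial>posM)"
  by (rule B_integral_cong[OF refl e])
 also have "\<dots> = integral\<^sup>L posM P1 + integral\<^sup>L posM P2 + integral\<^sup>L posM P3 + integral\<^sup>L posM P - integral\<^sup>L posM P4"
  using I1(1) I2(1) I3(1) I4(1) R(1) by simp
 finally show ?thesis using S R(2) unfolding I1(2) I2(2) I3(2) I4(2) by (intro exI[of _ "integral\<^sup>L posM P"]) simp
qed

section \<open>Evaluation of the kernel\<close>

abbreviation unitM :: "real measure" where "unitM \<equiv> restrict_space lborel {0<..<1}"

lemma space_unitM: "space unitM = {0<..<1}"
 by (simp add: space_restrict_space)

lemma continuous_on_unitM_measurable:
 fixes f :: "real => 'a::{second_countable_topology, topological_space}"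
 shows "continuous_on {0<..<1} f ==> f \<in> borel_measurable unitM"
 by (metis borel_measurable_continuous_on_restrict measurable_cong_sets sets_lborel sets_restrict_space_cong)

lemma unitM_integral:
 fixes f :: "real => complex"
 assumes "continuous_on {0..1} f"
 shows "integrable unitM f" "integral\<^sup>L unitM f = integral {0..1} f"
proof -
 have i: "set_integrable lborel {0..1} f" using assms by (rule borel_integrable_atLeastAtMost')
 have i': "set_integrable lborel {0<..<1} f" by (rule set_integrable_subset[OF i]) auto
 thus "integrable unitM f" unfolding set_integrable_def by (subst integrable_restrict_space) auto
 have "integral\<^sup>L unitM f = (LINT q:{0<..<1}|lborel. f q)"
  unfolding set_lebesgue_integral_def by (subst integral_restrict_space) auto
 also have "\<dots> = (LINT q:{0..1}|lborel. f q)"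
 proof (rule set_integral_cong_set)
  show "set_borel_measurable lborel {0<..<1} f" "set_borel_measurable lborel {0..1} f"
   using i i' unfolding set_integrable_def set_borel_measurable_def by auto
  show "AE x in lborel. (x \<in> {0..1}) = (x \<in> {0<..<1::real})"
   using AE_lborel_singleton[of "0::real"] AE_lborel_singleton[of "1::real"] by eventually_elim auto
 qed
 also have "\<dots> = integral {0..1} f" using i by (rule set_borel_integral_eq_integral(2))
 finally show "integral\<^sup>L unitM f = integral {0..1} f" .
qed

lemma integrable_unitM_const: "integrable unitM (%_. c :: real)"
proof -
 have "integrable unitM (%_. complex_of_real c)" by (rule unitM_integral(1)) (intro continuous_on_const)
 from integrable_Re[OF this] show ?thesis by simp
qed

lemma sigma_finite_unitM: "sigma_finite_measure unitM"
 by (intro sigma_finite_measure_restrict_space lborel.sigma_finite_measure_axioms) auto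

lemma continuous_on_product_measurable:
 fixes f :: "real \<times> real => complex"
 assumes "continuous_on ({0<..<1} \<times> {0<..}) f"
 shows "f \<in> borel_measurable (unitM \<Otimes>\<^sub>M posM)"
proof -
 have m1: "(%x. x) \<in> unitM \<rightarrow>\<^sub>M borel" by (rule measurable_restrict_space1) simp
 have m2: "(%x. x) \<in> posM \<rightarrow>\<^sub>M borel" by (rule measurable_restrict_space1) simp
 have "(%z. (fst z, snd z)) \<in> unitM \<Otimes>\<^sub>M posM \<rightarrow>\<^sub>M borel \<Otimes>\<^sub>M borel"
  by (intro measurable_Pair measurable_compose[OF measurable_fst m1] measurable_compose[OF measurable_snd m2])
 hence "(%z. z) \<in> unitM \<Otimes>\<^sub>M posM \<rightarrow>\<^sub>M restrict_space borel ({0<..<1} \<times> {0<..})"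
  by (intro measurable_restrict_space2) (auto simp: space_pair_measure space_unitM space_posM borel_prod)
 from measurable_compose[OF this borel_measurable_continuous_on_restrict[OF assms]] show ?thesis .
qed

text \<open>An integral form of 2F1(1-u, 1/2; 3/2; w). It makes sense for all u and for all w with 1
  - w off the nonpositive axis, which the continuations in z and in s require.\<close>

definition Jint :: "complex => complex => complex" where
 "Jint u w = (\<integral>q. (1 - w * of_real (q\<^sup>2)) powr (u - 1) \<partial>unitM)"

text \<open>Interpolation in q: the product (1 - w q^2)^u (1 + b q^2 y)^(-u) runs from 1 at q = 0 to
  (1 - w)^u (1 + b y)^(-u) at q = 1, and since b = a w its q-derivative contains the factor 1 + a y.
  This cancels (1 + a y)^(-1), after which the y-integral for fixed q is a Beta integral
  proportional to 1/q.\<close>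

lemma kernel_half:
 fixes a b :: complex and u w :: real
 assumes u: "u > 0" and w: "\<bar>w\<bar> < 1" and a: "a \<notin> \<real>\<^sub>\<le>\<^sub>0" and b: "b = a * of_real w" "b \<notin> \<real>\<^sub>\<le>\<^sub>0"
 defines "X \<equiv> (%y. of_real (y powr (- 1 / 2)) * (1 + a * of_real y) powr (- 1) * (1 + b * of_real y) powr (- of_real u))"
 shows "integrable posM X"
  and "integral\<^sup>L posM X = (1 - of_real w) powr (- of_real u) *
   (of_real pi * a powr (- 1 / 2) - 2 * of_real u * of_real (Beta (1 / 2) (u + 1 / 2)) * of_real w * b powr (- 1 / 2) * Jint (of_real u) (of_real w))"
proof -
 define \<beta> where "\<beta> = Beta (1 / 2) (u + 1 / 2)"
 \<comment> \<open>The q-derivative of the interpolating product without its constants and without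
   the factor 1 + a y, times y^(-1/2). The leading q cancels the 1/q of the Beta integral.\<close>
 define \<Phi> where "\<Phi> = (%(q, y). complex_of_real q * (1 - of_real w * of_real (q\<^sup>2)) powr (of_real u - 1) * (of_real (y powr (- 1 / 2)) * (1 + b * of_real (q\<^sup>2 * y)) powr (- of_real u - 1)))"
 have wq: "w * q\<^sup>2 \<le> \<bar>w\<bar>" "1 - w * q\<^sup>2 \<ge> 1 - \<bar>w\<bar>" if "0 \<le> q" "q \<le> 1" for q
 proof -
  have "q\<^sup>2 \<le> 1" using that by (simp add: power_le_one)
  hence "\<bar>w\<bar> * q\<^sup>2 \<le> \<bar>w\<bar> * 1" by (intro mult_left_mono) auto
  moreover have "w * q\<^sup>2 \<le> \<bar>w\<bar> * q\<^sup>2" by (intro mult_right_mono) auto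
  ultimately show "w * q\<^sup>2 \<le> \<bar>w\<bar>" "1 - w * q\<^sup>2 \<ge> 1 - \<bar>w\<bar>" by auto
 qed
 have slit1: "1 - complex_of_real w * of_real (q\<^sup>2) \<notin> \<real>\<^sub>\<le>\<^sub>0" if "0 \<le> q" "q \<le> 1" for q
  using wq[OF that] w by (auto simp: complex_nonpos_Reals_iff)
 have slit2: "1 + b * of_real (q\<^sup>2 * y) \<notin> \<real>\<^sub>\<le>\<^sub>0" if "y \<ge> 0" for q y
  using one_plus_mult_not_nonpos[OF b(2), of "q\<^sup>2 * y"] that by simp
 have s1: False if "1 - complex_of_real w * (of_real q)\<^sup>2 \<in> \<real>\<^sub>\<le>\<^sub>0" "0 < q" "q < 1" for q
  using slit1[of q] that by simp
 have s2: False if "1 + b * ((of_real q)\<^sup>2 * of_real y) \<in> \<real>\<^sub>\<le>\<^sub>0" "0 < y" for q y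
  using slit2[of y q] that by simp
 have slita: "1 + a * of_real y \<notin> \<real>\<^sub>\<le>\<^sub>0" if "y \<ge> 0" for y
  by (rule one_plus_mult_not_nonpos[OF a that])
 have cont: "continuous_on ({0<..<1} \<times> {0<..}) \<Phi>"
 proof -
  have "continuous_on ({0<..<1} \<times> {0<..}) (%z. complex_of_real (fst z) * (1 - of_real w * of_real ((fst z)\<^sup>2)) powr (of_real u - 1) * (of_real (snd z powr (- 1 / 2)) * (1 + b * of_real ((fst z)\<^sup>2 * snd z)) powr (- of_real u - 1)))"
   by (intro continuous_on_mult continuous_on_powr_slit continuous_on_of_real continuous_on_powr continuous_on_fst continuous_on_snd continuous_on_id continuous_on_const continuous_on_add continuous_on_diff continuous_on_power)
    (auto dest: s1 s2)
  thus ?thesis by (simp add: \<Phi>_def case_prod_unfold)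
 qed
 have meas: "\<Phi> \<in> borel_measurable (unitM \<Otimes>\<^sub>M posM)" by (rule continuous_on_product_measurable[OF cont])
 have ex: "- complex_of_real (1 / 2) - of_real (u + 1 / 2) = - of_real u - 1"
 proof -
  have "- complex_of_real (1 / 2) - of_real (u + 1 / 2) = of_real (- (1 / 2) - (u + 1 / 2))" by (simp only: of_real_diff of_real_minus)
  also have "- (1 / 2) - (u + 1 / 2) = - u - 1" by simp
  finally show ?thesis by simp
 qed
 have hp: "(1 / 2 :: real) > 0" "Re (complex_of_real (u + 1 / 2)) > 0" using u by simp_all
 have ph: "(1 / 2 - 1 :: real) = - 1 / 2" by simp
 have Bq: "integrable posM (%y. of_real (y powr (- 1 / 2)) * (1 + b * of_real (q\<^sup>2 * y)) powr (- of_real u - 1))"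
  "(\<integral>y. of_real (y powr (- 1 / 2)) * (1 + b * of_real (q\<^sup>2 * y)) powr (- of_real u - 1) \<partial>posM) = of_real (1 / q) * b powr (- 1 / 2) * of_real \<beta>" if q: "q > 0" for q
 proof -
  have nb: "b * of_real (q\<^sup>2) \<notin> \<real>\<^sub>\<le>\<^sub>0"
   using b(2) q by (auto simp: complex_nonpos_Reals_iff zero_le_mult_iff mult_le_0_iff)
  have e: "b * of_real (q\<^sup>2 * y) = b * of_real (q\<^sup>2) * of_real y" for y by simp
  note B = Beta_integral_complex[OF hp nb, unfolded ex ph]
  show "integrable posM (%y. of_real (y powr (- 1 / 2)) * (1 + b * of_real (q\<^sup>2 * y)) powr (- of_real u - 1))"
   unfolding e by (rule B(1))
  have "(b * of_real (q\<^sup>2)) powr (- of_real (1 / 2)) = of_real (1 / q) * b powr (- 1 / 2)"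
  proof -
   have "(of_real (q\<^sup>2) * b) powr (- 1 / 2) = of_real (q\<^sup>2) powr (- 1 / 2) * b powr (- 1 / 2)"
    by (rule powr_times_real_left) auto
   moreover have "complex_of_real (q\<^sup>2) powr (- 1 / 2) = of_real (1 / q)"
   proof -
    have "complex_of_real (q\<^sup>2) powr of_real (- 1 / 2) = of_real ((q\<^sup>2) powr (- 1 / 2))" by (rule powr_of_real) simp
    also have "(q\<^sup>2) powr (- 1 / 2) = 1 / q"
    proof -
     have "(q\<^sup>2) powr (1 / 2) = q" using q by (simp add: powr_half_sqrt)
     moreover have "(- 1 / 2 :: real) = - (1 / 2)" by simp
     ultimately show ?thesis by (simp only: powr_minus_divide)
    qed
    finally show ?thesis by simp
   qed
   ultimately show ?thesis by (simp add: mult.commute)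
  qed
  thus "(\<integral>y. of_real (y powr (- 1 / 2)) * (1 + b * of_real (q\<^sup>2 * y)) powr (- of_real u - 1) \<partial>posM) = of_real (1 / q) * b powr (- 1 / 2) * of_real \<beta>"
   unfolding e B(2) Beta_complex_of_real \<beta>_def by simp
 qed
 define h where "h = (%y. norm (of_real (y powr (- 1 / 2)) * (1 + b * of_real y) powr (- of_real u - 1)))"
 define H where "H = integral\<^sup>L posM h"
 have hq: "(\<integral>y. norm (of_real (y powr (- 1 / 2)) * (1 + b * of_real (q\<^sup>2 * y)) powr (- of_real u - 1)) \<partial>posM) = H / q" if q: "q > 0" for q
 proof -
  have q2: "q\<^sup>2 > 0" using q by simp
  have e: "norm (complex_of_real (y powr (- 1 / 2)) * (1 + b * of_real (q\<^sup>2 * y)) powr (- of_real u - 1)) = q * h (q\<^sup>2 * y)" if "y \<in> space posM" for y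
  proof -
   have y: "y > 0" using that by (simp add: space_posM)
   have "(q\<^sup>2) powr (- 1 / 2) = 1 / q"
   proof -
    have "(q\<^sup>2) powr (1 / 2) = q" using q by (simp add: powr_half_sqrt)
    moreover have "(- 1 / 2 :: real) = - (1 / 2)" by simp
    ultimately show ?thesis by (simp only: powr_minus_divide)
   qed
   hence "(q\<^sup>2 * y) powr (- 1 / 2) = 1 / q * y powr (- 1 / 2)" using q y by (simp only: powr_mult)
   hence "y powr (- 1 / 2) = q * (q\<^sup>2 * y) powr (- 1 / 2)" using q by simp
   thus ?thesis using q unfolding h_def norm_mult norm_of_real by simp
  qed
  have "(\<integral>y. norm (of_real (y powr (- 1 / 2)) * (1 + b * of_real (q\<^sup>2 * y)) powr (- of_real u - 1)) \<partial>posM) = (\<integral>y. q * h (q\<^sup>2 * y) \<partial>posM)"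
   by (rule B_integral_cong[OF refl e])
  also have "\<dots> = q * (H / q\<^sup>2)"
   unfolding integral_mult_right_zero integrable_integral_posM_scale(2)[OF q2] H_def real_scaleR_def by (simp only: divide_inverse mult_ac)
  finally show ?thesis using q by (simp add: power2_eq_square)
 qed
 have H0: "H \<ge> 0" unfolding H_def h_def by (rule integral_nonneg_AE) (auto intro: AE_I2)
 \<comment> \<open>The two summands cover both signs of u - 1: they are powers of the lower bound 1
   - |w| and of the upper bound 2 for 1 - w q^2.\<close>
 define C where "C = (1 - \<bar>w\<bar>) powr (- \<bar>u - 1\<bar>) + 2 powr \<bar>u - 1\<bar>"
 have wb: "norm ((1 - complex_of_real w * of_real (q\<^sup>2)) powr (of_real u - 1)) \<le> C" if q: "0 \<le> q" "q \<le> 1" for q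
 proof -
  define m where "m = 1 - w * q\<^sup>2"
  have m: "1 - \<bar>w\<bar> \<le> m" "m > 0" using wq[OF q] w by (auto simp: m_def)
  have m2: "m \<le> 2"
  proof -
   have "q\<^sup>2 \<le> 1" using q by (simp add: power_le_one)
   hence "\<bar>w\<bar> * q\<^sup>2 \<le> 1 * 1" using w by (intro mult_mono) auto
   moreover have "- (w * q\<^sup>2) \<le> \<bar>w\<bar> * q\<^sup>2" by (metis abs_ge_minus_self abs_mult abs_power2)
   ultimately show ?thesis by (simp add: m_def)
  qed
  have e1: "1 - complex_of_real w * of_real (q\<^sup>2) = of_real m" by (simp add: m_def)
  have e2: "norm (complex_of_real m powr (of_real u - 1)) = m powr (u - 1)"
   using m(2) by (subst norm_powr_real_powr) auto
  have e3: "m powr (u - 1) \<le> C"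
  proof (cases "u \<ge> 1")
   case True
   have "m powr (u - 1) \<le> 2 powr (u - 1)" using m(2) m2 True by (intro powr_mono2) auto
   moreover have "0 \<le> (1 - \<bar>w\<bar>) powr (- \<bar>u - 1\<bar>)" by simp
   moreover have "\<bar>u - 1\<bar> = u - 1" using True by simp
   ultimately show ?thesis unfolding C_def by linarith
  next
   case False
   have "m powr (u - 1) \<le> (1 - \<bar>w\<bar>) powr (u - 1)" using m(1) w False by (intro powr_mono2') simp_all
   moreover have "0 \<le> (2::real) powr \<bar>u - 1\<bar>" by simp
   moreover have e: "- \<bar>u - 1\<bar> = u - 1" using False by simp
   ultimately show ?thesis unfolding C_def e by linarith
  qed
  show ?thesis unfolding e1 e2 by (rule e3)
 qed
 interpret pair_sigma_finite unitM posM by (intro pair_sigma_finite.intro sigma_finite_unitM sigma_finite_posM)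
 have PhiI: "integrable (unitM \<Otimes>\<^sub>M posM) \<Phi>"
 proof (rule Fubini_integrable[OF meas])
  show "AE q in unitM. integrable posM (%y. \<Phi> (q, y))"
  proof (rule AE_I2)
   fix q assume "q \<in> space unitM"
   hence "q > 0" by (simp add: space_unitM)
   thus "integrable posM (%y. \<Phi> (q, y))" unfolding \<Phi>_def prod.case using Bq(1) by (intro integrable_mult_right)
  qed
  show "integrable unitM (%q. \<integral>y. norm (\<Phi> (q, y)) \<partial>posM)"
  proof (rule B_integrable_bound[OF integrable_unitM_const[of "C * H"]])
   have "(%z. norm (\<Phi> z)) \<in> borel_measurable (unitM \<Otimes>\<^sub>M posM)" using meas by measurable
   thus "(%q. \<integral>y. norm (\<Phi> (q, y)) \<partial>posM) \<in> borel_measurable unitM"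
    by (intro M2.borel_measurable_lebesgue_integral) (simp add: case_prod_unfold)
   show "AE q in unitM. norm (\<integral>y. norm (\<Phi> (q, y)) \<partial>posM) \<le> norm (C * H)"
   proof (rule AE_I2)
    fix q assume "q \<in> space unitM"
    hence q: "q > 0" "q \<le> 1" by (simp_all add: space_unitM)
    have "(\<integral>y. norm (\<Phi> (q, y)) \<partial>posM) = norm (complex_of_real q * (1 - of_real w * of_real (q\<^sup>2)) powr (of_real u - 1)) * (H / q)"
     unfolding \<Phi>_def prod.case norm_mult[of "complex_of_real q * _"] integral_mult_right_zero hq[OF q(1)] ..
    also have "\<dots> = norm ((1 - complex_of_real w * of_real (q\<^sup>2)) powr (of_real u - 1)) * H" using q unfolding norm_mult norm_of_real by simp
    also have "\<dots> \<le> C * H" using wb[of q] q H0 by (intro mult_right_mono) auto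
    finally have "(\<integral>y. norm (\<Phi> (q, y)) \<partial>posM) \<le> C * H" .
    moreover have "0 \<le> (\<integral>y. norm (\<Phi> (q, y)) \<partial>posM)" by (rule integral_nonneg_AE) (auto intro: AE_I2)
    ultimately show "norm (\<integral>y. norm (\<Phi> (q, y)) \<partial>posM) \<le> norm (C * H)" by simp
   qed
  qed
 qed
 have F1: "(\<integral>q. (\<integral>y. \<Phi> (q, y) \<partial>posM) \<partial>unitM) = b powr (- 1 / 2) * of_real \<beta> * Jint (of_real u) (of_real w)"
 proof -
  have "(\<integral>q. (\<integral>y. \<Phi> (q, y) \<partial>posM) \<partial>unitM) = (\<integral>q. (b powr (- 1 / 2) * of_real \<beta>) * (1 - of_real w * of_real (q\<^sup>2)) powr (of_real u - 1) \<partial>unitM)"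
  proof (rule B_integral_cong[OF refl])
   fix q assume "q \<in> space unitM"
   hence q: "q > 0" by (simp add: space_unitM)
   show "(\<integral>y. \<Phi> (q, y) \<partial>posM) = (b powr (- 1 / 2) * of_real \<beta>) * (1 - of_real w * of_real (q\<^sup>2)) powr (of_real u - 1)"
    unfolding \<Phi>_def prod.case integral_mult_right_zero Bq(2)[OF q] using q by simp
  qed
  thus ?thesis unfolding Jint_def integral_mult_right_zero .
 qed
 \<comment> \<open>The original integrand is (1 - w)^(-u) times the sum of \<open>L\<close> and
   \<open>A0\<close>. Here \<open>A0\<close> restores the subtracted 1, and its integral is an
   elementary Beta integral.\<close>
 define L where "L = (%y. of_real (y powr (- 1 / 2)) * (1 + a * of_real y) powr (- 1) * ((1 - of_real w) powr of_real u * (1 + b * of_real y) powr (- of_real u) - 1))"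
 have inner: "(\<integral>q. \<Phi> (q, y) \<partial>unitM) * (- 2 * of_real u * of_real w) = L y" if "y \<in> space posM" for y
 proof -
  have y: "y > 0" using that by (simp add: space_posM)
  define P where "P = (%q::real. (1 - of_real w * of_real (q\<^sup>2)) powr of_real u * (1 + b * of_real (q\<^sup>2 * y)) powr (- of_real u))"
  define g where "g = (%q::real. complex_of_real q * (1 - of_real w * of_real (q\<^sup>2)) powr (of_real u - 1) * (1 + b * of_real (q\<^sup>2 * y)) powr (- of_real u - 1))"
  have cg: "continuous_on {0..1} g" unfolding g_def
   by (intro continuous_on_mult continuous_on_powr_slit continuous_on_of_real continuous_on_id continuous_on_const continuous_on_add continuous_on_diff continuous_on_power)
    (use slit1 slit2 y in auto)
  have dP: "(P has_vector_derivative (- 2 * of_real u * of_real w * (1 + a * of_real y)) * g q) (at q within {0..1})" if q: "q \<in> {0..1}" for q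
  proof -
   define A where "A = 1 - complex_of_real w * of_real (q\<^sup>2)"
   define B where "B = 1 + b * of_real (q\<^sup>2 * y)"
   have nA: "A \<notin> \<real>\<^sub>\<le>\<^sub>0" "B \<notin> \<real>\<^sub>\<le>\<^sub>0" using slit1[of q] slit2[of y q] q y by (auto simp: A_def B_def)
   have A0: "A ~= 0" "B ~= 0" using nA by auto
   have dA: "((%z. 1 - of_real w * z\<^sup>2) has_field_derivative (- 2 * of_real w * of_real q)) (at (of_real q))"
    by (auto intro!: derivative_eq_intros)
   have dB: "((%z. 1 + b * (z\<^sup>2 * of_real y)) has_field_derivative (2 * b * of_real y * of_real q)) (at (of_real q))"
    by (auto intro!: derivative_eq_intros)
   have A': "1 - complex_of_real w * (of_real q)\<^sup>2 = A" "1 + b * ((of_real q)\<^sup>2 * of_real y) = B" by (simp_all add: A_def B_def)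
   have a1: "1 - complex_of_real w * (of_real q)\<^sup>2 \<notin> \<real>\<^sub>\<le>\<^sub>0" "1 + b * ((of_real q)\<^sup>2 * of_real y) \<notin> \<real>\<^sub>\<le>\<^sub>0"
    unfolding A' by (fact nA)+
   have d1: "((%z. (1 - of_real w * z\<^sup>2) powr of_real u) has_field_derivative (of_real u * A powr (of_real u - 1) * (- 2 * of_real w * of_real q))) (at (of_real q))"
    by (rule DERIV_chain2[OF has_field_derivative_powr[OF a1(1), of "of_real u"] dA, unfolded A'])
   have d2: "((%z. (1 + b * (z\<^sup>2 * of_real y)) powr (- of_real u)) has_field_derivative (- of_real u * B powr (- of_real u - 1) * (2 * b * of_real y * of_real q))) (at (of_real q))"
    by (rule DERIV_chain2[OF has_field_derivative_powr[OF a1(2), of "- of_real u"] dB, unfolded A'])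
   have dv: "((%x. (1 - of_real w * (of_real x)\<^sup>2) powr of_real u * (1 + b * ((of_real x)\<^sup>2 * of_real y)) powr (- of_real u)) has_vector_derivative
     (of_real u * A powr (of_real u - 1) * (- 2 * of_real w * of_real q)) * B powr (- of_real u) + (- of_real u * B powr (- of_real u - 1) * (2 * b * of_real y * of_real q)) * A powr of_real u) (at q within {0..1})"
    by (rule has_vector_derivative_real_field[OF DERIV_mult[OF d1 d2], of "{0..1}", unfolded A'])
   have e1: "B powr (- of_real u) = B * B powr (- of_real u - 1)" and e2: "A powr of_real u = A * A powr (of_real u - 1)"
    using A0 by (simp_all add: powr_diff)
   \<comment> \<open>The relation b = a w enters here and produces the factor 1 + a y.\<close>
   have e3: "A * b * of_real y + of_real w * B = of_real w * (1 + a * of_real y)"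
    unfolding A_def B_def b(1) by (simp add: algebra_simps)
   have "(of_real u * A powr (of_real u - 1) * (- 2 * of_real w * of_real q)) * B powr (- of_real u) + (- of_real u * B powr (- of_real u - 1) * (2 * b * of_real y * of_real q)) * A powr of_real u
     = - 2 * of_real u * of_real q * A powr (of_real u - 1) * B powr (- of_real u - 1) * (A * b * of_real y + of_real w * B)"
    unfolding e1 e2 by (simp add: algebra_simps)
   also have "\<dots> = (- 2 * of_real u * of_real w * (1 + a * of_real y)) * g q"
    unfolding e3 g_def A_def[symmetric] B_def[symmetric] by (simp only: mult_ac)
   finally have ge: "(of_real u * A powr (of_real u - 1) * (- 2 * of_real w * of_real q)) * B powr (- of_real u) + (- of_real u * B powr (- of_real u - 1) * (2 * b * of_real y * of_real q)) * A powr of_real u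
     = (- 2 * of_real u * of_real w * (1 + a * of_real y)) * g q" .
   have Pe: "P = (%x. (1 - of_real w * (of_real x)\<^sup>2) powr of_real u * (1 + b * ((of_real x)\<^sup>2 * of_real y)) powr (- of_real u))"
    by (simp add: P_def)
   show ?thesis unfolding Pe using dv unfolding ge .
  qed
  have "((%q. (- 2 * of_real u * of_real w * (1 + a * of_real y)) * g q) has_integral (P 1 - P 0)) {0..1}"
   by (rule fundamental_theorem_of_calculus) (use dP in auto)
  hence "integral {0..1} (%q. (- 2 * of_real u * of_real w * (1 + a * of_real y)) * g q) = P 1 - P 0" by (rule integral_unique)
  hence g1: "(- 2 * of_real u * of_real w * (1 + a * of_real y)) * integral {0..1} g = P 1 - P 0" by simp
  have "(\<integral>q. \<Phi> (q, y) \<partial>unitM) = (\<integral>q. of_real (y powr (- 1 / 2)) * g q \<partial>unitM)"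
   by (intro B_integral_cong) (auto simp: \<Phi>_def g_def)
  also have "\<dots> = of_real (y powr (- 1 / 2)) * integral {0..1} g" unfolding integral_mult_right_zero unitM_integral(2)[OF cg] ..
  finally have e: "(\<integral>q. \<Phi> (q, y) \<partial>unitM) = of_real (y powr (- 1 / 2)) * integral {0..1} g" .
  have ay: "1 + a * of_real y ~= 0" using slita[of y] y by auto
  have pm: "(1 + a * of_real y) powr (- 1) = 1 / (1 + a * of_real y)" using ay by (simp add: powr_minus inverse_eq_divide)
  have P10: "P 1 - P 0 = (1 - of_real w) powr of_real u * (1 + b * of_real y) powr (- of_real u) - 1" by (simp add: P_def)
  have gi: "(- 2 * of_real u * of_real w) * integral {0..1} g = (P 1 - P 0) / (1 + a * of_real y)"
   unfolding g1[symmetric] using ay by simp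
  have "(\<integral>q. \<Phi> (q, y) \<partial>unitM) * (- 2 * of_real u * of_real w) = of_real (y powr (- 1 / 2)) * ((- 2 * of_real u * of_real w) * integral {0..1} g)"
   unfolding e by (simp only: mult_ac)
  also have "\<dots> = L y" unfolding gi P10 L_def pm by simp
  finally show ?thesis .
 qed
 have LI: "integrable posM L" "integral\<^sup>L posM L = b powr (- 1 / 2) * of_real \<beta> * Jint (of_real u) (of_real w) * (- 2 * of_real u * of_real w)"
 proof -
  have \<Phi>c: "integrable (unitM \<Otimes>\<^sub>M posM) (%(q, y). \<Phi> (q, y))" unfolding case_prod_eta by (rule PhiI)
  have i: "integrable posM (%y. (\<integral>q. \<Phi> (q, y) \<partial>unitM) * (- 2 * of_real u * of_real w))"
   using integrable_snd[OF \<Phi>c] by (rule integrable_mult_left)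
  show "integrable posM L" using i by (subst (asm) B_integrable_cong[OF refl inner]) simp_all
  have "integral\<^sup>L posM L = (\<integral>y. (\<integral>q. \<Phi> (q, y) \<partial>unitM) * (- 2 * of_real u * of_real w) \<partial>posM)"
   by (rule B_integral_cong[OF refl inner[symmetric]])
  also have "\<dots> = (\<integral>q. (\<integral>y. \<Phi> (q, y) \<partial>posM) \<partial>unitM) * (- 2 * of_real u * of_real w)"
   unfolding integral_mult_left_zero Fubini_integral[OF \<Phi>c] ..
  finally show "integral\<^sup>L posM L = b powr (- 1 / 2) * of_real \<beta> * Jint (of_real u) (of_real w) * (- 2 * of_real u * of_real w)"
   unfolding F1 .
 qed
 define A0 where "A0 = (%y. complex_of_real (y powr (- 1 / 2)) * (1 + a * of_real y) powr (- 1))"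
 have exa: "- complex_of_real (1 / 2) - of_real (1 / 2) = -1"
 proof -
  have "- complex_of_real (1 / 2) - of_real (1 / 2) = of_real (- (1 / 2) - 1 / 2)" by (simp only: of_real_diff of_real_minus)
  also have "- (1 / 2) - 1 / 2 = (- 1 :: real)" by simp
  finally show ?thesis by simp
 qed
 have hp': "Re (complex_of_real (1 / 2)) > 0" by simp
 have A0I: "integrable posM A0" "integral\<^sup>L posM A0 = of_real pi * a powr (- 1 / 2)"
 proof -
  note B = Beta_integral_complex[OF hp(1) hp' a, unfolded exa ph]
  show "integrable posM A0" unfolding A0_def by (rule B(1))
  have "Beta (1 / 2) (1 / 2 :: real) = pi" by (simp add: Beta_def Gamma_one_half_real)
  thus "integral\<^sup>L posM A0 = of_real pi * a powr (- 1 / 2)" unfolding A0_def B(2) Beta_complex_of_real by simp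
 qed
 have w1: "complex_of_real 1 - of_real w ~= 0" using w by (auto simp flip: of_real_diff)
 have cinv: "(1 - complex_of_real w) powr (- of_real u) * (1 - of_real w) powr of_real u = 1"
  using w1 by (simp add: powr_minus)
 have XL: "X = (%y. (1 - complex_of_real w) powr (- of_real u) * (L y + A0 y))"
 proof
  fix y
  have "L y + A0 y = (1 - of_real w) powr of_real u * X y" by (simp add: L_def A0_def X_def algebra_simps)
  hence "(1 - complex_of_real w) powr (- of_real u) * (L y + A0 y) = ((1 - complex_of_real w) powr (- of_real u) * (1 - of_real w) powr of_real u) * X y" by (simp only: mult.assoc)
  thus "X y = (1 - complex_of_real w) powr (- of_real u) * (L y + A0 y)" unfolding cinv by simp
 qed
 show "integrable posM X" unfolding XL by (intro integrable_mult_right B_integrable_add LI(1) A0I(1))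
 show "integral\<^sup>L posM X = (1 - of_real w) powr (- of_real u) *
   (of_real pi * a powr (- 1 / 2) - 2 * of_real u * of_real (Beta (1 / 2) (u + 1 / 2)) * of_real w * b powr (- 1 / 2) * Jint (of_real u) (of_real w))"
 proof -
  have alg: "c * (b' * \<beta>' * J * (- 2 * u' * w') + P) = c * (P - 2 * u' * \<beta>' * w' * b' * J)" for c b' \<beta>' J u' w' P :: complex
   by (simp add: algebra_simps)
  show ?thesis
   unfolding XL integral_mult_right_zero B_integral_add[OF LI(1) A0I(1)] LI(2) A0I(2) \<beta>_def[symmetric]
   by (rule alg)
 qed
qed

lemma powr_i_mult:
 assumes "Re w > 0" shows "(\<i> * w) powr a = \<i> powr a * w powr a"
proof -
 have w0: "w ~= 0" using assms by auto
 have "\<bar>Im (Ln w)\<bar> < pi / 2" by (rule Re_Ln_pos_lt_imp[OF assms])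
 hence "Ln (\<i> * w) = Ln \<i> + Ln w" using w0 by (intro Ln_times_simple) auto
 thus ?thesis using w0 by (simp add: powr_def distrib_left exp_add)
qed

lemma Jint_real:
 fixes u w :: real
 assumes "\<bar>w\<bar> < 1"
 shows "Im (Jint (of_real u) (of_real w)) = 0"
proof -
 have "Jint (of_real u) (of_real w) = (\<integral>q. complex_of_real ((1 - w * q\<^sup>2) powr (u - 1)) \<partial>unitM)"
  unfolding Jint_def
 proof (rule B_integral_cong[OF refl])
  fix q assume "q \<in> space unitM"
  hence "q\<^sup>2 \<le> 1" by (simp add: space_unitM power_le_one)
  hence "\<bar>w\<bar> * q\<^sup>2 \<le> \<bar>w\<bar> * 1" by (intro mult_left_mono) auto
  moreover have "w * q\<^sup>2 \<le> \<bar>w\<bar> * q\<^sup>2" by (intro mult_right_mono) auto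
  ultimately have "1 - w * q\<^sup>2 \<ge> 0" using assms by linarith
  from powr_of_real[OF this, of "u - 1"] show "(1 - complex_of_real w * of_real (q\<^sup>2)) powr (of_real u - 1) = complex_of_real ((1 - w * q\<^sup>2) powr (u - 1))"
   by simp
 qed
 also have "\<dots> = of_real (\<integral>q. (1 - w * q\<^sup>2) powr (u - 1) \<partial>unitM)" by (rule integral_complex_of_real)
 finally show ?thesis by simp
qed

definition Rfun :: "complex => complex => complex" where
 "Rfun s v = (1 - v) powr (- (s + 1 / 2)) * Jint (s + 1 / 2) v"

text \<open>With u = s + 1/2 this is 2 u B(1/2, u + 1/2) / pi, the coefficient of
  \<open>Jint\<close> in \<open>kernel_half\<close> divided by pi.\<close>

definition kap_coeff :: "complex => complex" where
 "kap_coeff s = 2 * Gamma (s + 1) / (of_real (sqrt pi) * Gamma (s + 1 / 2))"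

text \<open>The closed form of \<open>kernel_int\<close> at n = 1, divided by pi, written so that it
  makes sense for complex s and v. The subtracted ones come from the value of \<open>lipterm\<close>
  at 0.\<close>

definition kap :: "complex => complex => complex" where
 "kap s v = - sin (of_real pi * s / 2) * ((1 + v) powr (- (s + 1 / 2)) - 1)
  + cos (of_real pi * s / 2) * ((1 - v) powr (- (s + 1 / 2)) - 1)
  - kap_coeff s * csqrt v * cos (of_real pi * s / 2) * (Rfun s v - Rfun s (- v))"

text \<open>The weight 2 / (1 + y^2) is the sum of 1 / (1 + i y) and 1 / (1 - i y), and (v y +
  i)^(-u) = i^(-u) (1 - i v y)^(-u). Two instances of \<open>kernel_half\<close> apply, a = i with w
  = -v and a = -i with w = v, sharing b = -i v.\<close>

lemma kernel_int_eval:
 fixes u v :: real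
 assumes u: "u > 0" and v: "0 < v" "v < 1"
 shows "complex_of_real (kernel_int u v 1) = of_real pi * kap (of_real (u - 1 / 2)) (of_real v)"
proof -
 define s where "s = u - 1 / 2"
 define b where "b = - \<i> * complex_of_real v"
 have b: "b \<notin> \<real>\<^sub>\<le>\<^sub>0" "b = \<i> * of_real (- v)" "b = - \<i> * of_real v"
  using v by (auto simp: b_def complex_nonpos_Reals_iff)
 have iv: "\<bar>- v\<bar> < 1" "\<bar>v\<bar> < 1" using v by simp_all
 have ni: "\<i> \<notin> \<real>\<^sub>\<le>\<^sub>0" "- \<i> \<notin> \<real>\<^sub>\<le>\<^sub>0" by (auto simp: complex_nonpos_Reals_iff)
 note K1 = kernel_half[OF u iv(1) ni(1) b(2) b(1)]
 note K2 = kernel_half[OF u iv(2) ni(2) b(3) b(1)]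
 define X1 where "X1 = (%y. of_real (y powr (- 1 / 2)) * (1 + \<i> * of_real y) powr (- 1) * (1 + b * of_real y) powr (- of_real u))"
 define X2 where "X2 = (%y. of_real (y powr (- 1 / 2)) * (1 + - \<i> * of_real y) powr (- 1) * (1 + b * of_real y) powr (- of_real u))"
 define \<beta> where "\<beta> = Beta (1 / 2) (u + 1 / 2)"
 define J1 where "J1 = Re (Jint (of_real u) (of_real (- v)))"
 define J2 where "J2 = Re (Jint (of_real u) (of_real v))"
 have J: "Jint (of_real u) (of_real (- v)) = of_real J1" "Jint (of_real u) (of_real v) = of_real J2"
  using Jint_real[OF iv(1), of u] Jint_real[OF iv(2), of u] by (simp_all add: J1_def J2_def complex_eq_iff)
 define ip where "ip = \<i> powr (- complex_of_real u)"
 have w: "y powr (- 1 / 2) / (1 + y\<^sup>2) * (lipterm u 1 (v * y) - lipterm u 1 0) = Re (ip * (X1 y + X2 y)) - 2 * Re ip * (y powr (1 / 2 - 1) * (1 / (1 + y\<^sup>2)))" for y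
 proof -
  define p where "p = y powr (- 1 / 2)"
  have p: "y powr (1 / 2 - 1) = p" by (simp add: p_def)
  have s1: "(1 + \<i> * complex_of_real y) powr (- 1) + (1 + - \<i> * of_real y) powr (- 1) = of_real (2 / (1 + y\<^sup>2))"
  proof -
   have n: "1 + \<i> * complex_of_real y ~= 0" "1 + - \<i> * complex_of_real y ~= 0" by (auto simp: complex_eq_iff)
   have "(1 + \<i> * complex_of_real y) * (1 + - \<i> * of_real y) = of_real (1 + y\<^sup>2)"
    by (simp add: complex_eq_iff power2_eq_square)
   moreover have "inverse (1 + \<i> * complex_of_real y) + inverse (1 + - \<i> * of_real y) = 2 / ((1 + \<i> * complex_of_real y) * (1 + - \<i> * of_real y))"
    using n by (simp add: field_simps)
   ultimately show ?thesis using n by (simp add: powr_minus)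
  qed
  have s2: "(complex_of_real (v * y) + \<i> * of_nat 1) powr (- of_real u) = ip * (1 + b * of_real y) powr (- of_real u)"
  proof -
   have "complex_of_real (v * y) + \<i> * of_nat 1 = \<i> * (1 + b * of_real y)" by (simp add: b_def complex_eq_iff)
   moreover have "Re (1 + b * of_real y) > 0" by (simp add: b_def)
   ultimately show ?thesis unfolding ip_def by (simp only: powr_i_mult)
  qed
  have "ip * (X1 y + X2 y) = of_real p * ((1 + \<i> * complex_of_real y) powr (- 1) + (1 + - \<i> * of_real y) powr (- 1)) * (ip * (1 + b * of_real y) powr (- of_real u))"
   unfolding X1_def X2_def p_def[symmetric] by (simp only: distrib_left distrib_right mult_ac)
  also have "\<dots> = of_real (p * (2 / (1 + y\<^sup>2))) * (complex_of_real (v * y) + \<i> * of_nat 1) powr (- of_real u)"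
   unfolding s1 s2[symmetric] of_real_mult[of p "2 / (1 + y\<^sup>2)"] ..
  finally have r1: "Re (ip * (X1 y + X2 y)) = p * (2 / (1 + y\<^sup>2)) * Re ((complex_of_real (v * y) + \<i> * of_nat 1) powr (- of_real u))"
   by (simp only: Re_of_real_mult)
  have l0: "lipterm u 1 0 = 2 * Re ip" by (simp add: lipterm_def ip_def)
  have alg: "P / D * (2 * L - 2 * r) = P * (2 / D) * L - 2 * r * (P * (1 / D))" for P D L r :: real
   by (simp add: right_diff_distrib diff_divide_distrib mult_ac)
  show ?thesis unfolding p p_def[symmetric] r1 l0 lipterm_def[of u 1 "v * y"] by (rule alg)
 qed
 have i1: "integrable posM X1" "integrable posM X2"
  unfolding X1_def X2_def by (rule K1(1), rule K2(1))
 have h: "0 < (1 / 2 :: real)" "1 / 2 < (1 :: real)" by simp_all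
 note MI = Mellin_inverse_one_plus_square[OF h]
 have iX: "integrable posM (%y. ip * (X1 y + X2 y))" using i1 by (intro integrable_mult_right B_integrable_add)
 have sq: "pi / (2 * sin (pi * (1 / 2) / 2)) = pi / sqrt 2" by (simp add: sin_45)
 have "kernel_int u v 1 = (\<integral>y. Re (ip * (X1 y + X2 y)) - 2 * Re ip * (y powr (1 / 2 - 1) * (1 / (1 + y\<^sup>2))) \<partial>posM)"
  unfolding kernel_int_def w ..
 also have "\<dots> = (\<integral>y. Re (ip * (X1 y + X2 y)) \<partial>posM) - 2 * Re ip * (pi / sqrt 2)"
  unfolding B_integral_diff[OF integrable_Re[OF iX] integrable_mult_right[OF MI(1)]] integral_mult_right_zero MI(2) sq ..
 also have "(\<integral>y. Re (ip * (X1 y + X2 y)) \<partial>posM) = Re (ip * (integral\<^sup>L posM X1 + integral\<^sup>L posM X2))"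
  unfolding integral_Re[OF iX] integral_mult_right_zero B_integral_add[OF i1] ..
 finally have k1: "kernel_int u v 1 = Re (ip * (integral\<^sup>L posM X1 + integral\<^sup>L posM X2)) - 2 * Re ip * (pi / sqrt 2)" .
 \<comment> \<open>As \<open>Jint\<close> is real at these arguments, the integrals reduce to sums
   of numbers \<open>e t\<close> times reals, and taking real parts replaces \<open>e t\<close> by
   cos t.\<close>
 define e where "e = (%t. exp (\<i> * complex_of_real t))"
 have e_add: "e x * e y = e (x + y)" for x y by (simp add: e_def distrib_left flip: exp_add)
 have Re_e: "Re (e t) = cos t" for t by (simp add: e_def Re_exp)
 have Re_real: "Re (e t * of_real c) = cos t * c" for t c by (simp add: e_def Re_exp)
 have pi1: "\<i> powr (- 1 / 2) = e (- pi / 4)" by (simp add: powr_def e_def)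
 have pi2: "(- \<i>) powr (- 1 / 2) = e (pi / 4)" by (simp add: powr_def e_def)
 have ipe: "ip = e (- (pi * u / 2))" by (simp add: ip_def powr_def e_def mult_ac)
 have bp: "complex_of_real v * b powr (- 1 / 2) = of_real (sqrt v) * e (pi / 4)"
 proof -
  have "b = of_real v * (- \<i>)" by (simp add: b_def)
  hence "b powr (- 1 / 2) = of_real v powr (- 1 / 2) * (- \<i>) powr (- 1 / 2)"
   by (simp only:) (rule powr_times_real_left, use v in auto)
  moreover have "complex_of_real v powr of_real (- 1 / 2) = of_real (v powr (- 1 / 2))" using v by (intro powr_of_real) simp
  moreover have "v * v powr (- 1 / 2) = sqrt v"
   using v powr_add[of v 1 "- 1 / 2"] by (simp add: powr_half_sqrt)
  hence "complex_of_real v * of_real (v powr (- 1 / 2)) = of_real (sqrt v)" by (simp only: flip: of_real_mult)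
  ultimately show ?thesis unfolding pi2 by (simp add: mult.assoc[symmetric])
 qed
 define a1 where "a1 = (1 + v) powr (- u)"
 define a2 where "a2 = (1 - v) powr (- u)"
 have ca: "(1 - complex_of_real (- v)) powr (- of_real u) = of_real a1" "(1 - complex_of_real v) powr (- of_real u) = of_real a2"
  using v powr_of_real[of "1 + v" "- u"] powr_of_real[of "1 - v" "- u"] by (simp_all add: a1_def a2_def)
 have I1: "integral\<^sup>L posM X1 = of_real a1 * (of_real pi * e (- pi / 4) + of_real (2 * u * \<beta> * sqrt v * J1) * e (pi / 4))"
 proof -
  have "integral\<^sup>L posM X1 = of_real a1 * (of_real pi * e (- pi / 4) - 2 * of_real u * of_real \<beta> * of_real (- v) * b powr (- 1 / 2) * of_real J1)"
   unfolding X1_def K1(2) J ca pi1 \<beta>_def ..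
  also have "2 * of_real u * of_real \<beta> * of_real (- v) * b powr (- 1 / 2) * of_real J1 = - (2 * of_real u * of_real \<beta> * (complex_of_real v * b powr (- 1 / 2)) * of_real J1)"
   by simp
  finally show ?thesis unfolding bp by (simp add: mult_ac)
 qed
 have I2: "integral\<^sup>L posM X2 = of_real a2 * (of_real pi * e (pi / 4) - of_real (2 * u * \<beta> * sqrt v * J2) * e (pi / 4))"
 proof -
  have "integral\<^sup>L posM X2 = of_real a2 * (of_real pi * e (pi / 4) - 2 * of_real u * of_real \<beta> * of_real v * b powr (- 1 / 2) * of_real J2)"
   unfolding X2_def K2(2) J ca pi2 \<beta>_def ..
  also have "2 * of_real u * of_real \<beta> * of_real v * b powr (- 1 / 2) * of_real J2 = 2 * of_real u * of_real \<beta> * (complex_of_real v * b powr (- 1 / 2)) * of_real J2"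
   by simp
  finally show ?thesis unfolding bp by (simp add: mult_ac)
 qed
 \<comment> \<open>The eighth turns from the square roots of i, -i and b combine with the phase of
   i^(-u) to angles in pi s / 2.\<close>
 have angles: "- (pi * u / 2) + - pi / 4 = - (pi * s / 2 + pi / 2)" "- (pi * u / 2) + pi / 4 = - (pi * s / 2)" "pi * u / 2 = pi * s / 2 + pi / 4"
  by (simp_all add: s_def field_simps)
 have c1: "cos (- (pi * s / 2 + pi / 2)) = - sin (pi * s / 2)" unfolding cos_minus by (simp add: cos_add)
 have c2: "cos (- (pi * s / 2)) = cos (pi * s / 2)" by simp
 have "ip * (integral\<^sup>L posM X1 + integral\<^sup>L posM X2) = e (- (pi * u / 2) + - pi / 4) * of_real (a1 * pi) + e (- (pi * u / 2) + pi / 4) * of_real (a1 * (2 * u * \<beta> * sqrt v * J1) + a2 * pi - a2 * (2 * u * \<beta> * sqrt v * J2))"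
  unfolding ipe I1 I2 e_add[symmetric] by (simp add: algebra_simps)
 hence r1: "Re (ip * (integral\<^sup>L posM X1 + integral\<^sup>L posM X2)) = - sin (pi * s / 2) * (a1 * pi) + cos (pi * s / 2) * (a1 * (2 * u * \<beta> * sqrt v * J1) + a2 * pi - a2 * (2 * u * \<beta> * sqrt v * J2))"
  unfolding angles(1,2) by (simp only: plus_complex.sel Re_real c1 c2)
 have r2: "2 * Re ip * (pi / sqrt 2) = pi * (cos (pi * s / 2) - sin (pi * s / 2))"
 proof -
  have "Re ip = cos (pi * s / 2 + pi / 4)" unfolding ipe Re_e angles(3)[symmetric] by simp
  also have "\<dots> = (cos (pi * s / 2) - sin (pi * s / 2)) * (sqrt 2 / 2)" by (simp add: cos_add cos_45 sin_45 algebra_simps)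
  finally have r: "Re ip = (cos (pi * s / 2) - sin (pi * s / 2)) * (sqrt 2 / 2)" .
  have alg: "2 * (D * (sqrt 2 / 2)) * (pi / sqrt 2) = pi * D" for D by (simp add: field_simps)
  show ?thesis unfolding r by (rule alg)
 qed
 have alg: "- S * (A * P) + C * (A * (T * v * I) + B * P - B * (T * v * J)) - P * (C - S) = P * (- S * (A - 1) + C * (B - 1) - (T / P) * v * C * (B * J - A * I))"
  if "P ~= 0" for S A P C T v I B J :: real using that by (simp add: field_simps)
 have k2: "kernel_int u v 1 = pi * (- sin (pi * s / 2) * (a1 - 1) + cos (pi * s / 2) * (a2 - 1) - (2 * u * \<beta> / pi) * sqrt v * cos (pi * s / 2) * (a2 * J2 - a1 * J1))"
  unfolding k1 r1 r2 by (rule alg) simp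
 have kc: "kap_coeff (of_real s) = of_real (2 * u * \<beta> / pi)"
 proof -
  have "\<beta> = sqrt pi * Gamma (u + 1 / 2) / Gamma (u + 1)" by (simp add: \<beta>_def Beta_def Gamma_one_half_real add.commute)
  moreover have "Gamma (u + 1) = u * Gamma u" using u by (intro Gamma_plus1) (auto elim!: nonpos_Ints_cases)
  ultimately have ub: "u * \<beta> = sqrt pi * Gamma (u + 1 / 2) / Gamma u" using u by simp
  have alg: "2 * (q * A / B) / (q * q) = 2 * A / (q * B)" if "q ~= 0" for q A B :: real using that by simp
  have "2 * u * \<beta> / pi = 2 * (u * \<beta>) / (sqrt pi * sqrt pi)" by simp
  also have "2 * (u * \<beta>) / (sqrt pi * sqrt pi) = 2 * Gamma (u + 1 / 2) / (sqrt pi * Gamma u)" unfolding ub by (rule alg) simp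
  finally have r: "2 * u * \<beta> / pi = 2 * Gamma (u + 1 / 2) / (sqrt pi * Gamma u)" .
  have g: "complex_of_real s + 1 = of_real (u + 1 / 2)" "complex_of_real s + 1 / 2 = of_real u" by (simp_all add: s_def)
  show ?thesis unfolding kap_coeff_def g Gamma_complex_of_real r by simp
 qed
 have "complex_of_real pi * kap (of_real s) (of_real v) = of_real (pi * (- sin (pi * s / 2) * (a1 - 1) + cos (pi * s / 2) * (a2 - 1) - (2 * u * \<beta> / pi) * sqrt v * cos (pi * s / 2) * (a2 * J2 - a1 * J1)))"
 proof -
  have g: "complex_of_real s + 1 / 2 = of_real u" by (simp add: s_def)
  have sn: "sin (complex_of_real pi * of_real s / 2) = of_real (sin (pi * s / 2))"
   using sin_of_real[of "pi * s / 2", where 'a = complex] by simp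
  have cs: "cos (complex_of_real pi * of_real s / 2) = of_real (cos (pi * s / 2))"
   using cos_of_real[of "pi * s / 2", where 'a = complex] by simp
  have q: "csqrt (of_real v) = of_real (sqrt v)" using v by (simp add: csqrt_of_real)
  have n: "- complex_of_real v = of_real (- v)" by simp
  have pl: "1 + complex_of_real v = 1 - of_real (- v)" by simp
  show ?thesis unfolding kap_def kc Rfun_def g sn cs q n pl J ca by simp
 qed
 thus ?thesis unfolding k2 s_def by simp
qed

lemma kernel_int_scale:
 assumes "n > 0"
 shows "kernel_int u z n = real n powr (- u) * kernel_int u (z / real n) 1"
proof -
 have l: "lipterm u n (z * y) = real n powr (- u) * lipterm u 1 (z / real n * y)" for y
 proof -
  have "lipterm u 1 (z / real n * y) = real n powr u * lipterm u (n * 1) (real n * (z / real n * y))"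
   by (rule lipterm_scale[OF assms])
  moreover have "real n * (z / real n * y) = z * y" using assms by simp
  moreover have "real n powr (- u) * real n powr u = 1" using assms by (simp only: powr_add[symmetric]) simp
  ultimately show ?thesis by (simp add: mult.assoc[symmetric])
 qed
 have l0: "lipterm u n 0 = real n powr (- u) * lipterm u 1 0" using l[of 0] by simp
 have e: "y powr (- 1 / 2) / (1 + y\<^sup>2) * (lipterm u n (z * y) - lipterm u n 0) = real n powr (- u) * (y powr (- 1 / 2) / (1 + y\<^sup>2) * (lipterm u 1 (z / real n * y) - lipterm u 1 0))" for y
  unfolding l l0 right_diff_distrib[symmetric] by (simp only: mult_ac)
 show ?thesis unfolding kernel_int_def e integral_mult_right_zero ..
qed

section \<open>Size and holomorphy of the kernel\<close>

lemma norm_exp_minus_one_le: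
 fixes z :: complex
 shows "norm (exp z - 1) \<le> norm z * exp (norm z)"
proof -
 have "norm (exp z - exp 0) \<le> exp (norm z) * norm (z - 0)"
 proof (rule field_differentiable_bound[of "cball 0 (norm z)" exp exp])
  fix w :: complex assume "w \<in> cball 0 (norm z)"
  hence "norm w \<le> norm z" by simp
  thus "norm (exp w) \<le> exp (norm z)" using norm_exp[of w] by (meson exp_le_cancel_iff order_trans)
 next
  fix w :: complex show "(exp has_field_derivative exp w) (at w within cball 0 (norm z))"
   by (rule has_field_derivative_at_within) (rule DERIV_exp)
 qed auto
 thus ?thesis by (simp add: mult.commute)
qed

text \<open>The logarithm of 1 + v is at most 2 |v|, and exp(z) - 1 is controlled by |z|. The
  constant depends on the exponent through M alone, so the bound is locally uniform in s.\<close>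

lemma one_plus_powr_minus_one_bound:
 fixes v a :: complex
 assumes v: "norm v \<le> 1 / 2" and a: "norm a \<le> M"
 shows "norm ((1 + v) powr a - 1) \<le> 2 * M * exp M * norm v"
proof -
 have n: "1 + v ~= 0"
 proof
  assume "1 + v = 0"
  hence "v = - 1" by (metis add.commute add_eq_0_iff)
  thus False using v by simp
 qed
 have l: "norm (Ln (1 + v)) \<le> 2 * norm v"
 proof (cases "norm v = 1 / 2")
  case False
  thus ?thesis using v by (intro norm_Ln_le) auto
 next
  case True
  \<comment> \<open>On the circle of radius 1/2 the bound follows from the open disc by letting t
    tend to 1 along t v.\<close>
  have "norm (Ln (1 + v)) \<le> 1"
  proof (rule tendsto_upperbound)
   have "(1 + v) \<notin> \<real>\<^sub>\<le>\<^sub>0"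
    using abs_Re_le_cmod[of v] True by (auto simp: complex_nonpos_Reals_iff)
   hence "isCont (%t. norm (Ln (1 + of_real t * v))) (1 :: real)" by (intro continuous_intros) auto
   thus "((%t :: real. norm (Ln (1 + of_real t * v))) \<longlongrightarrow> norm (Ln (1 + v))) (at_left 1)"
    unfolding isCont_def by (simp add: filterlim_at_split)
   show "eventually (%t. norm (Ln (1 + of_real t * v)) \<le> 1) (at_left (1 :: real))"
   proof (rule eventually_mono[OF eventually_at_left_real[of 0 1]])
    fix t :: real assume t: "t \<in> {0<..<1}"
    have n1: "norm (of_real t * v) = t * (1 / 2)" using t True by (simp add: norm_mult)
    have "norm (Ln (1 + of_real t * v)) \<le> 2 * norm (of_real t * v)" using t n1 by (intro norm_Ln_le) auto
    thus "norm (Ln (1 + of_real t * v)) \<le> 1" using n1 t by simp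
   qed simp
  qed simp
  thus ?thesis using True by simp
 qed
 have M0: "M \<ge> 0" using a norm_ge_zero[of a] by linarith
 have al: "norm (a * Ln (1 + v)) \<le> M * (2 * norm v)" unfolding norm_mult by (rule mult_mono) (use a l M0 in auto)
 have "M * (2 * norm v) \<le> M * 1" using v M0 by (intro mult_left_mono) auto
 hence e: "exp (norm (a * Ln (1 + v))) \<le> exp M" using al by simp
 have "norm ((1 + v) powr a - 1) = norm (exp (a * Ln (1 + v)) - 1)" using n by (simp add: powr_def)
 also have "\<dots> \<le> norm (a * Ln (1 + v)) * exp (norm (a * Ln (1 + v)))" by (rule norm_exp_minus_one_le)
 also have "\<dots> \<le> M * (2 * norm v) * exp M" using al e M0 by (intro mult_mono) auto
 finally show ?thesis by (simp add: mult_ac)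
qed

lemma one_minus_mult_not_nonpos:
 assumes "1 - v \<notin> \<real>\<^sub>\<le>\<^sub>0" "0 \<le> t" "t \<le> 1"
 shows "1 - v * complex_of_real t \<notin> \<real>\<^sub>\<le>\<^sub>0"
proof
 assume "1 - v * complex_of_real t \<in> \<real>\<^sub>\<le>\<^sub>0"
 hence h: "Re v * t \<ge> 1" "Im v * t = 0" by (auto simp: complex_nonpos_Reals_iff)
 hence "t ~= 0" by auto
 hence i: "Im v = 0" using h by auto
 have "Re v > 0" using h(1) assms(2) by (metis less_numeral_extra(1) less_le_trans zero_less_mult_pos2 \<open>t ~= 0\<close> less_eq_real_def)
 hence "Re v * t \<le> Re v * 1" using assms(3) by (intro mult_left_mono) auto
 hence "Re v \<ge> 1" using h(1) by simp
 thus False using i assms(1) by (auto simp: complex_nonpos_Reals_iff)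
qed

lemma one_minus_small_not_nonpos:
 fixes v :: complex
 shows "norm v < 1 ==> 1 - v \<notin> \<real>\<^sub>\<le>\<^sub>0"
 using abs_Re_le_cmod[of v] by (auto simp: complex_nonpos_Reals_iff)

lemma continuous_Jint_integrand:
 assumes "1 - v \<notin> \<real>\<^sub>\<le>\<^sub>0"
 shows "continuous_on {0..1} (%q. (1 - v * complex_of_real (q\<^sup>2)) powr (u - 1))"
proof (rule continuous_on_powr_slit)
 fix q :: real assume "q \<in> {0..1}"
 thus "1 - v * complex_of_real (q\<^sup>2) \<notin> \<real>\<^sub>\<le>\<^sub>0" using assms by (intro one_minus_mult_not_nonpos) (auto simp: power_le_one)
qed (intro continuous_intros)+

lemma Jint_eq_integral:
 assumes "1 - v \<notin> \<real>\<^sub>\<le>\<^sub>0"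
 shows "Jint u v = integral {0..1} (%q. (1 - v * complex_of_real (q\<^sup>2)) powr (u - 1))"
 unfolding Jint_def by (rule unitM_integral(2)[OF continuous_Jint_integrand[OF assms]])

lemma Jint_bound:
 assumes v: "norm v \<le> 1 / 2" and u: "norm (u - 1) \<le> M"
 shows "norm (Jint u v - 1) \<le> 2 * M * exp M * norm v"
proof -
 have nv: "1 - v \<notin> \<real>\<^sub>\<le>\<^sub>0" using v by (intro one_minus_small_not_nonpos) simp
 note c = continuous_Jint_integrand[OF nv, of u]
 have M0: "M \<ge> 0" using u norm_ge_zero[of "u - 1"] by linarith
 have "Jint u v - 1 = integral {0..1} (%q. (1 - v * complex_of_real (q\<^sup>2)) powr (u - 1) - 1)"
  unfolding Jint_eq_integral[OF nv]
  by (subst Henstock_Kurzweil_Integration.integral_diff[OF integrable_continuous_real[OF c] integrable_const_ivl[of 1]], simp)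
 also have "norm \<dots> \<le> 2 * M * exp M * norm v * (1 - 0)"
 proof (rule integral_bound)
  show "continuous_on {0..1} (%q. (1 - v * complex_of_real (q\<^sup>2)) powr (u - 1) - 1)"
   by (intro continuous_on_diff c continuous_on_const)
  fix t :: real assume t: "t \<in> {0..1}"
  hence t2: "t\<^sup>2 \<le> 1" by (simp add: power_le_one)
  have "norm (- (v * complex_of_real (t\<^sup>2))) = norm v * t\<^sup>2" by (simp add: norm_mult norm_power)
  also have "\<dots> \<le> norm v * 1" using t2 by (intro mult_left_mono) auto
  finally have n: "norm (- (v * complex_of_real (t\<^sup>2))) \<le> norm v" by simp
  hence "norm ((1 + - (v * complex_of_real (t\<^sup>2))) powr (u - 1) - 1) \<le> 2 * M * exp M * norm (- (v * complex_of_real (t\<^sup>2)))"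
   using v by (intro one_plus_powr_minus_one_bound u) simp
  also have "\<dots> \<le> 2 * M * exp M * norm v" using n M0 by (intro mult_left_mono) auto
  finally show "norm ((1 - v * complex_of_real (t\<^sup>2)) powr (u - 1) - 1) \<le> 2 * M * exp M * norm v" by simp
 qed auto
 finally show ?thesis by simp
qed

text \<open>Compactness of a closed disc times [0, 1] supplies a constant majorant, which is
  integrable on the unit interval.\<close>

lemma holomorphic_unit_integral:
 fixes f :: "complex => real => complex"
 assumes S: "open S" and c: "continuous_on (S \<times> {0..1}) (%(w, q). f w q)"
  and hol: "\<And>q. 0 \<le> q ==> q \<le> 1 ==> (%w. f w q) holomorphic_on S"
 shows "(%w. integral\<^sup>L unitM (f w)) holomorphic_on S"
proof (rule holomorphic_integral[OF S])
 fix w assume w: "w \<in> S"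
 have "continuous_on {0<..<1 :: real} (%q. (w, q))" by (intro continuous_on_Pair continuous_on_const continuous_on_id)
 moreover have "(%q. (w, q)) ` {0<..<1} \<subseteq> S \<times> {0..1 :: real}" using w by auto
 ultimately have "continuous_on {0<..<1} (%q. (%(w, q). f w q) (w, q))" by (rule continuous_on_compose2[OF c])
 hence "continuous_on {0<..<1} (f w)" by simp
 thus "f w \<in> borel_measurable unitM" by (rule continuous_on_unitM_measurable)
 obtain r where r: "r > 0" "cball w r \<subseteq> S" using S w open_contains_cball by blast
 have "compact ((%(w, q). f w q) ` (cball w r \<times> {0..1}))"
  using r by (intro compact_continuous_image continuous_on_subset[OF c] compact_Times) auto
 from compact_imp_bounded[OF this] obtain B where B: "\<And>p. p \<in> cball w r \<times> {0..1} ==> norm ((%(w, q). f w q) p) \<le> B"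
  unfolding bounded_iff by auto
 have "\<forall>w'\<in>ball w r. \<forall>q\<in>space unitM. norm (f w' q) \<le> B"
  using B by (fastforce simp: space_unitM)
 thus "\<exists>r>0. \<exists>g. ball w r \<subseteq> S \<and> integrable unitM g \<and> (\<forall>w'\<in>ball w r. \<forall>q\<in>space unitM. norm (f w' q) \<le> g q)"
  using r integrable_unitM_const[of B] ball_subset_cball[of w r] by blast
next
 fix q assume "q \<in> space unitM"
 thus "(%w. f w q) holomorphic_on S" by (intro hol) (auto simp: space_unitM)
qed

lemma open_one_minus_slit: "open {v :: complex. 1 - v \<notin> \<real>\<^sub>\<le>\<^sub>0}"
proof -
 have "open ((%v :: complex. 1 - v) -` (- \<real>\<^sub>\<le>\<^sub>0))" by (intro open_vimage continuous_intros) auto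
 thus ?thesis by (simp add: vimage_def)
qed

lemma Jint_holomorphic: "Jint u holomorphic_on {v. 1 - v \<notin> \<real>\<^sub>\<le>\<^sub>0}"
proof -
 have "(%w. \<integral>q. (1 - w * of_real (q\<^sup>2)) powr (u - 1) \<partial>unitM) holomorphic_on {v. 1 - v \<notin> \<real>\<^sub>\<le>\<^sub>0}"
 proof (rule holomorphic_unit_integral[OF open_one_minus_slit])
  have "continuous_on ({v. 1 - v \<notin> \<real>\<^sub>\<le>\<^sub>0} \<times> {0..1}) (%p. (1 - fst p * complex_of_real ((snd p)\<^sup>2)) powr (u - 1))"
   by (intro continuous_on_powr_slit continuous_intros one_minus_mult_not_nonpos) (auto simp: power_le_one)
  thus "continuous_on ({v. 1 - v \<notin> \<real>\<^sub>\<le>\<^sub>0} \<times> {0..1}) (%(w, q). (1 - w * complex_of_real (q\<^sup>2)) powr (u - 1))"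
   by (simp add: case_prod_unfold)
  fix q :: real assume q: "0 \<le> q" "q \<le> 1"
  show "(%w. (1 - w * complex_of_real (q\<^sup>2)) powr (u - 1)) holomorphic_on {v. 1 - v \<notin> \<real>\<^sub>\<le>\<^sub>0}"
   by (intro holomorphic_intros one_minus_mult_not_nonpos) (use q in \<open>auto simp: power_le_one\<close>)
 qed
 thus ?thesis unfolding Jint_def[abs_def] .
qed

lemma Jint_holomorphic_exponent:
 assumes v: "1 - v \<notin> \<real>\<^sub>\<le>\<^sub>0"
 shows "(%u. Jint u v) holomorphic_on UNIV"
 unfolding Jint_def
proof (rule holomorphic_unit_integral[OF open_UNIV])
 have "continuous_on (UNIV \<times> {0..1}) (%p. (1 - v * complex_of_real ((snd p)\<^sup>2)) powr (fst p - 1))"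
  by (intro continuous_on_powr_slit continuous_intros one_minus_mult_not_nonpos v) (auto simp: power_le_one)
 thus "continuous_on (UNIV \<times> {0..1}) (%(u, q). (1 - v * complex_of_real (q\<^sup>2)) powr (u - 1))"
  by (simp add: case_prod_unfold)
 fix q :: real assume q: "0 \<le> q" "q \<le> 1"
 have "1 - v * complex_of_real (q\<^sup>2) \<notin> \<real>\<^sub>\<le>\<^sub>0" using q v by (intro one_minus_mult_not_nonpos) (auto simp: power_le_one)
 hence "1 - v * complex_of_real (q\<^sup>2) ~= 0" by auto
 thus "(%u. (1 - v * complex_of_real (q\<^sup>2)) powr (u - 1)) holomorphic_on UNIV"
  by (intro holomorphic_intros)
qed

lemma Rfun_holomorphic: "Rfun s holomorphic_on {v. 1 - v \<notin> \<real>\<^sub>\<le>\<^sub>0}"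
proof -
 have "(%v. (1 - v) powr (- (s + 1 / 2)) * Jint (s + 1 / 2) v) holomorphic_on {v. 1 - v \<notin> \<real>\<^sub>\<le>\<^sub>0}"
  by (intro holomorphic_on_mult Jint_holomorphic holomorphic_intros) auto
 thus ?thesis unfolding Rfun_def[abs_def] .
qed

lemma Rfun_holomorphic_exponent:
 assumes v: "1 - v \<notin> \<real>\<^sub>\<le>\<^sub>0"
 shows "(%s. Rfun s v) holomorphic_on S"
proof -
 have n: "1 - v ~= 0" using v by auto
 have "(%s. Jint (s + 1 / 2) v) holomorphic_on UNIV"
  using holomorphic_on_compose_gen[OF _ Jint_holomorphic_exponent[OF v], of "%s. s + 1 / 2" UNIV]
  by (simp add: o_def holomorphic_intros)
 moreover have "(%s. (1 - v) powr (- (s + 1 / 2))) holomorphic_on UNIV"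
  using n by (intro holomorphic_intros) auto
 ultimately have "(%s. Rfun s v) holomorphic_on UNIV" unfolding Rfun_def by (rule holomorphic_on_mult[rotated])
 thus ?thesis by (rule holomorphic_on_subset) auto
qed

text \<open>Both values are 1 + O(v), so the constant terms cancel in the difference.\<close>

lemma Rfun_bound:
 assumes v: "norm v \<le> 1 / 2" and M: "norm s + 1 \<le> M"
 shows "norm (Rfun s v - Rfun s (- v)) \<le> 2 * M * exp M * (2 * M * exp M + 4) * norm v"
proof -
 define C where "C = 2 * M * exp M"
 have M0: "M \<ge> 0" using M norm_ge_zero[of s] by linarith
 hence C0: "C \<ge> 0" by (simp add: C_def)
 have a: "norm (- (s + 1 / 2)) \<le> M" "norm (s + 1 / 2 - 1) \<le> M"
 proof -
  have "norm (- (s + 1 / 2)) \<le> norm s + norm (1 / 2 :: complex)" by (metis norm_minus_cancel norm_triangle_ineq)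
  thus "norm (- (s + 1 / 2)) \<le> M" using M by simp
  have "norm (s - 1 / 2) \<le> norm s + norm (1 / 2 :: complex)" by (rule norm_triangle_ineq4)
  thus "norm (s + 1 / 2 - 1) \<le> M" using M by simp
 qed
 have R: "norm (Rfun s w - 1) \<le> C * (C / 2 + 2) * norm w" if w: "norm w \<le> 1 / 2" for w
 proof -
  define p where "p = (1 - w) powr (- (s + 1 / 2)) - 1"
  define j where "j = Jint (s + 1 / 2) w - 1"
  have p: "norm p \<le> C * norm w"
   using one_plus_powr_minus_one_bound[of "- w", OF _ a(1)] w by (simp add: p_def C_def)
  have j: "norm j \<le> C * norm w" unfolding j_def C_def by (rule Jint_bound[OF w a(2)])
  have "C * norm w \<le> C * (1 / 2)" using w C0 by (intro mult_left_mono) auto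
  hence p2: "norm p \<le> C / 2" using p by simp
  have "Rfun s w - 1 = p * j + p + j" by (simp add: Rfun_def p_def j_def algebra_simps)
  hence "norm (Rfun s w - 1) \<le> norm p * norm j + norm p + norm j"
   using norm_triangle_ineq[of "p * j + p" j] norm_triangle_ineq[of "p * j" p] by (simp add: norm_mult)
  also have "\<dots> \<le> C / 2 * (C * norm w) + C * norm w + C * norm w"
   using p p2 j C0 by (intro add_mono mult_mono) auto
  finally show ?thesis by (simp add: algebra_simps)
 qed
 have "Rfun s v - Rfun s (- v) = (Rfun s v - 1) - (Rfun s (- v) - 1)" by simp
 hence "norm (Rfun s v - Rfun s (- v)) \<le> norm (Rfun s v - 1) + norm (Rfun s (- v) - 1)" by (metis norm_triangle_ineq4)
 also have "\<dots> \<le> C * (C / 2 + 2) * norm v + C * (C / 2 + 2) * norm (- v)" using v by (intro add_mono R) auto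
 finally show ?thesis unfolding C_def[symmetric] by (simp add: algebra_simps)
qed

lemma norm_of_nat_powr: "d > 0 ==> norm (of_nat d powr s :: complex) = real d powr Re s"
 by (simp add: norm_powr_real_powr powr_def)

lemma divisor_sigma_bound:
 assumes s: "Re s \<ge> 0" and n: "n > 0"
 shows "norm (divisor_sigma s n) \<le> real n powr Re s * real (card {d. d dvd n})"
proof -
 have "norm (divisor_sigma s n) \<le> (\<Sum>d | d dvd n. real n powr Re s)"
  unfolding divisor_sigma_def
 proof (rule sum_norm_le)
  fix d assume "d \<in> {d. d dvd n}"
  hence d: "d > 0" "d \<le> n" using n by (auto intro: dvd_imp_le Nat.gr0I)
  show "norm (of_nat d powr s :: complex) \<le> real n powr Re s"
   unfolding norm_of_nat_powr[OF d(1)] using d s by (intro powr_mono2) auto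
 qed
 thus ?thesis by (simp add: mult.commute)
qed

lemma card_divisors_le: "n > 0 ==> card {d. d dvd n} \<le> n"
proof -
 assume "n > 0"
 hence "{d. d dvd n} \<subseteq> {1..n}" by (auto intro: dvd_imp_le Suc_leI Nat.gr0I)
 from card_mono[OF _ this] show ?thesis by simp
qed

text \<open>With n = d m the power n^(-3/2) factors, so this is the square of a convergent series
  regrouped by divisors. It is the majorant for the kernel series, both as a function of z and as a
  function of s.\<close>

lemma summable_card_divisors:
 "summable (%n. real (card {d. d dvd Suc n}) * real (Suc n) powr (- 3 / 2))"
proof -
 define F where "F = (%d m. (real (Suc d) powr (- 3 / 2)) * (real (Suc m) powr (- 3 / 2)))"
 have s: "summable (%m. real (Suc m) powr (- 3 / 2))" using summable_powr_shift[of "3 / 2"] by simp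
 have nF: "norm (F d m) = F d m" for d m by (simp add: F_def)
 have 1: "summable (%m. norm (F d m))" for d unfolding nF unfolding F_def by (rule summable_mult[OF s])
 have 2: "summable (%d. \<Sum>m. norm (F d m))" unfolding nF unfolding F_def suminf_mult[OF s] by (rule summable_mult2[OF s])
 have "F (d - 1) (Suc n div d - 1) = real (Suc n) powr (- 3 / 2)" if "d dvd Suc n" for d n
 proof -
  have d: "d > 0" "Suc n div d > 0" using that by (auto intro: Nat.gr0I simp: dvd_div_eq_0_iff)
  have "real (Suc n) = real d * real (Suc n div d)" using that by (metis dvd_mult_div_cancel of_nat_mult)
  thus ?thesis using d by (simp add: F_def powr_mult)
 qed
 hence "(\<Sum>d | d dvd Suc n. F (d - 1) (Suc n div d - 1)) = real (card {d. d dvd Suc n}) * real (Suc n) powr (- 3 / 2)" for n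
  by simp
 with sums_summable[OF divisor_sum_regroup[OF 1 2]] show ?thesis by simp
qed

lemma summable_powr_exp_sqrt:
 assumes c: "c > 0" shows "summable (%n. real (Suc n) powr a * exp (- c * sqrt (real (Suc n))))"
proof (rule summable_comparison_test_bigo)
 show "summable (%n. norm (real (Suc n) powr (- 2)))" using summable_powr_shift[of 2] by simp
 have O: "(%x. x powr a * exp (- c * sqrt x)) \<in> O(%x::real. x powr (- 2))" using c by real_asymp
 show "(%n. real (Suc n) powr a * exp (- c * sqrt (real (Suc n)))) \<in> O(%n. real (Suc n) powr (- 2))"
  by (rule landau_o.big.compose[OF O filterlim_compose[OF filterlim_real_sequentially filterlim_Suc]])
qed

lemma divisor_sigma_holomorphic: "(%s. divisor_sigma s n) holomorphic_on S"
 unfolding divisor_sigma_def by (intro holomorphic_intros)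

section \<open>Analytic continuation\<close>

text \<open>The general term of G(z). At z = ix and z = -ix the exponent has real and imaginary
  parts of equal size, the source of the exponential times sine on the left-hand side.\<close>

definition gterm :: "complex => complex => nat => complex" where
 "gterm s z n = divisor_sigma s (Suc n) / of_real (sqrt (real (Suc n))) * exp (- (4 * of_real pi * of_real (sqrt (real (Suc n))) * csqrt z))"

definition kterm :: "complex => complex => nat => complex" where
 "kterm s z n = divisor_sigma s (Suc n) * of_nat (Suc n) powr (- (s + 1 / 2)) * kap s (z / of_nat (Suc n))"

lemma divisor_sigma_of_real:
 "divisor_sigma (of_real s) (Suc n) = of_real (\<Sum>d | d dvd Suc n. real d powr s)"
proof -
 have "of_nat d powr of_real s = complex_of_real (real d powr s)" for d
  using powr_of_real[of "real d" s] by simp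
 thus ?thesis by (simp add: divisor_sigma_def)
qed

lemma zeta_sum_eq:
 assumes "a > 1" shows "of_real (zeta_sum a) = riemann_zeta (of_real a)"
proof -
 have "(%n. of_nat (Suc n) powr (- of_real a)) sums riemann_zeta (of_real a)"
  by (rule riemann_zeta_sums) (use assms in simp)
 moreover have "of_nat (Suc n) powr (- of_real a) = complex_of_real (real (n + 1) powr (- a))" for n
  using powr_of_real[of "real (Suc n)" "- a"] by simp
 ultimately have 1: "(%n. complex_of_real (real (n + 1) powr (- a))) sums riemann_zeta (of_real a)" by simp
 have "(%n. real (n + 1) powr (- a)) sums zeta_sum a"
  unfolding zeta_sum_def using summable_powr_shift[OF assms] by (rule summable_sums)
 hence "(%n. complex_of_real (real (n + 1) powr (- a))) sums of_real (zeta_sum a)" by (rule sums_of_real)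
 thus ?thesis using 1 by (rule sums_unique2)
qed

lemma divisor_pair:
 assumes "d dvd Suc n"
 shows "Suc (d - 1) = d" "Suc (d - 1) * Suc (Suc n div d - 1) = Suc n" "real (Suc (Suc n div d - 1)) = real (Suc n) / real d" "d > 0"
proof -
 show d: "d > 0" using assms by (auto intro: Nat.gr0I)
 thus d1: "Suc (d - 1) = d" by simp
 have "Suc n div d > 0" using assms by (auto intro: Nat.gr0I simp: dvd_div_eq_0_iff)
 hence q: "Suc (Suc n div d - 1) = Suc n div d" by simp
 show "Suc (d - 1) * Suc (Suc n div d - 1) = Suc n" unfolding d1 q using assms by simp
 show "real (Suc (Suc n div d - 1)) = real (Suc n) / real d" unfolding q using assms by (rule real_of_nat_div)
qed

text \<open>The real identity times sqrt(2), collected by n. The restriction z < 1 puts all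
  quotients z/n with n >= 1 into (0, 1), where \<open>kernel_int_eval\<close> applies.\<close>

lemma G_complex_real:
 fixes s z :: real
 assumes s: "0 < s" "s < 1 / 2" and z: "0 < z" "z < 1"
 defines "u \<equiv> s + 1 / 2"
 shows "(\<Sum>n. gterm (of_real s) (of_real z) n) =
  of_real (sqrt 2 * lipc u * Gamma (s + 1) * (2 * pi) powr (- s - 1)) * riemann_zeta (of_real s + 1) * of_real z powr (- (of_real s + 1 / 2))
  + riemann_zeta (1 - of_real s) / of_real (2 * pi) * of_real z powr (- (1 / 2))
  + riemann_zeta (1 / 2 - of_real s) * riemann_zeta (1 / 2)
  - of_real (lip_const u / sqrt 2) * csqrt (of_real z)
  + of_real (sqrt 2 * lipc u) * (\<Sum>n. kterm (of_real s) (of_real z) n)"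
proof -
 have u: "1 / 2 < u" "u < 1" "0 < u" using s by (simp_all add: u_def)
 obtain Y where Y: "(%n. \<Sum>d | d dvd Suc n. lipc u / pi * (real (Suc (d - 1)) powr (u - 1 / 2) * kernel_int u z (Suc (d - 1) * Suc (Suc n div d - 1)))) sums Y"
  and X: "(%n. \<Sum>d | d dvd Suc n. series_term u z (d - 1) (Suc n div d - 1)) sums
   (lipc u * z powr (- u) * (Gamma (u + 1 / 2) * (2 * pi) powr (- u - 1 / 2) * zeta_sum (u + 1 / 2))
    + 1 / (2 * pi) * (z powr (- 1 / 2) * (sqrt pi * (2 * pi) powr (- 1 / 2) * zeta_real (3 / 2 - u)))
    + zeta_real (1 - u) * (zeta_real (1 / 2) / sqrt 2)
    + Y - 1 / 2 * (sqrt z * lip_const u))" (is "_ sums ?X")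
  using G_real[OF u(1,2) z(1)] by blast
 have g: "gterm (of_real s) (of_real z) n = of_real (sqrt 2 * (\<Sum>d | d dvd Suc n. series_term u z (d - 1) (Suc n div d - 1)))" for n
 proof -
  define N where "N = real (Suc n)"
  have N: "N > 0" by (simp add: N_def)
  have t: "sqrt 2 * series_term u z (d - 1) (Suc n div d - 1) = real d powr s * (1 / sqrt N * exp (- (4 * pi * sqrt N * sqrt z)))" if d: "d dvd Suc n" for d
  proof -
   note p = divisor_pair[OF d]
   have d0: "real d > 0" using p by simp
   have "real (Suc (d - 1)) * real (Suc (Suc n div d - 1)) = real (Suc (d - 1) * Suc (Suc n div d - 1))" by (rule of_nat_mult[symmetric])
   hence m: "real (Suc (d - 1)) * real (Suc (Suc n div d - 1)) = N" unfolding p(2) N_def .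
   have r: "sqrt 2 * (real d powr (u - 1) * sqrt (1 / (2 * (N / real d)))) = real d powr s * (1 / sqrt N)"
   proof -
    have r1: "real d powr (u - 1) * sqrt (real d) = real d powr s"
     using d0 by (simp add: powr_half_sqrt[symmetric] powr_add[symmetric] u_def)
    have r2: "sqrt (1 / (2 * (N / real d))) = sqrt (real d) / (sqrt 2 * sqrt N)"
     by (simp add: real_sqrt_divide real_sqrt_mult)
    have alg: "w * (P * (q / (w * y))) = P * q * (1 / y)" if "w ~= 0" for w P q y :: real using that by simp
    show ?thesis unfolding r2 r1[symmetric] by (rule alg) simp
   qed
   have "sqrt 2 * series_term u z (d - 1) (Suc n div d - 1) = sqrt 2 * (real d powr (u - 1) * sqrt (1 / (2 * (N / real d)))) * exp (- 4 * pi * sqrt (N * z))"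
    unfolding series_term_def m unfolding p(1) p(3) N_def by (simp only: mult.assoc)
   also have "\<dots> = real d powr s * (1 / sqrt N) * exp (- (4 * pi * sqrt N * sqrt z))" unfolding r by (simp add: real_sqrt_mult mult.assoc)
   finally show ?thesis by (simp only: mult.assoc)
  qed
  have "sqrt 2 * (\<Sum>d | d dvd Suc n. series_term u z (d - 1) (Suc n div d - 1)) = (\<Sum>d | d dvd Suc n. real d powr s * (1 / sqrt N * exp (- (4 * pi * sqrt N * sqrt z))))"
   unfolding sum_distrib_left by (rule sum.cong[OF refl], rule t) simp
  also have "\<dots> = (\<Sum>d | d dvd Suc n. real d powr s) * (1 / sqrt N * exp (- (4 * pi * sqrt N * sqrt z)))" by (rule sum_distrib_right[symmetric])
  finally have e: "sqrt 2 * (\<Sum>d | d dvd Suc n. series_term u z (d - 1) (Suc n div d - 1)) = \<dots>" .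
  have q: "csqrt (of_real z) = of_real (sqrt z)" using z by (simp add: csqrt_of_real)
  have x: "exp (- (4 * complex_of_real pi * of_real (sqrt N) * of_real (sqrt z))) = of_real (exp (- (4 * pi * sqrt N * sqrt z)))"
   by (simp add: exp_of_real[symmetric])
  show ?thesis unfolding e gterm_def divisor_sigma_of_real q N_def[symmetric] x by simp
 qed
 have k: "of_real (sqrt 2 * lipc u) * kterm (of_real s) (of_real z) n = of_real (sqrt 2 * (\<Sum>d | d dvd Suc n. lipc u / pi * (real (Suc (d - 1)) powr (u - 1 / 2) * kernel_int u z (Suc (d - 1) * Suc (Suc n div d - 1)))))" for n
 proof -
  define N where "N = real (Suc n)"
  have N: "N > 0" "N \<ge> 1" by (simp_all add: N_def)
  have zn: "0 < z / N" "z / N < 1" using z N by (auto simp: divide_less_eq)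
  have u2: "u - 1 / 2 = s" by (simp add: u_def)
  have K: "kernel_int u z (Suc n) = N powr (- u) * kernel_int u (z / N) 1" unfolding N_def by (rule kernel_int_scale) simp
  have KE: "complex_of_real (kernel_int u (z / N) 1) = of_real pi * kap (of_real s) (of_real (z / N))"
   using kernel_int_eval[OF u(3) zn] unfolding u2 .
  have "(\<Sum>d | d dvd Suc n. lipc u / pi * (real (Suc (d - 1)) powr (u - 1 / 2) * kernel_int u z (Suc (d - 1) * Suc (Suc n div d - 1))))
   = (\<Sum>d | d dvd Suc n. real d powr s * (lipc u / pi * kernel_int u z (Suc n)))"
  proof (rule sum.cong[OF refl])
   fix d assume "d \<in> {d. d dvd Suc n}"
   hence d: "d dvd Suc n" by simp
   show "lipc u / pi * (real (Suc (d - 1)) powr (u - 1 / 2) * kernel_int u z (Suc (d - 1) * Suc (Suc n div d - 1))) = real d powr s * (lipc u / pi * kernel_int u z (Suc n))"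
    unfolding divisor_pair(2)[OF d] unfolding divisor_pair(1)[OF d] u2 by (simp only: mult_ac)
  qed
  also have "\<dots> = (\<Sum>d | d dvd Suc n. real d powr s) * (lipc u / pi * kernel_int u z (Suc n))" by (rule sum_distrib_right[symmetric])
  finally have e: "(\<Sum>d | d dvd Suc n. lipc u / pi * (real (Suc (d - 1)) powr (u - 1 / 2) * kernel_int u z (Suc (d - 1) * Suc (Suc n div d - 1)))) = \<dots>" .
  have a: "of_nat (Suc n) powr (- (complex_of_real s + 1 / 2)) = of_real (N powr (- u))"
   using powr_of_real[of N "- u"] N unfolding N_def by (simp add: u_def)
  have v: "complex_of_real z / of_nat (Suc n) = of_real (z / N)" by (simp add: N_def)
  have alg: "c2 * l * (S * b * q) = c2 * (S * (l / P * (b * (P * q))))" if "P ~= 0" for c2 l S b q P :: complex using that by simp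
  show ?thesis unfolding e K kterm_def divisor_sigma_of_real a v
   unfolding of_real_mult of_real_divide KE by (rule alg) simp
 qed
 have G: "(\<Sum>n. gterm (of_real s) (of_real z) n) = of_real (sqrt 2 * ?X)"
  unfolding g by (rule sums_unique[symmetric], rule sums_of_real, rule sums_mult[OF X])
 have K: "(%n. of_real (sqrt 2 * lipc u) * kterm (of_real s) (of_real z) n) sums of_real (sqrt 2 * Y)"
  unfolding k by (rule sums_of_real, rule sums_mult[OF Y])
 have l0: "complex_of_real (sqrt 2 * lipc u) ~= 0" using Gamma_real_pos[OF u(3)] by (simp add: lipc_def)
 have sk: "summable (%n. kterm (of_real s) (of_real z) n)" using sums_summable[OF K] l0 by (rule summable_mult_D)
 have K': "of_real (sqrt 2 * lipc u) * (\<Sum>n. kterm (of_real s) (of_real z) n) = of_real (sqrt 2 * Y)"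
  using sums_unique2[OF summable_sums[OF sk, THEN sums_mult, of "of_real (sqrt 2 * lipc u)"] K] .
 have z1: "riemann_zeta (complex_of_real s + 1) = of_real (zeta_sum (u + 1 / 2))"
  using zeta_sum_eq[of "u + 1 / 2"] s by (simp add: u_def add.commute add.left_commute)
 have z2: "riemann_zeta (1 - complex_of_real s) = of_real (zeta_real (3 / 2 - u))"
  using riemann_zeta_of_real[of "1 - s"] s by (simp add: u_def)
 have z3: "riemann_zeta (1 / 2 - complex_of_real s) = of_real (zeta_real (1 - u))"
  using riemann_zeta_of_real[of "1 / 2 - s"] s by (simp add: u_def)
 have z4: "riemann_zeta (1 / 2) = of_real (zeta_real (1 / 2))"
  using riemann_zeta_of_real[of "1 / 2"] by simp
 have p1: "of_real z powr (- (complex_of_real s + 1 / 2)) = of_real (z powr (- u))"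
  using powr_of_real[of z "- u"] z by (simp add: u_def)
 have p2: "of_real z powr (- (1 / 2)) = complex_of_real (z powr (- 1 / 2))"
  using powr_of_real[of z "- 1 / 2"] z by simp
 have q: "csqrt (of_real z) = of_real (sqrt z)" using z by (simp add: csqrt_of_real)
 have us: "u + 1 / 2 = s + 1" "- u - 1 / 2 = - s - 1" by (simp_all add: u_def)
 have sp: "sqrt pi * (2 * pi) powr (- 1 / 2) = 1 / sqrt 2"
  by (simp add: powr_minus_divide powr_half_sqrt real_sqrt_mult)
 have alg: "r * (l * a * (b * c * d) + 1 / P * (e * (f * g)) + h * (i / r) + y - 1 / 2 * (w * k)) = r * l * b * c * d * a + g / P * e + h * i - k / r * w + r * y"
  if "r ~= 0" "r * f = 1" "1 / r = r / 2" for r l a b c d P e f g h i y w k :: real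
 proof -
  have "r * (1 / P * (e * (f * g))) = (r * f) * (g / P * e)" by simp
  hence 1: "r * (1 / P * (e * (f * g))) = g / P * e" unfolding that(2) by simp
  have 2: "r * (1 / 2 * (w * k)) = (1 / r) * k * w" unfolding that(3) by simp
  show ?thesis unfolding distrib_left right_diff_distrib 1 2 using that(1) by (simp add: mult_ac)
 qed
 have "sqrt 2 * ?X = sqrt 2 * lipc u * Gamma (s + 1) * (2 * pi) powr (- s - 1) * zeta_sum (u + 1 / 2) * z powr (- u)
  + zeta_real (3 / 2 - u) / (2 * pi) * z powr (- 1 / 2) + zeta_real (1 - u) * zeta_real (1 / 2) - lip_const u / sqrt 2 * sqrt z + sqrt 2 * Y"
  unfolding us sp by (rule alg) (simp_all add: real_div_sqrt)
 thus ?thesis unfolding G K' z1 z2 z3 z4 p1 p2 q by simp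
qed

text \<open>The cut along (-infinity, 0] serves powers and roots of z, the cut along [1, infinity)
  serves powers of 1 - v and \<open>Jint\<close>. The domain is stable under division by positive
  integers and contains ix and -ix for every x > 0.\<close>

definition dslit :: "complex set" where "dslit = {z. z \<notin> \<real>\<^sub>\<le>\<^sub>0 \<and> 1 - z \<notin> \<real>\<^sub>\<le>\<^sub>0}"

lemma dslit_eq: "dslit = - (complex_of_real ` ({..0} \<union> {1..}))"
 by (auto simp: dslit_def complex_nonpos_Reals_iff complex_double_slot_eq)

lemma open_dslit: "open dslit"
proof -
 have "dslit = (- \<real>\<^sub>\<le>\<^sub>0) \<inter> {v. 1 - v \<notin> \<real>\<^sub>\<le>\<^sub>0}" by (auto simp: dslit_def)
 thus ?thesis using open_Int[OF open_Compl[OF closed_nonpos_Reals_complex] open_one_minus_slit] by simp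
qed

lemma connected_dslit: "connected dslit"
 unfolding dslit_eq by (intro starlike_imp_connected starlike_doubly_slotted_complex_plane) simp

lemma dslit_imp:
 assumes "v \<in> dslit"
 shows "v \<notin> \<real>\<^sub>\<le>\<^sub>0" "v ~= 0" "1 - v \<notin> \<real>\<^sub>\<le>\<^sub>0" "1 + v \<notin> \<real>\<^sub>\<le>\<^sub>0"
 using assms by (auto simp: dslit_def complex_nonpos_Reals_iff)

lemma dslit_divide:
 assumes z: "z \<in> dslit" shows "z / of_nat (Suc n) \<in> dslit"
proof -
 have e: "z / of_nat (Suc n) = z * of_real (1 / real (Suc n))" by simp
 have 1: "1 - z * of_real (1 / real (Suc n)) \<notin> \<real>\<^sub>\<le>\<^sub>0"
  by (rule one_minus_mult_not_nonpos) (use dslit_imp[OF z] in auto)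
 have "z * complex_of_real (1 / real (Suc n)) \<notin> \<real>\<^sub>\<le>\<^sub>0"
  using dslit_imp(1)[OF z] by (auto simp: complex_nonpos_Reals_iff divide_le_0_iff)
 thus ?thesis using 1 unfolding e dslit_def by blast
qed

lemma kap_holomorphic: "kap s holomorphic_on dslit"
proof -
 have R1: "Rfun s holomorphic_on dslit"
  by (rule holomorphic_on_subset[OF Rfun_holomorphic]) (auto simp: dslit_def)
 have "(Rfun s \<circ> uminus) holomorphic_on dslit"
  by (rule holomorphic_on_compose_gen[OF _ Rfun_holomorphic]) (auto intro!: holomorphic_intros dest: dslit_imp(4))
 hence R2: "(%v. Rfun s (- v)) holomorphic_on dslit" by (simp add: o_def)
 have "(%v. - sin (of_real pi * s / 2) * ((1 + v) powr (- (s + 1 / 2)) - 1)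
  + cos (of_real pi * s / 2) * ((1 - v) powr (- (s + 1 / 2)) - 1)
  - kap_coeff s * csqrt v * cos (of_real pi * s / 2) * (Rfun s v - Rfun s (- v))) holomorphic_on dslit"
  by (intro holomorphic_intros R1 R2) (simp_all add: dslit_imp)
 thus ?thesis unfolding kap_def[abs_def] .
qed

text \<open>Every bracket of \<open>kap\<close> vanishes to first order at v = 0. With v = z/n this
  yields the factor 1/n that makes the series over n converge.\<close>

lemma kap_bound: "\<exists>K\<ge>0. \<forall>v. norm v \<le> 1 / 2 \<longrightarrow> norm (kap s v) \<le> K * norm v"
proof -
 define M where "M = norm s + 1"
 define C where "C = 2 * M * exp M"
 define S where "S = norm (sin (of_real pi * s / 2))"
 define T where "T = norm (cos (of_real pi * s / 2))"
 define K where "K = S * C + T * C + norm (kap_coeff s) * T * (C * (C + 4))"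
 have C0: "C \<ge> 0" by (simp add: C_def M_def)
 have ST: "S \<ge> 0" "T \<ge> 0" by (simp_all add: S_def T_def)
 have a: "norm (- (s + 1 / 2)) \<le> M"
 proof -
  have "norm (- (s + 1 / 2)) \<le> norm s + norm (1 / 2 :: complex)" by (metis norm_minus_cancel norm_triangle_ineq)
  thus ?thesis by (simp add: M_def)
 qed
 have "norm (kap s v) \<le> K * norm v" if v: "norm v \<le> 1 / 2" for v
 proof -
  define A where "A = sin (of_real pi * s / 2) * ((1 + v) powr (- (s + 1 / 2)) - 1)"
  define B where "B = cos (of_real pi * s / 2) * ((1 + - v) powr (- (s + 1 / 2)) - 1)"
  define D where "D = kap_coeff s * csqrt v * cos (of_real pi * s / 2) * (Rfun s v - Rfun s (- v))"
  have A: "norm A \<le> S * (C * norm v)"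
   unfolding A_def norm_mult S_def[symmetric] C_def using ST by (intro mult_left_mono one_plus_powr_minus_one_bound v a)
  have "norm B \<le> T * (C * norm (- v))"
   unfolding B_def norm_mult T_def[symmetric] C_def by (intro mult_left_mono one_plus_powr_minus_one_bound a) (use v ST in simp_all)
  hence B: "norm B \<le> T * (C * norm v)" by simp
  have q: "norm (csqrt v) \<le> 1" using v by (simp add: cmod_def[symmetric] norm_csqrt)
  have "norm D = norm (kap_coeff s) * norm (csqrt v) * T * norm (Rfun s v - Rfun s (- v))" by (simp add: D_def T_def norm_mult)
  also have "\<dots> \<le> norm (kap_coeff s) * 1 * T * (C * (C + 4) * norm v)"
   unfolding C_def using q ST by (intro mult_mono Rfun_bound v) (auto simp: M_def)
  finally have D: "norm D \<le> norm (kap_coeff s) * T * (C * (C + 4)) * norm v" by (simp add: mult_ac)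
  have "kap s v = - A + B - D" by (simp add: kap_def A_def B_def D_def)
  hence "norm (kap s v) \<le> norm A + norm B + norm D"
   using norm_triangle_ineq4[of "- A + B" D] norm_triangle_ineq[of "- A" B] by simp
  also have "\<dots> \<le> K * norm v" using A B D by (simp add: K_def algebra_simps)
  finally show ?thesis .
 qed
 moreover have "K \<ge> 0" using C0 ST by (simp add: K_def)
 ultimately show ?thesis by blast
qed

lemma norm_sigma_over_sqrt:
 assumes "Re s \<ge> 0"
 shows "norm (divisor_sigma s (Suc n) / of_real (sqrt (real (Suc n)))) \<le> real (Suc n) powr (Re s + 1)"
proof -
 have "norm (divisor_sigma s (Suc n)) \<le> real (Suc n) powr Re s * real (card {d. d dvd Suc n})"
  by (rule divisor_sigma_bound[OF assms]) simp
 also have "\<dots> \<le> real (Suc n) powr Re s * real (Suc n)"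
  using card_divisors_le[of "Suc n"] by (intro mult_left_mono) (simp_all only: of_nat_le_iff zero_less_Suc powr_ge_zero)
 also have "\<dots> = real (Suc n) powr (Re s + 1)" by (simp add: powr_add)
 finally have a: "norm (divisor_sigma s (Suc n)) \<le> real (Suc n) powr (Re s + 1)" .
 have s1: "sqrt (real (Suc n)) \<ge> 1" by simp
 have "norm (divisor_sigma s (Suc n) / of_real (sqrt (real (Suc n)))) = norm (divisor_sigma s (Suc n)) / sqrt (real (Suc n))"
  by (simp add: norm_divide)
 also have "\<dots> \<le> norm (divisor_sigma s (Suc n)) / 1" using s1 by (intro divide_left_mono) auto
 finally show ?thesis using a by simp
qed

lemma gterm_bound:
 assumes "Re s \<ge> 0" "Re (csqrt z) \<ge> \<delta>"
 shows "norm (gterm s z n) \<le> real (Suc n) powr (Re s + 1) * exp (- (4 * pi * \<delta>) * sqrt (real (Suc n)))"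
proof -
 have "norm (exp (- (4 * of_real pi * of_real (sqrt (real (Suc n))) * csqrt z))) = exp (- (4 * pi * Re (csqrt z)) * sqrt (real (Suc n)))"
  by (simp add: mult_ac)
 also have "\<dots> \<le> exp (- (4 * pi * \<delta>) * sqrt (real (Suc n)))" using assms(2) by (simp add: mult_right_mono)
 finally show ?thesis unfolding gterm_def norm_mult using norm_sigma_over_sqrt[OF assms(1)] by (intro mult_mono) auto
qed

lemma Re_csqrt_pos: "z \<notin> \<real>\<^sub>\<le>\<^sub>0 ==> Re (csqrt z) > 0"
 using Re_csqrt[of z] csqrt_principal[of z]
 by (metis csqrt_eq_0 complex_nonpos_Reals_iff Im_power2 Re_power2 less_eq_real_def mult_zero_right mult_zero_left power2_csqrt zero_eq_power2 diff_0 neg_le_0_iff_le zero_le_power2 add_0)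

lemma gsum_holomorphic:
 assumes s: "Re s \<ge> 0"
 shows "(%z. \<Sum>n. gterm s z n) holomorphic_on dslit"
proof (rule holomorphic_suminf[OF open_dslit])
 fix n show "(%z. gterm s z n) holomorphic_on dslit"
  unfolding gterm_def by (intro holomorphic_intros) (simp add: dslit_imp)
next
 fix c assume c: "c \<in> dslit"
 define \<delta> where "\<delta> = Re (csqrt c) / 2"
 have d: "\<delta> > 0" using Re_csqrt_pos[OF dslit_imp(1)[OF c]] by (simp add: \<delta>_def)
 have "isCont csqrt c" using dslit_imp(1)[OF c] by (intro continuous_at_csqrt) auto
 from this[unfolded continuous_at_eps_delta] d obtain r where r: "r > 0" "\<And>z. dist z c < r ==> dist (csqrt z) (csqrt c) < \<delta>" by blast
 obtain r' where r': "r' > 0" "ball c r' \<subseteq> dslit" using open_dslit c openE by blast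
 have "ball c (min r r') \<subseteq> dslit" using r'(2) by auto
 moreover have "summable (%n. real (Suc n) powr (Re s + 1) * exp (- (4 * pi * \<delta>) * sqrt (real (Suc n))))"
  by (rule summable_powr_exp_sqrt) (use d in simp)
 moreover have "\<forall>z\<in>ball c (min r r'). \<forall>n\<ge>0. norm (gterm s z n) \<le> real (Suc n) powr (Re s + 1) * exp (- (4 * pi * \<delta>) * sqrt (real (Suc n)))"
 proof (intro ballI allI impI)
  fix z n assume "z \<in> ball c (min r r')"
  hence "dist (csqrt z) (csqrt c) < \<delta>" by (intro r) (simp add: dist_commute)
  hence "\<bar>Re (csqrt z) - Re (csqrt c)\<bar> < \<delta>" using abs_Re_le_cmod[of "csqrt z - csqrt c"] by (simp add: dist_norm)
  hence "Re (csqrt z) \<ge> \<delta>" unfolding \<delta>_def by linarith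
  thus "norm (gterm s z n) \<le> real (Suc n) powr (Re s + 1) * exp (- (4 * pi * \<delta>) * sqrt (real (Suc n)))" by (rule gterm_bound[OF s])
 qed
 moreover have "min r r' > 0" using r r' by simp
 ultimately show "\<exists>r>0. \<exists>g. \<exists>N. ball c r \<subseteq> dslit \<and> summable g \<and> (\<forall>z\<in>ball c r. \<forall>n\<ge>N. norm (gterm s z n) \<le> g n)"
  by blast
qed

lemma gterm_summable:
 assumes "Re s \<ge> 0" "z \<notin> \<real>\<^sub>\<le>\<^sub>0" shows "summable (gterm s z)"
proof (rule summable_comparison_test)
 show "summable (%n. real (Suc n) powr (Re s + 1) * exp (- (4 * pi * Re (csqrt z)) * sqrt (real (Suc n))))"
  by (rule summable_powr_exp_sqrt) (use Re_csqrt_pos[OF assms(2)] in simp)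
 show "\<exists>N. \<forall>n\<ge>N. norm (gterm s z n) \<le> real (Suc n) powr (Re s + 1) * exp (- (4 * pi * Re (csqrt z)) * sqrt (real (Suc n)))"
  using gterm_bound[OF assms(1) order_refl] by blast
qed

text \<open>With d(n) the number of divisors, sigma_s(n) contributes d(n) n^(Re s), the power n^(-Re
  s - 1/2) and \<open>kap\<close> a factor 1/n: in total d(n) n^(-3/2), with no Re s left in the
  exponent.\<close>

lemma kterm_bound:
 assumes s: "Re s \<ge> 0" and K: "K \<ge> 0" "\<And>v. norm v \<le> 1 / 2 ==> norm (kap s v) \<le> K * norm v"
  and B: "norm z \<le> B" "2 * B \<le> real (Suc n)"
 shows "norm (kterm s z n) \<le> K * B * (real (card {d. d dvd Suc n}) * real (Suc n) powr (- 3 / 2))"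
proof -
 define N where "N = real (Suc n)"
 define c where "c = real (card {d. d dvd Suc n})"
 have N: "N > 0" by (simp add: N_def)
 have 1: "norm (divisor_sigma s (Suc n)) \<le> N powr Re s * c"
  unfolding N_def c_def by (rule divisor_sigma_bound[OF s]) simp
 have 2: "norm (of_nat (Suc n) powr (- (s + 1 / 2)) :: complex) = N powr (- Re s - 1 / 2)"
  unfolding N_def by (subst norm_of_nat_powr) simp_all
 have nv: "norm (z / of_nat (Suc n)) = norm z / N" by (simp add: norm_divide N_def del: of_nat_Suc)
 have h: "norm (z / of_nat (Suc n)) \<le> 1 / 2" unfolding nv using B(1) B(2)[folded N_def] N by (simp add: divide_le_eq)
 have "norm (kap s (z / of_nat (Suc n))) \<le> K * norm (z / of_nat (Suc n))"
  by (rule K(2)[OF h])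
 also have "\<dots> \<le> K * (B / N)" unfolding nv using B N K by (intro mult_left_mono divide_right_mono) auto
 finally have 3: "norm (kap s (z / of_nat (Suc n))) \<le> K * (B / N)" .
 have "norm (kterm s z n) \<le> (N powr Re s * c) * N powr (- Re s - 1 / 2) * (K * (B / N))"
  unfolding kterm_def norm_mult 2 using 1 3 by (intro mult_mono) (auto simp: c_def)
 also have "\<dots> = K * B * (c * ((N powr Re s * N powr (- Re s - 1 / 2)) / N))" by (simp add: mult_ac)
 also have "(N powr Re s * N powr (- Re s - 1 / 2)) / N = N powr (- 3 / 2)"
 proof -
  have "N powr (- 3 / 2) * N powr 1 = N powr (- 1 / 2)" unfolding powr_add[symmetric] by simp
  hence "N powr (- 3 / 2) * N = N powr (- 1 / 2)" using N by simp
  moreover have "N powr Re s * N powr (- Re s - 1 / 2) = N powr (- 1 / 2)" unfolding powr_add[symmetric] by simp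
  ultimately show ?thesis using N by (simp add: field_simps)
 qed
 finally show ?thesis unfolding N_def c_def .
qed

lemma ksum_dominated:
 assumes s: "Re s \<ge> 0"
 shows "\<exists>g N. summable g \<and> (\<forall>z n. norm z \<le> B \<longrightarrow> N \<le> n \<longrightarrow> norm (kterm s z n) \<le> g n)"
proof -
 obtain K where K: "K \<ge> 0" "\<And>v. norm v \<le> 1 / 2 ==> norm (kap s v) \<le> K * norm v" using kap_bound[of s] by blast
 obtain N where N: "2 * B \<le> real N" using real_arch_simple by blast
 have "norm (kterm s z n) \<le> K * B * (real (card {d. d dvd Suc n}) * real (Suc n) powr (- 3 / 2))" if "norm z \<le> B" "N \<le> n" for z n
  using that N by (intro kterm_bound[OF s K]) auto
 thus ?thesis using summable_mult[OF summable_card_divisors, of "K * B"] by blast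
qed

lemma kterm_summable:
 assumes "Re s \<ge> 0" shows "summable (kterm s z)"
proof -
 obtain g N where g: "summable g" "\<And>z' n. norm z' \<le> norm z ==> N \<le> n ==> norm (kterm s z' n) \<le> g n"
  using ksum_dominated[OF assms, of "norm z"] by blast
 show ?thesis by (rule summable_comparison_test[OF _ g(1)]) (use g(2) in blast)
qed

lemma ksum_holomorphic:
 assumes s: "Re s \<ge> 0"
 shows "(%z. \<Sum>n. kterm s z n) holomorphic_on dslit"
proof (rule holomorphic_suminf[OF open_dslit])
 fix n
 have "(kap s \<circ> (%z. z / of_nat (Suc n))) holomorphic_on dslit"
  by (rule holomorphic_on_compose_gen[OF _ kap_holomorphic]) (auto simp del: of_nat_Suc intro!: holomorphic_intros dslit_divide)
 thus "(%z. kterm s z n) holomorphic_on dslit"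
  unfolding kterm_def o_def by (intro holomorphic_on_mult holomorphic_on_const)
next
 fix c assume c: "c \<in> dslit"
 obtain r where r: "r > 0" "ball c r \<subseteq> dslit" using open_dslit c openE by blast
 obtain g N where g: "summable g" "\<And>z n. norm z \<le> norm c + r ==> N \<le> n ==> norm (kterm s z n) \<le> g n"
  using ksum_dominated[OF s, of "norm c + r"] by blast
 have "\<forall>z\<in>ball c r. \<forall>n\<ge>N. norm (kterm s z n) \<le> g n"
 proof (intro ballI allI impI g(2))
  fix z assume "z \<in> ball c r"
  hence "norm (z - c) < r" by (simp add: dist_norm norm_minus_commute)
  thus "norm z \<le> norm c + r" using norm_triangle_ineq2[of z c] by linarith
 qed
 thus "\<exists>r>0. \<exists>g. \<exists>N. ball c r \<subseteq> dslit \<and> summable g \<and> (\<forall>z\<in>ball c r. \<forall>n\<ge>N. norm (kterm s z n) \<le> g n)"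
  using r g(1) by blast
qed

text \<open>Continuation in z from (0, 1) to \<open>dslit\<close>. On the left Re (csqrt z) > 0
  forces exponential decay, on the right the divisor majorant applies, each locally
  uniformly.\<close>

lemma G_complex:
 fixes s :: real and z :: complex
 assumes s: "0 < s" "s < 1 / 2" and z: "z \<in> dslit"
 defines "u \<equiv> s + 1 / 2"
 shows "(\<Sum>n. gterm (of_real s) z n) =
  of_real (sqrt 2 * lipc u * Gamma (s + 1) * (2 * pi) powr (- s - 1)) * riemann_zeta (of_real s + 1) * z powr (- (of_real s + 1 / 2))
  + riemann_zeta (1 - of_real s) / of_real (2 * pi) * z powr (- (1 / 2))
  + riemann_zeta (1 / 2 - of_real s) * riemann_zeta (1 / 2)
  - of_real (lip_const u / sqrt 2) * csqrt z
  + of_real (sqrt 2 * lipc u) * (\<Sum>n. kterm (of_real s) z n)" (is "?L z = ?R z")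
proof (rule holomorphic_eq_from_reals[OF open_dslit connected_dslit _ _ zero_less_one _ z])
 have s0: "Re (complex_of_real s) \<ge> 0" using s by simp
 show "?L holomorphic_on dslit" by (rule gsum_holomorphic[OF s0])
 show "?R holomorphic_on dslit"
  by (intro holomorphic_on_add holomorphic_on_diff holomorphic_on_mult holomorphic_on_const ksum_holomorphic[OF s0] holomorphic_on_powr holomorphic_on_csqrt' holomorphic_on_ident)
   (auto simp: dslit_imp)
next
 fix t :: real assume t: "0 < t" "t < 1"
 have "complex_of_real t \<in> dslit" using t by (auto simp: dslit_def complex_nonpos_Reals_iff)
 thus "complex_of_real t \<in> dslit \<and> ?L (of_real t) = ?R (of_real t)"
  using G_complex_real[OF s t] unfolding u_def by blast
qed

section \<open>Specialization to z = ix and z = -ix\<close>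

definition lterm :: "complex => real => nat => complex" where
 "lterm s x n = divisor_sigma s n / of_real (sqrt (real n))
  * of_real (exp (- 2 * pi * sqrt (2 * real n * x)) * sin (pi / 4 + 2 * pi * sqrt (2 * real n * x)))"

definition Wcomb :: "complex => real => complex" where
 "Wcomb s xi = sin (of_real pi / 4 + of_real pi * s / 2)
   * ((1 + \<i> * of_real xi) powr (- (s + 1 / 2)) - (1 - \<i> * of_real xi) powr (- (s + 1 / 2)))
  + \<i> * cos (of_real pi / 4 + of_real pi * s / 2)
   * ((1 + \<i> * of_real xi) powr (- (s + 1 / 2)) + (1 - \<i> * of_real xi) powr (- (s + 1 / 2)) - 2)"

definition Rdiff :: "complex => real => complex" where
 "Rdiff s xi = Rfun s (\<i> * of_real xi) - Rfun s (- (\<i> * of_real xi))"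

text \<open>One expression for the bracket of the theorem at xi = x/n, for n < x and for n >= x
  alike, and holomorphic in s on Re s > 0. The two displayed brackets arise from it by expanding
  \<open>Rdiff\<close> at infinity and at 0.\<close>

definition bterm :: "complex => real => complex" where
 "bterm s xi = - \<i> * Gamma (s + 1 / 2) / (2 powr (s + 1) * of_real (sqrt pi * sqrt xi))
  * (Wcomb s xi + 2 * kap_coeff s * of_real (sqrt xi) * cos (of_real pi * s / 2) * Rdiff s xi)"

lemma csqrt_i: assumes "x > 0"
 shows "csqrt (\<i> * of_real x) = of_real (sqrt x) * cis (pi / 4)" "csqrt (- (\<i> * of_real x)) = of_real (sqrt x) * cis (- (pi / 4))"
proof -
 have q: "(complex_of_real (sqrt x))\<^sup>2 = of_real x" using assms by (simp flip: of_real_power)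
 have c: "(cis (pi / 4))\<^sup>2 = \<i>" "(cis (- (pi / 4)))\<^sup>2 = - \<i>"
  by (simp_all add: power2_eq_square cis_mult cis.ctr complex_eq_iff cos_45 sin_45)
 have r: "cos (pi / 4) > 0" by (simp add: cos_45)
 show "csqrt (\<i> * of_real x) = of_real (sqrt x) * cis (pi / 4)"
  by (rule csqrt_unique) (use q c r assms in \<open>simp_all add: power_mult_distrib mult.commute\<close>)
 show "csqrt (- (\<i> * of_real x)) = of_real (sqrt x) * cis (- (pi / 4))"
  by (rule csqrt_unique) (use q c r assms in \<open>simp_all add: power_mult_distrib mult.commute\<close>)
qed

lemma cis_45: "cis (pi / 4) = (1 + \<i>) * of_real (sqrt 2 / 2)" "cis (- (pi / 4)) = (1 - \<i>) * of_real (sqrt 2 / 2)"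
 by (simp_all add: complex_eq_iff cos_45 sin_45)

text \<open>With N = n + 1 and t = 2 pi sqrt(2 N x), the product 4 pi sqrt(N) csqrt(z) equals t - i
  t at z = -ix and t + i t at z = ix. The phases at pi/4 and -pi/4 turn the difference of the two
  exponentials into exp(-t) sin(pi/4 + t).\<close>

lemma gterm_combination:
 assumes x: "x > 0"
 shows "(cis (pi / 4) * gterm s (- (\<i> * of_real x)) n - cis (- (pi / 4)) * gterm s (\<i> * of_real x) n) / (2 * \<i>) = lterm s x (Suc n)"
proof -
 define N where "N = real (Suc n)"
 define t where "t = 2 * pi * sqrt (2 * N * x)"
 have "sqrt (2 * N * x) = sqrt 2 * sqrt N * sqrt x" by (simp add: real_sqrt_mult)
 hence t: "t = 4 * pi * sqrt N * sqrt x * (sqrt 2 / 2)" by (simp add: t_def)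
 have e1: "- (4 * complex_of_real pi * of_real (sqrt N) * (of_real (sqrt x) * cis (- (pi / 4)))) = of_real (- t) + \<i> * of_real t"
  unfolding cis_45 t by (simp add: complex_eq_iff)
 have e2: "- (4 * complex_of_real pi * of_real (sqrt N) * (of_real (sqrt x) * cis (pi / 4))) = of_real (- t) + \<i> * of_real (- t)"
  unfolding cis_45 t by (simp add: complex_eq_iff)
 define D where "D = divisor_sigma s (Suc n) / of_real (sqrt N)"
 define E where "E = complex_of_real (exp (- t))"
 have g1: "gterm s (- (\<i> * of_real x)) n = D * (E * cis t)"
  unfolding gterm_def N_def[symmetric] D_def[symmetric] csqrt_i[OF x] e1 exp_add cis_conv_exp[symmetric] E_def by (simp only: exp_of_real)
 have g2: "gterm s (\<i> * of_real x) n = D * (E * cis (- t))"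
  unfolding gterm_def N_def[symmetric] D_def[symmetric] csqrt_i[OF x] e2 exp_add cis_conv_exp[symmetric] E_def by (simp only: exp_of_real)
 have "cis (pi / 4) * cis t - cis (- (pi / 4)) * cis (- t) = 2 * \<i> * of_real (sin (pi / 4 + t))"
  unfolding cis_mult by (simp add: complex_eq_iff sin_add cos_add sin_diff cos_diff)
 hence s: "(cis (pi / 4) * cis t - cis (- (pi / 4)) * cis (- t)) / (2 * \<i>) = of_real (sin (pi / 4 + t))" by simp
 have alg: "(a * (D * (E * b)) - c * (D * (E * d))) / k = D * (E * ((a * b - c * d) / k))" for a b c d k :: complex
  by (simp add: right_diff_distrib diff_divide_distrib mult_ac)
 have l: "lterm s x (Suc n) = D * (E * of_real (sin (pi / 4 + t)))"
  unfolding lterm_def N_def[symmetric] D_def E_def t_def by simp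
 show ?thesis unfolding g1 g2 alg s l ..
qed

text \<open>Used for the two power terms of G(z): for a = s + 1/2 the sine becomes cos(pi s/2), for
  a = 1/2 it becomes 1.\<close>

lemma powr_combination:
 fixes a :: complex
 assumes x: "x > 0"
 shows "cis (pi / 4) * (- (\<i> * of_real x)) powr (- a) - cis (- (pi / 4)) * (\<i> * of_real x) powr (- a)
  = of_real x powr (- a) * (2 * \<i> * sin (of_real pi / 4 + of_real pi * a / 2))"
proof -
 define t where "t = of_real pi / 4 + of_real pi * a / 2"
 have 1: "(\<i> * of_real x) powr (- a) = of_real x powr (- a) * exp (- (\<i> * (of_real pi * a / 2)))"
 proof -
  have "(\<i> * complex_of_real x) powr (- a) = \<i> powr (- a) * of_real x powr (- a)" by (rule powr_i_mult) (use x in simp)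
  thus ?thesis by (simp add: powr_def mult_ac)
 qed
 have 2: "(- (\<i> * of_real x)) powr (- a) = of_real x powr (- a) * exp (\<i> * (of_real pi * a / 2))"
 proof -
  have "- (\<i> * complex_of_real x) = of_real x * (- \<i>)" by simp
  hence "(- (\<i> * complex_of_real x)) powr (- a) = of_real x powr (- a) * (- \<i>) powr (- a)"
   by (simp only:) (rule powr_times_real_left, use x in auto)
  thus ?thesis by (simp add: powr_def mult_ac)
 qed
 have c: "cis (pi / 4) = exp (\<i> * (of_real pi / 4))" "cis (- (pi / 4)) = exp (- (\<i> * (of_real pi / 4)))" by (simp_all add: cis_conv_exp)
 have p: "exp (\<i> * (of_real pi / 4)) * exp (\<i> * (of_real pi * a / 2)) = exp (\<i> * t)"
  "exp (- (\<i> * (of_real pi / 4))) * exp (- (\<i> * (of_real pi * a / 2))) = exp (- (\<i> * t))"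
  by (simp_all add: t_def exp_add[symmetric] distrib_left)
 have s: "2 * \<i> * sin t = exp (\<i> * t) - exp (- (\<i> * t))" by (simp add: sin_exp_eq)
 have alg: "A * (X * P) - B * (X * Q) = X * (A * P - B * Q)" for A B P Q X :: complex by (simp add: right_diff_distrib mult_ac)
 show ?thesis unfolding 1 2 c alg p t_def[symmetric] s ..
qed

lemma of_real_pi_quarter: "sin (complex_of_real pi / 4) = of_real (sqrt 2 / 2)" "cos (complex_of_real pi / 4) = of_real (sqrt 2 / 2)"
proof -
 have "sin (complex_of_real (pi / 4)) = of_real (sin (pi / 4))" "cos (complex_of_real (pi / 4)) = of_real (cos (pi / 4))"
  by (rule sin_of_real, rule cos_of_real)
 thus "sin (complex_of_real pi / 4) = of_real (sqrt 2 / 2)" "cos (complex_of_real pi / 4) = of_real (sqrt 2 / 2)" by (simp_all add: sin_45 cos_45)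
qed

lemma of_real_pi_half: "sin (complex_of_real pi / 2) = 1" "cos (complex_of_real pi / 2) = 0"
 using cos_of_real[of "pi / 2", where 'a = complex] sin_of_real[of "pi / 2", where 'a = complex] by simp_all

text \<open>The difference \<open>Rfun s v - Rfun s (- v)\<close> is odd in v, and each prefactor
  meets a square root with the inverse phase, E1 * E2 = 1. So the two terms with
  \<open>Rdiff\<close> add up instead of cancelling.\<close>

lemma kap_combination:
 assumes x: "xi > 0"
 shows "cis (pi / 4) * kap s (- (\<i> * of_real xi)) - cis (- (pi / 4)) * kap s (\<i> * of_real xi)
  = Wcomb s xi + 2 * kap_coeff s * of_real (sqrt xi) * cos (of_real pi * s / 2) * Rdiff s xi"
proof -
 define S where "S = sin (of_real pi * s / 2)"
 define C where "C = cos (of_real pi * s / 2)"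
 define r where "r = complex_of_real (sqrt 2 / 2)"
 define p where "p = (1 + \<i> * of_real xi) powr (- (s + 1 / 2))"
 define m where "m = (1 - \<i> * of_real xi) powr (- (s + 1 / 2))"
 define b where "b = kap_coeff s"
 define w where "w = complex_of_real (sqrt xi)"
 define E1 where "E1 = cis (pi / 4)"
 define E2 where "E2 = cis (- (pi / 4))"
 have EE: "E1 * E2 = 1" by (simp add: E1_def E2_def cis_mult)
 have pi4: "sin (complex_of_real pi / 4) = r" "cos (complex_of_real pi / 4) = r"
  unfolding r_def by (rule of_real_pi_quarter)+
 have W: "Wcomb s xi = r * (C + S) * (p - m) + \<i> * (r * (C - S)) * (p + m - 2)"
  unfolding Wcomb_def sin_add cos_add pi4 p_def[symmetric] m_def[symmetric] S_def[symmetric] C_def[symmetric] by (simp add: algebra_simps)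
 have k1: "kap s (- (\<i> * of_real xi)) = - S * (m - 1) + C * (p - 1) - b * (w * E2) * C * (- Rdiff s xi)"
  unfolding kap_def csqrt_i[OF x] b_def w_def S_def C_def p_def m_def E2_def Rdiff_def by simp
 have k2: "kap s (\<i> * of_real xi) = - S * (p - 1) + C * (m - 1) - b * (w * E1) * C * Rdiff s xi"
  unfolding kap_def csqrt_i[OF x] b_def w_def S_def C_def p_def m_def E1_def Rdiff_def by simp
 have a1: "E1 * (X - b * (w * E2) * C * (- D)) - E2 * (Y - b * (w * E1) * C * D) = E1 * X - E2 * Y + 2 * b * w * C * D" for X Y D
 proof -
  have "E1 * (X - b * (w * E2) * C * (- D)) - E2 * (Y - b * (w * E1) * C * D) = E1 * X - E2 * Y + 2 * b * w * C * D * (E1 * E2)"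
   by (simp add: algebra_simps)
  thus ?thesis unfolding EE by simp
 qed
 have a2: "E1 * (- S * (m - 1) + C * (p - 1)) - E2 * (- S * (p - 1) + C * (m - 1)) = r * (C + S) * (p - m) + \<i> * (r * (C - S)) * (p + m - 2)"
  unfolding E1_def E2_def cis_45 r_def[symmetric] by (simp add: algebra_simps)
 show ?thesis
  unfolding E1_def[symmetric] E2_def[symmetric] b_def[symmetric] C_def[symmetric] w_def[symmetric] W k1 k2 a1 a2 ..
qed

text \<open>The third main term, up to sign, with zeta(s+1) in place of cot(pi s/2) zeta(-s). In
  this form it is holomorphic on Re s > 0, the even integers included, where the cotangent has
  poles.\<close>

definition main3 :: "complex => real => complex" where
 "main3 s x = 2 powr (- s) * of_real pi powr (- s - 1 / 2) * (2 * of_real pi) powr (- s - 1) * Gamma (s + 1 / 2) * Gamma (s + 1)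
   * riemann_zeta (s + 1) * cos (of_real pi * s / 2) * of_real x powr (- (s + 1 / 2))"

definition cterm :: "complex => real => nat => complex" where
 "cterm s x n = divisor_sigma s n / of_nat n powr (s + 1) * bterm s (x / real n)"

text \<open>Matches the constant sqrt(2) lipc(u) / 2 of the G-formula with the normalization of the
  theorem; the power N^(-s-1/2) is split into N^(-s-1) and the sqrt(N) hidden in sqrt(x/N).\<close>

lemma combination_coeff:
 fixes s x N :: real
 assumes x: "x > 0" and N: "N > 0"
 shows "sqrt 2 * lipc (s + 1 / 2) / 2 * N powr (- (s + 1 / 2)) = sqrt x / pi powr s * (1 / N powr (s + 1) * (Gamma (s + 1 / 2) / (2 powr (s + 1) * (sqrt pi * sqrt (x / N)))))"
proof -
 have 1: "(2 * pi) powr (- (s + 1 / 2)) = 2 powr (- (s + 1 / 2)) * pi powr (- (s + 1 / 2))" by (simp add: powr_mult)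
 have 2: "2 powr (- (s + 1 / 2)) * sqrt 2 / 2 = 1 / (2 :: real) powr (s + 1)"
 proof -
  have "2 powr (- (s + 1 / 2)) * sqrt 2 = (2 :: real) powr (- s)" by (simp add: powr_half_sqrt[symmetric] powr_add[symmetric])
  moreover have "(2 :: real) powr (s + 1) = 2 powr s * 2" by (simp add: powr_add)
  ultimately show ?thesis by (simp add: powr_minus_divide)
 qed
 have 3: "pi powr (- (s + 1 / 2)) = 1 / (pi powr s * sqrt pi)"
  by (simp only: powr_minus_divide powr_add powr_half_sqrt[OF pi_ge_zero])
 have "- (s + 1 / 2) = 1 / 2 - (s + 1)" by simp
 hence 4: "N powr (- (s + 1 / 2)) = sqrt N / N powr (s + 1)"
  using N by (simp only: powr_diff powr_half_sqrt[OF less_imp_le])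
 have alg: "r * (G * (T * P)) / 2 * (q / M) = y / Z * (1 / M * (G / (H * (V * (y / q)))))"
  if "T * r / 2 = 1 / H" "P = 1 / (Z * V)" "q ~= 0" "y ~= 0" for r G T P q M y Z H V :: real
 proof -
  have "r * (G * (T * P)) / 2 * (q / M) = (T * r / 2) * (G * P) * (q / M)" by simp
  thus ?thesis unfolding that(1) that(2) using that(3,4) by simp
 qed
 show ?thesis unfolding lipc_def 1 4 real_sqrt_divide by (rule alg[OF 2 3]) (use x N in auto)
qed

lemma combined_real:
 fixes s x :: real
 assumes s: "0 < s" "s < 1 / 2" and x: "x > 0"
 shows "(\<Sum>n. lterm (of_real s) x (Suc n)) = main3 (of_real s) x
  + riemann_zeta (1 - of_real s) / of_real (2 * pi * sqrt x)
  + riemann_zeta (1 / 2) * riemann_zeta (1 / 2 - of_real s) / of_real (sqrt 2)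
  + of_real (sqrt x) / of_real pi powr of_real s * (\<Sum>n. cterm (of_real s) x (Suc n))"
proof -
 define S where "S = complex_of_real s"
 define e1 where "e1 = cis (pi / 4)"
 define e2 where "e2 = cis (- (pi / 4))"
 define z1 where "z1 = - (\<i> * complex_of_real x)"
 define z2 where "z2 = \<i> * complex_of_real x"
 define A0 where "A0 = complex_of_real (sqrt 2 * lipc (s + 1 / 2) * Gamma (s + 1) * (2 * pi) powr (- s - 1)) * riemann_zeta (S + 1)"
 define A1 where "A1 = riemann_zeta (1 - S) / of_real (2 * pi)"
 define A2 where "A2 = riemann_zeta (1 / 2 - S) * riemann_zeta (1 / 2)"
 define A3 where "A3 = complex_of_real (lip_const (s + 1 / 2) / sqrt 2)"
 define A4 where "A4 = complex_of_real (sqrt 2 * lipc (s + 1 / 2))"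
 have S0: "Re S \<ge> 0" using s by (simp add: S_def)
 have zn: "z1 \<in> dslit" "z2 \<in> dslit" using x by (auto simp: z1_def z2_def dslit_def complex_nonpos_Reals_iff)
 have G: "(\<Sum>n. gterm S z n) = A0 * z powr (- (S + 1 / 2)) + A1 * z powr (- (1 / 2)) + A2 - A3 * csqrt z + A4 * (\<Sum>n. kterm S z n)" if "z \<in> dslit" for z
  using G_complex[OF s that] unfolding A0_def A1_def A2_def A3_def A4_def S_def .
 have gs: "gterm S z1 sums (\<Sum>n. gterm S z1 n)" "gterm S z2 sums (\<Sum>n. gterm S z2 n)"
  using gterm_summable[OF S0] zn dslit_imp by (auto intro: summable_sums)
 have ks: "kterm S z1 sums (\<Sum>n. kterm S z1 n)" "kterm S z2 sums (\<Sum>n. kterm S z2 n)"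
  using kterm_summable[OF S0] by (auto intro: summable_sums)
 have L: "(\<Sum>n. lterm S x (Suc n)) = (e1 * (\<Sum>n. gterm S z1 n) - e2 * (\<Sum>n. gterm S z2 n)) / (2 * \<i>)"
 proof (rule sums_unique[symmetric])
  show "(%n. lterm S x (Suc n)) sums ((e1 * (\<Sum>n. gterm S z1 n) - e2 * (\<Sum>n. gterm S z2 n)) / (2 * \<i>))"
   using sums_divide[OF sums_diff[OF sums_mult[OF gs(1), of e1] sums_mult[OF gs(2), of e2]], of "2 * \<i>"]
   unfolding e1_def e2_def z1_def z2_def gterm_combination[OF x] .
 qed
 have ct: "of_real (sqrt x) / of_real pi powr S * cterm S x (Suc n) = A4 / (2 * \<i>) * (e1 * kterm S z1 n - e2 * kterm S z2 n)" for n
 proof -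
  define N where "N = real (Suc n)"
  have N: "N > 0" by (simp add: N_def)
  have z: "z1 / of_nat (Suc n) = - (\<i> * of_real (x / N))" "z2 / of_nat (Suc n) = \<i> * of_real (x / N)"
   by (simp_all add: z1_def z2_def N_def)
  have xn: "x / N > 0" using x N by simp
  define Q where "Q = Wcomb S (x / N) + 2 * kap_coeff S * of_real (sqrt (x / N)) * cos (of_real pi * S / 2) * Rdiff S (x / N)"
  define D where "D = divisor_sigma S (Suc n)"
  have p1: "of_nat (Suc n) powr (- (S + 1 / 2)) = complex_of_real (N powr (- (s + 1 / 2)))"
   using powr_of_real[of N "- (s + 1 / 2)"] N unfolding S_def by (simp add: N_def)
  have p2: "of_nat (Suc n) powr (S + 1) = complex_of_real (N powr (s + 1))"
   using powr_of_real[of N "s + 1"] N unfolding S_def by (simp add: N_def)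
  have p3: "of_real pi powr S = complex_of_real (pi powr s)" using powr_of_real[of pi s] by (simp add: S_def)
  have p4: "2 powr (S + 1) = complex_of_real (2 powr (s + 1))" using powr_of_real[of 2 "s + 1"] by (simp add: S_def)
  have p5: "Gamma (S + 1 / 2) = complex_of_real (Gamma (s + 1 / 2))" using Gamma_complex_of_real[of "s + 1 / 2"] by (simp add: S_def)
  have "e1 * kterm S z1 n - e2 * kterm S z2 n = D * of_real (N powr (- (s + 1 / 2))) * (e1 * kap S (- (\<i> * of_real (x / N))) - e2 * kap S (\<i> * of_real (x / N)))"
   unfolding kterm_def z p1 D_def by (simp add: right_diff_distrib mult_ac)
  also have "\<dots> = D * of_real (N powr (- (s + 1 / 2))) * Q" unfolding e1_def e2_def kap_combination[OF xn] Q_def ..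
  finally have E: "e1 * kterm S z1 n - e2 * kterm S z2 n = D * of_real (N powr (- (s + 1 / 2))) * Q" .
  have alg: "a / (2 * \<i>) * (D * b * Q) = - \<i> * D * Q * (a / 2 * b)" for a b by simp
  have "A4 / (2 * \<i>) * (e1 * kterm S z1 n - e2 * kterm S z2 n) = - \<i> * D * Q * of_real (sqrt 2 * lipc (s + 1 / 2) / 2 * N powr (- (s + 1 / 2)))"
   unfolding E A4_def alg by simp
  also have "\<dots> = of_real (sqrt x) / of_real pi powr S * cterm S x (Suc n)"
   unfolding combination_coeff[OF x N] cterm_def bterm_def N_def[symmetric] Q_def[symmetric] D_def[symmetric] p2 p3 p4 p5 by (simp add: mult_ac)
  finally show ?thesis ..
 qed
 have ks': "(%n. A4 / (2 * \<i>) * (e1 * kterm S z1 n - e2 * kterm S z2 n)) sums (A4 / (2 * \<i>) * (e1 * (\<Sum>n. kterm S z1 n) - e2 * (\<Sum>n. kterm S z2 n)))"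
  by (intro sums_mult sums_diff ks)
 have c0: "of_real (sqrt x) / of_real pi powr S ~= (0 :: complex)" using x by simp
 have "summable (%n. cterm S x (Suc n))"
  using sums_summable[OF ks'] c0 unfolding ct[symmetric] by (rule summable_mult_D)
 hence C: "of_real (sqrt x) / of_real pi powr S * (\<Sum>n. cterm S x (Suc n)) = A4 / (2 * \<i>) * (e1 * (\<Sum>n. kterm S z1 n) - e2 * (\<Sum>n. kterm S z2 n))"
  using sums_unique2[OF summable_sums[THEN sums_mult] ks'[folded ct]] by blast
 define Y where "Y = complex_of_real x powr (- (S + 1 / 2))"
 have P0: "e1 * z1 powr (- (S + 1 / 2)) - e2 * z2 powr (- (S + 1 / 2)) = 2 * \<i> * (Y * cos (of_real pi * S / 2))"
 proof -
  have "of_real pi / 4 + of_real pi * (S + 1 / 2) / 2 = of_real pi * S / 2 + of_real pi / 2" by (simp add: field_simps)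
  moreover note of_real_pi_half
  ultimately have "sin (of_real pi / 4 + of_real pi * (S + 1 / 2) / 2) = cos (of_real pi * S / 2)" by (simp add: sin_add)
  thus ?thesis using powr_combination[OF x, of "S + 1 / 2"] unfolding e1_def e2_def z1_def z2_def Y_def by (simp add: mult_ac)
 qed
 have P1: "e1 * z1 powr (- (1 / 2)) - e2 * z2 powr (- (1 / 2)) = 2 * \<i> * (1 / of_real (sqrt x))"
 proof -
  have "complex_of_real pi / 4 + of_real pi * (1 / 2) / 2 = of_real (pi / 2)" by (simp add: field_simps)
  hence s: "sin (complex_of_real pi / 4 + of_real pi * (1 / 2) / 2) = 1" by (simp only: sin_of_real sin_pi_half of_real_1)
  have "complex_of_real x powr (- (1 / 2)) = of_real (x powr (- (1 / 2)))" using powr_of_real[of x "- (1 / 2)"] x by simp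
  also have "x powr (- (1 / 2)) = 1 / sqrt x" using x by (simp only: powr_minus_divide powr_half_sqrt)
  finally have "complex_of_real x powr (- (1 / 2)) = 1 / of_real (sqrt x)" by simp
  thus ?thesis using powr_combination[OF x, of "1 / 2"] unfolding e1_def e2_def z1_def z2_def s by (simp add: mult_ac)
 qed
 have P2: "e1 - e2 = 2 * \<i> * (1 / of_real (sqrt 2))"
 proof -
  have "sqrt 2 / 2 = 1 / sqrt (2 :: real)" by (simp add: field_simps)
  hence r: "1 / complex_of_real (sqrt 2) = of_real (sqrt 2 / 2)" by (metis of_real_1 of_real_divide)
  have alg: "(1 + \<i>) * R - (1 - \<i>) * R = 2 * \<i> * R" for R by (simp add: algebra_simps)
  show ?thesis unfolding e1_def e2_def cis_45 r by (rule alg)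
 qed
 \<comment> \<open>The combination annihilates \<open>csqrt z\<close>, and with it the unevaluated
   constant \<open>lip_const\<close>.\<close>
 have P3: "e1 * csqrt z1 - e2 * csqrt z2 = 0"
  unfolding z1_def z2_def csqrt_i[OF x] e1_def e2_def by (simp add: cis_mult mult.left_commute)
 have alg: "(e1 * (a0 * p1 + a1 * q1 + a2 - a3 * r1 + k1) - e2 * (a0 * p2 + a1 * q2 + a2 - a3 * r2 + k2)) / (2 * \<i>)
  = a0 * P + a1 * Q + a2 * R + (e1 * k1 - e2 * k2) / (2 * \<i>)"
  if "e1 * p1 - e2 * p2 = 2 * \<i> * P" "e1 * q1 - e2 * q2 = 2 * \<i> * Q" "e1 - e2 = 2 * \<i> * R" "e1 * r1 - e2 * r2 = 0"
  for a0 a1 a2 a3 p1 p2 q1 q2 r1 r2 k1 k2 P Q R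
 proof -
  have "e1 * (a0 * p1 + a1 * q1 + a2 - a3 * r1 + k1) - e2 * (a0 * p2 + a1 * q2 + a2 - a3 * r2 + k2)
   = a0 * (e1 * p1 - e2 * p2) + a1 * (e1 * q1 - e2 * q2) + a2 * (e1 - e2) - a3 * (e1 * r1 - e2 * r2) + (e1 * k1 - e2 * k2)"
   by (simp add: algebra_simps)
  also have "\<dots> = 2 * \<i> * (a0 * P + a1 * Q + a2 * R) + (e1 * k1 - e2 * k2)" unfolding that by (simp add: algebra_simps)
  finally have E: "e1 * (a0 * p1 + a1 * q1 + a2 - a3 * r1 + k1) - e2 * (a0 * p2 + a1 * q2 + a2 - a3 * r2 + k2) = 2 * \<i> * (a0 * P + a1 * Q + a2 * R) + (e1 * k1 - e2 * k2)" .
  have gen: "(2 * \<i> * X + Y) / (2 * \<i>) = X + Y / (2 * \<i>)" for X Y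
   by (subst add_divide_distrib, subst nonzero_mult_div_cancel_left) simp_all
  show ?thesis unfolding E by (rule gen)
 qed
 have L': "(\<Sum>n. lterm S x (Suc n)) = A0 * (Y * cos (of_real pi * S / 2)) + A1 * (1 / of_real (sqrt x)) + A2 * (1 / of_real (sqrt 2)) + (e1 * (A4 * (\<Sum>n. kterm S z1 n)) - e2 * (A4 * (\<Sum>n. kterm S z2 n))) / (2 * \<i>)"
  unfolding L G[OF zn(1)] G[OF zn(2)] by (rule alg[OF P0 P1 P2 P3])
 have M: "A0 * (Y * cos (of_real pi * S / 2)) = main3 S x"
 proof -
  have a: "sqrt 2 * lipc (s + 1 / 2) = 2 powr (- s) * pi powr (- s - 1 / 2) * Gamma (s + 1 / 2)"
  proof -
   have 1: "(2 * pi) powr (- (s + 1 / 2)) = 2 powr (- (s + 1 / 2)) * pi powr (- (s + 1 / 2))" by (simp add: powr_mult)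
   have 2: "sqrt 2 * 2 powr (- (s + 1 / 2)) = (2 :: real) powr (- s)" by (simp add: powr_half_sqrt[symmetric] powr_add[symmetric])
   have 3: "- s - 1 / 2 = - (s + 1 / 2)" by simp
   have "r * (G * (T * P)) = (r * T) * P * G" for r G T P :: real by (simp add: mult_ac)
   thus ?thesis unfolding lipc_def 1 3 2[symmetric] .
  qed
  have p2: "of_real pi powr (- S - 1 / 2) = complex_of_real (pi powr (- s - 1 / 2))" using powr_of_real[of pi "- s - 1 / 2"] by (simp add: S_def)
  have p3: "2 powr (- S) = complex_of_real (2 powr (- s))" using powr_of_real[of 2 "- s"] by (simp add: S_def)
  have p4: "(2 * of_real pi) powr (- S - 1) = complex_of_real ((2 * pi) powr (- s - 1))" using powr_of_real[of "2 * pi" "- s - 1"] by (simp add: S_def)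
  have p5: "Gamma (S + 1 / 2) = complex_of_real (Gamma (s + 1 / 2))" using Gamma_complex_of_real[of "s + 1 / 2"] by (simp add: S_def)
  have p6: "Gamma (S + 1) = complex_of_real (Gamma (s + 1))" using Gamma_complex_of_real[of "s + 1"] by (simp add: S_def)
  show ?thesis unfolding A0_def a main3_def p2 p3 p4 p5 p6 Y_def of_real_mult by (simp only: mult_ac)
 qed
 have c: "(e1 * (A4 * k1) - e2 * (A4 * k2)) / (2 * \<i>) = A4 / (2 * \<i>) * (e1 * k1 - e2 * k2)" for k1 k2
  by (simp add: right_diff_distrib diff_divide_distrib mult_ac)
 have o: "A1 * (1 / of_real (sqrt x)) = riemann_zeta (1 - S) / of_real (2 * pi * sqrt x)"
  "A2 * (1 / of_real (sqrt 2)) = riemann_zeta (1 / 2) * riemann_zeta (1 / 2 - S) / of_real (sqrt 2)"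
  unfolding A1_def A2_def by (simp_all add: mult.commute)
 show ?thesis unfolding S_def[symmetric] L' M c o C ..
qed

section \<open>Continuation in s to the half-plane Re s > 0\<close>

lemma open_Re_pos: "open {s. Re s > 0}" by (rule open_halfspace_Re_gt)

lemma lterm_bound:
 assumes s: "0 \<le> Re s" "Re s \<le> b" and x: "x > 0"
 shows "norm (lterm s x (Suc n)) \<le> real (Suc n) powr (b + 1) * exp (- (2 * pi * sqrt (2 * x)) * sqrt (real (Suc n)))"
proof -
 have e: "- 2 * pi * sqrt (2 * real (Suc n) * x) = - (2 * pi * sqrt (2 * x)) * sqrt (real (Suc n))"
  by (simp add: real_sqrt_mult del: of_nat_Suc)
 have "norm (divisor_sigma s (Suc n) / of_real (sqrt (real (Suc n)))) \<le> real (Suc n) powr (Re s + 1)" by (rule norm_sigma_over_sqrt[OF s(1)])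
 also have "\<dots> \<le> real (Suc n) powr (b + 1)" using s by (intro powr_mono) auto
 finally have 1: "norm (divisor_sigma s (Suc n) / of_real (sqrt (real (Suc n)))) \<le> real (Suc n) powr (b + 1)" .
 have 2: "norm (complex_of_real (exp a * sin y)) \<le> exp a" for a y
  by (simp add: norm_mult abs_mult mult_left_le)
 show ?thesis unfolding lterm_def norm_mult[of "divisor_sigma s (Suc n) / of_real (sqrt (real (Suc n)))"] e using 1 2 by (rule mult_mono) auto
qed

lemma lterm_summable:
 assumes s: "Re s > 0" and x: "x > 0" shows "summable (%n. lterm s x (Suc n))"
proof (rule summable_comparison_test)
 show "summable (%n. real (Suc n) powr (Re s + 1) * exp (- (2 * pi * sqrt (2 * x)) * sqrt (real (Suc n))))"
  by (rule summable_powr_exp_sqrt) (use x in simp)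
 show "\<exists>N. \<forall>n\<ge>N. norm (lterm s x (Suc n)) \<le> real (Suc n) powr (Re s + 1) * exp (- (2 * pi * sqrt (2 * x)) * sqrt (real (Suc n)))"
  using lterm_bound[OF less_imp_le[OF s] order_refl x] by blast
qed

lemma lsum_holomorphic:
 assumes x: "x > 0"
 shows "(%s. \<Sum>n. lterm s x (Suc n)) holomorphic_on {s. Re s > 0}"
proof (rule holomorphic_suminf[OF open_Re_pos])
 fix n show "(%s. lterm s x (Suc n)) holomorphic_on {s. Re s > 0}"
  unfolding lterm_def by (intro holomorphic_on_mult holomorphic_on_divide divisor_sigma_holomorphic holomorphic_on_const) simp
next
 fix c assume "c \<in> {s. Re s > 0}"
 then obtain r where r: "r > 0" "ball c r \<subseteq> {s. Re s > 0}" using open_Re_pos openE by blast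
 have "summable (%n. real (Suc n) powr ((Re c + r) + 1) * exp (- (2 * pi * sqrt (2 * x)) * sqrt (real (Suc n))))"
  by (rule summable_powr_exp_sqrt) (use x in simp)
 moreover have "\<forall>s\<in>ball c r. \<forall>n\<ge>0. norm (lterm s x (Suc n)) \<le> real (Suc n) powr ((Re c + r) + 1) * exp (- (2 * pi * sqrt (2 * x)) * sqrt (real (Suc n)))"
 proof (intro ballI allI impI lterm_bound x)
  fix s assume s: "s \<in> ball c r"
  thus "0 \<le> Re s" using r by auto
  have "norm (s - c) < r" using s by (simp add: dist_norm norm_minus_commute)
  thus "Re s \<le> Re c + r" using abs_Re_le_cmod[of "s - c"] by simp
 qed
 ultimately show "\<exists>r>0. \<exists>g. \<exists>N. ball c r \<subseteq> {s. Re s > 0} \<and> summable g \<and> (\<forall>s\<in>ball c r. \<forall>n\<ge>N. norm (lterm s x (Suc n)) \<le> g n)"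
  using r by blast
qed

lemma not_nonpos_Int_Re_pos: "Re s > 0 ==> s \<notin> \<int>\<^sub>\<le>\<^sub>0"
 by (auto elim!: nonpos_Ints_cases)

lemma Gamma_nonzero_Re_pos: "Re (s :: complex) > 0 ==> Gamma s ~= 0"
 using not_nonpos_Int_Re_pos[of s] by (simp add: Gamma_eq_zero_iff)

lemma kap_coeff_holomorphic: "kap_coeff holomorphic_on {s. Re s > 0}"
proof -
 have "(%s. 2 * Gamma (s + 1) / (of_real (sqrt pi) * Gamma (s + 1 / 2))) holomorphic_on {s. Re s > 0}"
  by (intro holomorphic_intros) (auto intro!: not_nonpos_Int_Re_pos Gamma_nonzero_Re_pos)
 thus ?thesis unfolding kap_coeff_def[abs_def] .
qed

lemma i_real_not_nonpos: "1 + \<i> * complex_of_real t \<notin> \<real>\<^sub>\<le>\<^sub>0" "1 - \<i> * complex_of_real t \<notin> \<real>\<^sub>\<le>\<^sub>0"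
 "1 + \<i> * complex_of_real t ~= 0" "1 - \<i> * complex_of_real t ~= 0"
 by (auto simp: complex_nonpos_Reals_iff complex_eq_iff)

lemma Rdiff_holomorphic: "(%s. Rdiff s xi) holomorphic_on S"
 unfolding Rdiff_def by (intro holomorphic_on_diff Rfun_holomorphic_exponent) (use i_real_not_nonpos[of xi] in simp_all)

lemma bterm_holomorphic: "xi > 0 ==> (%s. bterm s xi) holomorphic_on {s. Re s > 0}"
 unfolding bterm_def Wcomb_def
 by (intro holomorphic_intros kap_coeff_holomorphic Rdiff_holomorphic) (auto simp: i_real_not_nonpos intro!: not_nonpos_Int_Re_pos)

lemma continuous_compact_bounded:
 fixes f :: "complex => complex"
 assumes "f holomorphic_on S" "cball c r \<subseteq> S"
 shows "\<exists>B\<ge>0. \<forall>s\<in>cball c r. norm (f s) \<le> B"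
proof -
 have "compact (f ` cball c r)"
  by (intro compact_continuous_image continuous_on_subset[OF holomorphic_on_imp_continuous_on[OF assms(1)] assms(2)]) simp
 from compact_imp_bounded[OF this] obtain B where "\<forall>s\<in>cball c r. norm (f s) \<le> B" unfolding bounded_iff by auto
 hence "\<forall>s\<in>cball c r. norm (f s) \<le> max B 0" by (auto simp: le_max_iff_disj)
 thus ?thesis by (intro exI[of _ "max B 0"]) auto
qed

text \<open>The three brackets are O(xi) locally uniformly in s, and the prefactor contributes
  xi^(-1/2). At xi = x/n this leaves n^(-1/2), which together with sigma_s(n) / n^(s+1) is summable
  by \<open>summable_card_divisors\<close>.\<close>

lemma bterm_bound:
 assumes c: "Re c > 0"
 shows "\<exists>r>0. \<exists>K\<ge>0. ball c r \<subseteq> {s. Re s > 0} \<and> (\<forall>s\<in>ball c r. \<forall>xi. 0 < xi \<longrightarrow> xi \<le> 1 / 2 \<longrightarrow> norm (bterm s xi) \<le> K * sqrt xi)"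
proof -
 obtain r where r: "r > 0" "cball c r \<subseteq> {s. Re s > 0}" using open_Re_pos c open_contains_cball by blast
 have h: "(%s. Gamma (s + 1 / 2) / (2 powr (s + 1) * of_real (sqrt pi))) holomorphic_on {s. Re s > 0}"
  by (intro holomorphic_intros) (auto intro!: not_nonpos_Int_Re_pos)
 have h1: "(%s. sin (of_real pi / 4 + of_real pi * s / 2)) holomorphic_on {s. Re s > 0}"
  "(%s. \<i> * cos (of_real pi / 4 + of_real pi * s / 2)) holomorphic_on {s. Re s > 0}"
  "(%s. 2 * kap_coeff s * cos (of_real pi * s / 2)) holomorphic_on {s. Re s > 0}"
  by (intro holomorphic_intros kap_coeff_holomorphic; simp)+
 obtain B0 where B0: "B0 \<ge> 0" "\<forall>s\<in>cball c r. norm (Gamma (s + 1 / 2) / (2 powr (s + 1) * of_real (sqrt pi))) \<le> B0"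
  using continuous_compact_bounded[OF h r(2)] by blast
 obtain B1 where B1: "B1 \<ge> 0" "\<forall>s\<in>cball c r. norm (sin (of_real pi / 4 + of_real pi * s / 2)) \<le> B1"
  using continuous_compact_bounded[OF h1(1) r(2)] by blast
 obtain B2 where B2: "B2 \<ge> 0" "\<forall>s\<in>cball c r. norm (\<i> * cos (of_real pi / 4 + of_real pi * s / 2)) \<le> B2"
  using continuous_compact_bounded[OF h1(2) r(2)] by blast
 obtain B3 where B3: "B3 \<ge> 0" "\<forall>s\<in>cball c r. norm (2 * kap_coeff s * cos (of_real pi * s / 2)) \<le> B3"
  using continuous_compact_bounded[OF h1(3) r(2)] by blast
 define M where "M = norm c + r + 1"
 define C where "C = 2 * M * exp M"
 define K where "K = B0 * (B1 * (2 * C) + B2 * (2 * C) + B3 * (C * (C + 4)))"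
 have M0: "M \<ge> 0" "C \<ge> 0" using r by (simp_all add: M_def C_def)
 have "norm (bterm s xi) \<le> K * sqrt xi" if s: "s \<in> ball c r" and x: "0 < xi" "xi \<le> 1 / 2" for s xi
 proof -
  have sc: "s \<in> cball c r" using s by simp
  have "norm (s - c) < r" using s by (simp add: dist_norm norm_minus_commute)
  hence sM: "norm s + 1 \<le> M" using norm_triangle_ineq2[of s c] by (simp add: M_def)
  have a: "norm (- (s + 1 / 2)) \<le> M"
  proof -
   have "norm (- (s + 1 / 2)) \<le> norm s + norm (1 / 2 :: complex)" by (metis norm_minus_cancel norm_triangle_ineq)
   thus ?thesis using sM by simp
  qed
  define p where "p = (1 + \<i> * of_real xi) powr (- (s + 1 / 2)) - 1"
  define m where "m = (1 + - (\<i> * of_real xi)) powr (- (s + 1 / 2)) - 1"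
  have nx: "norm (\<i> * complex_of_real xi) = xi" "norm (- (\<i> * complex_of_real xi)) = xi" using x by (simp_all add: norm_mult)
  have p: "norm p \<le> C * xi" using one_plus_powr_minus_one_bound[of "\<i> * of_real xi", OF _ a] x unfolding nx p_def C_def by simp
  have m: "norm m \<le> C * xi" using one_plus_powr_minus_one_bound[of "- (\<i> * of_real xi)", OF _ a] x unfolding nx m_def C_def by simp
  have R: "norm (Rdiff s xi) \<le> C * (C + 4) * xi"
   using Rfun_bound[of "\<i> * of_real xi", OF _ sM] x unfolding nx Rdiff_def C_def by simp
  have q: "sqrt xi \<le> 1" "sqrt xi > 0" using x by simp_all
  define X1 where "X1 = sin (of_real pi / 4 + of_real pi * s / 2) * (p - m)"
  define X2 where "X2 = \<i> * cos (of_real pi / 4 + of_real pi * s / 2) * (p + m)"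
  define X3 where "X3 = 2 * kap_coeff s * cos (of_real pi * s / 2) * (of_real (sqrt xi) * Rdiff s xi)"
  have n1: "norm X1 \<le> B1 * (2 * C * xi)"
   unfolding X1_def norm_mult[of "sin (of_real pi / 4 + of_real pi * s / 2)"] using B1 sc p m norm_triangle_ineq4[of p m] by (intro mult_mono) auto
  have n2: "norm X2 \<le> B2 * (2 * C * xi)"
   unfolding X2_def norm_mult[of "\<i> * cos (of_real pi / 4 + of_real pi * s / 2)"] using B2 sc p m norm_triangle_ineq[of p m] by (intro mult_mono) auto
  have "norm (of_real (sqrt xi) * Rdiff s xi) = sqrt xi * norm (Rdiff s xi)" using q by (simp add: norm_mult)
  also have "\<dots> \<le> 1 * (C * (C + 4) * xi)" using q R by (intro mult_mono) auto
  finally have n3: "norm X3 \<le> B3 * (C * (C + 4) * xi)"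
   unfolding X3_def norm_mult[of "2 * kap_coeff s * cos (of_real pi * s / 2)"] using B3 sc by (intro mult_mono) auto
  have e: "bterm s xi = - \<i> * (Gamma (s + 1 / 2) / (2 powr (s + 1) * of_real (sqrt pi))) * ((X1 + X2 + X3) / of_real (sqrt xi))"
   unfolding bterm_def Wcomb_def X1_def X2_def X3_def p_def m_def by (simp add: mult_ac)
  have "norm (X1 + X2 + X3) \<le> norm X1 + norm X2 + norm X3"
   using norm_triangle_ineq[of "X1 + X2" X3] norm_triangle_ineq[of X1 X2] by simp
  also have "\<dots> \<le> (B1 * (2 * C) + B2 * (2 * C) + B3 * (C * (C + 4))) * xi" using n1 n2 n3 by (simp add: algebra_simps)
  finally have "norm (X1 + X2 + X3) / sqrt xi \<le> (B1 * (2 * C) + B2 * (2 * C) + B3 * (C * (C + 4))) * xi / sqrt xi"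
   using q by (intro divide_right_mono) auto
  also have "\<dots> = (B1 * (2 * C) + B2 * (2 * C) + B3 * (C * (C + 4))) * sqrt xi" using x real_div_sqrt[of xi] by (simp flip: times_divide_eq_right)
  finally have "norm ((X1 + X2 + X3) / of_real (sqrt xi)) \<le> (B1 * (2 * C) + B2 * (2 * C) + B3 * (C * (C + 4))) * sqrt xi"
   using q by (simp add: norm_divide)
  hence "norm (bterm s xi) \<le> B0 * ((B1 * (2 * C) + B2 * (2 * C) + B3 * (C * (C + 4))) * sqrt xi)"
   unfolding e norm_mult norm_minus_cancel norm_ii mult_1_left using B0 sc by (intro mult_mono) auto
  thus ?thesis by (simp only: K_def mult.assoc)
 qed
 moreover have "K \<ge> 0" using B0 B1 B2 B3 M0 by (simp add: K_def)
 moreover have "ball c r \<subseteq> {s. Re s > 0}" using r(2) ball_subset_cball by (rule order_trans[rotated])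
 ultimately show ?thesis using r(1) by blast
qed

lemma csum_dominated:
 assumes c: "Re c > 0" and x: "x > 0"
 shows "\<exists>r>0. \<exists>g N. ball c r \<subseteq> {s. Re s > 0} \<and> summable g \<and> (\<forall>s\<in>ball c r. \<forall>n\<ge>N. norm (cterm s x (Suc n)) \<le> g n)"
proof -
 obtain r K where r: "r > 0" "ball c r \<subseteq> {s. Re s > 0}" and K: "K \<ge> 0"
  "\<And>s xi. s \<in> ball c r ==> 0 < xi ==> xi \<le> 1 / 2 ==> norm (bterm s xi) \<le> K * sqrt xi"
  using bterm_bound[OF c] by blast
 obtain N0 where N0: "2 * x \<le> real N0" using real_arch_simple by blast
 have "norm (cterm s x (Suc n)) \<le> K * sqrt x * (real (card {d. d dvd Suc n}) * real (Suc n) powr (- 3 / 2))"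
  if s: "s \<in> ball c r" and n: "n \<ge> N0" for s n
 proof -
  define N where "N = real (Suc n)"
  define k where "k = real (card {d. d dvd Suc n})"
  have N: "N > 0" "2 * x \<le> N" using n N0 by (auto simp: N_def)
  have s0: "Re s \<ge> 0" using s r by auto
  have 1: "norm (divisor_sigma s (Suc n)) \<le> N powr Re s * k" unfolding N_def k_def by (rule divisor_sigma_bound[OF s0]) simp
  have 2: "norm (of_nat (Suc n) powr (s + 1) :: complex) = N powr (Re s + 1)" unfolding N_def by (subst norm_of_nat_powr) simp_all
  have xn: "0 < x / N" "x / N \<le> 1 / 2" using x N by (simp_all add: divide_le_eq)
  have 3: "norm (bterm s (x / N)) \<le> K * sqrt (x / N)" by (rule K(2)[OF s xn])
  have "norm (cterm s x (Suc n)) = norm (divisor_sigma s (Suc n)) / N powr (Re s + 1) * norm (bterm s (x / N))"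
   unfolding cterm_def norm_mult norm_divide 2 N_def ..
  also have "\<dots> \<le> (N powr Re s * k) / N powr (Re s + 1) * (K * sqrt (x / N))"
   using 1 3 by (intro mult_mono divide_right_mono) (auto simp: k_def)
  also have "\<dots> = K * sqrt x * (k * N powr (- 3 / 2))"
  proof -
   have "N powr (Re s + 1) = N powr Re s * N" using N by (simp add: powr_add)
   moreover have "N powr (- 3 / 2) = 1 / (N * sqrt N)"
   proof -
    have "N powr (- 3 / 2) = N powr (- (1 + 1 / 2))" by simp
    also have "\<dots> = 1 / (N powr 1 * N powr (1 / 2))" unfolding powr_minus_divide powr_add ..
    finally show ?thesis using N by (simp add: powr_half_sqrt)
   qed
   ultimately show ?thesis using N by (simp add: real_sqrt_divide)
  qed
  finally show ?thesis unfolding N_def k_def .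
 qed
 thus ?thesis using r summable_mult[OF summable_card_divisors, of "K * sqrt x"] by blast
qed

lemma cterm_summable:
 assumes "Re s > 0" "x > 0" shows "summable (%n. cterm s x (Suc n))"
proof -
 obtain r g N where g: "r > 0" "summable g" "\<forall>s'\<in>ball s r. \<forall>n\<ge>N. norm (cterm s' x (Suc n)) \<le> g n"
  using csum_dominated[OF assms] by blast
 have "\<exists>N. \<forall>n\<ge>N. norm (cterm s x (Suc n)) \<le> g n" using g(1,3) centre_in_ball by blast
 thus ?thesis by (rule summable_comparison_test[OF _ g(2)])
qed

lemma csum_holomorphic:
 assumes x: "x > 0"
 shows "(%s. \<Sum>n. cterm s x (Suc n)) holomorphic_on {s. Re s > 0}"
proof (rule holomorphic_suminf[OF open_Re_pos])
 fix n show "(%s. cterm s x (Suc n)) holomorphic_on {s. Re s > 0}"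
  unfolding cterm_def using x
  by (intro holomorphic_on_mult holomorphic_on_divide divisor_sigma_holomorphic bterm_holomorphic holomorphic_on_powr_right holomorphic_intros) (auto simp del: of_nat_Suc)
next
 fix c assume "c \<in> {s. Re s > 0}"
 thus "\<exists>r>0. \<exists>g. \<exists>N. ball c r \<subseteq> {s. Re s > 0} \<and> summable g \<and> (\<forall>s\<in>ball c r. \<forall>n\<ge>N. norm (cterm s x (Suc n)) \<le> g n)"
  using csum_dominated[OF _ x, of c] by simp
qed

lemma riemann_zeta_holomorphic_affine:
 assumes "f holomorphic_on S" "\<And>s. s \<in> S ==> f s ~= 1"
 shows "(%s. riemann_zeta (f s)) holomorphic_on S"
proof -
 have "f ` S \<subseteq> - {1}" using assms(2) by auto
 from holomorphic_on_compose_gen[OF assms(1) riemann_zeta_holomorphic this] show ?thesis by (simp add: o_def)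
qed

lemma main3_holomorphic:
 assumes "x > 0" shows "(%s. main3 s x) holomorphic_on {s. Re s > 0}"
 unfolding main3_def using assms
 by (intro holomorphic_intros riemann_zeta_holomorphic_affine) (auto intro!: not_nonpos_Int_Re_pos)

text \<open>The identity theorem in s, starting from the interval (0, 1/2). On Re s > 0 none of s +
  1, 1 - s and 1/2 - s meets the pole of zeta, so all terms are holomorphic.\<close>

theorem combined_formula:
 fixes s :: complex and x :: real
 assumes s: "Re s > 0" and x: "x > 0"
 shows "(\<Sum>n. lterm s x (Suc n)) = main3 s x
  + riemann_zeta (1 - s) / of_real (2 * pi * sqrt x)
  + riemann_zeta (1 / 2) * riemann_zeta (1 / 2 - s) / of_real (sqrt 2)
  + of_real (sqrt x) / of_real pi powr s * (\<Sum>n. cterm s x (Suc n))" (is "?L s = ?R s")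
proof (rule holomorphic_eq_from_reals[OF open_Re_pos, where f = "?L" and g = "?R" and a = 0 and b = "1 / 2" and w = s])
 show "connected {s. Re s > 0}" by (intro convex_connected convex_halfspace_Re_gt)
 show "?L holomorphic_on {s. Re s > 0}" by (rule lsum_holomorphic[OF x])
 have z: "(%s. riemann_zeta (1 - s)) holomorphic_on {s. Re s > 0}" "(%s. riemann_zeta (1 / 2 - s)) holomorphic_on {s. Re s > 0}"
 proof -
  show "(%s. riemann_zeta (1 - s)) holomorphic_on {s. Re s > 0}"
   by (rule riemann_zeta_holomorphic_affine) (intro holomorphic_intros, auto)
  show "(%s. riemann_zeta (1 / 2 - s)) holomorphic_on {s. Re s > 0}"
  proof (rule riemann_zeta_holomorphic_affine)
   fix s assume "s \<in> {s :: complex. Re s > 0}"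
   hence "Re (1 / 2 - s) ~= 1" by simp
   thus "1 / 2 - s ~= 1" by (metis one_complex.sel(1))
  qed (intro holomorphic_intros)
 qed
 have p: "(%s. complex_of_real (sqrt x) / of_real pi powr s) holomorphic_on {s. Re s > 0}"
  by (rule holomorphic_on_divide[OF holomorphic_on_const holomorphic_on_powr_right[OF holomorphic_on_ident]]) simp
 have nz: "complex_of_real (2 * pi * sqrt x) ~= 0" "complex_of_real (sqrt 2) ~= 0" using x by simp_all
 show "?R holomorphic_on {s. Re s > 0}"
  by (rule holomorphic_on_add[OF holomorphic_on_add[OF holomorphic_on_add[OF main3_holomorphic[OF x]
   holomorphic_on_divide[OF z(1) holomorphic_on_const]]
   holomorphic_on_divide[OF holomorphic_on_mult[OF holomorphic_on_const z(2)] holomorphic_on_const]]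
   holomorphic_on_mult[OF p csum_holomorphic[OF x]]]) (use nz in simp_all)
 show "(0::real) < 1 / 2" by simp
 show "s \<in> {s. Re s > 0}" using s by simp
 fix t :: real assume t: "0 < t" "t < 1 / 2"
 show "complex_of_real t \<in> {s. Re s > 0} \<and> ?L (of_real t) = ?R (of_real t)" using combined_real[OF t x] t by simp
qed

text \<open>At a positive integer the punctured limit of \<open>f\<close> is that of
  \<open>g\<close>, which is continuous there, as nearby points are not integers. Any other s with
  Re s > 0 is not an integer, and there \<open>f\<close> is read literally.\<close>

lemma limiting_value_eq:
 assumes s: "Re s > 0" and fg: "\<And>s'. s' \<notin> \<int> ==> Re s' > 0 ==> f s' = g s'" and g: "isCont g s"
 shows "limiting_value f s = g s"
proof (cases "\<exists>k::nat. k > 0 \<and> s = of_nat k")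
 case True
 then obtain k where k: "s = of_nat k" by blast
 have lim: "(g \<longlongrightarrow> g s) (at s)" using g by (simp add: isCont_def)
 have "eventually (%s'. f s' = g s') (at s)"
  unfolding eventually_at
 proof (intro exI[of _ "min (Re s) 1"] conjI ballI impI)
  show "min (Re s) 1 > 0" using s by simp
  fix s' assume h: "s' ~= s \<and> dist s' s < min (Re s) 1"
  have d: "norm (s' - s) < Re s" "norm (s' - s) < 1" using h by (simp_all add: dist_norm)
  have "Re s' > 0" using d(1) abs_Re_le_cmod[of "s' - s"] by simp
  moreover have "s' \<notin> \<int>"
  proof
   assume "s' \<in> \<int>"
   then obtain j where j: "s' = of_int j" by (auto elim: Ints_cases)
   have "s' - s = of_int (j - int k)" using j k by simp
   hence "norm (s' - s) = \<bar>of_int (j - int k)\<bar>" by (metis norm_of_int)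
   hence "j - int k = 0" using d(2) by linarith
   thus False using h j k by simp
  qed
  ultimately show "f s' = g s'" by (intro fg)
 qed
 hence "eventually (%s'. g s' = f s') (at s)" by (simp only: eq_commute)
 from Lim_transform_eventually[OF lim this] have "(f \<longlongrightarrow> g s) (at s)" .
 hence "Lim (at s) f = g s" by (intro tendsto_Lim) auto
 thus ?thesis using True by (simp add: limiting_value_def)
next
 case False
 have "s \<notin> \<int>"
 proof
  assume "s \<in> \<int>"
  then obtain j where j: "s = of_int j" by (auto elim: Ints_cases)
  hence "j > 0" using s by simp
  hence "s = of_nat (nat j)" "nat j > 0" using j by (auto simp: of_nat_nat)
  thus False using False by blast
 qed
 from fg[OF this s] show ?thesis unfolding limiting_value_def if_not_P[OF False] .
qed

lemma holomorphic_Re_pos_isCont: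
 assumes "g holomorphic_on {s. Re s > 0}" "Re s > 0" shows "isCont g s"
 using assms by (metis continuous_on_eq_continuous_at holomorphic_on_imp_continuous_on mem_Collect_eq open_Re_pos)

lemma sin_half_pi_nonzero:
 fixes s :: complex
 assumes "s \<notin> \<int>" shows "sin (of_real pi * s / 2) ~= 0"
proof
 assume "sin (of_real pi * s / 2) = 0"
 then obtain n :: int where "of_real pi * s / 2 = of_real (of_int n * pi)" unfolding sin_eq_0 by auto
 hence "s = of_int (2 * n)" by (simp add: field_simps)
 thus False using assms by (metis Ints_of_int)
qed

text \<open>Reflection expresses zeta(-s) by sin(pi s/2) zeta(s+1), and this sine cancels the
  denominator of the cotangent.\<close>

lemma main_third_term:
 assumes s: "Re s > 0" and x: "x > 0"
 shows "4 * of_real pi * limiting_value (%s. 2 powr (- s - 3) / of_real pi powr (s + 3 / 2)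
        * (Gamma (s + 1 / 2) * cot (of_real pi * s / 2) * riemann_zeta (- s)
         / of_real x powr (s + 1 / 2))) s = - main3 s x"
proof -
 have "limiting_value (%s. 2 powr (- s - 3) / of_real pi powr (s + 3 / 2)
        * (Gamma (s + 1 / 2) * cot (of_real pi * s / 2) * riemann_zeta (- s)
         / of_real x powr (s + 1 / 2))) s = - main3 s x / (4 * of_real pi)"
 proof (rule limiting_value_eq[OF s])
  show "isCont (%s. - main3 s x / (4 * of_real pi)) s"
   by (intro holomorphic_Re_pos_isCont[OF _ s] holomorphic_on_divide holomorphic_on_minus main3_holomorphic x holomorphic_on_const) simp
  fix s assume si: "s \<notin> \<int>" and s: "Re s > 0"
  define S where "S = sin (of_real pi * s / 2)"
  define C where "C = cos (of_real pi * s / 2)"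
  define X where "X = complex_of_real x powr (s + 1 / 2)"
  define Z where "Z = riemann_zeta (s + 1)"
  define L where "L = (2 * complex_of_real pi) powr (- s - 1)"
  define Q where "Q = complex_of_real pi powr (s + 1 / 2)"
  define T where "T = 2 powr (- s)"
  have S0: "S ~= 0" unfolding S_def by (rule sin_half_pi_nonzero[OF si])
  have X0: "X ~= 0" "Q ~= 0" using x by (simp_all add: X_def Q_def)
  have "riemann_zeta (- s) = 2 * (2 * of_real pi) powr (- s - 1) * Gamma (1 - - s) * sin (of_real pi * - s / 2) * riemann_zeta (1 - - s)"
   by (rule riemann_zeta_reflect) (use s in simp)
  hence z: "riemann_zeta (- s) = - (2 * L * Gamma (s + 1) * S * Z)" by (simp add: L_def S_def Z_def add.commute)
  have ct: "cot (of_real pi * s / 2) = C / S" by (simp add: cot_def C_def S_def)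
  have p1: "2 powr (- s - 3) = T / (8 :: complex)" unfolding T_def by (simp add: powr_diff)
  have e2: "s + 3 / 2 = (s + 1 / 2) + 1" by simp
  have p2: "complex_of_real pi powr (s + 3 / 2) = Q * of_real pi" unfolding e2 Q_def by (subst powr_add) simp
  have p3: "complex_of_real pi powr (- s - 1 / 2) = 1 / Q" unfolding Q_def by (simp add: powr_minus_divide[symmetric])
  have p4: "complex_of_real x powr (- (s + 1 / 2)) = 1 / X" unfolding X_def by (rule powr_minus_divide)
  have alg: "T / 8 / (Q * p) * (G * (C / S) * (- (2 * L * H * S * Z)) / X) = - (T * (1 / Q) * L * G * H * Z * C * (1 / X)) / (4 * p)"
   if "p ~= 0" for G H p using S0 X0 that by (simp add: field_simps)
  show "2 powr (- s - 3) / of_real pi powr (s + 3 / 2) * (Gamma (s + 1 / 2) * cot (of_real pi * s / 2) * riemann_zeta (- s) / of_real x powr (s + 1 / 2)) = - main3 s x / (4 * of_real pi)"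
   unfolding main3_def z ct p1 p2 p3 p4 X_def[symmetric] C_def[symmetric] Z_def[symmetric] L_def[symmetric] T_def[symmetric]
   by (rule alg) simp
 qed
 thus ?thesis by simp
qed

section \<open>Hypergeometric functions\<close>

text \<open>The series 2F1(a, 1; b), whose parameter 1 cancels the factorial. The 3F2 functions of
  the theorem are even parts of such series, since Pochhammer symbols of index 2n split by
  duplication.\<close>

definition hypF :: "complex => complex => complex fps" where
 "hypF a b = Abs_fps (%k. pochhammer a k / pochhammer b k)"

lemma pochhammer_not_nonpos: "b \<notin> \<int>\<^sub>\<le>\<^sub>0 ==> pochhammer b k ~= (0 :: complex)"
 by (auto dest: pochhammer_eq_0_imp_nonpos_Int)

lemma hypF_rec:
 assumes "b \<notin> \<int>\<^sub>\<le>\<^sub>0"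
 shows "(b + of_nat k) * fps_nth (hypF a b) (Suc k) = (a + of_nat k) * fps_nth (hypF a b) k"
proof -
 have "b + of_nat k ~= 0" using assms plus_of_nat_eq_0_imp by blast
 thus ?thesis using pochhammer_not_nonpos[OF assms] by (simp add: hypF_def pochhammer_Suc)
qed

lemma hypF_radius:
 assumes a: "a \<notin> \<int>\<^sub>\<le>\<^sub>0" and b: "b \<notin> \<int>\<^sub>\<le>\<^sub>0"
 shows "fps_conv_radius (hypF a b) = 1"
 unfolding fps_conv_radius_def
proof (rule conv_radius_ratio_limit_nonzero)
 show "(1 :: ereal) = ereal 1" by simp
 show "(1 :: real) ~= 0" by simp
 have "((%n. (b - a) / (a + of_nat n)) \<longlongrightarrow> 0) sequentially"
  by (rule tendsto_divide_0[OF tendsto_const]) (rule tendsto_add_filterlim_at_infinity[OF tendsto_const tendsto_of_nat])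
 hence "(%n. norm (1 + (b - a) / (a + of_nat n))) \<longlonglongrightarrow> norm (1 + 0 :: complex)" by (intro tendsto_intros)
 moreover have "norm (fps_nth (hypF a b) n) / norm (fps_nth (hypF a b) (Suc n)) = norm (1 + (b - a) / (a + of_nat n))" for n
 proof -
  have nz: "a + of_nat n ~= 0" "b + of_nat n ~= 0" using a b plus_of_nat_eq_0_imp by blast+
  have t: "fps_nth (hypF a b) n ~= 0" using pochhammer_not_nonpos[OF a] pochhammer_not_nonpos[OF b] by (simp add: hypF_def)
  have "fps_nth (hypF a b) (Suc n) = (a + of_nat n) * fps_nth (hypF a b) n / (b + of_nat n)"
   using hypF_rec[OF b, of n a] nz by (simp add: field_simps)
  hence "norm (fps_nth (hypF a b) n) / norm (fps_nth (hypF a b) (Suc n)) = norm ((b + of_nat n) / (a + of_nat n))"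
   using t nz by (simp add: norm_divide norm_mult)
  also have "(b + of_nat n) / (a + of_nat n) = 1 + (b - a) / (a + of_nat n)" using nz by (simp add: field_simps)
  finally show ?thesis .
 qed
 ultimately show "(%n. norm (fps_nth (hypF a b) n) / norm (fps_nth (hypF a b) (Suc n))) \<longlonglongrightarrow> 1" by simp
qed

lemma hypF_sums:
 assumes "a \<notin> \<int>\<^sub>\<le>\<^sub>0" "b \<notin> \<int>\<^sub>\<le>\<^sub>0" "norm v < 1"
 shows "(%k. fps_nth (hypF a b) k * v ^ k) sums eval_fps (hypF a b) v"
 unfolding eval_fps_def using hypF_radius[OF assms(1,2)] assms(3) by (intro summable_sums summable_fps) (simp add: one_ereal_def)

text \<open>Because one parameter is 1, the two-term recurrence for the coefficients amounts to an
  inhomogeneous equation of first order; the right-hand side b - 1 comes from the constant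
  coefficient.\<close>

lemma hypF_ode:
 assumes a: "a \<notin> \<int>\<^sub>\<le>\<^sub>0" and b: "b \<notin> \<int>\<^sub>\<le>\<^sub>0" and v: "norm v < 1"
 shows "v * (1 - v) * eval_fps (fps_deriv (hypF a b)) v + (b - 1 - a * v) * eval_fps (hypF a b) v = b - 1"
proof -
 define t where "t = fps_nth (hypF a b)"
 define F where "F = eval_fps (hypF a b) v"
 define F' where "F' = eval_fps (fps_deriv (hypF a b)) v"
 have S0: "(%k. t k * v ^ k) sums F" unfolding t_def F_def by (rule hypF_sums[OF a b v])
 have r: "norm v < fps_conv_radius (fps_deriv (hypF a b))"
  using fps_conv_radius_deriv[of "hypF a b"] hypF_radius[OF a b] v by (simp add: one_ereal_def) (metis ereal_less(3) less_le_trans order_less_le_trans one_ereal_def ereal_less_le less_ereal.simps(1))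
 have "(%k. fps_nth (fps_deriv (hypF a b)) k * v ^ k) sums F'"
  unfolding F'_def eval_fps_def by (intro summable_sums summable_fps r)
 hence "(%k. v * (of_nat (Suc k) * t (Suc k) * v ^ k)) sums (v * F')" unfolding t_def by (intro sums_mult) simp
 hence "(%k. (%k. of_nat k * t k * v ^ k) (Suc k)) sums (v * F')" by (simp add: mult_ac)
 from sums_Suc[OF this] have S1: "(%k. of_nat k * t k * v ^ k) sums (v * F')" by simp
 have A: "(%k. (b - 1 + of_nat k) * t k * v ^ k) sums ((b - 1) * F + v * F')"
  using sums_add[OF sums_mult[OF S0, of "b - 1"] S1] by (simp add: algebra_simps)
 have "(%k. v * ((a + of_nat k) * t k * v ^ k)) sums (v * (a * F + v * F'))"
  using sums_mult[OF sums_add[OF sums_mult[OF S0, of a] S1], of v] by (simp add: algebra_simps)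
 moreover have "v * ((a + of_nat k) * t k * v ^ k) = (%k. (b - 1 + of_nat k) * t k * v ^ k) (Suc k)" for k
  using hypF_rec[OF b, of k a] unfolding t_def by simp
 ultimately have "(%k. (%k. (b - 1 + of_nat k) * t k * v ^ k) (Suc k)) sums (v * (a * F + v * F'))" by simp
 from sums_Suc[OF this] have "(%k. (b - 1 + of_nat k) * t k * v ^ k) sums (v * (a * F + v * F') + (b - 1))"
  by (simp add: t_def hypF_def)
 from sums_unique2[OF A this] have "(b - 1) * F + v * F' = v * (a * F + v * F') + (b - 1)" .
 thus ?thesis unfolding F_def[symmetric] F'_def[symmetric] by (simp add: algebra_simps)
qed

section \<open>Expansion of the kernel at 0: the terms n >= x\<close>

definition Phi :: "complex => complex => real => complex" where
 "Phi u e t = integral {0..t} (%p. (1 - e * of_real (p\<^sup>2)) powr (u - 1))"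

lemma imaginary_unit_cases:
 assumes "e \<in> {\<i>, - \<i>}"
 shows "1 - e * complex_of_real y \<notin> \<real>\<^sub>\<le>\<^sub>0" "1 - e * complex_of_real y ~= 0" "norm e = 1"
proof -
 show 1: "1 - e * complex_of_real y \<notin> \<real>\<^sub>\<le>\<^sub>0" using assms i_real_not_nonpos[of y] by auto
 show "1 - e * complex_of_real y ~= 0" using 1 by auto
 show "norm e = 1" using assms by auto
qed

lemma Phi_integrand_continuous:
 assumes e: "e \<in> {\<i>, - \<i>}"
 shows "continuous_on A (%p. (1 - e * complex_of_real (p\<^sup>2)) powr (u - 1))"
 by (rule continuous_on_powr_slit) (intro continuous_intros imaginary_unit_cases(1)[OF e])+

lemma Phi_eq_Jint:
 assumes e: "e \<in> {\<i>, - \<i>}" and t: "t > 0"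
 shows "Phi u e t = of_real t * Jint u (e * of_real (t\<^sup>2))"
proof -
 define f where "f = (%p. (1 - e * complex_of_real (p\<^sup>2)) powr (u - 1))"
 have "(f has_integral Phi u e t) {0..t}" unfolding f_def Phi_def
  by (intro integrable_integral integrable_continuous_real Phi_integrand_continuous e)
 from has_integral_stretch_real[OF this, of t] t have 1: "((%x. f (t * x)) has_integral (1 / t) *\<^sub>R Phi u e t) {0..1}"
  by (simp add: image_divide_atLeastAtMost)
 have "Jint u (e * of_real (t\<^sup>2)) = integral {0..1} (%q. (1 - e * of_real (t\<^sup>2) * complex_of_real (q\<^sup>2)) powr (u - 1))"
  by (rule Jint_eq_integral[OF imaginary_unit_cases(1)[OF e]])
 also have "(%q. (1 - e * of_real (t\<^sup>2) * complex_of_real (q\<^sup>2)) powr (u - 1)) = (%x. f (t * x))"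
  by (simp add: f_def power_mult_distrib mult.assoc)
 also have "integral {0..1} \<dots> = (1 / t) *\<^sub>R Phi u e t" using 1 by (rule integral_unique)
 finally show ?thesis using t by (simp add: scaleR_conv_of_real)
qed

lemma Phi_deriv:
 assumes e: "e \<in> {\<i>, - \<i>}" and t: "t \<in> {0..b}"
 shows "(Phi u e has_vector_derivative (1 - e * of_real (t\<^sup>2)) powr (u - 1)) (at t within {0..b})"
 unfolding Phi_def[abs_def] by (rule integral_has_vector_derivative[OF Phi_integrand_continuous[OF e] t])

lemma same_vector_derivative:
 fixes f g :: "real => complex"
 assumes "convex S" "\<And>t. t \<in> S ==> (f has_vector_derivative h t) (at t within S)"
  "\<And>t. t \<in> S ==> (g has_vector_derivative h t) (at t within S)"
 shows "\<exists>c. \<forall>t\<in>S. f t = g t + c"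
proof -
 have "((%t. f t - g t) has_derivative (%_. 0)) (at t within S)" if "t \<in> S" for t
  using has_vector_derivative_diff[OF assms(2,3)[OF that]] by (simp add: has_vector_derivative_def)
 from has_derivative_zero_constant[OF assms(1) this] obtain c where "\<forall>t\<in>S. f t - g t = c" by blast
 hence "\<forall>t\<in>S. f t = g t + c" by (simp add: algebra_simps)
 thus ?thesis ..
qed

text \<open>\<open>Phi\<close> and z (1 - e z^2)^u H(e z^2) have the same derivative, by the
  first-order equation for H = 2F1(s+1, 1; 3/2), and both vanish at 0. This is Euler's
  transformation of the function behind \<open>Jint\<close>; its power is cancelled by the factor (1
  - v)^(-u) in \<open>Rfun\<close>.\<close>

lemma Rfun_eq_hypF:
 assumes e: "e \<in> {\<i>, - \<i>}" and s: "s + 1 \<notin> \<int>\<^sub>\<le>\<^sub>0" and x: "0 < xi" "xi < 1"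
 shows "Rfun s (e * of_real xi) = eval_fps (hypF (s + 1) (3 / 2)) (e * of_real xi)"
proof -
 define u where "u = s + 1 / 2"
 define H where "H = hypF (s + 1) (3 / 2)"
 define g where "g = (%z. z * (1 - e * z\<^sup>2) powr u * eval_fps H (e * z\<^sup>2))"
 have h: "(3 / 2 :: complex) \<notin> \<int>\<^sub>\<le>\<^sub>0" by (rule not_nonpos_Int_Re_pos) simp
 define t where "t = sqrt xi"
 have t: "0 < t" "t < 1" "t\<^sup>2 = xi" using x by (auto simp: t_def)
 have "\<exists>c. \<forall>p\<in>{0..t}. Phi u e p = g (of_real p) + c"
 proof (rule same_vector_derivative)
  fix p assume p: "p \<in> {0..t}"
  thus "(Phi u e has_vector_derivative (1 - e * of_real (p\<^sup>2)) powr (u - 1)) (at p within {0..t})" by (rule Phi_deriv[OF e])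
  define Z where "Z = complex_of_real p"
  define v where "v = e * Z\<^sup>2"
  define F where "F = eval_fps H v"
  define F' where "F' = eval_fps (fps_deriv H) v"
  define q where "q = (1 - v) powr (u - 1)"
  have v1: "1 - v \<notin> \<real>\<^sub>\<le>\<^sub>0" "1 - v ~= 0" using imaginary_unit_cases(1,2)[OF e, of "p\<^sup>2"] by (simp_all add: v_def Z_def)
  have "norm v = p\<^sup>2" using imaginary_unit_cases(3)[OF e] by (simp add: v_def Z_def norm_mult norm_power)
  also have "\<dots> < 1" using p t by (auto intro: power_less_one_iff[THEN iffD2] simp: power2_eq_square mult_le_one) (smt (verit) mult_le_one mult_left_le)
  finally have v: "norm v < 1" .
  have d0: "((%z. e * z\<^sup>2) has_field_derivative (e * (2 * Z))) (at Z)"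
   by (rule DERIV_cmult) (auto intro!: derivative_eq_intros)
  have dF: "((%z. eval_fps H (e * z\<^sup>2)) has_field_derivative F' * (e * (2 * Z))) (at Z)"
   unfolding F'_def v_def
   by (rule DERIV_chain2[OF has_field_derivative_eval_fps d0]) (use v hypF_radius[OF s h] in \<open>simp add: H_def v_def one_ereal_def\<close>)
  have d1: "((%z. 1 - e * z\<^sup>2) has_field_derivative (0 - e * (2 * Z))) (at Z)" by (rule DERIV_diff[OF DERIV_const d0])
  have dP: "((%z. (1 - e * z\<^sup>2) powr u) has_field_derivative (u * q) * (0 - e * (2 * Z))) (at Z)"
   unfolding q_def v_def by (rule DERIV_chain2[OF has_field_derivative_powr d1]) (use v1 in \<open>simp add: v_def\<close>)
  have "(g has_field_derivative ((1 * (1 - v) powr u + (u * q) * (0 - e * (2 * Z)) * Z) * F + F' * (e * (2 * Z)) * (Z * (1 - v) powr u))) (at Z)"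
   unfolding g_def F_def v_def[symmetric]
   using DERIV_mult[OF DERIV_mult[OF DERIV_ident dP] dF] unfolding v_def by simp
  moreover have "(1 - v) powr u = (1 - v) * q"
  proof -
   have "(1 - v) powr u = (1 - v) powr (1 + (u - 1))" by simp
   thus ?thesis unfolding powr_add q_def using v1 by simp
  qed
  moreover have "(1 * ((1 - v) * q) + (u * q) * (0 - e * (2 * Z)) * Z) * F + F' * (e * (2 * Z)) * (Z * ((1 - v) * q)) = q"
  proof -
   have o: "v * (1 - v) * F' + (3 / 2 - 1 - (s + 1) * v) * F = 3 / 2 - 1"
    unfolding F_def F'_def H_def by (rule hypF_ode[OF s h v])
   have "(1 * ((1 - v) * q) + (u * q) * (0 - e * (2 * Z)) * Z) * F + F' * (e * (2 * Z)) * (Z * ((1 - v) * q))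
    = (2 * q) * (v * (1 - v) * F' + (3 / 2 - 1 - (s + 1) * v) * F)"
    unfolding v_def u_def by (simp add: field_simps power2_eq_square)
   thus ?thesis unfolding o by simp
  qed
  ultimately have "(g has_field_derivative q) (at (of_real p))" by (simp only: Z_def)
  from has_vector_derivative_real_field[OF this] show "((%p. g (of_real p)) has_vector_derivative (1 - e * of_real (p\<^sup>2)) powr (u - 1)) (at p within {0..t})"
   unfolding q_def v_def Z_def by simp
 qed simp
 then obtain c where c: "\<forall>p\<in>{0..t}. Phi u e p = g (of_real p) + c" ..
 have "c = 0" using c[rule_format, of 0] t by (simp add: Phi_def g_def)
 hence "Phi u e t = g (of_real t)" using c t by simp
 moreover have tc: "(complex_of_real t)\<^sup>2 = of_real xi" using t(3) by (metis of_real_power)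
 ultimately have "of_real t * Jint u (e * of_real xi) = of_real t * ((1 - e * of_real xi) powr u * eval_fps H (e * of_real xi))"
  using Phi_eq_Jint[OF e t(1), of u] by (simp only: g_def t(3) tc mult.assoc)
 hence J: "Jint u (e * of_real xi) = (1 - e * of_real xi) powr u * eval_fps H (e * of_real xi)" using t(1) by simp
 have "(1 - e * of_real xi) powr (- u) * (1 - e * of_real xi) powr u = 1"
  using imaginary_unit_cases(2)[OF e, of xi] by (simp flip: powr_add)
 thus ?thesis unfolding Rfun_def u_def[symmetric] J H_def[symmetric] by (simp add: mult.assoc[symmetric])
qed

text \<open>Coefficients of bounded variation tending to 0 give convergence on the closed disc away
  from 1, in particular at i and -i. The transformed series converges absolutely, which permits
  passage to the boundary.\<close>

lemma sums_summation_by_parts: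
 fixes c :: "nat => complex"
 assumes c0: "c \<longlonglongrightarrow> 0" and sm: "summable (%k. norm (c (Suc k) - c k))" and w: "norm w \<le> 1" "w ~= 1"
 shows "(%k. c k * w ^ k) sums ((c 0 + (\<Sum>k. (c (Suc k) - c k) * w ^ Suc k)) / (1 - w))"
proof -
 have p: "(1 - w) * (\<Sum>k<n. c k * w ^ k) = c 0 + (\<Sum>k<n. (c (Suc k) - c k) * w ^ Suc k) - c n * w ^ n" for n
 proof (induction n)
  case (Suc n)
  have alg: "a + T - d * X + (1 - w) * (d * X) = a + (T + (b - d) * (w * X)) - b * (w * X)" for a b d T X
   by (simp add: algebra_simps)
  show ?case unfolding sum.lessThan_Suc distrib_left Suc power_Suc by (rule alg)
 qed simp
 have w1: "norm (w ^ k) \<le> 1" for k using w by (simp add: norm_power power_le_one)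
 have "summable (%k. norm ((c (Suc k) - c k) * w ^ Suc k))"
  by (rule summable_comparison_test'[OF sm, of 0]) (use w1[of "Suc _"] in \<open>auto simp: norm_mult norm_power intro!: mult_left_le simp del: power_Suc\<close>)
 hence "(%n. \<Sum>k<n. (c (Suc k) - c k) * w ^ Suc k) \<longlonglongrightarrow> (\<Sum>k. (c (Suc k) - c k) * w ^ Suc k)"
  by (rule summable_LIMSEQ[OF summable_norm_cancel])
 moreover have "(%n. c n * w ^ n) \<longlonglongrightarrow> 0"
 proof (rule Lim_null_comparison)
  show "eventually (%n. norm (c n * w ^ n) \<le> norm (c n)) sequentially"
   using w1 by (auto simp: norm_mult intro!: always_eventually mult_left_le)
  show "(%n. norm (c n)) \<longlonglongrightarrow> 0" using tendsto_norm[OF c0] by simp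
 qed
 ultimately have "(%n. (1 - w) * (\<Sum>k<n. c k * w ^ k)) \<longlonglongrightarrow> c 0 + (\<Sum>k. (c (Suc k) - c k) * w ^ Suc k) - 0"
  unfolding p by (intro tendsto_intros)
 hence "(%n. (1 - w) * (\<Sum>k<n. c k * w ^ k) / (1 - w)) \<longlonglongrightarrow> (c 0 + (\<Sum>k. (c (Suc k) - c k) * w ^ Suc k) - 0) / (1 - w)"
  using w(2) by (intro tendsto_divide tendsto_const) auto
 thus ?thesis unfolding sums_def using w(2) by simp
qed

text \<open>The coefficients (s)_k / (1/2)_k are of order k^(s - 1/2), by the product formula for
  Gamma, and their differences of order k^(s - 3/2). The condition Re s < 1/2 for integral x
  originates here.\<close>

lemma hypF_half_asymp:
 assumes s: "0 < Re s" "Re s < 1 / 2"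
 shows "fps_nth (hypF s (1 / 2)) \<longlonglongrightarrow> 0" "summable (%k. norm (fps_nth (hypF s (1 / 2)) (Suc k) - fps_nth (hypF s (1 / 2)) k))"
proof -
 define c where "c = fps_nth (hypF s (1 / 2))"
 have s0: "s \<notin> \<int>\<^sub>\<le>\<^sub>0" "(1 / 2 :: complex) \<notin> \<int>\<^sub>\<le>\<^sub>0" by (rule not_nonpos_Int_Re_pos; use s in simp)+
 have "(%n. Gamma_series (1 / 2) n / Gamma_series s n) \<longlonglongrightarrow> Gamma (1 / 2) / Gamma s"
  using Gamma_nonzero_Re_pos[OF s(1)] by (intro tendsto_divide Gamma_series_LIMSEQ)
 hence "Bseq (%n. Gamma_series (1 / 2) n / Gamma_series s n)" by (intro convergent_imp_Bseq) (auto simp: convergent_def)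
 then obtain A where A: "A > 0" "\<And>n. norm (Gamma_series (1 / 2) n / Gamma_series s n) \<le> A" by (auto simp: Bseq_def)
 have cb: "norm (c (Suc n)) \<le> A * real n powr (Re s - 1 / 2)" if n: "n > 0" for n
 proof -
  define L where "L = complex_of_real (ln (real n))"
  have "Gamma_series (1 / 2) n / Gamma_series s n = c (Suc n) * (exp (1 / 2 * L) / exp (s * L))"
   using pochhammer_not_nonpos[OF s0(1), of "Suc n"] pochhammer_not_nonpos[OF s0(2), of "Suc n"]
   by (simp add: Gamma_series_def c_def hypF_def L_def)
  also have "exp (1 / 2 * L) / exp (s * L) = exp ((1 / 2 - s) * L)" by (simp add: exp_diff[symmetric] left_diff_distrib)
  finally have e: "Gamma_series (1 / 2) n / Gamma_series s n = c (Suc n) * exp ((1 / 2 - s) * L)" .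
  have "norm (exp ((1 / 2 - s) * L)) = real n powr (1 / 2 - Re s)" using n by (simp add: L_def powr_def)
  hence "norm (c (Suc n)) * real n powr (1 / 2 - Re s) \<le> A" using A(2)[of n] unfolding e norm_mult by simp
  hence "norm (c (Suc n)) * real n powr (1 / 2 - Re s) * real n powr (Re s - 1 / 2) \<le> A * real n powr (Re s - 1 / 2)"
   by (intro mult_right_mono) auto
  moreover have "real n powr (1 / 2 - Re s) * real n powr (Re s - 1 / 2) = 1" using n by (simp flip: powr_add)
  ultimately show ?thesis by (simp add: mult.assoc)
 qed
 have "(%n. c (Suc n)) \<longlonglongrightarrow> 0"
 proof (rule Lim_null_comparison)
  show "eventually (%n. norm (c (Suc n)) \<le> A * real n powr (Re s - 1 / 2)) sequentially"
   using eventually_gt_at_top[of 0] by eventually_elim (rule cb)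
  have "((%n. real n powr (Re s - 1 / 2)) \<longlongrightarrow> 0) sequentially"
   by (rule tendsto_neg_powr) (use s in \<open>auto intro: filterlim_real_sequentially\<close>)
  thus "(%n. A * real n powr (Re s - 1 / 2)) \<longlonglongrightarrow> 0" by (rule tendsto_mult_right_zero)
 qed
 thus "c \<longlonglongrightarrow> 0" by (rule LIMSEQ_imp_Suc)
 define B where "B = A * norm (s - 1 / 2)"
 have d: "norm (c (Suc (n + 2)) - c (n + 2)) \<le> B * real (n + 1) powr (Re s - 3 / 2)" for n
 proof -
  define k where "k = n + 2"
  define N where "N = real (n + 1)"
  have N: "N > 0" by (simp add: N_def)
  have nz: "1 / 2 + complex_of_nat k ~= 0" using s0(2) plus_of_nat_eq_0_imp by blast
  have H: "(1 / 2 + of_nat k) * (c (Suc k) - c k) = (s - 1 / 2) * c k"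
   using hypF_rec[OF s0(2), of k s] unfolding c_def[symmetric] by (simp add: algebra_simps)
  have "c (Suc k) - c k = (s - 1 / 2) * c k / (1 / 2 + of_nat k)"
   by (subst nonzero_eq_divide_eq[OF nz]) (use H in \<open>simp only: mult.commute\<close>)
  hence "norm (c (Suc k) - c k) = norm (s - 1 / 2) * norm (c k) / norm (1 / 2 + complex_of_nat k)" by (simp add: norm_mult norm_divide)
  also have "norm (1 / 2 + complex_of_nat k) = 1 / 2 + real k"
  proof -
   have "1 / 2 + complex_of_nat k = of_real (1 / 2 + real k)" by simp
   thus ?thesis by (simp only: norm_of_real)
  qed
  also have "norm (s - 1 / 2) * norm (c k) / (1 / 2 + real k) \<le> norm (s - 1 / 2) * (A * N powr (Re s - 1 / 2)) / N"
   using cb[of "n + 1"] N less_imp_le[OF A(1)] by (intro frac_le mult_left_mono mult_nonneg_nonneg) (auto simp: k_def N_def)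
  also have "\<dots> = B * N powr (Re s - 3 / 2)"
  proof -
   have "N powr (Re s - 1 / 2) = N powr ((Re s - 3 / 2) + 1)" by simp
   also have "\<dots> = N powr (Re s - 3 / 2) * N" using N by (simp only: powr_add powr_one)
   finally show ?thesis using N by (simp add: B_def mult_ac)
  qed
  finally show ?thesis unfolding k_def N_def .
 qed
 have sm: "summable (%n. real (n + 1) powr (Re s - 3 / 2))"
  using summable_powr_shift[of "3 / 2 - Re s"] s by simp
 have "summable (%n. norm (c (Suc (n + 2)) - c (n + 2)))"
  by (rule summable_comparison_test'[OF summable_mult[OF sm, of B], of 0]) (use d in simp)
 thus "summable (%k. norm (c (Suc k) - c k))" by (subst summable_iff_shift[of _ 2, symmetric])
qed

text \<open>By (s)_(k+1) / (1/2)_(k+1) = 2 s (s+1)_k / (3/2)_k, the series 2F1(s, 1; 1/2; v) is 1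
  plus 2 s v times the series of \<open>Rfun\<close>. The value at xi = 1 is obtained as an Abel
  limit.\<close>

lemma hypF_half_sums:
 assumes e: "e \<in> {\<i>, - \<i>}" and s: "0 < Re s" and x: "0 < xi" "xi \<le> 1" "xi = 1 \<longrightarrow> Re s < 1 / 2"
 shows "(%k. fps_nth (hypF s (1 / 2)) k * (e * of_real xi) ^ k) sums (1 + 2 * s * (e * of_real xi) * Rfun s (e * of_real xi))"
proof -
 define c where "c = fps_nth (hypF s (1 / 2))"
 have s1: "s + 1 \<notin> \<int>\<^sub>\<le>\<^sub>0" "(3 / 2 :: complex) \<notin> \<int>\<^sub>\<le>\<^sub>0" by (rule not_nonpos_Int_Re_pos; use s in simp)+
 have n: "norm (e * complex_of_real y) = \<bar>y\<bar>" for y using imaginary_unit_cases(3)[OF e] by (simp add: norm_mult)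
 have small: "(%k. c k * (e * of_real y) ^ k) sums (1 + 2 * s * (e * of_real y) * Rfun s (e * of_real y))" if y: "0 < y" "y < 1" for y
 proof -
  define v where "v = e * complex_of_real y"
  have v: "norm v < 1" using y n by (simp add: v_def)
  have "(%k. 2 * s * v * (fps_nth (hypF (s + 1) (3 / 2)) k * v ^ k)) sums (2 * s * v * Rfun s v)"
   unfolding v_def Rfun_eq_hypF[OF e s1(1) y] by (rule sums_mult, rule hypF_sums[OF s1]) (use v v_def in simp)
  moreover have "2 * s * v * (fps_nth (hypF (s + 1) (3 / 2)) k * v ^ k) = (%k. c k * v ^ k) (Suc k)" for k
  proof -
   have "(1 / 2 + 1 :: complex) = 3 / 2" by simp
   hence p: "pochhammer (1 / 2 :: complex) (Suc k) = 1 / 2 * pochhammer (3 / 2) k" unfolding pochhammer_rec by simp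
   have "2 * s * v * (fps_nth (hypF (s + 1) (3 / 2)) k * v ^ k) = c (Suc k) * v ^ Suc k"
    unfolding c_def hypF_def fps_nth_Abs_fps p pochhammer_rec[of s] by simp
   thus ?thesis .
  qed
  ultimately have "(%k. (%k. c k * v ^ k) (Suc k)) sums (2 * s * v * Rfun s v)" by simp
  from sums_Suc[OF this] show ?thesis by (simp add: v_def c_def hypF_def add.commute)
 qed
 show ?thesis
 proof (cases "xi = 1")
  case False
  thus ?thesis using small[of xi] x unfolding c_def by simp
 next
  case True
  hence sh: "Re s < 1 / 2" using x by simp
  note as = hypF_half_asymp[OF s sh, folded c_def]
  define g where "g = (%w. \<Sum>k. (c (Suc k) - c k) * w ^ Suc k)"
  have e1: "e * complex_of_real y ~= 1" for y using imaginary_unit_cases(2)[OF e, of y] by auto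
  have parts: "(%k. c k * (e * of_real y) ^ k) sums ((c 0 + g (e * of_real y)) / (1 - e * of_real y))" if "0 \<le> y" "y \<le> 1" for y
   unfolding g_def by (rule sums_summation_by_parts[OF as _ e1]) (use that n in simp)
  \<comment> \<open>\<open>D\<close> vanishes on (0, 1) and is continuous on [0, 1], by uniform
    convergence of the series summed by parts; so it vanishes at 1 as well.\<close>
  define D where "D = (%y. (c 0 + g (e * of_real y)) / (1 - e * of_real y) - (1 + 2 * s * (e * of_real y) * Rfun s (e * of_real y)))"
  have cg: "continuous_on {0..1} (%y. g (e * complex_of_real y))"
  proof -
   have "uniform_limit {0..1} (%m y. \<Sum>k<m. (c (Suc k) - c k) * (e * complex_of_real y) ^ Suc k) (%y. g (e * of_real y)) sequentially"
    unfolding g_def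
   proof (rule Weierstrass_m_test[OF _ as(2)])
    fix k and y :: real assume "y \<in> {0..1}"
    hence "norm ((e * complex_of_real y) ^ Suc k) \<le> 1" unfolding norm_power n by (intro power_le_one) auto
    thus "norm ((c (Suc k) - c k) * (e * complex_of_real y) ^ Suc k) \<le> norm (c (Suc k) - c k)"
     unfolding norm_mult by (intro mult_left_le) auto
   qed
   thus ?thesis by (rule uniform_limit_theorem[rotated]) (auto intro!: always_eventually continuous_intros)
  qed
  have "continuous_on {0..1} (%y. Rfun s (e * complex_of_real y))"
   by (rule continuous_on_compose2[OF holomorphic_on_imp_continuous_on[OF Rfun_holomorphic[of s]]])
    (use imaginary_unit_cases(1)[OF e] in \<open>auto intro!: continuous_intros\<close>)
  hence cD: "continuous_on (closure {0<..<1}) D"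
   unfolding D_def using cg imaginary_unit_cases(2)[OF e] by (auto intro!: continuous_on_diff continuous_on_divide continuous_on_add continuous_on_mult continuous_on_const continuous_on_of_real continuous_on_id)
  have "D 1 = 0"
  proof (rule continuous_constant_on_closure[OF cD])
   fix y :: real assume y: "y \<in> {0<..<1}"
   hence "(c 0 + g (e * of_real y)) / (1 - e * of_real y) = 1 + 2 * s * (e * of_real y) * Rfun s (e * of_real y)"
    by (intro sums_unique2[OF parts small]) auto
   thus "D y = 0" by (simp add: D_def)
  qed simp
  thus ?thesis using parts[of 1] unfolding True D_def c_def by simp
 qed
qed

lemma even_part_sums:
 fixes c :: "nat => complex"
 assumes "(%k. c k * w ^ k) sums A" "(%k. c k * (- w) ^ k) sums B"
 shows "(%n. c (2 * n) * (w\<^sup>2) ^ n) sums ((A + B) / 2)"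
proof -
 have s: "(%k. (c k * w ^ k + c k * (- w) ^ k) / 2) sums ((A + B) / 2)" by (intro sums_divide sums_add assms)
 have "(c k * w ^ k + c k * (- w) ^ k) / 2 = 0" if "k \<notin> range (%n :: nat. 2 * n)" for k
 proof -
  have "odd k" using that by (auto elim!: evenE)
  thus ?thesis by simp
 qed
 moreover have "strict_mono (%n :: nat. 2 * n)" by (simp add: strict_mono_def)
 ultimately have "(%n. (c (2 * n) * w ^ (2 * n) + c (2 * n) * (- w) ^ (2 * n)) / 2) sums ((A + B) / 2)"
  using s sums_mono_reindex[of "%n. 2 * n" "%k. (c k * w ^ k + c k * (- w) ^ k) / 2"] by blast
 thus ?thesis by (simp add: power_mult)
qed

text \<open>By duplication (s)_(2n) / (1/2)_(2n) is the n-th coefficient of the 3F2. Hence the 3F2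
  at -xi^2 is the even part of 2F1(s, 1; 1/2) at i xi, and averaging over v and -v produces
  \<open>Rdiff\<close>.\<close>

lemma hypergeo_large:
 assumes s: "0 < Re s" and x: "0 < xi" "xi \<le> 1" "xi = 1 \<longrightarrow> Re s < 1 / 2"
 shows "hypergeo [s / 2, (1 + s) / 2, 1] [1 / 4, 3 / 4] (of_real (- (xi\<^sup>2))) = 1 + s * (\<i> * of_real xi) * Rdiff s xi"
proof -
 define c where "c = fps_nth (hypF s (1 / 2))"
 define w where "w = \<i> * complex_of_real xi"
 have w2: "w\<^sup>2 = of_real (- (xi\<^sup>2))" by (simp add: w_def power_mult_distrib)
 have 1: "(%k. c k * w ^ k) sums (1 + 2 * s * w * Rfun s w)"
  using hypF_half_sums[of \<i>, OF _ s x] by (simp add: w_def c_def)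
 have 2: "(%k. c k * (- w) ^ k) sums (1 + 2 * s * (- w) * Rfun s (- w))"
  using hypF_half_sums[of "- \<i>", OF _ s x] by (simp add: w_def c_def)
 have "(1 + 2 * s * w * Rfun s w + (1 + 2 * s * (- w) * Rfun s (- w))) / 2 = 1 + s * w * Rdiff s xi"
  by (simp add: Rdiff_def w_def field_simps)
 with even_part_sums[OF 1 2] have "(%n. c (2 * n) * (w\<^sup>2) ^ n) sums (1 + s * w * Rdiff s xi)" by (simp only:)
 moreover have "c (2 * n) * (w\<^sup>2) ^ n = fps_nth (fps_hypergeo [s / 2, (1 + s) / 2, 1] [1 / 4, 3 / 4] 1) n * (of_real (- (xi\<^sup>2))) ^ n" for n
 proof -
  have p1: "pochhammer s (2 * n) = of_nat (2 ^ (2 * n)) * pochhammer (s / 2) n * pochhammer ((1 + s) / 2) n"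
   using pochhammer_double[of "s / 2" n] by (simp add: add_divide_distrib add.commute)
  have p2: "pochhammer (1 / 2 :: complex) (2 * n) = of_nat (2 ^ (2 * n)) * pochhammer (1 / 4) n * pochhammer (3 / 4) n"
   using pochhammer_double[of "1 / 4 :: complex" n] by simp
  have f: "pochhammer 1 n = (of_nat (fact n) :: complex)" unfolding of_nat_fact by (rule pochhammer_fact[symmetric])
  have "fps_nth (fps_hypergeo [s / 2, (1 + s) / 2, 1] [1 / 4, 3 / 4] 1) n = c (2 * n)"
   by (simp add: c_def hypF_def p1 p2 f)
  thus ?thesis unfolding w2 by simp
 qed
 ultimately have "(%n. fps_nth (fps_hypergeo [s / 2, (1 + s) / 2, 1] [1 / 4, 3 / 4] 1) n * (of_real (- (xi\<^sup>2))) ^ n) sums (1 + s * w * Rdiff s xi)"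
  by simp
 thus ?thesis unfolding hypergeo_def eval_fps_def w_def by (rule sums_unique[symmetric])
qed

section \<open>Inversion of the kernel: the terms n < x\<close>

lemma powr_unit_mult:
 assumes "f \<in> {\<i>, - \<i>}" "Re z > 0"
 shows "(f * z) powr a = f powr a * z powr a"
proof -
 have n: "z ~= 0" "f ~= 0" using assms by auto
 have "\<bar>Im (Ln z)\<bar> < pi / 2" by (rule Re_Ln_pos_lt_imp[OF assms(2)])
 moreover have "\<bar>Im (Ln f)\<bar> = pi / 2" using assms(1) by auto
 ultimately have "Ln (f * z) = Ln f + Ln z" using n by (intro Ln_times_simple) linarith+
 thus ?thesis using n by (simp add: powr_def distrib_left exp_add)
qed

text \<open>Since e^2 = -1, the base is xi (-e) (1 + e/xi). The last factor has positive real part,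
  so the arguments add without leaving the principal branch.\<close>

lemma powr_inversion:
 assumes e: "e \<in> {\<i>, - \<i>}" and x: "xi > 0"
 shows "(1 - e * of_real xi) powr a = (- e) powr a * of_real xi powr a * (1 + e / of_real xi) powr a"
proof -
 have me: "- e \<in> {\<i>, - \<i>}" using e by auto
 have r: "Re (1 + e / of_real xi) > 0" using e by auto
 have ee: "e * e = - 1" using e by auto
 have "1 - e * complex_of_real xi = of_real xi * ((- e) * (1 + e / of_real xi))"
  using x ee by (simp add: algebra_simps)
 hence "(1 - e * complex_of_real xi) powr a = of_real xi powr a * ((- e) * (1 + e / of_real xi)) powr a"
  by (simp only:) (rule powr_times_real_left, use x in auto)
 thus ?thesis unfolding powr_unit_mult[OF me r] by (simp only: mult_ac)
qed

text \<open>An antiderivative of the integrand of \<open>Phi\<close> adapted to infinity. Pulling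
  out (-e t^2)^(s - 1/2) leaves a function of 1/t^2; the factor t^(2s) / (2s) integrates the power,
  and the first-order equation for 2F1(1/2, 1; 1-s) accounts for the rest.\<close>

lemma small_derivative:
 fixes s t :: real
 assumes e: "e \<in> {\<i>, - \<i>}" and s: "- 1 / 2 < s" "s < 0" and t: "t > 1"
 defines "g \<equiv> (%Z. 1 / (2 * of_real s) * (- e) powr (of_real s - 1 / 2) * (Z powr (2 * of_real s) * (1 - (- e) / Z\<^sup>2) powr (of_real s + 1 / 2) * eval_fps (hypF (1 / 2) (1 - of_real s)) ((- e) / Z\<^sup>2)))"
 shows "(g has_field_derivative (1 - e * of_real (t\<^sup>2)) powr (of_real s - 1 / 2)) (at (of_real t))"
proof -
 define S where "S = complex_of_real s"
 define u where "u = S + 1 / 2"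
 define Z where "Z = complex_of_real t"
 define H where "H = hypF (1 / 2) (1 - S)"
 define w where "w = (- e) / Z\<^sup>2"
 define F where "F = eval_fps H w"
 define F' where "F' = eval_fps (fps_deriv H) w"
 define q where "q = (1 - w) powr (u - 1)"
 define y where "y = Z powr (2 * S - 1)"
 have h: "(1 / 2 :: complex) \<notin> \<int>\<^sub>\<le>\<^sub>0" "1 - S \<notin> \<int>\<^sub>\<le>\<^sub>0" by (rule not_nonpos_Int_Re_pos; use s in \<open>simp add: S_def\<close>)+
 have Z: "Z ~= 0" "Z \<notin> \<real>\<^sub>\<le>\<^sub>0" using t by (auto simp: Z_def)
 have Z2: "Z\<^sup>2 = of_real (t\<^sup>2)" by (simp add: Z_def)
 have t2: "t\<^sup>2 > 1" using t by (simp add: power2_eq_square) (metis less_trans mult_strict_mono' mult_1 zero_le_one zero_less_one less_eq_real_def)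
 have "norm w = 1 / t\<^sup>2" unfolding w_def Z2 using imaginary_unit_cases(3)[OF e] by (simp add: norm_divide norm_power)
 moreover have "1 / t\<^sup>2 < 1 / 1" using t2 by (intro divide_strict_left_mono) auto
 ultimately have nw: "norm w < 1" by simp
 have w1: "1 - w \<notin> \<real>\<^sub>\<le>\<^sub>0" "1 - w ~= 0" using one_minus_small_not_nonpos[OF nw] by auto
 have d2: "((%Z. Z\<^sup>2) has_field_derivative 2 * Z) (at Z)" by (auto intro!: derivative_eq_intros)
 have "((%Z. (- e) / Z\<^sup>2) has_field_derivative (0 * Z\<^sup>2 - (- e) * (2 * Z)) / (Z\<^sup>2 * Z\<^sup>2)) (at Z)"
  by (rule DERIV_divide[OF DERIV_const d2]) (use Z in simp)
 moreover have "(0 * Z\<^sup>2 - (- e) * (2 * Z)) / (Z\<^sup>2 * Z\<^sup>2) = - 2 * w / Z" using Z by (simp add: w_def power2_eq_square field_simps)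
 ultimately have d0: "((%Z. (- e) / Z\<^sup>2) has_field_derivative (- 2 * w / Z)) (at Z)" by simp
 have dF: "((%Z. eval_fps H ((- e) / Z\<^sup>2)) has_field_derivative F' * (- 2 * w / Z)) (at Z)"
  unfolding F'_def w_def[of]
  by (rule DERIV_chain2[OF has_field_derivative_eval_fps d0[unfolded w_def]]) (use nw hypF_radius[OF h] in \<open>simp add: H_def w_def one_ereal_def\<close>)
 have d1: "((%Z. 1 - (- e) / Z\<^sup>2) has_field_derivative (0 - (- 2 * w / Z))) (at Z)" by (rule DERIV_diff[OF DERIV_const d0])
 have dP: "((%Z. (1 - (- e) / Z\<^sup>2) powr u) has_field_derivative (u * q) * (0 - (- 2 * w / Z))) (at Z)"
  unfolding q_def w_def by (rule DERIV_chain2[OF has_field_derivative_powr d1[unfolded w_def]]) (use w1 in \<open>simp add: w_def\<close>)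
 have dZ: "((%Z. Z powr (2 * S)) has_field_derivative (2 * S) * y) (at Z)"
  unfolding y_def by (rule has_field_derivative_powr[OF Z(2)])
 define K where "K = 1 / (2 * S) * (- e) powr (S - 1 / 2)"
 have S0: "S ~= 0" using s by (simp add: S_def)
 have ZZ: "Z powr (2 * S) = Z * y"
 proof -
  have "Z powr (2 * S) = Z powr (1 + (2 * S - 1))" by simp
  thus ?thesis unfolding powr_add y_def using Z by simp
 qed
 have Pq: "(1 - w) powr u = (1 - w) * q"
 proof -
  have "(1 - w) powr u = (1 - w) powr (1 + (u - 1))" by simp
  thus ?thesis unfolding powr_add q_def using w1 by simp
 qed
 have "(g has_field_derivative K * ((2 * S * y * (1 - w) powr u + (u * q) * (0 - (- 2 * w / Z)) * Z powr (2 * S)) * F + F' * (- 2 * w / Z) * (Z powr (2 * S) * (1 - w) powr u))) (at Z)"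
  unfolding g_def F_def w_def S_def[symmetric] u_def[symmetric] H_def[symmetric] K_def[symmetric]
  using DERIV_cmult[OF DERIV_mult[OF DERIV_mult[OF dZ dP] dF], of K] unfolding w_def .
 moreover have "K * ((2 * S * y * (1 - w) powr u + (u * q) * (0 - (- 2 * w / Z)) * Z powr (2 * S)) * F + F' * (- 2 * w / Z) * (Z powr (2 * S) * (1 - w) powr u))
  = (- e) powr (S - 1 / 2) * y * q"
 proof -
  have o: "w * (1 - w) * F' + (1 - S - 1 - 1 / 2 * w) * F = 1 - S - 1" unfolding F_def F'_def H_def by (rule hypF_ode[OF h nw])
  have zz: "w / Z * (Z * y) = w * y" using Z by simp
  have "(2 * S * y * ((1 - w) * q) + (u * q) * (0 - (- 2 * w / Z)) * (Z * y)) * F + F' * (- 2 * w / Z) * (Z * y * ((1 - w) * q))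
   = (2 * S * y * ((1 - w) * q) + 2 * (u * q) * (w / Z * (Z * y))) * F - 2 * F' * (w / Z * (Z * y)) * ((1 - w) * q)"
   by (simp add: algebra_simps)
  also have "\<dots> = - (2 * y * q) * (w * (1 - w) * F' + (1 - S - 1 - 1 / 2 * w) * F)"
   unfolding zz u_def by (simp add: field_simps)
  also have "\<dots> = 2 * S * (y * q)" unfolding o by simp
  finally have E: "(2 * S * y * ((1 - w) * q) + (u * q) * (0 - (- 2 * w / Z)) * (Z * y)) * F + F' * (- 2 * w / Z) * (Z * y * ((1 - w) * q)) = 2 * S * (y * q)" .
  show ?thesis unfolding ZZ Pq E K_def using S0 by simp
 qed
 moreover have "(- e) powr (S - 1 / 2) * y * q = (1 - e * of_real (t\<^sup>2)) powr (S - 1 / 2)"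
 proof -
  have "complex_of_real (t\<^sup>2) powr (S - 1 / 2) = y"
  proof -
   have "complex_of_real (t\<^sup>2) powr of_real (s - 1 / 2) = of_real ((t\<^sup>2) powr (s - 1 / 2))" by (rule powr_of_real) simp
   also have "(t\<^sup>2) powr (s - 1 / 2) = t powr (2 * s - 1)"
   proof -
    have "t\<^sup>2 = t powr 2" using t by simp
    hence "(t\<^sup>2) powr (s - 1 / 2) = t powr (2 * (s - 1 / 2))" by (simp only: powr_powr)
    thus ?thesis by (simp add: algebra_simps)
   qed
   also have "complex_of_real (t powr (2 * s - 1)) = of_real t powr of_real (2 * s - 1)" using powr_of_real[of t "2 * s - 1"] t by simp
   finally show ?thesis by (simp add: y_def Z_def S_def)
  qed
  moreover have "1 + e / complex_of_real (t\<^sup>2) = 1 - w" unfolding w_def Z2 by simp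
  moreover have "u - 1 = S - 1 / 2" by (simp add: u_def)
  moreover have t20: "t\<^sup>2 > 0" using t2 by linarith
  ultimately show ?thesis using powr_inversion[OF e t20, of "S - 1 / 2"] unfolding q_def by (simp only:)
 qed
 ultimately show ?thesis unfolding S_def Z_def by simp
qed

text \<open>Substituting y = p^2 makes the full integral half of a Beta integral with parameter -e,
  convergent at infinity because s < 0.\<close>

lemma Phi_limit:
 fixes s :: real
 assumes e: "e \<in> {\<i>, - \<i>}" and s: "s < 0"
 shows "((%b. Phi (of_real s + 1 / 2) e (sqrt b)) \<longlongrightarrow> 1 / 2 * ((- e) powr (- (1 / 2)) * Beta (1 / 2) (- of_real s))) at_top"
proof -
 define u where "u = complex_of_real s + 1 / 2"
 define h where "h = (%y. complex_of_real (y powr (1 / 2 - 1)) * (1 + (- e) * of_real y) powr (- of_real (1 / 2) - (- of_real s)))"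
 have me: "- e \<notin> \<real>\<^sub>\<le>\<^sub>0" using e by (auto simp: complex_nonpos_Reals_iff)
 have q: "Re (- complex_of_real s) > 0" using s by simp
 have p: "(0 :: real) < 1 / 2" by simp
 note B = Beta_integral_complex[OF p q me]
 have ih: "integrable posM h" unfolding h_def by (rule B(1))
 have vh: "integral\<^sup>L posM h = (- e) powr (- (1 / 2)) * Beta (1 / 2) (- of_real s)" unfolding h_def B(2) by simp
 have il: "integrable lborel (%y. indicator {0<..} y *\<^sub>R h y)" using ih by (simp add: integrable_restrict_space)
 have vl: "(\<integral>y. indicator {0<..} y *\<^sub>R h y \<partial>lborel) = integral\<^sup>L posM h" by (simp add: integral_restrict_space)
 have lim: "((%b. \<integral>y. indicator {..b} y *\<^sub>R (indicator {0<..} y *\<^sub>R h y) \<partial>lborel) \<longlongrightarrow> integral\<^sup>L posM h) at_top"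
  using tendsto_integral_at_top[OF _ il] unfolding vl by simp
 have eq: "(\<integral>y. indicator {..b} y *\<^sub>R (indicator {0<..} y *\<^sub>R h y) \<partial>lborel) = 2 * Phi u e (sqrt b)" if b: "b > 0" for b
 proof -
  have h0: "h 0 = 0" by (simp add: h_def)
  have f: "indicator {..b} y *\<^sub>R (indicator {0<..} y *\<^sub>R h y) = indicator {0..b} y *\<^sub>R h y" for y
   by (cases "y = 0") (auto simp: h0 indicator_def)
  have "integrable lborel (%y. indicator {..b} y *\<^sub>R (indicator {0<..} y *\<^sub>R h y))"
   by (rule integrable_mult_indicator[OF _ il]) simp
  hence si: "set_integrable lborel {0..b} h" unfolding f set_integrable_def .
  have "(h has_integral (2 * Phi u e (sqrt b) - 2 * Phi u e (sqrt 0))) {0..b}"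
  proof (rule fundamental_theorem_of_calculus_interior)
   show "0 \<le> b" using b by simp
   have "continuous_on {0..sqrt b} (Phi u e)"
    by (rule continuous_on_vector_derivative) (rule Phi_deriv[OF e])
   hence "continuous_on {0..b} (%y. Phi u e (sqrt y))"
    by (rule continuous_on_compose2) (auto intro!: continuous_intros)
   thus "continuous_on {0..b} (%y. 2 * Phi u e (sqrt y))" by (intro continuous_intros)
   fix y assume y: "y \<in> {0<..<b}"
   hence sy: "0 < sqrt y" "sqrt y < sqrt b" by auto
   have "(Phi u e has_vector_derivative (1 - e * of_real ((sqrt y)\<^sup>2)) powr (u - 1)) (at (sqrt y) within {0..sqrt b})"
    by (rule Phi_deriv[OF e]) (use sy in auto)
   moreover have "at (sqrt y) within {0..sqrt b} = at (sqrt y)" by (rule at_within_Icc_at) (use sy in auto)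
   moreover have "(sqrt y)\<^sup>2 = y" using y by simp
   ultimately have P: "(Phi u e has_vector_derivative (1 - e * of_real y) powr (u - 1)) (at (sqrt y))" by (simp only:)
   have "(sqrt has_real_derivative inverse (sqrt y) / 2) (at y)" using y by (intro DERIV_real_sqrt) auto
   hence "(sqrt has_vector_derivative inverse (sqrt y) / 2) (at y)" by (simp add: has_real_derivative_iff_has_vector_derivative)
   from vector_diff_chain_at[OF this P] have "((%y. Phi u e (sqrt y)) has_vector_derivative (inverse (sqrt y) / 2) *\<^sub>R (1 - e * of_real y) powr (u - 1)) (at y)"
    by (simp add: o_def)
   hence "((%y. 2 * Phi u e (sqrt y)) has_vector_derivative 2 * ((inverse (sqrt y) / 2) *\<^sub>R (1 - e * of_real y) powr (u - 1))) (at y)"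
    by (rule has_vector_derivative_mult_right)
   moreover have "2 * ((inverse (sqrt y) / 2) *\<^sub>R (1 - e * of_real y) powr (u - 1)) = h y"
   proof -
    have "y powr (1 / 2 - 1) = inverse (sqrt y)"
    proof -
     have "y powr (1 / 2 - 1) = y powr (- (1 / 2))" by simp
     also have "\<dots> = inverse (y powr (1 / 2))" by (rule powr_minus)
     finally show ?thesis using y by (simp add: powr_half_sqrt)
    qed
    moreover have "- complex_of_real (1 / 2) - (- of_real s) = u - 1" by (simp add: u_def)
    ultimately show ?thesis unfolding h_def by (simp add: scaleR_conv_of_real)
   qed
   ultimately show "((%y. 2 * Phi u e (sqrt y)) has_vector_derivative h y) (at y)" by simp
  qed
  hence "integral {0..b} h = 2 * Phi u e (sqrt b)" by (simp add: integral_unique Phi_def)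
  moreover have "(\<integral>y. indicator {0..b} y *\<^sub>R h y \<partial>lborel) = integral {0..b} h"
   using set_borel_integral_eq_integral(2)[OF si] unfolding set_lebesgue_integral_def .
  ultimately show ?thesis unfolding f by simp
 qed
 have "((%b. 2 * Phi u e (sqrt b)) \<longlongrightarrow> integral\<^sup>L posM h) at_top"
  by (rule Lim_transform_eventually[OF lim eventually_mono[OF eventually_gt_at_top[of 0]]]) (rule eq)
 from tendsto_mult[OF tendsto_const[of "1 / 2"] this] show ?thesis unfolding vh u_def by simp
qed

lemma eval_fps_tendsto_zero:
 fixes F :: "complex fps"
 assumes "fps_conv_radius F > 0" "(f \<longlongrightarrow> 0) G"
 shows "((%x. eval_fps F (f x)) \<longlongrightarrow> fps_nth F 0) G"
proof -
 have "isCont (eval_fps F) 0"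
  using has_field_derivative_eval_fps[of 0 F UNIV] assms(1) by (intro DERIV_isCont) (auto simp: zero_ereal_def)
 from isCont_tendsto_compose[OF this assms(2)] show ?thesis by (simp add: eval_fps_at_0)
qed

text \<open>A connection formula at infinity. The first summand comes from the full integral over
  (0, infinity), its Gamma product being B(1/2, -s); \<open>rGamma\<close> keeps it holomorphic at s
  = 1/2, 3/2 and so on. The second summand accounts for the tail, expanded in powers of
  1/xi.\<close>

definition Rinv :: "complex => complex => real => complex" where
 "Rinv s e xi = 1 / 2 * (- e) powr (- (1 / 2)) * (of_real (sqrt pi) * Gamma (- s) * rGamma (1 / 2 - s)) / of_real (sqrt xi) * (1 - e * of_real xi) powr (- (s + 1 / 2))
  + e / (2 * s * of_real xi) * eval_fps (hypF (1 / 2) (1 - s)) ((- e) / of_real xi)"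

text \<open>On (1, infinity) \<open>Phi\<close> and the antiderivative of
  \<open>small_derivative\<close> differ by a constant. For s < 0 the latter tends to 0, which
  identifies the constant as the limit of \<open>Phi\<close>.\<close>

lemma Rfun_inversion_real:
 fixes s xi :: real
 assumes e: "e \<in> {\<i>, - \<i>}" and s: "- 1 / 2 < s" "s < 0" and x: "xi > 1"
 shows "Rfun (of_real s) (e * of_real xi) = Rinv (of_real s) e xi"
proof -
 define S where "S = complex_of_real s"
 define u where "u = S + 1 / 2"
 define H where "H = hypF (1 / 2) (1 - S)"
 define K where "K = 1 / (2 * S) * (- e) powr (S - 1 / 2)"
 define g where "g = (%Z. K * (Z powr (2 * S) * (1 - (- e) / Z\<^sup>2) powr u * eval_fps H ((- e) / Z\<^sup>2)))"
 define C0 where "C0 = 1 / 2 * ((- e) powr (- (1 / 2)) * Beta (1 / 2) (- S))"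
 have h: "(1 / 2 :: complex) \<notin> \<int>\<^sub>\<le>\<^sub>0" "1 - S \<notin> \<int>\<^sub>\<le>\<^sub>0" by (rule not_nonpos_Int_Re_pos; use s in \<open>simp add: S_def\<close>)+
 have S0: "S ~= 0" using s by (simp add: S_def)
 have "\<exists>c. \<forall>t\<in>{1<..}. Phi u e t = g (of_real t) + c"
 proof (rule same_vector_derivative)
  fix t :: real assume t: "t \<in> {1<..}"
  have "(Phi u e has_vector_derivative (1 - e * of_real (t\<^sup>2)) powr (u - 1)) (at t within {0..t + 1})"
   by (rule Phi_deriv[OF e]) (use t in auto)
  moreover have "at t within {0..t + 1} = at t" by (rule at_within_Icc_at) (use t in auto)
  ultimately have "(Phi u e has_vector_derivative (1 - e * of_real (t\<^sup>2)) powr (u - 1)) (at t)" by simp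
  thus "(Phi u e has_vector_derivative (1 - e * of_real (t\<^sup>2)) powr (u - 1)) (at t within {1<..})" by (rule has_vector_derivative_at_within)
  have u1: "u - 1 = S - 1 / 2" by (simp add: u_def)
  have "(g has_field_derivative (1 - e * of_real (t\<^sup>2)) powr (S - 1 / 2)) (at (of_real t))"
   using small_derivative[OF e s, of t] t unfolding g_def K_def S_def u_def H_def by simp
  thus "((%t. g (of_real t)) has_vector_derivative (1 - e * of_real (t\<^sup>2)) powr (u - 1)) (at t within {1<..})"
   unfolding u1 by (rule has_vector_derivative_real_field)
 qed simp
 then obtain c where c: "\<forall>t\<in>{1<..}. Phi u e t = g (of_real t) + c" ..
 have "((%b. g (of_real (sqrt b))) \<longlongrightarrow> K * (0 * 1 * 1)) at_top"
 proof -
  have w: "((%b. (- e) / (complex_of_real (sqrt b))\<^sup>2) \<longlongrightarrow> 0) at_top"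
  proof (rule tendsto_divide_0[OF tendsto_const])
   have "filterlim (%b. complex_of_real b) at_infinity at_top" by (rule filterlim_of_real_at_infinity)
   moreover have "eventually (%b. complex_of_real b = (complex_of_real (sqrt b))\<^sup>2) at_top"
    using eventually_ge_at_top[of 0] by eventually_elim (metis of_real_power real_sqrt_pow2)
   ultimately show "filterlim (%b. (complex_of_real (sqrt b))\<^sup>2) at_infinity at_top" by (simp add: filterlim_cong)
  qed
  have 1: "((%b. complex_of_real (sqrt b) powr (2 * S)) \<longlongrightarrow> 0) at_top"
  proof (rule Lim_null_comparison)
   show "eventually (%b. norm (complex_of_real (sqrt b) powr (2 * S)) \<le> b powr s) at_top"
    using eventually_gt_at_top[of 0]
   proof eventually_elim
    case (elim b)
    have "complex_of_real (sqrt b) powr of_real (2 * s) = of_real (sqrt b powr (2 * s))" using elim by (intro powr_of_real) simp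
    hence "norm (complex_of_real (sqrt b) powr (2 * S)) = sqrt b powr (2 * s)" by (simp add: S_def)
    also have "\<dots> = b powr s" using elim by (simp add: powr_half_sqrt[symmetric] powr_powr)
    finally show ?case by simp
   qed
   show "((%b. b powr s) \<longlongrightarrow> 0) at_top" by (rule tendsto_neg_powr[OF s(2) filterlim_ident])
  qed
  have 2: "((%b. (1 - (- e) / (complex_of_real (sqrt b))\<^sup>2) powr u) \<longlongrightarrow> (1 - 0) powr u) at_top"
   by (rule tendsto_powr_complex[OF _ tendsto_diff[OF tendsto_const w] tendsto_const]) simp
  have 3: "((%b. eval_fps H ((- e) / (complex_of_real (sqrt b))\<^sup>2)) \<longlongrightarrow> fps_nth H 0) at_top"
   by (rule eval_fps_tendsto_zero[OF _ w]) (simp add: H_def hypF_radius[OF h])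
  have "fps_nth H 0 = 1" by (simp add: H_def hypF_def)
  with tendsto_mult[OF tendsto_const[of K] tendsto_mult[OF tendsto_mult[OF 1 2] 3]] show ?thesis unfolding g_def by simp
 qed
 hence "((%b. g (of_real (sqrt b)) + c) \<longlongrightarrow> 0 + c) at_top" by (intro tendsto_add tendsto_const) simp
 moreover have "eventually (%b. g (of_real (sqrt b)) + c = Phi u e (sqrt b)) at_top"
  using eventually_gt_at_top[of 1] by eventually_elim (use c in auto)
 ultimately have "((%b. Phi u e (sqrt b)) \<longlongrightarrow> c) at_top" by (simp add: Lim_transform_eventually)
 moreover have "((%b. Phi u e (sqrt b)) \<longlongrightarrow> C0) at_top" unfolding u_def C0_def S_def by (rule Phi_limit[OF e s(2)])
 ultimately have cC: "c = C0" by (intro tendsto_unique) auto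
 define t where "t = sqrt xi"
 have t: "t > 1" "t > 0" "t\<^sup>2 = xi" using x by (auto simp: t_def)
 have tc: "(complex_of_real t)\<^sup>2 = of_real xi" using t(3) by (metis of_real_power)
 define w where "w = (- e) / complex_of_real xi"
 define X where "X = complex_of_real xi"
 define V where "V = (1 - e * X) powr (- u)"
 have X0: "X ~= 0" "complex_of_real t ~= 0" using x t by (simp_all add: X_def)
 have e0: "e ~= 0" "e * e = - 1" using e by auto
 have "of_real t * Jint u (e * X) = K * (of_real t powr (2 * S) * (1 - w) powr u * eval_fps H w) + C0"
  using c t Phi_eq_Jint[OF e t(2), of u] unfolding cC g_def X_def w_def by (simp add: tc)
 hence "of_real t * (V * Jint u (e * X)) = V * (K * (of_real t powr (2 * S) * (1 - w) powr u * eval_fps H w) + C0)"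
  by (metis mult.left_commute)
 hence "of_real t * (V * Jint u (e * X)) = V * (K * (of_real t powr (2 * S) * (1 - w) powr u * eval_fps H w)) + V * C0"
  unfolding distrib_left .
 moreover have "V * (K * (of_real t powr (2 * S) * (1 - w) powr u * eval_fps H w)) = of_real t * (e / (2 * S * X) * eval_fps H w)"
 proof -
  have xp: "X powr a = of_real t powr (2 * a)" if "a \<in> \<real>" for a
  proof -
   obtain r where r: "a = of_real r" using \<open>a \<in> \<real>\<close> by (auto elim: Reals_cases)
   have "X powr of_real r = of_real (xi powr r)" unfolding X_def by (rule powr_of_real) (use x in simp)
   also have "xi powr r = t powr (2 * r)" using x by (simp add: t_def powr_half_sqrt[symmetric] powr_powr)
   also have "complex_of_real (t powr (2 * r)) = of_real t powr of_real (2 * r)" using powr_of_real[of t "2 * r"] t by simp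
   finally show ?thesis by (simp add: r)
  qed
  have uR: "- u \<in> \<real>" by (simp add: u_def S_def)
  have V: "V = (- e) powr (- u) * of_real t powr (2 * (- u)) * (1 - w) powr (- u)"
   unfolding V_def X_def powr_inversion[OF e less_trans[OF zero_less_one x]] unfolding X_def[symmetric] xp[OF uR] by (simp add: w_def X_def)
  have w1: "1 - w ~= 0" using imaginary_unit_cases(2)[of "- e" "1 / xi"] e by (auto simp: w_def)
  have a1: "(1 - w) powr (- u) * (1 - w) powr u = 1" using w1 by (simp flip: powr_add)
  have a2: "(- e) powr (- u) * (- e) powr (S - 1 / 2) = e"
  proof -
   have "- u + (S - 1 / 2) = - 1" by (simp add: u_def)
   hence "(- e) powr (- u) * (- e) powr (S - 1 / 2) = (- e) powr (- 1)" by (simp only: powr_add[symmetric])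
   also have "\<dots> = inverse (- e)" using e0 by (simp add: powr_minus)
   also have "\<dots> = e" using e by auto
   finally show ?thesis .
  qed
  have a3: "complex_of_real t powr (2 * (- u)) * of_real t powr (2 * S) = of_real t / X"
  proof -
   have "2 * (- u) + 2 * S = - 1" by (simp add: u_def)
   hence "complex_of_real t powr (2 * (- u)) * of_real t powr (2 * S) = of_real t powr (- 1)" by (simp only: powr_add[symmetric])
   also have "\<dots> = 1 / of_real t" using X0 by (simp add: powr_minus inverse_eq_divide)
   also have "\<dots> = of_real t / X" unfolding X_def tc[symmetric] using X0 by (simp add: power2_eq_square)
   finally show ?thesis .
  qed
  have "V * (K * (of_real t powr (2 * S) * (1 - w) powr u * eval_fps H w))
   = 1 / (2 * S) * ((- e) powr (- u) * (- e) powr (S - 1 / 2)) * (of_real t powr (2 * (- u)) * of_real t powr (2 * S)) * ((1 - w) powr (- u) * (1 - w) powr u) * eval_fps H w"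
   unfolding V K_def by (simp only: mult_ac)
  thus ?thesis unfolding a1 a2 a3 by (simp add: mult_ac)
 qed
 ultimately have "of_real t * (V * Jint u (e * X)) = of_real t * (e / (2 * S * X) * eval_fps H w + V * C0 / of_real t)"
  using X0 by (simp add: distrib_left)
 hence R: "V * Jint u (e * X) = e / (2 * S * X) * eval_fps H w + V * C0 / of_real t" using X0(2) by (simp only: mult_cancel_left) simp
 have B: "Beta (1 / 2) (- S) = of_real (sqrt pi) * Gamma (- S) * rGamma (1 / 2 - S)"
  by (simp add: Beta_altdef Gamma_one_half_complex)
 show ?thesis unfolding Rfun_def Rinv_def S_def[symmetric] u_def[symmetric] X_def[symmetric] V_def[symmetric] R H_def[symmetric] C0_def B t_def[symmetric] w_def
  unfolding X_def[symmetric] by (simp add: mult_ac)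
qed

lemma pochhammer_holomorphic: "(%s. pochhammer (1 - s) n :: complex) holomorphic_on S"
 by (induction n) (auto simp: pochhammer_Suc intro!: holomorphic_intros)

text \<open>A ratio test that is locally uniform in s: near c the terms are eventually dominated by
  one geometric series of ratio \<rho> < 1.\<close>

lemma hypF_holomorphic:
 assumes w: "norm w < 1"
 shows "(%s. eval_fps (hypF (1 / 2) (1 - s)) w) holomorphic_on (- \<int>)"
proof -
 define f where "f = (%n s. pochhammer (1 / 2) n / pochhammer (1 - s) n * w ^ n)"
 have nz: "1 - s \<notin> \<int>\<^sub>\<le>\<^sub>0" if "s \<in> - \<int>" for s :: complex
 proof
  assume "1 - s \<in> \<int>\<^sub>\<le>\<^sub>0"
  hence "1 - s \<in> \<int>" using nonpos_Ints_subset_Ints by blast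
  hence "1 - (1 - s) \<in> \<int>" by (rule Ints_diff[OF Ints_1])
  thus False using that by simp
 qed
 have op: "open (- (\<int> :: complex set))" by (intro open_Compl closed_Ints)
 have hol: "f n holomorphic_on - \<int>" for n
  unfolding f_def by (intro holomorphic_intros pochhammer_holomorphic) (use pochhammer_not_nonpos nz in auto)
 have "(%s. \<Sum>n. f n s) holomorphic_on - \<int>"
 proof (rule holomorphic_suminf[OF op hol])
  fix c :: complex assume c: "c \<in> - \<int>"
  obtain r where r: "r > 0" "cball c r \<subseteq> - \<int>" using op c open_contains_cball by blast
  define \<rho> where "\<rho> = (1 + norm w) / 2"
  have rho: "\<rho> > 0" "\<rho> < 1" "norm w < \<rho>" using w norm_ge_zero[of w] by (auto simp: \<rho>_def simp del: norm_ge_zero)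
  define M where "M = norm c + r"
  \<comment> \<open>From this bound on, (k + 1/2) |w| is at most \<rho> (k + 1 - M), so consecutive
    terms have ratio at most \<rho>; N1 keeps k + 1 - M positive.\<close>
  obtain N0 where N0: "(norm w / 2 + \<rho> * M) / (\<rho> - norm w) \<le> real N0" using real_arch_simple by blast
  obtain N1 where N1: "M \<le> real N1" using real_arch_simple by blast
  define N where "N = max N0 N1"
  obtain B where B: "B \<ge> 0" "\<forall>s\<in>cball c r. norm (f N s) \<le> B" using continuous_compact_bounded[OF hol r(2)] by blast
  have bnd: "norm (f n s) \<le> B / \<rho> ^ N * \<rho> ^ n" if s: "s \<in> ball c r" and n: "n \<ge> N" for s n
   using n
  proof (induction n rule: dec_induct)
   case base
   have "s \<in> cball c r" using s by simp
   thus ?case using B rho by simp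
  next
   case (step k)
   have "norm (s - c) < r" using s by (simp add: dist_norm norm_minus_commute)
   hence sM: "norm s \<le> M" using norm_triangle_ineq2[of s c] by (simp add: M_def)
   have kN: "real N0 \<le> real k" "real N1 \<le> real k" using step by (auto simp: N_def)
   have "s \<in> cball c r" using s by simp
   hence "s \<in> - \<int>" using r(2) by blast
   hence knz: "1 - s + of_nat k ~= 0" using nz plus_of_nat_eq_0_imp by blast
   have "norm (of_nat (Suc k) :: complex) \<le> norm (1 - s + of_nat k) + norm s"
    using norm_triangle_ineq[of "1 - s + of_nat k" s] by (simp add: add.commute)
   hence lo: "real k + 1 - M \<le> norm (1 - s + of_nat k)" using sM by (simp only: norm_of_nat)
   have pos: "real k + 1 - M > 0" using kN N1 by simp
   have "(norm w / 2 + \<rho> * M) / (\<rho> - norm w) \<le> real k" using N0 kN by linarith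
   hence "norm w / 2 + \<rho> * M \<le> real k * (\<rho> - norm w)" using rho by (simp add: pos_divide_le_eq)
   hence "(real k + 1 / 2) * norm w \<le> \<rho> * (real k + 1 - M)" using rho by (simp add: algebra_simps)
   also have "\<dots> \<le> \<rho> * norm (1 - s + of_nat k)" using lo rho by (intro mult_left_mono) auto
   finally have "(real k + 1 / 2) * norm w / norm (1 - s + of_nat k) \<le> \<rho>" using knz by (simp add: pos_divide_le_eq)
   moreover have "norm (f (Suc k) s) = norm (f k s) * ((real k + 1 / 2) * norm w / norm (1 - s + of_nat k))"
   proof -
    have "f (Suc k) s = f k s * (of_real (real k + 1 / 2) * w / (1 - s + of_nat k))"
     by (simp add: f_def pochhammer_Suc add.commute)
    moreover have "norm (complex_of_real (real k + 1 / 2)) = real k + 1 / 2" by (simp only: norm_of_real)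
    ultimately show ?thesis by (simp only: norm_mult norm_divide)
   qed
   ultimately have "norm (f (Suc k) s) \<le> norm (f k s) * \<rho>" by (simp only: mult_left_mono norm_ge_zero)
   also have "\<dots> \<le> B / \<rho> ^ N * \<rho> ^ k * \<rho>" using step.IH rho by (intro mult_right_mono) auto
   finally show ?case by (simp add: mult_ac)
  qed
  have "summable (%n. B / \<rho> ^ N * \<rho> ^ n)" using rho by (intro summable_mult summable_geometric) simp
  moreover have "ball c r \<subseteq> - \<int>" using r(2) ball_subset_cball by blast
  ultimately show "\<exists>r>0. \<exists>g. \<exists>N. ball c r \<subseteq> - \<int> \<and> summable g \<and> (\<forall>c'\<in>ball c r. \<forall>n\<ge>N. norm (f n c') \<le> g n)"
   using r(1) bnd by blast
 qed
 thus ?thesis unfolding f_def eval_fps_def hypF_def by simp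
qed

text \<open>Continuation in s from (-1/2, 0) to the complement of the integers, which is connected.
  Integers are left out because the summands of \<open>Rinv\<close> have poles among them.\<close>

lemma Rfun_inversion:
 assumes e: "e \<in> {\<i>, - \<i>}" and s: "s \<notin> \<int>" and x: "xi > 1"
 shows "Rfun s (e * of_real xi) = Rinv s e xi"
proof (rule holomorphic_eq_from_reals[where S = "- \<int>" and f = "%s. Rfun s (e * of_real xi)" and g = "%s. Rinv s e xi" and a = "- 1 / 2" and b = 0 and w = s])
 show "open (- (\<int> :: complex set))" by (intro open_Compl closed_Ints)
 have "connected (UNIV - (\<int> :: complex set))" by (rule connected_open_diff_countable) (auto simp: Ints_def)
 thus "connected (- (\<int> :: complex set))" by (simp add: Compl_eq_Diff_UNIV)
 show "(%s. Rfun s (e * of_real xi)) holomorphic_on - \<int>"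
  by (rule Rfun_holomorphic_exponent[OF imaginary_unit_cases(1)[OF e]])
 have nw: "norm ((- e) / of_real xi) < 1" using x imaginary_unit_cases(3)[OF e] by (simp add: norm_divide)
 have "- s \<notin> \<int>\<^sub>\<le>\<^sub>0" if "s \<in> - \<int>" for s :: complex
  using that by (metis ComplD Ints_minus add.inverse_inverse nonpos_Ints_subset_Ints subsetD)
 hence G: "(%s. Gamma (- s)) holomorphic_on - \<int>"
  using holomorphic_on_compose_gen[OF _ holomorphic_Gamma[of "- \<int>\<^sub>\<le>\<^sub>0"], of uminus "- \<int>"] by (simp add: o_def image_subset_iff holomorphic_intros)
 have rG: "(%s. rGamma (1 / 2 - s)) holomorphic_on - \<int>"
  using holomorphic_on_compose_gen[OF _ holomorphic_rGamma[of UNIV], of "%s. 1 / 2 - s" "- \<int>"] by (simp add: o_def holomorphic_intros)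
 have P: "(%s. (1 - e * complex_of_real xi) powr (- (s + 1 / 2))) holomorphic_on - \<int>"
  by (intro holomorphic_intros)
 have D: "(%s. e / (2 * s * of_real xi)) holomorphic_on - \<int>" using x by (intro holomorphic_intros) auto
 have c: "complex_of_real (sqrt xi) ~= 0" using x by simp
 show "(%s. Rinv s e xi) holomorphic_on - \<int>" unfolding Rinv_def
  by (intro holomorphic_on_add holomorphic_on_mult[OF D hypF_holomorphic[OF nw]] holomorphic_on_mult[OF _ P] holomorphic_on_divide holomorphic_on_mult holomorphic_on_const G rG c)
 fix t :: real assume t: "- 1 / 2 < t" "t < 0"
 have "complex_of_real t \<notin> \<int>"
 proof
  assume "complex_of_real t \<in> \<int>"
  then obtain k where k: "complex_of_real t = of_int k" by (auto elim: Ints_cases)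
  hence "t = of_int k" by (metis of_real_eq_iff of_real_of_int_eq)
  hence "real_of_int k < real_of_int 0" "real_of_int (- 1) < real_of_int k" using t by auto
  thus False unfolding of_int_less_iff by linarith
 qed
 thus "complex_of_real t \<in> - \<int> \<and> Rfun (of_real t) (e * of_real xi) = Rinv (of_real t) e xi"
  using Rfun_inversion_real[OF e t x] by simp
qed (use s in auto)

lemma not_Int_one_minus: "s \<notin> \<int> ==> 1 - s \<notin> (\<int>\<^sub>\<le>\<^sub>0 :: complex set)"
proof
 assume s: "s \<notin> \<int>" and "1 - s \<in> \<int>\<^sub>\<le>\<^sub>0"
 hence "1 - (1 - s) \<in> \<int>" using nonpos_Ints_subset_Ints Ints_diff[OF Ints_1] by blast
 thus False using s by simp
qed

text \<open>The 3F2 is the even part of 2F1(1/2, 1; 1-s), again by duplication. Off the integers the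
  lower parameter 1 - s is admissible.\<close>

lemma hypergeo_small:
 assumes s: "s \<notin> \<int>" and v: "0 < \<nu>" "\<nu> < 1"
 shows "hypergeo [1 / 4, 3 / 4, 1] [(1 - s) / 2, 1 - s / 2] (of_real (- (\<nu>\<^sup>2)))
  = (eval_fps (hypF (1 / 2) (1 - s)) (\<i> * of_real \<nu>) + eval_fps (hypF (1 / 2) (1 - s)) (- (\<i> * of_real \<nu>))) / 2"
proof -
 define c where "c = fps_nth (hypF (1 / 2) (1 - s))"
 define w where "w = \<i> * complex_of_real \<nu>"
 have w2: "w\<^sup>2 = of_real (- (\<nu>\<^sup>2))" by (simp add: w_def power_mult_distrib)
 have nw: "norm w < 1" "norm (- w) < 1" using v by (simp_all add: w_def norm_mult)
 have h: "(1 / 2 :: complex) \<notin> \<int>\<^sub>\<le>\<^sub>0" by (rule not_nonpos_Int_Re_pos) simp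
 have "(%n. c (2 * n) * (w\<^sup>2) ^ n) sums ((eval_fps (hypF (1 / 2) (1 - s)) w + eval_fps (hypF (1 / 2) (1 - s)) (- w)) / 2)"
  unfolding c_def by (intro even_part_sums hypF_sums h not_Int_one_minus s nw)
 moreover have "c (2 * n) = fps_nth (fps_hypergeo [1 / 4, 3 / 4, 1] [(1 - s) / 2, 1 - s / 2] 1) n" for n
 proof -
  have d: "2 * ((1 - s) / 2) = 1 - s" "(1 - s) / 2 + 1 / 2 = 1 - s / 2" by (simp_all add: field_simps)
  have p1: "pochhammer (1 - s) (2 * n) = of_nat (2 ^ (2 * n)) * pochhammer ((1 - s) / 2) n * pochhammer (1 - s / 2) n"
   using pochhammer_double[of "(1 - s) / 2" n] by (simp only: d)
  have p2: "pochhammer (1 / 2 :: complex) (2 * n) = of_nat (2 ^ (2 * n)) * pochhammer (1 / 4) n * pochhammer (3 / 4) n"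
   using pochhammer_double[of "1 / 4 :: complex" n] by simp
  have f: "pochhammer 1 n = (of_nat (fact n) :: complex)" unfolding of_nat_fact by (rule pochhammer_fact[symmetric])
  show ?thesis by (simp add: c_def hypF_def p1 p2 f)
 qed
 ultimately have "(%n. fps_nth (fps_hypergeo [1 / 4, 3 / 4, 1] [(1 - s) / 2, 1 - s / 2] 1) n * (of_real (- (\<nu>\<^sup>2))) ^ n) sums
  ((eval_fps (hypF (1 / 2) (1 - s)) w + eval_fps (hypF (1 / 2) (1 - s)) (- w)) / 2)"
  unfolding w2 by simp
 thus ?thesis unfolding hypergeo_def eval_fps_def[of "fps_hypergeo _ _ _"] w_def by (rule sums_unique[symmetric])
qed

lemma i_powr: "\<i> powr a = exp (\<i> * (of_real pi * a / 2))" "(- \<i>) powr a = exp (- (\<i> * (of_real pi * a / 2)))"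
 by (simp_all add: powr_def mult_ac)

lemma cos_half_pi_nonzero:
 fixes s :: complex
 assumes "s \<notin> \<int>" shows "cos (of_real pi * s / 2) ~= 0"
proof -
 have "s + 1 \<notin> \<int>" using assms Ints_diff[OF _ Ints_1, of "s + 1"] by auto
 from sin_half_pi_nonzero[OF this] have "sin (of_real pi * s / 2 + of_real pi / 2) ~= 0"
  by (simp add: distrib_left add_divide_distrib)
 thus ?thesis by (simp add: sin_add of_real_pi_half)
qed

lemma of_real_sqrt_pi: "complex_of_real (sqrt pi) * of_real (sqrt pi) = of_real pi"
proof -
 have "sqrt pi * sqrt pi = pi" by simp
 hence "complex_of_real (sqrt pi * sqrt pi) = of_real pi" by (simp only:)
 thus ?thesis by (simp only: of_real_mult)
qed

text \<open>Duplication at z = 1/4 + s/2 produces Gamma(s + 1/2). Reflection at z + 1/2 trades the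
  companion factor for Gamma(1/4 - s/2) and the cosine of pi/4 + pi s/2.\<close>

lemma Gamma_quarter_quotient:
 assumes s: "Re s > 0"
 shows "Gamma (1 / 4 + s / 2) / Gamma (1 / 4 - s / 2) = 2 * Gamma (s + 1 / 2) * (cos (of_real pi * s / 2) - sin (of_real pi * s / 2)) / (2 powr (s + 1) * of_real (sqrt pi))"
proof -
 define z where "z = 1 / 4 + s / 2"
 define C where "C = cos (of_real pi * s / 2)"
 define S where "S = sin (of_real pi * s / 2)"
 define r where "r = complex_of_real (sqrt 2 / 2)"
 have zp: "Re z > 0" "Re (z + 1 / 2) > 0" using s by (simp_all add: z_def)
 have d: "Gamma z * Gamma (z + 1 / 2) = exp ((1 - 2 * z) * of_real (ln 2)) * of_real (sqrt pi) * Gamma (2 * z)"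
  by (rule Gamma_legendre_duplication) (use zp not_nonpos_Int_Re_pos in auto)
 have z2: "2 * z = s + 1 / 2" by (simp add: z_def)
 have x: "exp ((1 - 2 * z) * of_real (ln 2)) * r * 2 powr (s + 1) = 2"
 proof -
  have 1: "exp ((1 - 2 * z) * of_real (ln 2)) = 2 powr (1 / 2 - s)" unfolding z2 by (simp add: powr_def Ln_of_real[of 2, simplified])
  have 2: "2 powr (1 / 2 - s) * 2 powr (s + 1) = (2 :: complex) powr (3 / 2)" by (simp flip: powr_add)
  have 3: "(2 :: complex) powr (3 / 2) = of_real (2 * sqrt 2)"
  proof -
   have "(2 :: complex) powr (3 / 2) = of_real (2 powr (1 + 1 / 2))" using powr_of_real[of 2 "3 / 2"] by simp
   also have "(2 :: real) powr (1 + 1 / 2) = 2 * sqrt 2" unfolding powr_add by (simp add: powr_half_sqrt)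
   finally show ?thesis .
  qed
  have 4: "complex_of_real (2 * sqrt 2) * r = 2" unfolding r_def of_real_mult[symmetric] by simp
  have "2 powr (1 / 2 - s) * r * 2 powr (s + 1) = 2 powr (1 / 2 - s) * 2 powr (s + 1) * r" by (simp only: mult_ac)
  thus ?thesis unfolding 1 2 3 4 .
 qed
 have 1: "rGamma (z + 1 / 2) * rGamma (1 - (z + 1 / 2)) = sin (of_real pi * (z + 1 / 2)) / of_real pi" by (rule rGamma_reflection_complex)
 have 2: "sin (of_real pi * (z + 1 / 2)) = r * (C - S)"
 proof -
  have a: "of_real pi * (z + 1 / 2) = (of_real pi / 4 + of_real pi * s / 2) + of_real pi / 2" unfolding z_def by (simp add: distrib_left)
  have "sin (of_real pi * (z + 1 / 2)) = cos (of_real pi / 4 + of_real pi * s / 2)" unfolding a by (subst sin_add) (simp only: of_real_pi_half mult_zero_right mult_1_right add_0)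
  thus ?thesis unfolding cos_add of_real_pi_quarter r_def C_def S_def by (simp only: right_diff_distrib)
 qed
 have 3: "1 - (z + 1 / 2) = 1 / 4 - s / 2" by (simp add: z_def)
 have q: "rGamma (z + 1 / 2) * rGamma (1 / 4 - s / 2) = r * (C - S) / of_real pi" using 1 unfolding 2 3 .
 have g0: "Gamma (z + 1 / 2) ~= 0" by (rule Gamma_nonzero_Re_pos[OF zp(2)])
 have rg: "rGamma (z + 1 / 2) = 1 / Gamma (z + 1 / 2)" by (simp add: rGamma_inverse_Gamma inverse_eq_divide)
 have e: "rGamma (1 / 4 - s / 2) = Gamma (z + 1 / 2) * (r * (C - S) / of_real pi)"
 proof -
  have "rGamma (1 / 4 - s / 2) = Gamma (z + 1 / 2) * (rGamma (z + 1 / 2) * rGamma (1 / 4 - s / 2))" unfolding rg using g0 by simp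
  thus ?thesis unfolding q .
 qed
 have "Gamma z / Gamma (1 / 4 - s / 2) = Gamma z * rGamma (1 / 4 - s / 2)" unfolding rGamma_inverse_Gamma by (rule divide_inverse)
 also have "\<dots> = (Gamma z * Gamma (z + 1 / 2)) * (r * (C - S) / of_real pi)" unfolding e by (simp only: mult.assoc)
 also have "\<dots> = exp ((1 - 2 * z) * of_real (ln 2)) * of_real (sqrt pi) * Gamma (s + 1 / 2) * (r * (C - S) / of_real pi)" unfolding d z2 ..
 finally have f: "Gamma z / Gamma (1 / 4 - s / 2) = exp ((1 - 2 * z) * of_real (ln 2)) * of_real (sqrt pi) * Gamma (s + 1 / 2) * (r * (C - S) / of_real pi)" .
 note p = of_real_sqrt_pi[symmetric]
 have alg: "X * q * G * (r * D / (q * q)) = 2 * G * D / (t * q)" if "X * r * t = 2" "q ~= 0" "t ~= 0" for X q G D t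
 proof -
  have "X * q * G * (r * D / (q * q)) = X * r * t * G * D / (t * q)" using that(2,3) by simp
  thus ?thesis unfolding that(1) .
 qed
 show ?thesis unfolding z_def[symmetric] C_def[symmetric] S_def[symmetric] f unfolding p by (rule alg[OF x]) simp_all
qed

text \<open>\<open>hypergeo_large\<close> expresses \<open>Rdiff\<close> by the 3F2 without its
  constant term 1, and \<open>Wcomb\<close> is the trigonometric bracket as it stands.\<close>

lemma bterm_large:
 fixes n :: nat
 assumes s: "Re s > 0" and x: "x > 0" and n: "x \<le> real n" "x = real n \<longrightarrow> Re s < 1 / 2"
 shows "bterm s (x / real n) = - (of_nat n * Gamma s * cos (of_real pi * s / 2)
       / (2 powr (s - 1) * of_real (pi * x))
       * (hypergeo [s / 2, (1 + s) / 2, 1] [1 / 4, 3 / 4]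
          (of_real (- (x\<^sup>2 / (real n)\<^sup>2))) - 1))
      - \<i> * of_real (sqrt (real n)) * Gamma (s + 1 / 2)
       / (2 powr (s + 1) * of_real (sqrt (pi * x)))
       * (sin (of_real pi / 4 + of_real pi * s / 2)
          * ((1 + \<i> * of_real (x / real n)) powr (- (s + 1 / 2))
           - (1 - \<i> * of_real (x / real n)) powr (- (s + 1 / 2)))
         + \<i> * cos (of_real pi / 4 + of_real pi * s / 2)
          * ((1 + \<i> * of_real (x / real n)) powr (- (s + 1 / 2))
           + (1 - \<i> * of_real (x / real n)) powr (- (s + 1 / 2)) - 2))"
proof -
 define xi where "xi = x / real n"
 define N where "N = complex_of_nat n"
 define X where "X = complex_of_real x"
 define C where "C = cos (of_real pi * s / 2)"
 define D where "D = Rdiff s xi"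
 define q where "q = complex_of_real (sqrt pi)"
 define T where "T = (2 :: complex) powr (s - 1)"
 define G where "G = Gamma (s + 1 / 2)"
 have n0: "real n > 0" using x n by linarith
 have xi: "0 < xi" "xi \<le> 1" "xi = 1 \<longrightarrow> Re s < 1 / 2" using x n n0 by (auto simp: xi_def)
 have nz: "N ~= 0" "X ~= 0" "q ~= 0" "T ~= 0" "G ~= 0" using n0 x s by (auto simp: N_def X_def q_def T_def G_def intro!: Gamma_nonzero_Re_pos)
 have "x\<^sup>2 / (real n)\<^sup>2 = xi\<^sup>2" by (simp add: xi_def power_divide)
 hence h: "hypergeo [s / 2, (1 + s) / 2, 1] [1 / 4, 3 / 4] (of_real (- (x\<^sup>2 / (real n)\<^sup>2))) - 1 = s * (\<i> * (X / N)) * D"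
  using hypergeo_large[OF s xi] by (simp add: xi_def X_def N_def D_def)
 have W: "sin (of_real pi / 4 + of_real pi * s / 2) * ((1 + \<i> * of_real xi) powr (- (s + 1 / 2)) - (1 - \<i> * of_real xi) powr (- (s + 1 / 2)))
   + \<i> * cos (of_real pi / 4 + of_real pi * s / 2) * ((1 + \<i> * of_real xi) powr (- (s + 1 / 2)) + (1 - \<i> * of_real xi) powr (- (s + 1 / 2)) - 2) = Wcomb s xi"
  unfolding Wcomb_def ..
 have t4: "(2 :: complex) powr (s + 1) = 4 * T"
 proof -
  have "(2 :: complex) powr (s + 1) = 2 powr ((s - 1) + 2)" by (simp add: algebra_simps)
  also have "\<dots> = T * 2 powr 2" unfolding powr_add T_def ..
  also have "(2 :: complex) powr 2 = 4" using powr_nat'[of "2 :: complex" 2] by simp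
  finally show ?thesis by simp
 qed
 have sq: "complex_of_real (sqrt pi * sqrt xi) = of_real (sqrt (pi * x)) / of_real (sqrt (real n))"
  by (simp add: xi_def real_sqrt_mult real_sqrt_divide)
 define w where "w = complex_of_real (sqrt xi)"
 have w: "w ~= 0" "complex_of_real (sqrt pi * sqrt xi) = q * w" using xi by (simp_all add: w_def q_def)
 have pix: "complex_of_real (pi * x) = q * q * X" unfolding q_def of_real_sqrt_pi X_def by (rule of_real_mult)
 have gs: "Gamma (s + 1) = s * Gamma s" using not_nonpos_Int_Re_pos[OF s] by (rule Gamma_plus1)
 have first: "- \<i> * G / (4 * T * (q * w)) * (2 * kap_coeff s * w * C * D) = - (N * Gamma s * C / (T * (q * q * X)) * (s * (\<i> * (X / N)) * D))"
 proof -
  have k: "kap_coeff s = 2 * (s * Gamma s) / (q * G)" unfolding kap_coeff_def gs q_def G_def ..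
  show ?thesis unfolding k using nz w by (simp add: field_simps)
 qed
 have second: "- \<i> * G / (4 * T * (q * w)) * Wcomb s xi = - (\<i> * of_real (sqrt (real n)) * G / (4 * T * of_real (sqrt (pi * x))) * Wcomb s xi)"
  unfolding w(2)[symmetric] sq by simp
 have "bterm s xi = - \<i> * G / (4 * T * (q * w)) * Wcomb s xi + - \<i> * G / (4 * T * (q * w)) * (2 * kap_coeff s * w * C * D)"
  unfolding bterm_def t4 w(2) G_def[symmetric] w_def[symmetric] C_def[symmetric] D_def[symmetric] by (rule distrib_left)
 thus ?thesis unfolding xi_def[symmetric] h W N_def[symmetric] C_def[symmetric] T_def[symmetric] G_def[symmetric] t4 pix first second by simp
qed

definition smallf :: "complex => real => nat => complex => complex" where
 "smallf a x n s = - (of_real (sqrt (real n)) * Gamma (1 / 4 + s / 2)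
        / (of_real (sqrt (2 * x)) * Gamma (1 / 4 - s / 2)))
      - a * Gamma (s + 1 / 2) * cot (of_real pi * s / 2)
        / (2 powr (s + 1) * of_real (sqrt pi))
        * of_real (real n / x) powr (s + 1)
        * ((1 + \<i> * of_real (real n / x)) powr (- (s + 1 / 2))
         + (1 - \<i> * of_real (real n / x)) powr (- (s + 1 / 2)))
      + of_nat n * 2 powr (- s)
        / (of_real x * sin (of_real pi * s / 2) * Gamma (1 - s))
        * hypergeo [1 / 4, 3 / 4, 1] [(1 - s) / 2, 1 - s / 2]
          (of_real (- ((real n)\<^sup>2 / x\<^sup>2)))"

text \<open>Inversion splits \<open>Rdiff\<close> into algebraic powers and 2F1 functions of the
  inverse argument. The powers merge with those of \<open>Wcomb\<close> to the cotangent term, the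
  constant 2 in \<open>Wcomb\<close> leaves the quotient of Gamma functions, and the two 2F1
  functions add up to the 3F2.\<close>

lemma bterm_small:
 fixes n :: nat
 assumes s: "Re s > 0" "s \<notin> \<int>" and n: "0 < n" "real n < x"
 shows "smallf 1 x n s = bterm s (x / real n)"
proof -
 define \<nu> where "\<nu> = real n / x"
 define xi where "xi = x / real n"
 define u where "u = s + 1 / 2"
 define C where "C = cos (of_real pi * s / 2)"
 define S where "S = sin (of_real pi * s / 2)"
 define r where "r = complex_of_real (sqrt 2 / 2)"
 define G where "G = Gamma u"
 define q where "q = complex_of_real (sqrt pi)"
 define T where "T = (2 :: complex) powr (s + 1)"
 define y where "y = complex_of_real (sqrt \<nu>)"
 define V where "V = complex_of_real \<nu>"
 define P where "P = (1 + \<i> * of_real xi) powr (- u)"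
 define M where "M = (1 - \<i> * of_real xi) powr (- u)"
 define p where "p = (1 + \<i> * V) powr (- u)"
 define m where "m = (1 - \<i> * V) powr (- u)"
 define Z where "Z = V powr (s + 1)"
 define F1 where "F1 = eval_fps (hypF (1 / 2) (1 - s)) (\<i> * V)"
 define F2 where "F2 = eval_fps (hypF (1 / 2) (1 - s)) (- (\<i> * V))"
 define Q where "Q = q * Gamma (- s) * rGamma (1 / 2 - s)"
 define kc where "kc = kap_coeff s"
 have x: "x > 0" using n by linarith
 have nu: "0 < \<nu>" "\<nu> < 1" using n x by (auto simp: \<nu>_def)
 have xi: "xi > 1" "xi > 0" using n x by (auto simp: xi_def)
 have xn: "xi = 1 / \<nu>" by (simp add: xi_def \<nu>_def)
 have S0: "S ~= 0" unfolding S_def by (rule sin_half_pi_nonzero[OF s(2)])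
 have C0: "C ~= 0" unfolding C_def by (rule cos_half_pi_nonzero[OF s(2)])
 have s0: "s ~= 0" using s by auto
 have nz: "q ~= 0" "T ~= 0" "y ~= 0" "V ~= 0" "G ~= 0" using nu s by (auto simp: q_def T_def y_def V_def G_def u_def intro!: Gamma_nonzero_Re_pos)
 have vx: "1 / complex_of_real xi = V" by (simp add: xn V_def)
 have sx: "complex_of_real (sqrt xi) = 1 / y" by (simp add: xn y_def real_sqrt_divide)
 have im: "(- \<i>) powr (- (1 / 2)) = r * (1 + \<i>)" "\<i> powr (- (1 / 2)) = r * (1 - \<i>)"
 proof -
  have "(- \<i>) powr (- (1 / 2)) = cis (pi / 4)" "\<i> powr (- (1 / 2)) = cis (- (pi / 4))"
   by (simp_all add: i_powr cis_conv_exp)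
  thus "(- \<i>) powr (- (1 / 2)) = r * (1 + \<i>)" "\<i> powr (- (1 / 2)) = r * (1 - \<i>)" unfolding cis_45 r_def by simp_all
 qed
 have R1: "Rfun s (\<i> * of_real xi) = 1 / 2 * (r * (1 + \<i>)) * Q * y * M + \<i> * V / (2 * s) * F2"
 proof -
  have a: "(- \<i>) / complex_of_real xi = - (\<i> * V)" unfolding vx[symmetric] by simp
  have b: "\<i> / (2 * s * complex_of_real xi) = \<i> * V / (2 * s)" unfolding vx[symmetric] by simp
  have "Rfun s (\<i> * of_real xi) = Rinv s \<i> xi" by (rule Rfun_inversion) (use s xi in auto)
  thus ?thesis unfolding Rinv_def a b sx im F2_def M_def u_def Q_def q_def by simp
 qed
 have R2: "Rfun s (- (\<i> * of_real xi)) = 1 / 2 * (r * (1 - \<i>)) * Q * y * P - \<i> * V / (2 * s) * F1"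
 proof -
  have a: "(- (- \<i>)) / complex_of_real xi = \<i> * V" unfolding vx[symmetric] by simp
  have b: "- \<i> / (2 * s * complex_of_real xi) = - (\<i> * V / (2 * s))" unfolding vx[symmetric] by simp
  have c: "(- (- \<i>)) powr (- (1 / 2)) = r * (1 - \<i>)" "1 - - \<i> * complex_of_real xi = 1 + \<i> * of_real xi" using im(2) by simp_all
  have d: "- (\<i> * complex_of_real xi) = - \<i> * of_real xi" by simp
  have "Rfun s (- \<i> * of_real xi) = Rinv s (- \<i>) xi" by (rule Rfun_inversion) (use s xi in auto)
  thus ?thesis unfolding d Rinv_def a b c sx F1_def P_def u_def Q_def q_def by simp
 qed
 have Dl: "Rdiff s xi = 1 / 2 * Q * y * (r * (1 + \<i>) * M - r * (1 - \<i>) * P) + \<i> * V / (2 * s) * (F1 + F2)"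
 proof -
  have alg: "(h * a * Q * y * M + k * F2) - (h * b * Q * y * P - k * F1) = h * Q * y * (a * M - b * P) + k * (F1 + F2)" for a b h k
   by (simp add: algebra_simps)
  show ?thesis unfolding Rdiff_def R1 R2 by (rule alg)
 qed
 have W: "Wcomb s xi = r * (C + S) * (P - M) + \<i> * (r * (C - S)) * (P + M - 2)"
  unfolding Wcomb_def sin_add cos_add of_real_pi_quarter r_def[symmetric] u_def[symmetric] P_def[symmetric] M_def[symmetric] S_def[symmetric] C_def[symmetric] by (simp add: algebra_simps)
 have sc: "sin (of_real pi * s) = 2 * S * C" "cos (of_real pi * s) = C\<^sup>2 - S\<^sup>2"
  using sin_double[of "of_real pi * s / 2"] cos_double[of "of_real pi * s / 2"] by (simp_all add: S_def C_def)
 \<comment> \<open>Reflection for Gamma(-s) and for Gamma(s + 1/2) leaves -cos(pi s) / sin(pi s/2).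
   With this coefficient the powers \<open>P\<close> and \<open>M\<close> collapse to multiples of
   the cotangent.\<close>
 have kQ: "kc * Q * C = - (C\<^sup>2 - S\<^sup>2) / S"
 proof -
  have H: "Gamma (- s) * Gamma (1 - - s) = of_real pi / sin (of_real pi * (- s))" by (rule Gamma_reflection_complex)
  have o: "1 - - s = s + 1" "sin (of_real pi * (- s)) = - (2 * S * C)" using sc(1) by simp_all
  have A: "Gamma (s + 1) * Gamma (- s) = - of_real pi / (2 * S * C)" using H unfolding o by (simp add: mult.commute)
  have "rGamma u * rGamma (1 - u) = sin (of_real pi * u) / of_real pi" by (rule rGamma_reflection_complex)
  moreover have "of_real pi * u = of_real pi * s + of_real pi / 2" by (simp add: u_def distrib_left)
  hence "sin (of_real pi * u) = C\<^sup>2 - S\<^sup>2" by (simp only:) (simp add: sin_add of_real_pi_half sc)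
  moreover have "1 - u = 1 / 2 - s" by (simp add: u_def)
  ultimately have B: "rGamma u * rGamma (1 / 2 - s) = (C\<^sup>2 - S\<^sup>2) / of_real pi" by simp
  have rg: "rGamma u = 1 / G" by (simp add: rGamma_inverse_Gamma inverse_eq_divide G_def)
  have "kc * Q * C = 2 * (Gamma (s + 1) * Gamma (- s)) * (rGamma u * rGamma (1 / 2 - s)) * C"
   unfolding kc_def kap_coeff_def Q_def q_def[symmetric] u_def[symmetric] G_def[symmetric] rg using nz by simp
  also have "\<dots> = - (C\<^sup>2 - S\<^sup>2) / S" unfolding A B using S0 C0 by (simp add: field_simps)
  finally show ?thesis .
 qed
 define E1 where "E1 = \<i> powr u"
 define E2 where "E2 = (- \<i>) powr u"
 have EE: "E1 * E2 = 1" unfolding E1_def E2_def i_powr by (simp flip: exp_add)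
 have Em: "\<i> powr (- u) = E2" "(- \<i>) powr (- u) = E1" unfolding E1_def E2_def i_powr by simp_all
 have Ecs: "E1 = r * ((C - S) + \<i> * (C + S))" "E2 = r * ((C - S) - \<i> * (C + S))"
 proof -
  have a: "of_real pi * u / 2 = of_real pi / 4 + of_real pi * s / 2" by (simp add: u_def field_simps)
  have c: "cos (of_real pi * u / 2) = r * (C - S)" unfolding a cos_add of_real_pi_quarter r_def C_def S_def by (simp add: right_diff_distrib)
  have d: "sin (of_real pi * u / 2) = r * (C + S)" unfolding a sin_add of_real_pi_quarter r_def C_def S_def by (simp add: distrib_left add.commute)
  have "E1 = cos (of_real pi * u / 2) + \<i> * sin (of_real pi * u / 2)" unfolding E1_def i_powr by (rule exp_Euler)
  thus "E1 = r * ((C - S) + \<i> * (C + S))" unfolding c d by (simp add: distrib_left mult_ac)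
  have "E2 = exp (\<i> * (- (of_real pi * u / 2)))" unfolding E2_def i_powr by simp
  also have "\<dots> = cos (- (of_real pi * u / 2)) + \<i> * sin (- (of_real pi * u / 2))" by (rule exp_Euler)
  finally show "E2 = r * ((C - S) - \<i> * (C + S))" unfolding cos_minus sin_minus c d by (simp add: right_diff_distrib mult_ac)
 qed
 \<comment> \<open>As xi = 1/\<nu>, the factor xi^(-u) sqrt(\<nu>) is \<nu>^(u + 1/2) with u + 1/2 =
   s + 1: the origin of the power (n/x)^(s+1) in the theorem.\<close>
 have xu: "complex_of_real xi powr (- u) * y = Z"
 proof -
  have L: "Ln V = of_real (ln \<nu>)" unfolding V_def using nu by (simp add: Ln_of_real)
  have "complex_of_real xi powr (- u) = exp (u * of_real (ln \<nu>))"
  proof -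
   have "ln xi = - ln \<nu>" using nu by (simp add: xn ln_div)
   moreover have "Ln (complex_of_real xi) = of_real (ln xi)" using xi by (simp add: Ln_of_real)
   ultimately show ?thesis using xi by (simp add: powr_def)
  qed
  moreover have "y = exp (1 / 2 * of_real (ln \<nu>))"
  proof -
   have "sqrt \<nu> = exp (1 / 2 * ln \<nu>)" using nu by (simp add: powr_half_sqrt[symmetric] powr_def)
   thus ?thesis unfolding y_def by (simp only: exp_of_real[symmetric]) simp
  qed
  ultimately have "complex_of_real xi powr (- u) * y = exp ((u + 1 / 2) * of_real (ln \<nu>))" by (simp add: exp_add[symmetric] distrib_right)
  also have "\<dots> = Z" unfolding Z_def using nz L by (simp add: powr_def u_def add.commute)
  finally show ?thesis .
 qed
 have PM: "P * y = E2 * Z * m" "M * y = E1 * Z * p"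
 proof -
  have "(1 - - \<i> * complex_of_real xi) powr (- u) = (- (- \<i>)) powr (- u) * of_real xi powr (- u) * (1 + - \<i> / of_real xi) powr (- u)"
   by (rule powr_inversion) (use xi in auto)
  hence "P = E2 * of_real xi powr (- u) * m" unfolding P_def m_def vx[symmetric] using Em by simp
  thus "P * y = E2 * Z * m" unfolding xu[symmetric] by simp
  have "(1 - \<i> * complex_of_real xi) powr (- u) = (- \<i>) powr (- u) * of_real xi powr (- u) * (1 + \<i> / of_real xi) powr (- u)"
   by (rule powr_inversion) (use xi in auto)
  hence "M = E1 * of_real xi powr (- u) * p" unfolding M_def p_def vx[symmetric] using Em by simp
  thus "M * y = E1 * Z * p" unfolding xu[symmetric] by simp
 qed
 \<comment> \<open>The trigonometric factors of \<open>P\<close> and \<open>M\<close> turn out to be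
   multiples of E1 and E2, the inverses of the phases that inversion attaches to these powers in
   \<open>PM\<close>; by E1 * E2 = 1 all phases disappear.\<close>
 have key: "Wcomb s xi * y + 2 * kc * C * Rdiff s xi = - 2 * \<i> * r * (C - S) * y - \<i> * (C / S) * Z * (p + m) + kc * C * (\<i> * V / s) * (F1 + F2)"
 proof -
  have r1: "r * ((C + S) - \<i> * (C - S)) = - \<i> * E1" "r * ((C + S) + \<i> * (C - S)) = \<i> * E2"
   unfolding Ecs by (simp_all add: algebra_simps)
  have f1: "r * (C + S) * (P - M) + \<i> * (r * (C - S)) * (P + M - 2) + (- (C\<^sup>2 - S\<^sup>2) / S) * (r * (1 + \<i>) * M - r * (1 - \<i>) * P)
   = - 2 * \<i> * r * (C - S) + (C / S) * ((r * ((C + S) - \<i> * (C - S))) * P - (r * ((C + S) + \<i> * (C - S))) * M)"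
   using S0 by (simp add: field_simps power2_eq_square)
  have "Wcomb s xi * y + 2 * kc * C * Rdiff s xi = y * (Wcomb s xi + (kc * Q * C) * (r * (1 + \<i>) * M - r * (1 - \<i>) * P)) + kc * C * (\<i> * V / s) * (F1 + F2)"
  proof -
   have h: "\<i> * V / (2 * s) = 1 / 2 * (\<i> * V / s)" by simp
   have alg: "w * y + 2 * k * c * (1 / 2 * q * y * d + 1 / 2 * K * f) = y * (w + (k * q * c) * d) + k * c * K * f" for w k c q d K f
    by (simp add: algebra_simps)
   show ?thesis unfolding Dl h by (rule alg)
  qed
  also have "\<dots> = y * (- 2 * \<i> * r * (C - S) + (C / S) * ((- \<i> * E1) * P - (\<i> * E2) * M)) + kc * C * (\<i> * V / s) * (F1 + F2)"
   unfolding kQ W f1 unfolding r1 ..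
  also have "y * (- 2 * \<i> * r * (C - S) + (C / S) * ((- \<i> * E1) * P - (\<i> * E2) * M)) = - 2 * \<i> * r * (C - S) * y - \<i> * (C / S) * (E1 * (P * y) + E2 * (M * y))"
   by (simp add: algebra_simps)
  also have "E1 * (P * y) + E2 * (M * y) = (E1 * E2) * Z * m + (E1 * E2) * Z * p" unfolding PM by (simp only: mult_ac)
  also have "\<dots> = Z * (p + m)" unfolding EE by (simp add: distrib_left)
  finally show ?thesis by (simp only: mult.assoc)
 qed
 have b: "bterm s xi = - \<i> * G / (T * q) * (Wcomb s xi * y + 2 * kc * C * Rdiff s xi)"
 proof -
  have g1: "- \<i> * G / (T * (q * (1 / y))) * A = - \<i> * G / (T * q) * (A * y)" for A using nz(3) by simp
  have g2: "(W + 2 * k * (1 / y) * c * R) * y = W * y + 2 * k * c * R" for W k c R using nz(3) by (simp add: distrib_right)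
  show ?thesis
   unfolding bterm_def of_real_mult sx u_def[symmetric] G_def[symmetric] T_def[symmetric] q_def[symmetric] kc_def[symmetric] C_def[symmetric] g1 g2 ..
 qed
 have l1: "complex_of_real (sqrt (real n)) * Gamma (1 / 4 + s / 2) / (of_real (sqrt (2 * x)) * Gamma (1 / 4 - s / 2)) = 2 * G * r * (C - S) * y / (T * q)"
 proof -
  have "sqrt (real n) / sqrt (2 * x) = sqrt \<nu> * (sqrt 2 / 2)"
  proof -
   have h: "sqrt 2 / 2 = 1 / sqrt (2 :: real)" by (simp add: field_simps)
   show ?thesis unfolding \<nu>_def real_sqrt_divide real_sqrt_mult h by simp
  qed
  hence a: "complex_of_real (sqrt (real n)) / of_real (sqrt (2 * x)) = y * r" unfolding y_def r_def of_real_divide[symmetric] of_real_mult[symmetric] by (simp only:)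
  have "complex_of_real (sqrt (real n)) * Gamma (1 / 4 + s / 2) / (of_real (sqrt (2 * x)) * Gamma (1 / 4 - s / 2)) = (of_real (sqrt (real n)) / of_real (sqrt (2 * x))) * (Gamma (1 / 4 + s / 2) / Gamma (1 / 4 - s / 2))"
   by simp
  also have "\<dots> = y * r * (2 * G * (C - S) / (T * q))" unfolding a Gamma_quarter_quotient[OF s(1)] G_def u_def T_def q_def C_def S_def ..
  finally show ?thesis by (simp add: mult_ac)
 qed
 have l3: "of_nat n * 2 powr (- s) / (of_real x * S * Gamma (1 - s)) * ((F1 + F2) / 2) = G / (T * q) * (kc * C * (V / s) * (F1 + F2))"
 proof -
  have "Gamma s * Gamma (1 - s) = of_real pi / sin (of_real pi * s)" by (rule Gamma_reflection_complex)
  hence g: "Gamma s * Gamma (1 - s) = q * q / (2 * S * C)" unfolding sc q_def of_real_sqrt_pi .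
  have g0: "Gamma s ~= 0" by (rule Gamma_nonzero_Re_pos[OF s(1)])
  have "Gamma (1 - s) = Gamma s * Gamma (1 - s) / Gamma s" using g0 by simp
  hence g1: "Gamma (1 - s) = q * q / (2 * S * C * Gamma s)" unfolding g by simp
  have gs: "Gamma (s + 1) = s * Gamma s" using not_nonpos_Int_Re_pos[OF s(1)] by (rule Gamma_plus1)
  have t: "2 powr (- s) = 2 / T"
  proof -
   have "T = 2 powr s * 2" unfolding T_def by (simp add: powr_add)
   thus ?thesis by (simp add: powr_minus_divide)
  qed
  have v: "V = of_nat n / of_real x" by (simp add: V_def \<nu>_def)
  have kc: "kc = 2 * (s * Gamma s) / (q * G)" unfolding kc_def kap_coeff_def gs q_def G_def u_def ..
  have X0: "complex_of_real x ~= 0" using x by simp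
  have alg: "n * (2 / T) / (X * S * (q * q / (2 * S * C * g))) * (F / 2) = G / (T * q) * (2 * (s * g) / (q * G) * C * (n / X / s) * F)"
   if "X ~= 0" "g ~= 0" for n X g F using nz S0 C0 s0 that by (simp add: mult_ac)
  show ?thesis unfolding g1 t kc v by (rule alg[OF X0 g0])
 qed
 have sq: "(real n)\<^sup>2 / x\<^sup>2 = \<nu>\<^sup>2" by (simp add: \<nu>_def power_divide)
 have ct: "cot (of_real pi * s / 2) = C / S" by (simp add: cot_def C_def S_def)
 have "smallf 1 x n s = - (2 * G * r * (C - S) * y / (T * q)) - 1 * G * (C / S) / (T * q) * Z * (p + m) + G / (T * q) * (kc * C * (V / s) * (F1 + F2))"
  unfolding smallf_def l1 sq ct hypergeo_small[OF s(2) nu] \<nu>_def[symmetric] V_def[symmetric] F1_def[symmetric] F2_def[symmetric] S_def[symmetric]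
   u_def[symmetric] G_def[symmetric] T_def[symmetric] q_def[symmetric] Z_def[symmetric] p_def[symmetric] m_def[symmetric] l3 ..
 also have "\<dots> = bterm s xi"
 proof -
  have alg: "- \<i> * G / (T * q) * (- 2 * \<i> * r * D * y - \<i> * E * Z * A + k * c * (\<i> * V / s) * F)
   = - (2 * G * r * D * y / (T * q)) - 1 * G * E / (T * q) * Z * A + G / (T * q) * (k * c * (V / s) * F)" for D E A k c F
   by (simp add: algebra_simps)
  show ?thesis unfolding b key by (rule alg[symmetric])
 qed
 finally show ?thesis unfolding xi_def .
qed

text \<open>The literal bracket with a = 1 agrees off the integers with \<open>bterm\<close>, which
  is continuous in s. For odd s the coefficient a is 0; the cotangent term omitted in this way is
  continuous there and vanishes because cos(pi s/2) = 0, so the limit is the same.\<close>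

lemma limiting_small:
 fixes n :: nat
 assumes s: "Re s > 0" and n: "0 < n" "real n < x"
  and a: "a = (if \<exists>k::int. odd k \<and> s = of_int k then 0 else 1)"
 shows "limiting_value (smallf a x n) s = bterm s (x / real n)"
proof -
 have xn: "x / real n > 0" using n by simp
 have bc: "isCont (%s. bterm s (x / real n)) s" by (rule holomorphic_Re_pos_isCont[OF bterm_holomorphic[OF xn] s])
 show ?thesis
 proof (cases "\<exists>k::int. odd k \<and> s = of_int k")
  case False
  hence "a = 1" using a by simp
  show ?thesis unfolding \<open>a = 1\<close> by (rule limiting_value_eq[OF s _ bc]) (use bterm_small n in blast)
 next
  case True
  then obtain k where k: "odd k" "s = of_int k" by blast
  have a0: "a = 0" using a True by simp
  define h where "h = (%s. Gamma (s + 1 / 2) * cot (of_real pi * s / 2)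
        / (2 powr (s + 1) * of_real (sqrt pi))
        * of_real (real n / x) powr (s + 1)
        * ((1 + \<i> * of_real (real n / x)) powr (- (s + 1 / 2))
         + (1 - \<i> * of_real (real n / x)) powr (- (s + 1 / 2))))"
  obtain j where j: "k = 2 * j + 1" using k(1) by (auto elim: oddE)
  have c0: "cos (of_real pi * s / 2) = 0"
  proof -
   have "of_real pi * s / 2 = complex_of_real (of_int j * pi + pi / 2)" unfolding k(2) j by (simp add: field_simps)
   hence "cos (of_real pi * s / 2) = complex_of_real (cos (of_int j * pi + pi / 2))" by (simp only: cos_of_real)
   moreover have "cos (of_int j * pi + pi / 2) = 0" unfolding cos_add by (simp add: sin_int_times_real mult.commute)
   ultimately show ?thesis by simp
  qed
  have "sin (of_real pi * s / 2) ~= 0" using sin_cos_squared_add[of "of_real pi * s / 2"] c0 by auto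
  moreover have "of_real (real n / x) ~= (0 :: complex)" using n by auto
  ultimately have hc: "isCont h s"
  proof -
   assume sn: "sin (of_real pi * s / 2) ~= 0" and nx: "of_real (real n / x) ~= (0 :: complex)"
   have g: "isCont (%s. Gamma (s + 1 / 2)) s"
    by (rule holomorphic_Re_pos_isCont[OF _ s]) (intro holomorphic_intros, auto intro!: not_nonpos_Int_Re_pos)
   have ct: "isCont (%s. cot (of_real pi * s / 2)) s"
    unfolding cot_def using sn by (intro continuous_intros) auto
   have pw: "isCont (%s. w powr (f s)) s" if "isCont f s" for w and f :: "complex => complex"
   proof (cases "w = 0")
    case True thus ?thesis by simp
   next
    case False thus ?thesis using that unfolding powr_def by (simp add: isCont_exp' continuous_intros)
   qed
   show ?thesis unfolding h_def
    by (rule continuous_mult[OF continuous_mult[OF continuous_divide[OF continuous_mult[OF g ct] continuous_mult[OF pw continuous_const]] pw] continuous_add[OF pw pw]])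
     (auto intro!: continuous_intros)
  qed
  have f: "smallf 0 x n s' = bterm s' (x / real n) + h s'" if "s' \<notin> \<int>" "Re s' > 0" for s'
  proof -
   have "smallf 0 x n s' = smallf 1 x n s' + h s'" by (simp add: smallf_def h_def)
   thus ?thesis using bterm_small[OF that(2,1) n] by simp
  qed
  have "limiting_value (smallf 0 x n) s = bterm s (x / real n) + h s"
   by (rule limiting_value_eq[OF s f]) (use bc hc in \<open>auto intro!: continuous_add\<close>)
  moreover have "h s = 0" unfolding h_def cot_def c0 by simp
  ultimately show ?thesis unfolding a0 by simp
 qed
qed

section \<open>Assembly of the two ranges\<close>

lemma split_sums:
 fixes f l :: "nat => complex"
 assumes f: "(%n. f (Suc n)) sums A" and f0: "f 0 = 0" and x: "x > 0" and l: "\<And>n. x \<le> real n ==> l n = f n"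
 shows "(%n. if x \<le> real n then l n else 0) sums (A - (\<Sum>n | 1 \<le> n \<and> real n < x. f n))"
proof -
 have "finite {n. real n < x}" using finite_nat_set_iff_bounded[of "{n. real n < x}"] reals_Archimedean2[of x]
  by (metis less_trans mem_Collect_eq of_nat_less_iff)
 hence fin: "finite {n. 1 \<le> n \<and> real n < x}" by (rule rev_finite_subset) auto
 have "(%n. f n - (if n \<in> {n. 1 \<le> n \<and> real n < x} then f n else 0)) sums ((A + f 0) - (\<Sum>n | 1 \<le> n \<and> real n < x. f n))"
  by (rule sums_diff[OF sums_Suc[OF f] sums_If_finite_set[OF fin]])
 moreover have "f n - (if n \<in> {n. 1 \<le> n \<and> real n < x} then f n else 0) = (if x \<le> real n then l n else 0)" for n
  using l[of n] f0 x by (cases "n = 0") auto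
 ultimately show ?thesis unfolding f0 by simp
qed

text \<open>The sum over n >= x runs over all naturals with zeros inserted. Its summability is
  asserted separately, because \<open>suminf\<close> denotes some value for a divergent series
  too.\<close>

theorem theorem1p1:
  fixes s a :: complex and x :: real
  assumes s: "Re s > 0"
    and x: "x > 0"
    and a: "a = (if \<exists>k::int. odd k \<and> s = of_int k then 0 else 1)"
    and int_case: "x \<in> \<int> \<longrightarrow> Re s < 1 / 2"
  defines "lhs \<equiv> (\<lambda>n::nat. divisor_sigma s n / of_real (sqrt (real n))
              * of_real (exp (- 2 * pi * sqrt (2 * real n * x))
                         * sin (pi / 4 + 2 * pi * sqrt (2 * real n * x))))"
    and "main \<equiv> 4 * of_real pi *
           (riemann_zeta (1 - s) / of_real (8 * pi\<^sup>2 * sqrt x)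
            + 1 / of_real (4 * sqrt 2 * pi) * riemann_zeta (1 / 2) * riemann_zeta (1 / 2 - s)
            - limiting_value (\<lambda>s. 2 powr (- s - 3) / of_real pi powr (s + 3 / 2)
                * (Gamma (s + 1 / 2) * cot (of_real pi * s / 2) * riemann_zeta (- s)
                   / of_real x powr (s + 1 / 2))) s)"
    and "small \<equiv> (\<lambda>n::nat. divisor_sigma s n / of_nat n powr (s + 1) *
           limiting_value (\<lambda>s.
             - (of_real (sqrt (real n)) * Gamma (1 / 4 + s / 2)
                / (of_real (sqrt (2 * x)) * Gamma (1 / 4 - s / 2)))
             - a * Gamma (s + 1 / 2) * cot (of_real pi * s / 2)
                / (2 powr (s + 1) * of_real (sqrt pi))
                * of_real (real n / x) powr (s + 1)
                * ((1 + \<i> * of_real (real n / x)) powr (- (s + 1 / 2))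
                   + (1 - \<i> * of_real (real n / x)) powr (- (s + 1 / 2)))
             + of_nat n * 2 powr (- s)
                / (of_real x * sin (of_real pi * s / 2) * Gamma (1 - s))
                * hypergeo [1 / 4, 3 / 4, 1] [(1 - s) / 2, 1 - s / 2]
                    (of_real (- ((real n)\<^sup>2 / x\<^sup>2)))) s)"
    and "large \<equiv> (\<lambda>n::nat. divisor_sigma s n / of_nat n powr (s + 1) *
           (- (of_nat n * Gamma s * cos (of_real pi * s / 2)
               / (2 powr (s - 1) * of_real (pi * x))
               * (hypergeo [s / 2, (1 + s) / 2, 1] [1 / 4, 3 / 4]
                    (of_real (- (x\<^sup>2 / (real n)\<^sup>2))) - 1))
            - \<i> * of_real (sqrt (real n)) * Gamma (s + 1 / 2)
               / (2 powr (s + 1) * of_real (sqrt (pi * x)))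
               * (sin (of_real pi / 4 + of_real pi * s / 2)
                    * ((1 + \<i> * of_real (x / real n)) powr (- (s + 1 / 2))
                       - (1 - \<i> * of_real (x / real n)) powr (- (s + 1 / 2)))
                  + \<i> * cos (of_real pi / 4 + of_real pi * s / 2)
                    * ((1 + \<i> * of_real (x / real n)) powr (- (s + 1 / 2))
                       + (1 - \<i> * of_real (x / real n)) powr (- (s + 1 / 2)) - 2))))"
  shows "summable (\<lambda>n. if x \<le> real n then large n else 0) \<and>
    (\<lambda>n. lhs (Suc n)) sums
      (main + of_real (sqrt x) / of_real pi powr s *
         ((\<Sum>n | 1 \<le> n \<and> real n < x. small n)
          + (\<Sum>n. if x \<le> real n then large n else 0)))"
proof -
 have lg: "large n = cterm s x n" if n: "x \<le> real n" for n
 proof -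
  \<comment> \<open>Only at n = x does the 3F2 sit at the boundary point -1 of its disc of
    convergence.\<close>
  have "x = real n \<longrightarrow> Re s < 1 / 2" using int_case by auto
  from bterm_large[OF s x n this] show ?thesis unfolding large_def cterm_def by simp
 qed
 have sl: "small n = cterm s x n" if n: "1 \<le> n \<and> real n < x" for n
 proof -
  have "limiting_value (smallf a x n) s = bterm s (x / real n)" by (rule limiting_small[OF s _ _ a]) (use n in auto)
  thus ?thesis unfolding small_def cterm_def smallf_def[abs_def] by simp
 qed
 have "(%n. cterm s x (Suc n)) sums (\<Sum>n. cterm s x (Suc n))" by (rule summable_sums[OF cterm_summable[OF s x]])
 \<comment> \<open>Index 0 contributes nothing: the term contains a division by
   \<open>0 powr (s + 1)\<close>, which is 0, and such a quotient is 0. So the series from 1 can be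
   rewritten over all naturals.\<close>
 moreover have "cterm s x 0 = 0" by (simp add: cterm_def)
 ultimately have L: "(%n. if x \<le> real n then large n else 0) sums ((\<Sum>n. cterm s x (Suc n)) - (\<Sum>n | 1 \<le> n \<and> real n < x. cterm s x n))"
  by (rule split_sums[OF _ _ x lg])
 have "(\<Sum>n | 1 \<le> n \<and> real n < x. small n) = (\<Sum>n | 1 \<le> n \<and> real n < x. cterm s x n)"
  by (rule sum.cong[OF refl], rule sl) simp
 hence T: "(\<Sum>n | 1 \<le> n \<and> real n < x. small n) + (\<Sum>n. if x \<le> real n then large n else 0) = (\<Sum>n. cterm s x (Suc n))"
  unfolding sums_unique[OF L, symmetric] by simp
 have m: "main = main3 s x + riemann_zeta (1 - s) / of_real (2 * pi * sqrt x) + riemann_zeta (1 / 2) * riemann_zeta (1 / 2 - s) / of_real (sqrt 2)"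
 proof -
  have 1: "4 * of_real pi * (A / of_real (8 * pi\<^sup>2 * sqrt x)) = A / of_real (2 * pi * sqrt x)" for A :: complex
   using x by (simp add: field_simps power2_eq_square)
  have 2: "4 * of_real pi * (1 / of_real (4 * sqrt 2 * pi) * A * B) = A * B / of_real (sqrt 2)" for A B :: complex
   by (simp add: field_simps)
  show ?thesis unfolding main_def right_diff_distrib distrib_left 1 2 main_third_term[OF s x] by simp
 qed
 have "(%n. lterm s x (Suc n)) sums (\<Sum>n. lterm s x (Suc n))" by (rule summable_sums[OF lterm_summable[OF s x]])
 hence "(%n. lterm s x (Suc n)) sums (main + of_real (sqrt x) / of_real pi powr s * (\<Sum>n. cterm s x (Suc n)))"
  unfolding combined_formula[OF s x] m .
 hence "(%n. lhs (Suc n)) sums (main + of_real (sqrt x) / of_real pi powr s * (\<Sum>n. cterm s x (Suc n)))"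
  unfolding lhs_def lterm_def .
 thus ?thesis unfolding T using sums_summable[OF L] by blast
qed

end
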